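(* Let $\mathcal T\subset\mathbb R$ be a closed finite interval, $k,r,R\in\mathbb N$, and $r_1,\dots,r_R\in\mathbb N$ with $\sum_{\ell=1}^R r_\ell=r$. Let $\mathbf H=[\mathbf H_1^\top,\dots,\mathbf H_R^\top]^\top\in\mathbb R^{r\times k}$ be a fixed block matrix with blocks $\mathbf H_\ell\in\mathbb R^{r_\ell\times k}$, and $\mathbf c=(\mathbf c_\ell)_{\ell\in\{1,\dots,R\}}:\mathcal T\to\mathbb R^r$ a fixed measurable function with $\mathbf c_\ell:\mathcal T\to\mathbb R^{r_\ell}$. Consider $k$ independent samples of real-valued stochastic processes on $\mathcal T$, where for each $i\in\{1,\dots,k\}$ the $i$th sample is $x_{i1},\dots,x_{in_i}$, $n=\sum_{i=1}^k n_i$, and put $v_{ij}:=x_{ij}-\eta_i$. Assume that for every $i\in\{1,\dots,k\}$: (i) $x_{i1},\dots,x_{in_i}$ are i.i.d. with mean function $\eta_i$ and covariance function $\gamma_i$ and take values in $\mathcal L_2(\mathcal T)$; (ii) $\eta_i\in\mathcal L_2(\mathcal T)$; (iii) the function $\mathcal T\ni t\mapsto\gamma_i(t,t)\in\mathbb R$ is continuous and positive; (iv) there exists $\tau_i>0$ such that $n_i/n\to\tau_i$ as $n\to\infty$; (v) for each $j\in\{1,2\}$, $\mathrm E_{\mathrm{out}}\Big[\sup_{t,s\in\mathcal T,\,|t-s|<\delta}|v_{i1}(t)v_{ij}(t)-v_{i1}(s)v_{ij}(s)|\Big]\to0$ as $\delta\to0$. Assume moreover that the null hypothesis $\mathbf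 H\boldsymbol\eta(t)=\mathbf c(t)$ for all $t\in\mathcal T$ holds, where $\boldsymbol\eta=(\eta_1,\dots,\eta_k)^\top$. Let $\mathbf z=(\mathbf z_\ell)_{\ell\in\{1,\dots,R\}}\sim GP_r(\mathbf 0_r,\mathbf H\boldsymbol\Sigma\mathbf H^\top)$, with $\mathbf z_\ell$ being $\mathbb R^{r_\ell}$-valued. Then, as $n\to\infty$, $$\big(T_n(\mathbf H_\ell,\mathbf c_\ell)\big)_{\ell\in\{1,\dots,R\}}\xrightarrow{d}\left(\int_{\mathcal T}\mathbf z_\ell^\top(t)\big(\mathbf H_\ell\boldsymbol\Sigma(t,t)\mathbf H_\ell^\top\big)^+\mathbf z_\ell(t)\,\mathrm dt\right)_{\ell\in\{1,\dots,R\}}.$$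
   Context: $\mathcal L_2(\mathcal T)$ is the Hilbert space of square-integrable real functions on $\mathcal T$. $\mathrm E_{\mathrm{out}}$ is outer expectation. $\mathbf A^+$ is the Moore–Penrose inverse of $\mathbf A$. $GP_r(\mathbf 0_r,\boldsymbol\Gamma)$ denotes an $r$-dimensional centered Gaussian process on $\mathcal T$ (all finite-dimensional distributions Gaussian), viewed as a random element of $\mathcal L_2^r(\mathcal T)$, with covariance function $\boldsymbol\Gamma:\mathcal T^2\to\mathbb R^{r\times r}$. $\xrightarrow{d}$ is convergence in distribution in the sense of van der Vaart and Wellner (outer expectations of bounded continuous functions converge). Define $$\boldsymbol\Sigma(t,s):=\mathrm{diag}\Big(\tfrac1{\tau_1}\gamma_1(t,s),\dots,\tfrac1{\tau_k}\gamma_k(t,s)\Big).$$ Estimators: $\widehat\eta_i(t):=\frac1{n_i}\sum_{j=1}^{n_i}x_{ij}(t)$, $\widehat{\boldsymbol\eta}:=(\widehat\eta_1,\dots,\widehat\eta_k)^\top$, $$\widehat\gamma_i(t,s):=\frac1{n_i-1}\sum_{j=1}^{n_i}(x_{ij}(t)-\widehat\eta_i(t))(x_{ij}(s)-\widehat\eta_i(s)),\qquad \widehat{\boldsymbol\Sigma}(t,s):=\mathrm{diag}\Big(\tfrac n{n_1}\widehat\gamma_1(t,s),\dots,\tfrac n{n_k}\widehat\gamma_k(t,s)\Big).$$ For each $\ell$, $$T_n(\mathbf H_\ell,\mathbf c_\ell):=\int_{\mathcal T}n\,(\mathbf H_\ell\widehat{\boldsymbol\eta}(t)-\mathbf c_\ell(t))^\top\big(\mathbf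 H_\ell\widehat{\boldsymbol\Sigma}(t,t)\mathbf H_\ell^\top\big)^+(\mathbf H_\ell\widehat{\boldsymbol\eta}(t)-\mathbf c_\ell(t))\,\mathrm dt .$$ *)

theory Defs
  imports "HOL-Probability.Probability" "Jordan_Normal_Form.Matrix"
begin

text \<open>
  The dollar and dot symbols denote entries and the scalar product of \<^typ>\<open>'a Matrix.vec\<close>.
  All indices (samples, observations, matrix entries, blocks) start at 0.
\<close>

unbundle no vec_syntax
no_notation inner (infix \<open>\<bullet>\<close> 70)


section \<open>Outer expectation and convergence in distribution\<close>

definition expectation_exists :: "'w measure \<Rightarrow> ('w \<Rightarrow> ereal) \<Rightarrow> bool" where
  "expectation_exists M U \<longleftrightarrow>
     (\<integral>\<^sup>+\<omega>. e2ennreal (U \<omega>) \<partial>M) < \<infinity> \<or> (\<integral>\<^sup>+\<omega>. e2ennreal (- U \<omega>) \<partial>M) < \<infinity>"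

text \<open>\<^const>\<open>e2ennreal\<close> maps negative numbers to 0, so this is the positive part minus the
  negative part.\<close>

definition ereal_expectation :: "'w measure \<Rightarrow> ('w \<Rightarrow> ereal) \<Rightarrow> ereal" where
  "ereal_expectation M U =
     enn2ereal (\<integral>\<^sup>+\<omega>. e2ennreal (U \<omega>) \<partial>M) - enn2ereal (\<integral>\<^sup>+\<omega>. e2ennreal (- U \<omega>) \<partial>M)"

definition outer_expectation :: "'w measure \<Rightarrow> ('w \<Rightarrow> ereal) \<Rightarrow> ereal" where
  "outer_expectation M X =
     Inf {ereal_expectation M U | U. U \<in> borel_measurable M \<and> expectation_exists M U \<and>
            (\<forall>\<omega>\<in>space M. X \<omega> \<le> U \<omega>)}"

text \<open>Convergence in distribution in the sense of van der Vaart and Wellner in a topological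
  space: the \<open>Y m\<close> need not be measurable, the limit \<open>Z\<close> is Borel measurable.\<close>

definition converges_in_distribution ::
    "'a topology \<Rightarrow> 'w measure \<Rightarrow> (nat \<Rightarrow> 'w \<Rightarrow> 'a) \<Rightarrow> 'z measure \<Rightarrow> ('z \<Rightarrow> 'a) \<Rightarrow> bool" where
  "converges_in_distribution X M Y N Z \<longleftrightarrow>
     (\<forall>m. \<forall>\<omega>\<in>space M. Y m \<omega> \<in> topspace X) \<and>
     (\<forall>\<omega>\<in>space N. Z \<omega> \<in> topspace X) \<and>
     (\<forall>U. openin X U \<longrightarrow> {\<omega> \<in> space N. Z \<omega> \<in> U} \<in> sets N) \<and>
     (\<forall>f. continuous_map X euclideanreal f \<and> bounded (f ` topspace X) \<longrightarrow>
        (\<lambda>m. outer_expectation M (\<lambda>\<omega>. ereal (f (Y m \<omega>))))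
          \<longlonglongrightarrow> ereal (\<integral>\<omega>. f (Z \<omega>) \<partial>N))"


section \<open>Stochastic processes with square-integrable paths\<close>

definition L2_on :: "real set \<Rightarrow> (real \<Rightarrow> real) set" where
  "L2_on T = {f \<in> borel_measurable (lebesgue_on T). integrable (lebesgue_on T) (\<lambda>t. (f t)\<^sup>2)}"

text \<open>Joint measurability is what makes a process with paths in \<open>L2_on T\<close> a random element of
  the Hilbert space whose law is determined by the finite-dimensional distributions.\<close>

definition L2_process :: "'w measure \<Rightarrow> real set \<Rightarrow> ('w \<Rightarrow> real \<Rightarrow> real) \<Rightarrow> bool" where
  "L2_process M T X \<longleftrightarrow>
     (\<lambda>(\<omega>, t). X \<omega> t) \<in> borel_measurable (M \<Otimes>\<^sub>M lebesgue_on T) \<and>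
     (\<forall>\<omega>\<in>space M. X \<omega> \<in> L2_on T)"

definition has_mean_function ::
    "'w measure \<Rightarrow> real set \<Rightarrow> ('w \<Rightarrow> real \<Rightarrow> real) \<Rightarrow> (real \<Rightarrow> real) \<Rightarrow> bool" where
  "has_mean_function M T X \<eta> \<longleftrightarrow>
     (\<forall>t\<in>T. integrable M (\<lambda>\<omega>. X \<omega> t) \<and> (\<integral>\<omega>. X \<omega> t \<partial>M) = \<eta> t)"

definition has_covariance_function ::
    "'w measure \<Rightarrow> real set \<Rightarrow> ('w \<Rightarrow> real \<Rightarrow> real) \<Rightarrow> (real \<Rightarrow> real \<Rightarrow> real) \<Rightarrow> bool" where
  "has_covariance_function M T X \<gamma> \<longleftrightarrow>
     (\<forall>t\<in>T. integrable M (\<lambda>\<omega>. X \<omega> t) \<and> integrable M (\<lambda>\<omega>. (X \<omega> t)\<^sup>2)) \<and>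
     (\<forall>t\<in>T. \<forall>s\<in>T.
        (\<integral>\<omega>. (X \<omega> t - (\<integral>\<omega>'. X \<omega>' t \<partial>M)) * (X \<omega> s - (\<integral>\<omega>'. X \<omega>' s \<partial>M)) \<partial>M) = \<gamma> t s)"

text \<open>Independence and equality in law of processes refer to the product \<open>\<sigma>\<close>-algebra, that is, to
  the finite-dimensional distributions.\<close>

abbreviation path_space :: "real set \<Rightarrow> (real \<Rightarrow> real) measure" where
  "path_space T \<equiv> \<Pi>\<^sub>M t\<in>T. borel"

definition independent_processes ::
    "'w measure \<Rightarrow> real set \<Rightarrow> 'i set \<Rightarrow> ('i \<Rightarrow> 'w \<Rightarrow> real \<Rightarrow> real) \<Rightarrow> bool" where
  "independent_processes M T I X \<longleftrightarrow>
     prob_space.indep_vars M (\<lambda>_. path_space T) (\<lambda>i \<omega>. restrict (X i \<omega>) T) I"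

definition identically_distributed ::
    "'w measure \<Rightarrow> real set \<Rightarrow> ('w \<Rightarrow> real \<Rightarrow> real) \<Rightarrow> ('w \<Rightarrow> real \<Rightarrow> real) \<Rightarrow> bool" where
  "identically_distributed M T X Y \<longleftrightarrow>
     distr M (path_space T) (\<lambda>\<omega>. restrict (X \<omega>) T) =
     distr M (path_space T) (\<lambda>\<omega>. restrict (Y \<omega>) T)"

text \<open>Standard deviation 0 gives the point mass.\<close>

definition normal_law :: "real \<Rightarrow> real \<Rightarrow> real measure" where
  "normal_law \<mu> \<sigma> =
     (if \<sigma> = 0 then return borel \<mu> else density lborel (\<lambda>x. ennreal (normal_density \<mu> \<sigma> x)))"

text \<open>Centered \<open>r\<close>-dimensional Gaussian process with covariance function \<open>\<Gamma>\<close>: a finite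
  family of variables is jointly Gaussian if all its linear combinations are (possibly degenerate)
  normal.\<close>

definition gaussian_process ::
    "'z measure \<Rightarrow> real set \<Rightarrow> nat \<Rightarrow> (real \<Rightarrow> real \<Rightarrow> real mat) \<Rightarrow>
     ('z \<Rightarrow> real \<Rightarrow> real Matrix.vec) \<Rightarrow> bool" where
  "gaussian_process N T r \<Gamma> z \<longleftrightarrow>
     (\<forall>\<omega>\<in>space N. \<forall>t\<in>T. z \<omega> t \<in> carrier_vec r) \<and>
     (\<forall>p<r. L2_process N T (\<lambda>\<omega> t. z \<omega> t $ p)) \<and>
     (\<forall>F u. finite F \<and> F \<subseteq> T \<longrightarrow>
        (\<exists>\<mu> \<sigma>. 0 \<le> \<sigma> \<and>
           distr N borel (\<lambda>\<omega>. \<Sum>t\<in>F. \<Sum>p<r. u t p * z \<omega> t $ p) = normal_law \<mu> \<sigma>)) \<and>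
     (\<forall>t\<in>T. \<forall>p<r. (\<integral>\<omega>. z \<omega> t $ p \<partial>N) = 0) \<and>
     (\<forall>t\<in>T. \<forall>s\<in>T. \<forall>p<r. \<forall>q<r. (\<integral>\<omega>. z \<omega> t $ p * z \<omega> s $ q \<partial>N) = \<Gamma> t s $$ (p, q))"


section \<open>Matrices\<close>

definition is_moore_penrose_inverse :: "real mat \<Rightarrow> real mat \<Rightarrow> bool" where
  "is_moore_penrose_inverse A X \<longleftrightarrow>
     X \<in> carrier_mat (dim_col A) (dim_row A) \<and>
     A * X * A = A \<and> X * A * X = X \<and> (A * X)\<^sup>T = A * X \<and> (X * A)\<^sup>T = X * A"

definition moore_penrose_inverse :: "real mat \<Rightarrow> real mat" where
  "moore_penrose_inverse A = (THE X. is_moore_penrose_inverse A X)"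

text \<open>The \<open>l\<close>-th block of a matrix or vector whose rows are partitioned into consecutive
  blocks of sizes \<open>rs 0, rs 1, \<dots>\<close>.\<close>

definition row_block :: "(nat \<Rightarrow> nat) \<Rightarrow> nat \<Rightarrow> real mat \<Rightarrow> real mat" where
  "row_block rs l A =
     Matrix.mat (rs l) (dim_col A) (\<lambda>(p, j). A $$ ((\<Sum>m<l. rs m) + p, j))"

definition vec_block :: "(nat \<Rightarrow> nat) \<Rightarrow> nat \<Rightarrow> real Matrix.vec \<Rightarrow> real Matrix.vec" where
  "vec_block rs l v = Matrix.vec (rs l) (\<lambda>p. v $ ((\<Sum>m<l. rs m) + p))"


section \<open>Estimators and test statistics\<close>

text \<open>Below, \<open>y i j t\<close> is the realised value at time \<open>t\<close> of the \<open>j\<close>-th observation of the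
  \<open>i\<close>-th sample, and \<open>ns i\<close> is the size of the \<open>i\<close>-th sample.\<close>

definition Sigma_mat ::
    "nat \<Rightarrow> (nat \<Rightarrow> real) \<Rightarrow> (nat \<Rightarrow> real \<Rightarrow> real \<Rightarrow> real) \<Rightarrow> real \<Rightarrow> real \<Rightarrow> real mat" where
  "Sigma_mat k \<tau> \<gamma> t s = mat_diag k (\<lambda>i. 1 / \<tau> i * \<gamma> i t s)"

definition eta_hat ::
    "(nat \<Rightarrow> nat) \<Rightarrow> (nat \<Rightarrow> nat \<Rightarrow> real \<Rightarrow> real) \<Rightarrow> nat \<Rightarrow> real \<Rightarrow> real" where
  "eta_hat ns y i t = 1 / real (ns i) * (\<Sum>j<ns i. y i j t)"

definition gamma_hat ::
    "(nat \<Rightarrow> nat) \<Rightarrow> (nat \<Rightarrow> nat \<Rightarrow> real \<Rightarrow> real) \<Rightarrow> nat \<Rightarrow> real \<Rightarrow> real \<Rightarrow> real" where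
  "gamma_hat ns y i t s =
     1 / (real (ns i) - 1) *
       (\<Sum>j<ns i. (y i j t - eta_hat ns y i t) * (y i j s - eta_hat ns y i s))"

definition Sigma_hat ::
    "nat \<Rightarrow> (nat \<Rightarrow> nat) \<Rightarrow> (nat \<Rightarrow> nat \<Rightarrow> real \<Rightarrow> real) \<Rightarrow> real \<Rightarrow> real \<Rightarrow> real mat" where
  "Sigma_hat k ns y t s =
     mat_diag k (\<lambda>i. real (\<Sum>i'<k. ns i') / real (ns i) * gamma_hat ns y i t s)"

text \<open>The integrand is nonnegative; the Bochner integral assigns 0 if it is not integrable.\<close>

definition T_stat ::
    "real set \<Rightarrow> nat \<Rightarrow> (nat \<Rightarrow> nat) \<Rightarrow> (nat \<Rightarrow> nat \<Rightarrow> real \<Rightarrow> real) \<Rightarrow>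
     real mat \<Rightarrow> (real \<Rightarrow> real Matrix.vec) \<Rightarrow> real" where
  "T_stat T k ns y A d =
     (\<integral>t. real (\<Sum>i<k. ns i) *
         ((A *\<^sub>v Matrix.vec k (\<lambda>i. eta_hat ns y i t) - d t) \<bullet>
          (moore_penrose_inverse (A * Sigma_hat k ns y t t * A\<^sup>T) *\<^sub>v
            (A *\<^sub>v Matrix.vec k (\<lambda>i. eta_hat ns y i t) - d t)))
       \<partial>lebesgue_on T)"

end

theory Submission
  imports Defs "Jordan_Normal_Form.Determinant"
begin

text \<open>
  Under the null hypothesis the integrand of the \<open>l\<close>-th statistic is the value at
  \<open>W = sqrt n * H_l (eta_hat - \<eta>)\<close> of the quadratic form of
  \<open>(H_l Sigma_hat H_l^T)\<^sup>+\<close>. For a positive diagonal matrix \<open>D\<close> the range of \<open>H_l D H_l^T\<close> does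
  not depend on \<open>D\<close>, and changing the entries of \<open>D\<close> by factors between \<open>1 / \<kappa>\<close> and \<open>\<kappa>\<close> changes the
  quadratic form of the pseudoinverse by factors in the same range. The oscillation condition and the
  law of large numbers make the variance estimators consistent uniformly in time, up to null sets, so
  \<open>Sigma_hat\<close> may be replaced by \<open>\<Sigma>\<close> at the cost of \<open>\<kappa> - 1\<close> times a variable that is bounded in
  mean.

  For the remaining integrated quadratic forms no central limit theorem in the Hilbert space is needed.
  By polarization they are integrals of squares \<open>u\<^sup>2\<close> of linear forms, and \<open>u\<^sup>2\<close> is
  approximated by the bounded function \<open>2 (1 - cos (\<epsilon> u)) / \<epsilon>\<^sup>2\<close>, in mean and uniformly in the sample
  size because second moments converge. By Fubini and the product formula for cosines, the mixed
  moments of integrals of cosines are integrals of characteristic functions of finite-dimensional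
  distributions, which converge by the classical central limit theorem. Bounded random vectors
  converge in law as soon as their mixed moments do.
\<close>


section \<open>Quadratic forms of Moore-Penrose inverses\<close>

text \<open>The supremum in the oscillation condition need not be measurable, and identity in law
  concerns finite-dimensional distributions only, so a bound for the first two observations of a
  sample cannot be carried over to the others as a statement about suprema over the whole interval.
  It is carried over on finite sets of times, with constants that do not depend on the set; a Fubini
  argument then yields control at almost every time, which is all that the integrals see. The pairs
  with j in {0, 1} suffice because the variance estimator is quadratic: subtracting the sample mean
  creates products of two observations, whose indices are either equal or distinct. A second
  obstacle is that the pseudoinverse is discontinuous where the rank drops. Estimated and true
  matrices are therefore compared only on events where all estimated variances are positive at
  almost every time, and there by ratios rather than by distances. On the remaining events of small
  probability nothing is claimed about the statistics; their outer expectations are sandwiched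
  between expectations of measurable approximations.\<close>

lemma transpose_mult_self_eq_0:
  fixes C :: "real mat"
  assumes C: "C \<in> carrier_mat m n" and 0: "C\<^sup>T * C = 0\<^sub>m n n"
  shows "C = 0\<^sub>m m n"
proof (rule eq_matI)
  fix i j assume ij: "i < dim_row (0\<^sub>m m n :: real mat)" "j < dim_col (0\<^sub>m m n :: real mat)"
  have "(C\<^sup>T * C) $$ (j, j) = (\<Sum>i<m. (C $$ (i, j))\<^sup>2)"
    using C ij by (simp add: scalar_prod_def power2_eq_square lessThan_atLeast0)
  then have "(\<Sum>i<m. (C $$ (i, j))\<^sup>2) = 0" using 0 ij by simp
  then show "C $$ (i, j) = 0\<^sub>m m n $$ (i, j)"
    using ij by (auto simp: sum_nonneg_eq_0_iff)
qed (use C in auto)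

text \<open>Coefficients are listed from the constant term upwards, so dividing out a factor
  \<open>A\<close> is passing to the tail of the list, and the search for the lowest nonzero
  coefficient becomes an induction on lists.\<close>

primrec horner_mat :: "nat \<Rightarrow> real mat \<Rightarrow> real list \<Rightarrow> real mat" where
  "horner_mat n A [] = 0\<^sub>m n n"
| "horner_mat n A (c # cs) = c \<cdot>\<^sub>m 1\<^sub>m n + horner_mat n A cs * A"

context
  fixes n :: nat and A :: "real mat"
  assumes A [simp]: "A \<in> carrier_mat n n"
begin

lemma dim_A [simp]: "dim_row A = n" "dim_col A = n"
  using carrier_matD[OF A] by simp_all

lemma horner_mat_carrier [simp]: "horner_mat n A cs \<in> carrier_mat n n"
  by (induction cs) (auto simp: mult_carrier_mat[of _ n n])

lemma dim_horner_mat [simp]: "dim_row (horner_mat n A cs) = n" "dim_col (horner_mat n A cs) = n"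
  using carrier_matD[OF horner_mat_carrier] by auto

lemma horner_mat_commute: "A * horner_mat n A cs = horner_mat n A cs * A"
proof (induction cs)
  case Nil
  show ?case by (simp add: left_mult_zero_mat[of _ n n] right_mult_zero_mat[of _ n n])
next
  case (Cons c cs)
  have "A * horner_mat n A (c # cs) = c \<cdot>\<^sub>m A + A * (horner_mat n A cs * A)"
    by (simp add: mult_carrier_mat[of _ n n _ n] mult_add_distrib_mat[of _ n n _ n] mult_smult_distrib[of _ n
      n _ n] right_mult_one_mat[of _ n n])
  also have "A * (horner_mat n A cs * A) = horner_mat n A cs * A * A"
    using Cons by (simp flip: assoc_mult_mat[of _ n n _ n _ n])
  finally show ?case
    by (simp add: mult_carrier_mat[of _ n n _ n] add_mult_distrib_mat[of _ n n _ _ n] mult_smult_assoc_mat[of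
      _ n n _ n] left_mult_one_mat[of _ n n])
qed

text \<open>Makes the vanishing of a polynomial in \<open>A\<close> a linear system for its
  coefficients, with one equation per matrix entry.\<close>

lemma horner_mat_eq:
  "horner_mat n A cs = Matrix.mat n n (\<lambda>pq. \<Sum>i<length cs. cs ! i * (A ^\<^sub>m i) $$ pq)"
proof (induction cs)
  case Nil
  then show ?case by auto
next
  case (Cons c cs)
  show ?case
  proof (rule eq_matI)
    fix p q assume "p < dim_row (Matrix.mat n n (\<lambda>pq. \<Sum>i<length (c # cs). (c # cs) ! i * (A ^\<^sub>m i) $$ pq))"
      "q < dim_col (Matrix.mat n n (\<lambda>pq. \<Sum>i<length (c # cs). (c # cs) ! i * (A ^\<^sub>m i) $$ pq))"
    then have pq: "p < n" "q < n" by auto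
    have "(horner_mat n A cs * A) $$ (p, q) = (\<Sum>r<n. \<Sum>i<length cs. cs ! i * (A ^\<^sub>m i) $$ (p, r) * A $$ (r, q))"
      using pq A by (simp add: Cons scalar_prod_def lessThan_atLeast0 sum_distrib_right)
    also have "\<dots> = (\<Sum>i<length cs. cs ! i * (\<Sum>r<n. (A ^\<^sub>m i) $$ (p, r) * A $$ (r, q)))"
      by (subst sum.swap) (simp add: sum_distrib_left mult.assoc)
    also have "\<dots> = (\<Sum>i<length cs. cs ! i * (A ^\<^sub>m Suc i) $$ (p, q))"
      using pq A by (simp add: scalar_prod_def lessThan_atLeast0)
    finally show "horner_mat n A (c # cs) $$ (p, q) =
      Matrix.mat n n (\<lambda>pq. \<Sum>i<length (c # cs). (c # cs) ! i * (A ^\<^sub>m i) $$ pq) $$ (p, q)"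
      using pq A
      by (simp add: sum.lessThan_Suc_shift del: pow_mat.simps(2)
          sum.lessThan_Suc)
  qed (use horner_mat.simps in auto)
qed

text \<open>Dimension count: the \<open>n * n + 1\<close> powers of \<open>A\<close> from degree 0
  to \<open>n * n\<close> lie in a space of dimension \<open>n * n\<close>. Any nonzero annihilating
  polynomial serves the purpose.\<close>

lemma exists_annihilating_horner: "\<exists>cs. horner_mat n A cs = 0\<^sub>m n n \<and> (\<exists>c\<in>set cs. c \<noteq> 0)"
proof -
  define m where "m = n * n + 1"
  \<comment> \<open>Column \<open>i\<close> lists the entries of the \<open>i\<close>-th power row
    by row. The last row is zero: it makes the matrix square, so that its kernel is governed by a
    determinant, and forces that determinant to vanish.\<close>
  define B where "B = Matrix.mat m m
    (\<lambda>(r, i). if r < n * n then (A ^\<^sub>m i) $$ (r div n, r mod n) else 0)"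
  have B: "B \<in> carrier_mat m m" by (simp add: B_def)
  have "B\<^sup>T *\<^sub>v unit_vec m (n * n) = 0\<^sub>v m"
    by (rule eq_vecI) (auto simp: B_def m_def scalar_prod_def unit_vec_def sum.If_cases intro!: sum.neutral)
  moreover have "unit_vec m (n * n) \<noteq> (0\<^sub>v m :: real Matrix.vec)"
    using unit_vec_nonzero[of "n * n" m] by (auto simp: m_def)
  ultimately have "det (B\<^sup>T) = 0"
    using B by (subst det_0_iff_vec_prod_zero_field[of _ m]) (auto intro!: exI[of _ "unit_vec m (n * n)"])
  then have "det B = 0" using B by (simp add: det_transpose)
  then obtain v where v: "v \<in> carrier_vec m" "v \<noteq> 0\<^sub>v m" "B *\<^sub>v v = 0\<^sub>v m"
    using det_0_iff_vec_prod_zero_field[OF B] by auto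
  define cs where "cs = list_of_vec v"
  have len: "length cs = m" and nth: "i < m \<Longrightarrow> cs ! i = v $ i" for i
    using v(1) by (auto simp: cs_def list_of_vec_index)
  have "(\<Sum>i<length cs. cs ! i * (A ^\<^sub>m i) $$ (p, q)) = 0" if pq: "p < n" "q < n" for p q
  proof -
    define r where "r = p * n + q"
    have r: "r < n * n"
      using pq mult_le_mono1[of "Suc p" n n] by (auto simp: r_def)
    have [simp]: "r div n = p" "r mod n = q" using pq by (auto simp: r_def)
    have "(B *\<^sub>v v) $ r = (\<Sum>i<m. (A ^\<^sub>m i) $$ (p, q) * v $ i)"
      using r v(1) by (auto simp: B_def m_def scalar_prod_def lessThan_atLeast0 intro!: sum.cong)
    then show ?thesis using v(3) r by (simp add: len nth m_def mult.commute)
  qed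
  then have "horner_mat n A cs = 0\<^sub>m n n"
    unfolding horner_mat_eq by (intro eq_matI) auto
  moreover have "\<exists>c\<in>set cs. c \<noteq> 0"
  proof (rule ccontr)
    assume "\<not> ?thesis"
    then have "v $ i = 0" if "i < m" for i
      using that nth[OF that] len by (auto simp: in_set_conv_nth)
    then have "v = 0\<^sub>v m" using v(1) by (intro eq_vecI) auto
    then show False using v(2) by simp
  qed
  ultimately show ?thesis by blast
qed

context
  assumes A_sym: "A\<^sup>T = A"
begin

lemma transpose_horner_mat: "(horner_mat n A cs)\<^sup>T = horner_mat n A cs"
proof (induction cs)
  case (Cons c cs)
  have "(c \<cdot>\<^sub>m 1\<^sub>m n + horner_mat n A cs * A)\<^sup>T = (c \<cdot>\<^sub>m 1\<^sub>m n)\<^sup>T + (horner_mat n A cs * A)\<^sup>T"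
    by (rule transpose_add[of _ n n]) auto
  moreover have "(horner_mat n A cs * A)\<^sup>T = A\<^sup>T * (horner_mat n A cs)\<^sup>T"
    by (rule transpose_mult[of _ n n _ n]) auto
  moreover have "(c \<cdot>\<^sub>m 1\<^sub>m n)\<^sup>T = c \<cdot>\<^sub>m 1\<^sub>m n"
    by (rule eq_matI) auto
  ultimately show ?case using Cons by (simp add: A_sym horner_mat_commute)
qed auto

text \<open>For a symmetric matrix the kernels of all positive powers coincide, so the lowest nonzero
  coefficient of an annihilating polynomial may be taken in degree at most one; solving for the
  linear term gives an inverse of \<open>A\<close> on its range that is a polynomial in \<open>A\<close>.\<close>

lemma symmetric_inner_inverse_of_horner:
  assumes "horner_mat n A cs * A = 0\<^sub>m n n" "\<exists>c\<in>set cs. c \<noteq> 0"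
  shows "\<exists>X\<in>carrier_mat n n. X\<^sup>T = X \<and> A * X = X * A \<and> A * X * A = A"
  using assms
proof (induction cs)
  case (Cons c cs)
  let ?h = "horner_mat n A cs"
  note assoc = assoc_mult_mat[of _ n n _ n _ n]
  have hA: "?h * A \<in> carrier_mat n n" by (rule mult_carrier_mat[of _ n n]) simp_all
  have 0: "c \<cdot>\<^sub>m A + ?h * A * A = 0\<^sub>m n n"
    using Cons.prems(1)
    by (simp add: hA add_mult_distrib_mat[of _ n n _ _ n] mult_smult_assoc_mat[of _ n n _ n]
      left_mult_one_mat[of _ n n])
  have hAA: "?h * A * A \<in> carrier_mat n n" by (rule mult_carrier_mat[OF hA A])
  show ?case
  proof (cases "c = 0")
    case True
    have hAA0: "?h * A * A = 0\<^sub>m n n"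
    proof -
      have "c \<cdot>\<^sub>m A = 0\<^sub>m n n" using True A by (intro eq_matI) auto
      then show ?thesis using 0 hAA by simp
    qed
    have "(?h * A)\<^sup>T = ?h * A"
      using transpose_mult[of ?h n n A n] by (simp add: A_sym transpose_horner_mat horner_mat_commute)
    moreover have "?h * A * (?h * A) = ?h * (?h * A * A)"
      by (simp add: assoc hA mult_carrier_mat[of _ n n] horner_mat_commute flip: assoc_mult_mat[of A n n ?h n A n])
    ultimately have "(?h * A)\<^sup>T * (?h * A) = 0\<^sub>m n n"
      by (simp add: hAA0 right_mult_zero_mat[of _ n n])
    then have "?h * A = 0\<^sub>m n n"
      by (rule transpose_mult_self_eq_0[OF hA])
    then show ?thesis using Cons True by auto
  next
    case False
    define X where "X = (- 1 / c) \<cdot>\<^sub>m ?h"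
    have X: "X \<in> carrier_mat n n" by (simp add: X_def)
    have 1: "X * A = A * X"
      by (simp add: X_def mult_smult_assoc_mat[of _ n n _ n] mult_smult_distrib[of _ n n _ n] horner_mat_commute)
    have 2: "A * X * A = (- 1 / c) \<cdot>\<^sub>m (?h * A * A)"
      unfolding 1[symmetric]
      by (simp add: X_def mult_smult_assoc_mat[of _ n n _ n] hA)
    have "A * X * A = A"
      unfolding 2
    proof (rule eq_matI)
      fix i j assume "i < dim_row A" "j < dim_col A"
      then have ij: "i < n" "j < n" using A by auto
      have "c * A $$ (i, j) + (?h * A * A) $$ (i, j) = 0"
        using arg_cong[OF 0, of "\<lambda>B. B $$ (i, j)"] ij A hAA by (simp del: index_mult_mat)
      then show "((- 1 / c) \<cdot>\<^sub>m (?h * A * A)) $$ (i, j) = A $$ (i, j)"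
        using ij hAA False by (simp add: field_simps del: index_mult_mat)
    qed (use A hAA in auto)
    moreover have "X\<^sup>T = X"
    proof -
      have "X\<^sup>T = (- 1 / c) \<cdot>\<^sub>m ?h\<^sup>T" unfolding X_def by (rule eq_matI) auto
      then show ?thesis by (simp add: X_def transpose_horner_mat)
    qed
    ultimately show ?thesis using X 1 by auto
  qed
qed auto

lemma exists_moore_penrose_inverse: "\<exists>X. is_moore_penrose_inverse A X"
proof -
  note assoc = assoc_mult_mat[of _ n n _ n _ n]
  obtain cs where cs: "horner_mat n A cs = 0\<^sub>m n n" "\<exists>c\<in>set cs. c \<noteq> 0"
    using exists_annihilating_horner by blast
  then have "horner_mat n A cs * A = 0\<^sub>m n n" by (simp add: left_mult_zero_mat[of _ n n])
  then obtain Y where Y: "Y \<in> carrier_mat n n" "Y\<^sup>T = Y" and comm: "A * Y = Y * A" and AYA: "A * Y * A = A"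
    using symmetric_inner_inverse_of_horner cs(2) by blast
  note [simp] = Y(1) carrier_matD[OF Y(1)] mult_carrier_mat[of _ n n _ n]
  \<comment> \<open>Sandwiching an inner inverse: \<open>Y * A * Y\<close> is still one, satisfies
    the second Penrose equation as well, and both of its products with \<open>A\<close> collapse to
    \<open>Y * A\<close>, which is symmetric because \<open>Y\<close> and \<open>A\<close> are
    symmetric and commute.\<close>
  define X where "X = Y * A * Y"
  have AX: "A * X = Y * A"
  proof -
    have "A * X = A * Y * A * Y" by (simp add: X_def assoc)
    also have "\<dots> = A * Y" by (simp add: AYA)
    finally show ?thesis by (simp add: comm)
  qed
  have XA: "X * A = Y * A"
  proof -
    have "X * A = Y * (A * Y * A)" by (simp add: X_def assoc)
    then show ?thesis by (simp add: AYA)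
  qed
  have sym: "(Y * A)\<^sup>T = Y * A"
    using transpose_mult[of Y n n A n] by (simp add: Y A_sym comm)
  have "X * A * X = Y * A * Y"
  proof -
    have "X * A * X = Y * (A * X)" unfolding XA by (simp add: assoc X_def)
    also have "\<dots> = Y * (A * Y)" by (simp add: AX comm)
    finally show ?thesis by (simp add: assoc)
  qed
  moreover have "A * X * A = A" unfolding AX using AYA comm by simp
  ultimately have "is_moore_penrose_inverse A X"
    unfolding is_moore_penrose_inverse_def using sym
    by (simp add: AX XA) (simp add: X_def)
  then show ?thesis ..
qed

end
end

lemma is_moore_penrose_inverseD:
  assumes "is_moore_penrose_inverse G X" "G \<in> carrier_mat n n"
  shows "X \<in> carrier_mat n n" "G * X * G = G" "X * G * X = X" "(G * X)\<^sup>T = G * X" "(X * G)\<^sup>T = X * G"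
  using assms unfolding is_moore_penrose_inverse_def by auto

text \<open>\<open>G * X\<close> and \<open>G * Y\<close> are symmetric and each absorbs the other
  from one side; transposing exchanges the sides, so they agree, and so do \<open>X * G\<close> and
  \<open>Y * G\<close>. Then X = X G X = X G Y = Y G Y.\<close>

lemma moore_penrose_inverse_unique:
  assumes G: "G \<in> carrier_mat n n"
    and "is_moore_penrose_inverse G X" "is_moore_penrose_inverse G Y"
  shows "X = Y"
proof -
  note X = is_moore_penrose_inverseD[OF assms(2) G] and Y = is_moore_penrose_inverseD[OF assms(3) G]
  note [simp] = X(1) Y(1) G mult_carrier_mat[of _ n n _ n]
  note assoc = assoc_mult_mat[of _ n n _ n _ n]
  have 1: "G * X = G * Y"
  proof -
    have "G * X = (G * Y) * (G * X)"
      using arg_cong[OF Y(2), of "\<lambda>M. M * X"] by (simp add: assoc)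
    then have "(G * X)\<^sup>T = ((G * Y) * (G * X))\<^sup>T" by simp
    also have "\<dots> = (G * X)\<^sup>T * (G * Y)\<^sup>T" by (rule transpose_mult[of _ n n _ n]) simp_all
    also have "\<dots> = (G * X * G) * Y" by (simp add: X(4) Y(4) assoc)
    finally show ?thesis by (simp add: X(2,4))
  qed
  have 2: "X * G = Y * G"
  proof -
    have "X * G = (X * G) * (Y * G)"
      using arg_cong[OF Y(2), of "\<lambda>M. X * M"] by (simp add: assoc)
    then have "(X * G)\<^sup>T = ((X * G) * (Y * G))\<^sup>T" by simp
    also have "\<dots> = (Y * G)\<^sup>T * (X * G)\<^sup>T" by (rule transpose_mult[of _ n n _ n]) simp_all
    also have "\<dots> = Y * (G * X * G)" by (simp add: X(5) Y(5) assoc)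
    finally show ?thesis by (simp add: X(2,5))
  qed
  have "X = X * (G * X)" by (simp add: X(3) flip: assoc)
  also have "\<dots> = (X * G) * Y" by (simp add: 1 assoc)
  also have "\<dots> = Y" by (simp add: 2 Y(3))
  finally show ?thesis .
qed

text \<open>Existence and uniqueness give the definite description its meaning. For symmetric
  \<open>G\<close>, transposition maps solutions of the Penrose equations to solutions, so
  uniqueness makes the solution symmetric.\<close>

lemma symmetric_moore_penrose_inverse:
  assumes G: "G \<in> carrier_mat n n" and sym: "G\<^sup>T = G"
  defines "X \<equiv> moore_penrose_inverse G"
  shows "is_moore_penrose_inverse G X" "X\<^sup>T = X"
proof -
  show 1: "is_moore_penrose_inverse G X"
    unfolding X_def moore_penrose_inverse_def
    using exists_moore_penrose_inverse[OF G sym] moore_penrose_inverse_unique[OF G] by (metis theI)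
  note X = is_moore_penrose_inverseD[OF 1 G]
  note [simp] = X(1) G
  have tr: "(A * B)\<^sup>T = B\<^sup>T * A\<^sup>T" if "A \<in> carrier_mat n n" "B \<in> carrier_mat n n" for A B :: "real mat"
    using that by (rule transpose_mult)
  have a: "X\<^sup>T * G = G * X" using tr[of G X] by (simp add: X(4) sym)
  have b: "G * X\<^sup>T = X * G" using tr[of X G] by (simp add: X(5) sym)
  have "G * X\<^sup>T * G = G"
    using tr[of "G * X" G] tr[of G X] X(2) by (simp add: sym assoc_mult_mat[of _ n n _ n _ n]
      mult_carrier_mat[of _ n n _ n])
  moreover have "X\<^sup>T * G * X\<^sup>T = X\<^sup>T"
    using tr[of "X * G" X] tr[of X G] X(3) by (simp add: sym assoc_mult_mat[of _ n n _ n _ n]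
      mult_carrier_mat[of _ n n _ n])
  moreover have "(G * X\<^sup>T)\<^sup>T = G * X\<^sup>T" unfolding b by (rule X(5))
  moreover have "(X\<^sup>T * G)\<^sup>T = X\<^sup>T * G" unfolding a by (rule X(4))
  ultimately have "is_moore_penrose_inverse G (X\<^sup>T)"
    unfolding is_moore_penrose_inverse_def carrier_matD[OF G] by simp
  then show "X\<^sup>T = X" using moore_penrose_inverse_unique[OF G _ 1] by blast
qed

section \<open>Pseudoinverses of \<open>A * D * A\<^sup>T\<close> for positive diagonal
  \<open>D\<close>\<close>

definition pinv_form :: "nat \<Rightarrow> real mat \<Rightarrow> (nat \<Rightarrow> real) \<Rightarrow> real Matrix.vec \<Rightarrow> real" where
  "pinv_form k A d y = y \<bullet> (moore_penrose_inverse (A * mat_diag k d * A\<^sup>T) *\<^sub>v y)"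

definition gram :: "nat \<Rightarrow> real mat \<Rightarrow> (nat \<Rightarrow> real) \<Rightarrow> real mat" where
  "gram k A d = A * mat_diag k d * A\<^sup>T"

definition gram_inv :: "nat \<Rightarrow> real mat \<Rightarrow> (nat \<Rightarrow> real) \<Rightarrow> real mat" where
  "gram_inv k A d = moore_penrose_inverse (gram k A d)"

context
  fixes r k :: nat and A :: "real mat"
  assumes A: "A \<in> carrier_mat r k"
begin

lemma gram_carrier: "A * mat_diag k d * A\<^sup>T \<in> carrier_mat r r"
  using A by (intro mult_carrier_mat[of _ r k] mult_carrier_mat[of _ r k]) auto

lemma transpose_mat_diag: "(mat_diag k d)\<^sup>T = (mat_diag k d :: real mat)"
  by (rule eq_matI) (auto simp: mat_diag_def)

lemma transpose_gram: "(A * mat_diag k d * A\<^sup>T)\<^sup>T = A * mat_diag k d * A\<^sup>T"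
proof -
  have "(A * mat_diag k d * A\<^sup>T)\<^sup>T = (A\<^sup>T)\<^sup>T * (A * mat_diag k d)\<^sup>T"
    using A by (intro transpose_mult[of _ r k _ r]) (auto intro: mult_carrier_mat[of _ r k])
  also have "(A * mat_diag k d)\<^sup>T = mat_diag k d * A\<^sup>T"
    using A by (subst transpose_mult[of _ r k _ k]) (auto simp: transpose_mat_diag)
  finally show ?thesis using A by (simp add: assoc_mult_mat[of _ r k _ k _ r])
qed

text \<open>A weighted inner product of \<open>A\<^sup>T *\<^sub>v u\<close> and
  \<open>A\<^sup>T *\<^sub>v v\<close>: the diagonal matrix enters only through its entries as
  weights, which makes Gram matrices with different weights comparable.\<close>

lemma gram_form:
  assumes u: "u \<in> carrier_vec r" and v: "v \<in> carrier_vec r"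
  shows "u \<bullet> ((A * mat_diag k d * A\<^sup>T) *\<^sub>v v) = (\<Sum>i<k. d i * (A\<^sup>T *\<^sub>v u) $ i * (A\<^sup>T *\<^sub>v v) $ i)"
proof -
  have "(A * mat_diag k d * A\<^sup>T) *\<^sub>v v = A *\<^sub>v (mat_diag k d *\<^sub>v (A\<^sup>T *\<^sub>v v))"
    using A v by (simp add: assoc_mult_mat_vec[of _ r k _ r] assoc_mult_mat_vec[of _ r k _ k]
      mult_carrier_mat[of _ r k])
  also have "u \<bullet> \<dots> = (A\<^sup>T *\<^sub>v u) \<bullet> (mat_diag k d *\<^sub>v (A\<^sup>T *\<^sub>v v))"
    using A u v by (subst transpose_vec_mult_scalar[of A r k]) (auto intro: mult_mat_vec_carrier[of _ k k])
  also have "mat_diag k d *\<^sub>v (A\<^sup>T *\<^sub>v v) = Matrix.vec k (\<lambda>i. d i * (A\<^sup>T *\<^sub>v v) $ i)"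
  proof (rule eq_vecI)
    fix i assume "i < dim_vec (Matrix.vec k (\<lambda>i. d i * (A\<^sup>T *\<^sub>v v) $ i))"
    then show "(mat_diag k d *\<^sub>v (A\<^sup>T *\<^sub>v v)) $ i = Matrix.vec k (\<lambda>i. d i * (A\<^sup>T *\<^sub>v v) $ i) $ i"
      using A by (simp add: mat_diag_def scalar_prod_def if_distrib[of "\<lambda>x. x * _"] sum.delta cong: if_cong)
  qed (simp add: mat_diag_def)
  finally show ?thesis
    using A by (simp add: scalar_prod_def lessThan_atLeast0 mult_ac)
qed

context
  fixes d :: "nat \<Rightarrow> real"
  assumes d: "\<And>i. i < k \<Longrightarrow> 0 < d i"
begin

lemma gram_inv_props:
  "gram k A d \<in> carrier_mat r r" "gram_inv k A d \<in> carrier_mat r r"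
  "gram k A d * gram_inv k A d * gram k A d = gram k A d" "gram_inv k A d * gram k A d * gram_inv k A d =
    gram_inv k A d"
  "(gram k A d * gram_inv k A d)\<^sup>T = gram k A d * gram_inv k A d" "gram_inv k A d * gram k A d = gram k A d *
    gram_inv k A d"
  "(gram_inv k A d)\<^sup>T = gram_inv k A d"
proof -
  show c: "gram k A d \<in> carrier_mat r r" unfolding gram_def by (rule gram_carrier)
  have t: "(gram k A d)\<^sup>T = gram k A d" unfolding gram_def by (rule transpose_gram)
  note m = symmetric_moore_penrose_inverse[OF c t, folded gram_inv_def]
  note p = is_moore_penrose_inverseD[OF m(1) c]
  show "gram_inv k A d \<in> carrier_mat r r"
  "gram k A d * gram_inv k A d * gram k A d = gram k A d" "gram_inv k A d * gram k A d * gram_inv k A d =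
    gram_inv k A d"
  "(gram k A d * gram_inv k A d)\<^sup>T = gram k A d * gram_inv k A d" "(gram_inv k A d)\<^sup>T = gram_inv k A d"
    using p m by auto
  show "gram_inv k A d * gram k A d = gram k A d * gram_inv k A d"
    using transpose_mult[OF c p(1)] by (simp add: t m(2) p(4))
qed

text \<open>The difference of \<open>v\<close> and its projection is in the kernel of the Gram
  matrix, so its weighted square sum vanishes, and positive weights force \<open>A\<^sup>T\<close>
  to kill it. Thus the kernel is that of \<open>A\<^sup>T\<close>, whatever the weights.\<close>

lemma range_projection:
  assumes v: "v \<in> carrier_vec r"
  shows "A\<^sup>T *\<^sub>v ((gram k A d * gram_inv k A d) *\<^sub>v v) = A\<^sup>T *\<^sub>v v"
proof -
  note p = gram_inv_props
  define Pv where "Pv = (gram k A d * gram_inv k A d) *\<^sub>v v"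
  have Pv: "Pv \<in> carrier_vec r" unfolding Pv_def using p(1,2) v by auto
  have "gram k A d *\<^sub>v Pv = (gram k A d * (gram k A d * gram_inv k A d)) *\<^sub>v v"
    unfolding Pv_def by (rule assoc_mult_mat_vec[symmetric, OF p(1) mult_carrier_mat[OF p(1,2)] v])
  also have "gram k A d * (gram k A d * gram_inv k A d) = gram k A d * (gram_inv k A d * gram k A d)"
    by (simp only: p(6))
  also have "\<dots> = gram k A d"
    using assoc_mult_mat[OF p(1,2,1)] p(3) by (rule trans[OF sym])
  finally have "gram k A d *\<^sub>v (v - Pv) = 0\<^sub>v r"
    using p(1) v Pv by (simp add: mult_minus_distrib_mat_vec[of _ r r])
  then have "(v - Pv) \<bullet> (gram k A d *\<^sub>v (v - Pv)) = 0" using v Pv by simp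
  then have "(\<Sum>i<k. d i * ((A\<^sup>T *\<^sub>v (v - Pv)) $ i)\<^sup>2) = 0"
    unfolding gram_def using gram_form[of "v - Pv" "v - Pv" d] v Pv by (simp add: power2_eq_square mult_ac)
  then have "(A\<^sup>T *\<^sub>v (v - Pv)) $ i = 0" if "i < k" for i
  proof -
    have "\<forall>i\<in>{..<k}. d i * ((A\<^sup>T *\<^sub>v (v - Pv)) $ i)\<^sup>2 = 0"
      using \<open>(\<Sum>i<k. d i * ((A\<^sup>T *\<^sub>v (v - Pv)) $ i)\<^sup>2) = 0\<close>
      by (subst (asm) sum_nonneg_eq_0_iff) (auto intro!: mult_nonneg_nonneg simp: less_imp_le[OF d])
    then show ?thesis using that d[OF that] by (metis lessThan_iff less_irrefl mult_eq_0_iff zero_eq_power2)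
  qed
  moreover have "A\<^sup>T *\<^sub>v (v - Pv) = A\<^sup>T *\<^sub>v v - A\<^sup>T *\<^sub>v Pv"
    using A v Pv by (intro mult_minus_distrib_mat_vec[of _ k r]) auto
  ultimately have z: "(A\<^sup>T *\<^sub>v v - A\<^sup>T *\<^sub>v Pv) $ i = 0" if "i < k" for i using that by simp
  show ?thesis unfolding Pv_def[symmetric]
  proof (rule eq_vecI)
    fix i assume "i < dim_vec (A\<^sup>T *\<^sub>v v)"
    then show "(A\<^sup>T *\<^sub>v Pv) $ i = (A\<^sup>T *\<^sub>v v) $ i" using z[of i] A by simp
  qed (use A in simp)
qed

end
end

lemma mat_eqI_mult_vec:
  fixes B C :: "real mat"
  assumes "B \<in> carrier_mat n m" "C \<in> carrier_mat n m"
    and "\<And>v. v \<in> carrier_vec m \<Longrightarrow> B *\<^sub>v v = C *\<^sub>v v"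
  shows "B = C"
proof (rule eq_matI)
  fix i j assume "i < dim_row C" "j < dim_col C"
  then have ij: "i < n" "j < m" using assms by auto
  have "(B *\<^sub>v unit_vec m j) $ i = (C *\<^sub>v unit_vec m j) $ i" using assms(3) by simp
  then show "B $$ (i, j) = C $$ (i, j)" using ij assms(1,2) by simp
qed (use assms in auto)

text \<open>Pseudoinversion reverses inequalities between these Gram matrices, because all of them
  have the same range. The proof is a Cauchy-Schwarz argument for the weights \<open>d'\<close>,
  applied to the vectors belonging to \<open>X *\<^sub>v y\<close> and
  \<open>X' *\<^sub>v y\<close>.\<close>

lemma pinv_form_le:
  assumes A: "A \<in> carrier_mat r k" and y: "y \<in> carrier_vec r"
    and d: "\<And>i. i < k \<Longrightarrow> 0 < d i" and d': "\<And>i. i < k \<Longrightarrow> 0 < d' i"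
    and le: "\<And>i. i < k \<Longrightarrow> d' i \<le> \<kappa> * d i" and \<kappa>: "0 < \<kappa>"
  shows "0 \<le> pinv_form k A d y" "pinv_form k A d y \<le> \<kappa> * pinv_form k A d' y"
proof -
  define G where "G = gram k A d"
  define X where "X = gram_inv k A d"
  define G' where "G' = gram k A d'"
  define X' where "X' = gram_inv k A d'"
  have p: "G \<in> carrier_mat r r" "X \<in> carrier_mat r r"
    "G * X * G = G" "X * G * X = X" "(G * X)\<^sup>T = G * X" "X * G = G * X" "X\<^sup>T = X"
    unfolding G_def X_def by (rule gram_inv_props[OF A d]; assumption)+
  have p': "G' \<in> carrier_mat r r" "X' \<in> carrier_mat r r"
    "G' * X' * G' = G'" "X' * G' * X' = X'" "(G' * X')\<^sup>T = G' * X'" "X' * G' = G' * X'" "X'\<^sup>T = X'"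
    unfolding G'_def X'_def by (rule gram_inv_props[OF A d']; assumption)+
  note [simp] = p(1,2) p'(1,2) mult_carrier_mat[of _ r r _ r]
  note assoc = assoc_mult_mat[of _ r r _ r _ r] and assocv = assoc_mult_mat_vec[of _ r r _ r]
  have mv [simp]: "M *\<^sub>v v \<in> carrier_vec r" if "M \<in> carrier_mat r r" "v \<in> carrier_vec r" for M :: "real mat" and v
    using that by (rule mult_mat_vec_carrier)
  have GP: "G * (G' * X') = G"
  proof (rule mat_eqI_mult_vec[of _ r r])
    fix v :: "real Matrix.vec" assume v: "v \<in> carrier_vec r"
    have "G *\<^sub>v w = (A * mat_diag k d) *\<^sub>v (A\<^sup>T *\<^sub>v w)" if "w \<in> carrier_vec r" for w
      unfolding G_def gram_def using A that
      by (intro assoc_mult_mat_vec[of _ r k _ r]) (auto intro: mult_carrier_mat[of _ r k])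
    moreover have "A\<^sup>T *\<^sub>v ((G' * X') *\<^sub>v v) = A\<^sup>T *\<^sub>v v"
      unfolding G'_def X'_def using A d' v by (intro range_projection)
    ultimately show "(G * (G' * X')) *\<^sub>v v = G *\<^sub>v v"
      using v by (simp add: assocv)
  qed simp_all
  have GP': "G' * (G * X) = G'"
  proof (rule mat_eqI_mult_vec[of _ r r])
    fix v :: "real Matrix.vec" assume v: "v \<in> carrier_vec r"
    have "G' *\<^sub>v w = (A * mat_diag k d') *\<^sub>v (A\<^sup>T *\<^sub>v w)" if "w \<in> carrier_vec r" for w
      unfolding G'_def gram_def using A that
      by (intro assoc_mult_mat_vec[of _ r k _ r]) (auto intro: mult_carrier_mat[of _ r k])
    moreover have "A\<^sup>T *\<^sub>v ((G * X) *\<^sub>v v) = A\<^sup>T *\<^sub>v v"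
      unfolding G_def X_def using A d v by (intro range_projection)
    ultimately show "(G' * (G * X)) *\<^sub>v v = G' *\<^sub>v v"
      using v by (simp add: assocv)
  qed simp_all
  have 1: "(G * X) * (G' * X') = G * X"
    unfolding p(6)[symmetric] by (simp add: assoc GP)
  have 2: "(G' * X') * (G * X) = G' * X'"
    unfolding p'(6)[symmetric] by (simp add: assoc GP')
  \<comment> \<open>Each range projection absorbs the other, and transposing one of the two
    identities compares them.\<close>
  have P: "G' * X' = G * X"
    using arg_cong[OF 1, of transpose_mat] transpose_mult[of "G * X" r r "G' * X'" r] 2
    by (simp add: p(5) p'(5))
  define u where "u = X *\<^sub>v y"
  define u' where "u' = X' *\<^sub>v y"
  have [simp]: "u \<in> carrier_vec r" "u' \<in> carrier_vec r" unfolding u_def u'_def using y by simp_all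
  have self: "(M *\<^sub>v v) \<bullet> w = v \<bullet> (M *\<^sub>v w)" if "M \<in> carrier_mat r r" "M\<^sup>T = M" "v \<in> carrier_vec r" "w \<in>
    carrier_vec r" for M :: "real mat" and v w
    using transpose_vec_mult_scalar[of M r r w v] that by simp
  have q: "y \<bullet> u = u \<bullet> (G *\<^sub>v u)"
  proof -
    have "u \<bullet> (G *\<^sub>v u) = y \<bullet> (X *\<^sub>v (G *\<^sub>v u))"
      unfolding u_def using y by (intro self) (simp_all add: p(7))
    also have "X *\<^sub>v (G *\<^sub>v u) = u"
      unfolding u_def using y p(4) by (simp flip: assocv add: assoc del: assoc_mult_mat_vec)
    finally show ?thesis ..
  qed
  have q': "y \<bullet> u' = u' \<bullet> (G' *\<^sub>v u')"
  proof -
    have "u' \<bullet> (G' *\<^sub>v u') = y \<bullet> (X' *\<^sub>v (G' *\<^sub>v u'))"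
      unfolding u'_def using y by (intro self) (simp_all add: p'(7))
    also have "X' *\<^sub>v (G' *\<^sub>v u') = u'"
      unfolding u'_def using y p'(4) by (simp flip: assocv add: assoc del: assoc_mult_mat_vec)
    finally show ?thesis ..
  qed
  \<comment> \<open>Here the common range enters: \<open>G' *\<^sub>v u'\<close> is the projection
    of \<open>y\<close>, which may be computed with \<open>G\<close> and \<open>X\<close>
    instead.\<close>
  have c: "y \<bullet> u = u \<bullet> (G' *\<^sub>v u')"
  proof -
    have "u \<bullet> (G' *\<^sub>v u') = u \<bullet> ((G * X) *\<^sub>v y)"
      unfolding u'_def using y by (simp flip: assocv add: P del: assoc_mult_mat_vec)
    also have "\<dots> = y \<bullet> (X *\<^sub>v ((G * X) *\<^sub>v y))"
      unfolding u_def using y by (intro self) (simp_all add: p(7))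
    also have "X *\<^sub>v ((G * X) *\<^sub>v y) = u"
      unfolding u_def using y p(4) by (simp flip: assocv add: assoc del: assoc_mult_mat_vec)
    finally show ?thesis ..
  qed
  define a where "a i = (A\<^sup>T *\<^sub>v u) $ i" for i
  define b where "b i = (A\<^sup>T *\<^sub>v u') $ i" for i
  have qa: "y \<bullet> u = (\<Sum>i<k. d i * (a i)\<^sup>2)"
    unfolding q G_def gram_def using gram_form[OF A, of u u d] by (simp add: a_def power2_eq_square mult_ac)
  have qb: "y \<bullet> u' = (\<Sum>i<k. d' i * (b i)\<^sup>2)"
    unfolding q' G'_def gram_def using gram_form[OF A, of u' u' d'] by (simp add: b_def power2_eq_square mult_ac)
  have qc: "y \<bullet> u = (\<Sum>i<k. d' i * a i * b i)"
    unfolding c G'_def gram_def using gram_form[OF A, of u u' d'] by (simp add: a_def b_def)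
  have form: "pinv_form k A d y = y \<bullet> u" "pinv_form k A d' y = y \<bullet> u'"
    unfolding pinv_form_def u_def u'_def X_def X'_def
    by (simp_all add: gram_inv_def gram_def)
  show "0 \<le> pinv_form k A d y" unfolding form qa
    by (intro sum_nonneg) (auto simp: less_imp_le[OF d])
  \<comment> \<open>With q = \<open>y \<bullet> u\<close> and q' = \<open>y \<bullet> u'\<close> the
    expanded square reads 0 \<le> \<Sum> d' a^2 - 2 \<kappa> q + \<kappa>^2 q'. The first sum is at
    most \<kappa> q, which leaves 0 \<le> \<kappa> (\<kappa> q' - q).\<close>
  have "0 \<le> (\<Sum>i<k. d' i * (a i - \<kappa> * b i)\<^sup>2)"
    by (intro sum_nonneg) (auto simp: less_imp_le[OF d'])
  also have "\<dots> = (\<Sum>i<k. d' i * (a i)\<^sup>2 - 2 * \<kappa> * (d' i * a i * b i) + \<kappa>\<^sup>2 * (d' i * (b i)\<^sup>2))"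
    by (intro sum.cong) (simp_all add: algebra_simps power2_eq_square)
  also have "\<dots> = (\<Sum>i<k. d' i * (a i)\<^sup>2) - 2 * \<kappa> * (\<Sum>i<k. d' i * a i * b i) + \<kappa>\<^sup>2 * (\<Sum>i<k. d' i * (b i)\<^sup>2)"
    by (simp add: sum.distrib sum_subtractf sum_distrib_left)
  also have "(\<Sum>i<k. d' i * (a i)\<^sup>2) \<le> (\<Sum>i<k. \<kappa> * d i * (a i)\<^sup>2)"
    by (intro sum_mono mult_right_mono le) auto
  also have "\<dots> = \<kappa> * (y \<bullet> u)" unfolding qa by (simp add: sum_distrib_left mult_ac)
  finally have "0 \<le> \<kappa> * (\<kappa> * (y \<bullet> u') - y \<bullet> u)"
    unfolding qc[symmetric] qb[symmetric] by (simp add: algebra_simps power2_eq_square)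
  then show "pinv_form k A d y \<le> \<kappa> * pinv_form k A d' y"
    unfolding form using \<kappa> by (simp add: zero_le_mult_iff)
qed

text \<open>The error is measured by the form at \<open>d\<close> alone. Later \<open>d\<close>
  holds the true variances, whose form has bounded expectation, while no mean is available for the
  form at the estimated variances \<open>d'\<close>.\<close>

lemma pinv_form_close:
  assumes "A \<in> carrier_mat r k" "y \<in> carrier_vec r"
    and "\<And>i. i < k \<Longrightarrow> 0 < d i" "\<And>i. i < k \<Longrightarrow> 0 < d' i"
    and "\<And>i. i < k \<Longrightarrow> d' i \<le> \<kappa> * d i" "\<And>i. i < k \<Longrightarrow> d i \<le> \<kappa> * d' i" and \<kappa>: "1 \<le> \<kappa>"
  shows "\<bar>pinv_form k A d' y - pinv_form k A d y\<bar> \<le> (\<kappa> - 1) * pinv_form k A d y"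
proof -
  let ?q = "pinv_form k A d y" and ?q' = "pinv_form k A d' y"
  have 1: "?q \<le> \<kappa> * ?q'" "0 \<le> ?q"
    using pinv_form_le[of A r k y d d' \<kappa>] assms by auto
  have 2: "?q' \<le> \<kappa> * ?q" "0 \<le> ?q'"
    using pinv_form_le[of A r k y d' d \<kappa>] assms by auto
  \<comment> \<open>The inequality between the forms gives this with \<open>?q'\<close> on the
    right. If \<open>?q'\<close> is at most \<open>?q\<close> it may be replaced; otherwise the left
    side is negative.\<close>
  have "?q - ?q' \<le> (\<kappa> - 1) * ?q"
  proof (cases "?q' \<le> ?q")
    case True
    have "?q - ?q' \<le> (\<kappa> - 1) * ?q'" using 1 by (simp add: algebra_simps)
    also have "\<dots> \<le> (\<kappa> - 1) * ?q" using True \<kappa> by (intro mult_left_mono) auto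
    finally show ?thesis .
  next
    case False
    then show ?thesis using mult_nonneg_nonneg[of "\<kappa> - 1" ?q] \<kappa> 1 by linarith
  qed
  then show ?thesis using 2 by (simp add: abs_le_iff algebra_simps)
qed

text \<open>Near a positive weight function all ratios in the \<open>k\<close> relevant coordinates
  are close to 1, so the previous comparison yields continuity without any formula for the
  pseudoinverse. Positivity keeps the rank constant.\<close>

lemma continuous_on_pinv_form:
  assumes A: "A \<in> carrier_mat r k" and y: "y \<in> carrier_vec r"
  shows "continuous_on {d. \<forall>i<k. 0 < d i} (\<lambda>d. pinv_form k A d y)"
  unfolding continuous_on_def
proof (intro ballI tendstoI)
  fix d0 :: "nat \<Rightarrow> real" and e :: real
  let ?S = "{d. \<forall>i<k. 0 < d i} :: (nat \<Rightarrow> real) set"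
  assume d0: "d0 \<in> ?S" and e: "0 < e"
  let ?q = "pinv_form k A d0 y"
  have q: "0 \<le> ?q" using pinv_form_le(1)[OF A y, of d0 d0 1] d0 by auto
  \<comment> \<open>Makes (\<kappa> - 1) \<open>?q\<close> smaller than \<open>e\<close>, including
    when \<open>?q\<close> is 0.\<close>
  define \<kappa> where "\<kappa> = 1 + e / (?q + 1)"
  have \<kappa>: "1 < \<kappa>" using e q by (simp add: \<kappa>_def)
  have "\<forall>\<^sub>F d in at d0 within ?S. d i \<le> \<kappa> * d0 i \<and> d0 i \<le> \<kappa> * d i" if "i < k" for i
  proof -
    have lim: "((\<lambda>d. d i) \<longlongrightarrow> d0 i) (at d0 within ?S)"
      using continuous_on_subset[OF continuous_on_product_coordinates subset_UNIV, of ?S i] d0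
      unfolding continuous_on_def by blast
    have pos: "0 < d0 i" using d0 that by auto
    have "\<forall>\<^sub>F d in at d0 within ?S. d i < \<kappa> * d0 i" "\<forall>\<^sub>F d in at d0 within ?S. d0 i / \<kappa> < d i"
      using order_tendstoD(2)[OF lim, of "\<kappa> * d0 i"] order_tendstoD(1)[OF lim, of "d0 i / \<kappa>"] pos \<kappa>
      by (auto simp: divide_less_eq)
    then show ?thesis by eventually_elim (use \<kappa> in \<open>auto simp: field_simps\<close>)
  qed
  then have "\<forall>\<^sub>F d in at d0 within ?S. \<forall>i\<in>{..<k}. d i \<le> \<kappa> * d0 i \<and> d0 i \<le> \<kappa> * d i"
    by (intro eventually_ball_finite) auto
  moreover have "\<forall>\<^sub>F d in at d0 within ?S. d \<in> ?S" by (simp add: eventually_at_filter)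
  ultimately show "\<forall>\<^sub>F d in at d0 within ?S. dist (pinv_form k A d y) ?q < e"
  proof eventually_elim
    case (elim d)
    have "\<bar>pinv_form k A d y - ?q\<bar> \<le> (\<kappa> - 1) * ?q"
      using elim d0 \<kappa> by (intro pinv_form_close[OF A y]) auto
    also have "\<dots> = e * ?q / (?q + 1)" by (simp add: \<kappa>_def)
    also have "\<dots> < e" using e q by (simp add: divide_less_eq)
    finally show ?case by (simp add: dist_real_def)
  qed
qed

definition pinv_entry :: "nat \<Rightarrow> real mat \<Rightarrow> (nat \<Rightarrow> real) \<Rightarrow> nat \<Rightarrow> nat \<Rightarrow> real" where
  "pinv_entry k A d p q = gram_inv k A d $$ (p, q)"

lemma
  assumes A: "A \<in> carrier_mat r k"
  shows gram_inv_carrier: "gram_inv k A d \<in> carrier_mat r r"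
    and pinv_entry_commute: "p < r \<Longrightarrow> q < r \<Longrightarrow> pinv_entry k A d p q = pinv_entry k A d q p"
proof -
  have c: "gram k A d \<in> carrier_mat r r" unfolding gram_def by (rule gram_carrier[OF A])
  have t: "(gram k A d)\<^sup>T = gram k A d" unfolding gram_def by (rule transpose_gram[OF A])
  note m = symmetric_moore_penrose_inverse[OF c t, folded gram_inv_def]
  show X: "gram_inv k A d \<in> carrier_mat r r" using is_moore_penrose_inverseD(1)[OF m(1) c] .
  show "pinv_entry k A d p q = pinv_entry k A d q p" if "p < r" "q < r"
    unfolding pinv_entry_def by (subst m(2)[symmetric]) (use that X in simp)
qed

lemma pinv_form_eq_sum:
  assumes A: "A \<in> carrier_mat r k" and y: "y \<in> carrier_vec r"
  shows "pinv_form k A d y = (\<Sum>p<r. \<Sum>q<r. pinv_entry k A d p q * (y $ p * y $ q))"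
proof -
  note X = gram_inv_carrier[OF A, of d]
  have "pinv_form k A d y = (\<Sum>p<r. y $ p * (\<Sum>q<r. gram_inv k A d $$ (p, q) * y $ q))"
    unfolding pinv_form_def gram_inv_def[unfolded gram_def, symmetric]
    using X y by (simp add: scalar_prod_def lessThan_atLeast0 carrier_vecD)
  then show ?thesis by (simp add: pinv_entry_def sum_distrib_left mult_ac)
qed

text \<open>Polarization with unit vectors recovers the entries from the quadratic form. Continuity
  of the entries is what makes them bounded and measurable as functions of time later on.\<close>

lemma continuous_on_pinv_entry:
  assumes A: "A \<in> carrier_mat r k" and "p < r" "q < r"
  shows "continuous_on {d. \<forall>i<k. 0 < d i} (\<lambda>d. pinv_entry k A d p q)"
proof -
  let ?e = "\<lambda>p. unit_vec r p :: real Matrix.vec"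
  have unit: "(\<Sum>p'<r. \<Sum>q'<r. X p' q' * (?e a $ p' * ?e b $ q')) = X a b"
    if "a < r" "b < r" for X :: "nat \<Rightarrow> nat \<Rightarrow> real" and a b
  proof -
    have "(\<Sum>p'<r. \<Sum>q'<r. X p' q' * (?e a $ p' * ?e b $ q'))
        = (\<Sum>p'<r. if p' = a then \<Sum>q'<r. if q' = b then X p' q' else 0 else 0)"
      using that by (intro sum.cong) (auto intro!: sum.neutral simp: mult_delta_right)
    then show ?thesis using that by simp
  qed
  have Q: "pinv_form k A d (?e p + ?e q) = pinv_entry k A d p p + pinv_entry k A d p q + pinv_entry k A d q p
    + pinv_entry k A d q q" for d
  proof -
    have "pinv_form k A d (?e p + ?e q) =
      (\<Sum>p'<r. \<Sum>q'<r. pinv_entry k A d p' q' * (?e p $ p' * ?e p $ q') + pinv_entry k A d p' q' * (?e p $ p' *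
        ?e q $ q')
        + pinv_entry k A d p' q' * (?e q $ p' * ?e p $ q') + pinv_entry k A d p' q' * (?e q $ p' * ?e q $ q'))"
      by (subst pinv_form_eq_sum[OF A]) (auto intro!: sum.cong simp: algebra_simps)
    then show ?thesis unfolding sum.distrib by (simp only: unit assms)
  qed
  have q: "pinv_form k A d (?e p) = pinv_entry k A d p p" if "p < r" for p d
    by (subst pinv_form_eq_sum[OF A]) (simp_all only: unit that unit_vec_carrier)
  have eq: "pinv_entry k A d p q = (pinv_form k A d (?e p + ?e q) - pinv_form k A d (?e p) - pinv_form k A d
    (?e q)) / 2" for d
    unfolding Q q[OF \<open>p < r\<close>] q[OF \<open>q < r\<close>] using pinv_entry_commute[OF A assms(2,3), of d] by simp
  show ?thesis unfolding eq
    by (intro continuous_intros continuous_on_pinv_form[OF A]) auto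
qed


section \<open>Central limit theorem for linear functionals of the samples\<close>

lemma exp_uminus_approx:
  fixes w :: real
  assumes "0 \<le> w"
  shows "\<bar>exp (- w) - (1 - w)\<bar> \<le> w\<^sup>2"
proof -
  have 1: "1 - w \<le> exp (- w)" using exp_ge_add_one_self[of "- w"] by simp
  have "exp (- w) \<le> 1 / (1 + w)"
    using exp_ge_add_one_self[of w] assms by (simp add: exp_minus field_simps)
  also have "\<dots> \<le> 1 - w + w\<^sup>2"
  proof -
    have "1 \<le> (1 - w + w\<^sup>2) * (1 + w)" using assms by (simp add: algebra_simps power2_eq_square)
    then show ?thesis using assms by (simp add: divide_le_eq)
  qed
  finally show ?thesis using 1 by (simp add: abs_le_iff)
qed

text \<open>The classical central limit theorem with a moving argument: the samples are scaled by
  sqrt n rather than by the root of their own sizes, and only the ratio of the two converges. Powers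
  with exponent \<open>N m\<close> of two numbers in the unit disc differ by at most
  \<open>N m\<close> times the difference of the bases.\<close>

lemma (in real_distribution) char_power_tendsto:
  fixes \<theta> :: "nat \<Rightarrow> real" and N :: "nat \<Rightarrow> nat"
  assumes i1: "integrable M (\<lambda>x. x)" and i2: "integrable M (\<lambda>x. x\<^sup>2)" and mean: "expectation (\<lambda>x. x) = 0"
    and N: "filterlim N at_top sequentially" and \<theta>: "\<theta> \<longlonglongrightarrow> t"
  shows "(\<lambda>m. char M (\<theta> m / sqrt (N m)) ^ N m) \<longlonglongrightarrow> exp (- t\<^sup>2 * expectation (\<lambda>x. x\<^sup>2) / 2)"
proof -
  define s where "s = expectation (\<lambda>x. x\<^sup>2)"
  have s: "0 \<le> s" unfolding s_def by simp
  define u where "u m = \<theta> m / sqrt (N m)" for m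
  \<comment> \<open>Truncated third-order Taylor remainder of \<open>char_approx3\<close>. The
    minimum with 6 x^2 lets dominated convergence work with second moments only.\<close>
  define E where "E m = (LINT x|M. min (6 * x\<^sup>2) (\<bar>u m\<bar> * \<bar>x\<bar> ^ 3))" for m
  have N': "filterlim (\<lambda>m. real (N m)) at_top sequentially"
    using N by (rule filterlim_compose[OF filterlim_real_sequentially])
  have u0: "u \<longlonglongrightarrow> 0"
    unfolding u_def by (rule tendsto_divide_0[OF \<theta>] filterlim_at_top_imp_at_infinity filterlim_compose[OF
      sqrt_at_top] N')+
  have "E \<longlonglongrightarrow> (LINT x|M. 0)"
    unfolding E_def
  proof (rule integral_dominated_convergence[where w = "\<lambda>x. 6 * x\<^sup>2"])
    show "AE x in M. (\<lambda>m. min (6 * x\<^sup>2) (\<bar>u m\<bar> * \<bar>x\<bar> ^ 3)) \<longlonglongrightarrow> 0"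
    proof (rule AE_I2)
      fix x :: real
      have "(\<lambda>m. min (6 * x\<^sup>2) (\<bar>u m\<bar> * \<bar>x\<bar> ^ 3)) \<longlonglongrightarrow> min (6 * x\<^sup>2) (\<bar>0\<bar> * \<bar>x\<bar> ^ 3)"
        by (intro tendsto_intros u0)
      then show "(\<lambda>m. min (6 * x\<^sup>2) (\<bar>u m\<bar> * \<bar>x\<bar> ^ 3)) \<longlonglongrightarrow> 0" by simp
    qed
  qed (use i2 in \<open>auto simp: min_def\<close>)
  then have E0: "E \<longlonglongrightarrow> 0" by simp
  \<comment> \<open>\<open>N m\<close> times the error u^2 / 6 E + w^2 of a single factor, rewritten
    with \<open>N m * (u m)\<^sup>2 = (\<theta> m)\<^sup>2\<close>; the second summand keeps a
    factor 1 / N.\<close>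
  define B where "B m = (\<theta> m)\<^sup>2 / 6 * E m + ((\<theta> m)\<^sup>2 * s / 2)\<^sup>2 / N m" for m
  have "B \<longlonglongrightarrow> t\<^sup>2 / 6 * 0 + 0"
    unfolding B_def
    by (intro tendsto_add tendsto_mult tendsto_divide tendsto_power \<theta> E0 tendsto_const
        tendsto_divide_0[where c = "(t\<^sup>2 * s / 2)\<^sup>2"] filterlim_at_top_imp_at_infinity N') auto
  then have B0: "B \<longlonglongrightarrow> 0" by simp
  have le: "norm (char M (u m) ^ N m - complex_of_real (exp (- (\<theta> m)\<^sup>2 * s / 2))) \<le> B m" if "N m > 0" for m
  proof -
    define w where "w = (u m)\<^sup>2 * s / 2"
    have w: "0 \<le> w" using s by (simp add: w_def)
    have Nu: "N m * (u m)\<^sup>2 = (\<theta> m)\<^sup>2" using that by (simp add: u_def power_divide)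
    have Nw: "N m * w = (\<theta> m)\<^sup>2 * s / 2" unfolding w_def using Nu by (metis times_divide_eq_right mult.assoc)
    have "exp (- w) ^ N m = exp (- (\<theta> m)\<^sup>2 * s / 2)"
      using Nw by (simp flip: exp_of_nat_mult)
    then have "norm (char M (u m) ^ N m - complex_of_real (exp (- (\<theta> m)\<^sup>2 * s / 2)))
        = norm (char M (u m) ^ N m - complex_of_real (exp (- w)) ^ N m)"
      by (simp flip: of_real_power)
    also have "\<dots> \<le> N m * norm (char M (u m) - complex_of_real (exp (- w)))"
      using w by (intro norm_power_diff cmod_char_le_1) simp
    also have "norm (char M (u m) - complex_of_real (exp (- w))) \<le> (u m)\<^sup>2 / 6 * E m + w\<^sup>2"
    proof -
      have a: "norm (char M (u m) - complex_of_real (1 - w)) \<le> (u m)\<^sup>2 / 6 * E m"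
        using char_approx3[OF i1 mean i2, of s "u m"] unfolding w_def E_def by (simp add: s_def mean)
      have b: "norm (complex_of_real (1 - w) - complex_of_real (exp (- w))) \<le> w\<^sup>2"
        using exp_uminus_approx[OF w] by (simp add: norm_of_real abs_minus_commute del: of_real_diff flip:
          of_real_diff)
      show ?thesis using norm_triangle_le[OF add_mono[OF a b]] by simp
    qed
    also have "N m * ((u m)\<^sup>2 / 6 * E m + w\<^sup>2) = B m"
    proof -
      have "N m * w\<^sup>2 = (N m * w)\<^sup>2 / N m" using that by (simp add: power2_eq_square)
      moreover have "N m * ((u m)\<^sup>2 / 6 * E m) = (N m * (u m)\<^sup>2) / 6 * E m" by simp
      ultimately show ?thesis unfolding B_def Nu Nw by (simp add: distrib_left)
    qed
    finally show ?thesis by (simp add: mult_left_mono)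
  qed
  have ev: "\<forall>\<^sub>F m in sequentially. N m > 0"
    using N by (auto simp: filterlim_at_top dest!: spec[of _ "1::nat"] elim: eventually_mono)
  have "(\<lambda>m. complex_of_real (exp (- (\<theta> m)\<^sup>2 * s / 2))) \<longlonglongrightarrow> complex_of_real (exp (- t\<^sup>2 * s / 2))"
    by (intro tendsto_intros \<theta>) auto
  then have "(\<lambda>m. char M (u m) ^ N m) \<longlonglongrightarrow> complex_of_real (exp (- t\<^sup>2 * s / 2))"
    by (rule Lim_transform) (rule Lim_null_comparison[OF eventually_mono[OF ev le] B0])
  then show ?thesis unfolding u_def s_def by simp
qed

section \<open>The sampling model and linear functionals of the samples\<close>

locale k_sample = prob_space M for M :: "'w measure" +
  fixes a b :: real and T :: "real set" and k :: nat
    and x :: "nat \<Rightarrow> nat \<Rightarrow> 'w \<Rightarrow> real \<Rightarrow> real"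
    and \<eta> :: "nat \<Rightarrow> real \<Rightarrow> real" and \<gamma> :: "nat \<Rightarrow> real \<Rightarrow> real \<Rightarrow> real"
    and \<tau> :: "nat \<Rightarrow> real"
    and ns :: "nat \<Rightarrow> nat \<Rightarrow> nat" and n :: "nat \<Rightarrow> nat"
  assumes ab: "a \<le> b" and T: "T = {a..b}"
    and n: "\<And>m. n m = (\<Sum>i<k. ns m i)" and n_infinity: "filterlim n at_top sequentially"
    and indep: "independent_processes M T ({..<k} \<times> UNIV) (\<lambda>(i, j). x i j)"
    and ident: "\<And>i j. i < k \<Longrightarrow> identically_distributed M T (x i j) (x i 0)"
    and mean: "\<And>i j. i < k \<Longrightarrow> has_mean_function M T (x i j) (\<eta> i)"
    and cov: "\<And>i j. i < k \<Longrightarrow> has_covariance_function M T (x i j) (\<gamma> i)"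
    and L2: "\<And>i j. i < k \<Longrightarrow> L2_process M T (x i j)"
    and eta: "\<And>i. i < k \<Longrightarrow> \<eta> i \<in> L2_on T"
    and gamma_cont: "\<And>i. i < k \<Longrightarrow> continuous_on T (\<lambda>t. \<gamma> i t t)"
    and gamma_pos: "\<And>i t. i < k \<Longrightarrow> t \<in> T \<Longrightarrow> \<gamma> i t t > 0"
    and tau_pos: "\<And>i. i < k \<Longrightarrow> \<tau> i > 0"
    and tau_lim: "\<And>i. i < k \<Longrightarrow> (\<lambda>m. real (ns m i) / real (n m)) \<longlonglongrightarrow> \<tau> i"
    and osc: "\<And>i j. i < k \<Longrightarrow> j \<in> {0, 1} \<Longrightarrow>
      ((\<lambda>\<delta>. outer_expectation M
          (\<lambda>\<omega>. SUP (t, s) \<in> {(t, s). t \<in> T \<and> s \<in> T \<and> \<bar>t - s\<bar> < \<delta>}.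
                 ereal \<bar>(x i 0 \<omega> t - \<eta> i t) * (x i j \<omega> t - \<eta> i t) -
                   (x i 0 \<omega> s - \<eta> i s) * (x i j \<omega> s - \<eta> i s)\<bar>))
        \<longlongrightarrow> 0) (at_right 0)"
begin

definition v :: "nat \<Rightarrow> nat \<Rightarrow> 'w \<Rightarrow> real \<Rightarrow> real" where
  "v i j \<omega> t = x i j \<omega> t - \<eta> i t"

lemma
  assumes "i < k" "t \<in> T"
  shows integrable_v: "integrable M (\<lambda>\<omega>. v i j \<omega> t)"
    and expectation_v: "expectation (\<lambda>\<omega>. v i j \<omega> t) = 0"
    and integrable_v_sq: "integrable M (\<lambda>\<omega>. (v i j \<omega> t)\<^sup>2)"
proof -
  have i: "integrable M (\<lambda>\<omega>. x i j \<omega> t)" "expectation (\<lambda>\<omega>. x i j \<omega> t) = \<eta> i t"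
    using mean[OF assms(1), of j] assms unfolding has_mean_function_def by auto
  have sq: "integrable M (\<lambda>\<omega>. (x i j \<omega> t)\<^sup>2)"
    using cov[OF assms(1), of j] assms unfolding has_covariance_function_def by auto
  show "integrable M (\<lambda>\<omega>. v i j \<omega> t)" unfolding v_def using i by auto
  show "expectation (\<lambda>\<omega>. v i j \<omega> t) = 0" unfolding v_def using i by (simp add: prob_space)
  show "integrable M (\<lambda>\<omega>. (v i j \<omega> t)\<^sup>2)" unfolding v_def power2_diff using i sq by auto
qed

lemma
  assumes "i < k" "t \<in> T" "s \<in> T"
  shows integrable_v_mult: "integrable M (\<lambda>\<omega>. v i j \<omega> t * v i j \<omega> s)"
    and expectation_v_mult: "expectation (\<lambda>\<omega>. v i j \<omega> t * v i j \<omega> s) = \<gamma> i t s"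
proof -
  note v = integrable_v[OF assms(1,2), of j] integrable_v[OF assms(1,3), of j]
    and vsq = integrable_v_sq[OF assms(1,2), of j] integrable_v_sq[OF assms(1,3), of j]
  show "integrable M (\<lambda>\<omega>. v i j \<omega> t * v i j \<omega> s)"
  proof (rule Bochner_Integration.integrable_bound)
    show "integrable M (\<lambda>\<omega>. (v i j \<omega> t)\<^sup>2 + (v i j \<omega> s)\<^sup>2)" using vsq by auto
    show "AE \<omega> in M. norm (v i j \<omega> t * v i j \<omega> s) \<le> norm ((v i j \<omega> t)\<^sup>2 + (v i j \<omega> s)\<^sup>2)"
    proof (rule AE_I2)
      fix \<omega>
      have "2 * \<bar>v i j \<omega> t\<bar> * \<bar>v i j \<omega> s\<bar> \<le> (v i j \<omega> t)\<^sup>2 + (v i j \<omega> s)\<^sup>2"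
        using sum_squares_bound[of "\<bar>v i j \<omega> t\<bar>" "\<bar>v i j \<omega> s\<bar>"] by simp
      then show "norm (v i j \<omega> t * v i j \<omega> s) \<le> norm ((v i j \<omega> t)\<^sup>2 + (v i j \<omega> s)\<^sup>2)"
        using mult_nonneg_nonneg[OF abs_ge_zero[of "v i j \<omega> t"] abs_ge_zero[of "v i j \<omega> s"]]
        unfolding real_norm_def abs_mult by linarith
    qed
  qed (use v in auto)
  show "expectation (\<lambda>\<omega>. v i j \<omega> t * v i j \<omega> s) = \<gamma> i t s"
    using cov[OF assms(1), of j] mean[OF assms(1), of j] assms
    unfolding has_covariance_function_def has_mean_function_def v_def by auto
qed

lemma tau_lim_inverse:
  assumes i: "i < k"
  shows "(\<lambda>m. real (n m) / real (ns m i)) \<longlonglongrightarrow> 1 / \<tau> i"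
  using tendsto_divide[OF tendsto_const[of 1] tau_lim[OF i]] tau_pos[OF i] by simp

lemma ns_infinity:
  assumes i: "i < k"
  shows "filterlim (\<lambda>m. ns m i) at_top sequentially"
proof -
  have "filterlim (\<lambda>m. real (n m)) at_top sequentially"
    using n_infinity by (rule filterlim_compose[OF filterlim_real_sequentially])
  then have "filterlim (\<lambda>m. real (ns m i) / real (n m) * real (n m)) at_top sequentially"
    by (intro filterlim_tendsto_pos_mult_at_top[OF tau_lim[OF i] tau_pos[OF i]])
  \<comment> \<open>If \<open>n m = 0\<close>, division yields 0 and the identity survives because
    \<open>ns m i\<close> is 0 too.\<close>
  moreover have "real (ns m i) / real (n m) * real (n m) = real (ns m i)" for m
  proof -
    have "ns m i \<le> n m" unfolding n using i by (intro member_le_sum) auto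
    then show ?thesis by (cases "n m = 0") auto
  qed
  ultimately have "filterlim (\<lambda>m. real (ns m i)) at_top sequentially" by simp
  then show ?thesis
    unfolding filterlim_at_top by (metis (mono_tags, lifting) eventually_mono of_nat_le_iff)
qed

lemma ns_ge: "i < k \<Longrightarrow> \<forall>\<^sub>F m in sequentially. ns m i \<ge> N"
  using ns_infinity[of i] by (simp add: filterlim_at_top)

lemma restrict_x_measurable:
  assumes "i < k"
  shows "(\<lambda>\<omega>. restrict (x i j \<omega>) T) \<in> measurable M (path_space T)"
  using indep assms unfolding independent_processes_def indep_vars_def2 by auto

lemma distr_path_functional:
  assumes i: "i < k" and g: "g \<in> borel_measurable (path_space T)"
  shows "distr M borel (\<lambda>\<omega>. g (restrict (x i j \<omega>) T)) = distr M borel (\<lambda>\<omega>. g (restrict (x i 0 \<omega>) T))"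
proof -
  have "distr (distr M (path_space T) (\<lambda>\<omega>. restrict (x i j \<omega>) T)) borel g =
    distr (distr M (path_space T) (\<lambda>\<omega>. restrict (x i 0 \<omega>) T)) borel g"
    using ident[OF i, of j] unfolding identically_distributed_def by simp
  then show ?thesis
    using restrict_x_measurable[OF i] g by (simp add: distr_distr comp_def)
qed

definition linear_form :: "real set \<Rightarrow> (nat \<Rightarrow> real \<Rightarrow> real) \<Rightarrow> nat \<Rightarrow> nat \<Rightarrow> 'w \<Rightarrow> real" where
  "linear_form F w i j \<omega> = (\<Sum>t\<in>F. w i t * v i j \<omega> t)"

text \<open>The functional of sqrt n (eta_hat - \<eta>) with weights \<open>w\<close>: one real
  variable for all samples and all times in \<open>F\<close>, as in the Cramer-Wold device.\<close>

definition scaled_sum :: "real set \<Rightarrow> (nat \<Rightarrow> real \<Rightarrow> real) \<Rightarrow> nat \<Rightarrow> 'w \<Rightarrow> real" where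
  "scaled_sum F w m \<omega> = (\<Sum>i<k. sqrt (n m) / ns m i * (\<Sum>j<ns m i. linear_form F w i j \<omega>))"

text \<open>Variance of the same functional of independent centered Gaussian processes with
  covariance functions \<gamma>_i / \<tau>_i.\<close>

definition limit_variance :: "real set \<Rightarrow> (nat \<Rightarrow> real \<Rightarrow> real) \<Rightarrow> real" where
  "limit_variance F w = (\<Sum>i<k. 1 / \<tau> i * (\<Sum>t\<in>F. \<Sum>s\<in>F. w i t * w i s * \<gamma> i t s))"

context
  fixes F :: "real set" and w :: "nat \<Rightarrow> real \<Rightarrow> real"
  assumes F: "finite F" "F \<subseteq> T"
begin

text \<open>Expressed through restricted paths, since independence and identity in law are assumed
  for these only.\<close>

lemma linear_form_path:
  "linear_form F w i j = (\<lambda>\<omega>. \<Sum>t\<in>F. w i t * (restrict (x i j \<omega>) T t - \<eta> i t))"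
  unfolding linear_form_def[abs_def] v_def using F by (intro ext sum.cong) auto

lemma linear_functional_measurable:
  "(\<lambda>f. \<Sum>t\<in>F. w i t * (f t - \<eta> i t)) \<in> borel_measurable (path_space T)"
  using F by (auto intro!: borel_measurable_sum borel_measurable_times borel_measurable_diff
    measurable_component_singleton)

lemma linear_form_measurable [measurable]:
  "i < k \<Longrightarrow> linear_form F w i j \<in> borel_measurable M"
  unfolding linear_form_path
  by (rule measurable_compose[where g = "\<lambda>f. \<Sum>t\<in>F. w i t * (f t - \<eta> i t)",
      OF restrict_x_measurable linear_functional_measurable])

lemma linear_form_distr:
  "i < k \<Longrightarrow> distr M borel (linear_form F w i j) = distr M borel (linear_form F w i 0)"
  unfolding linear_form_path by (rule distr_path_functional[where g = "\<lambda>f. \<Sum>t\<in>F. w i t * (f t - \<eta> i t)", OF _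
    linear_functional_measurable])

lemma linear_form_moments:
  assumes "i < k"
  shows "integrable M (linear_form F w i j)" "expectation (linear_form F w i j) = 0"
    "integrable M (\<lambda>\<omega>. (linear_form F w i j \<omega>)\<^sup>2)"
    "expectation (\<lambda>\<omega>. (linear_form F w i j \<omega>)\<^sup>2) = (\<Sum>t\<in>F. \<Sum>s\<in>F. w i t * w i s * \<gamma> i t s)"
proof -
  have T: "t \<in> T" if "t \<in> F" for t using that F by auto
  show "integrable M (linear_form F w i j)" "expectation (linear_form F w i j) = 0"
    unfolding linear_form_def[abs_def]
    using integrable_v[OF assms T] expectation_v[OF assms T] by auto
  have eq: "(linear_form F w i j \<omega>)\<^sup>2 = (\<Sum>t\<in>F. \<Sum>s\<in>F. w i t * w i s * (v i j \<omega> t * v i j \<omega> s))" for \<omega>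
    unfolding linear_form_def power2_eq_square sum_product by (simp only: mult_ac)
  show "integrable M (\<lambda>\<omega>. (linear_form F w i j \<omega>)\<^sup>2)" unfolding eq
    using integrable_v_mult[OF assms T T] by auto
  show "expectation (\<lambda>\<omega>. (linear_form F w i j \<omega>)\<^sup>2) = (\<Sum>t\<in>F. \<Sum>s\<in>F. w i t * w i s * \<gamma> i t s)" unfolding eq
    by (simp add: integrable_v_mult[OF assms T T] expectation_v_mult[OF assms T T])
qed

lemma indep_linear_form:
  assumes "A \<subseteq> {..<k} \<times> UNIV"
  shows "indep_vars (\<lambda>_. borel) (\<lambda>p \<omega>. c p * linear_form F w (fst p) (snd p) \<omega>) A"
proof -
  have "indep_vars (\<lambda>_. path_space T) (\<lambda>p \<omega>. restrict (x (fst p) (snd p) \<omega>) T) ({..<k} \<times> UNIV)"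
    using indep unfolding independent_processes_def by (simp add: case_prod_unfold)
  from indep_vars_subset[OF this assms] show ?thesis
    unfolding linear_form_path
    by (rule indep_vars_compose2[where Y = "\<lambda>p f. c p * (\<Sum>t\<in>F. w (fst p) t * (f t - \<eta> (fst p) t))"])
      (intro borel_measurable_times borel_measurable_const linear_functional_measurable)
qed

lemma scaled_sum_measurable: "scaled_sum F w m \<in> borel_measurable M"
  unfolding scaled_sum_def[abs_def] by measurable

lemma char_scaled_sum:
  "char (distr M borel (scaled_sum F w m)) 1 =
    (\<Prod>i<k. char (distr M borel (linear_form F w i 0)) (sqrt (n m) / ns m i) ^ ns m i)"
proof -
  define c where "c i = sqrt (n m) / ns m i" for i
  define A where "A = (SIGMA i:{..<k}. {..<ns m i})"
  have eq: "scaled_sum F w m = (\<lambda>\<omega>. \<Sum>p\<in>A. c (fst p) * linear_form F w (fst p) (snd p) \<omega>)"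
    unfolding A_def scaled_sum_def[abs_def] c_def sum_distrib_left
      by (subst sum.Sigma) (auto simp: case_prod_unfold)
  have "char (distr M borel (scaled_sum F w m)) 1 =
      char (distr M borel (\<lambda>\<omega>. \<Sum>p\<in>A. c (fst p) * linear_form F w (fst p) (snd p) \<omega>)) 1"
    unfolding eq ..
  also have "\<dots> = (\<Prod>p\<in>A. char (distr M borel (\<lambda>\<omega>. c (fst p) * linear_form F w (fst p) (snd p) \<omega>)) 1)"
    by (intro char_distr_sum indep_linear_form) (auto simp: A_def)
  also have "\<dots> = (\<Prod>p\<in>A. char (distr M borel (linear_form F w (fst p) 0)) (c (fst p)))"
  proof (intro prod.cong refl)
    fix p assume "p \<in> A"
    then have i: "fst p < k" by (auto simp: A_def)
    have "char (distr M borel (\<lambda>\<omega>. c (fst p) * linear_form F w (fst p) (snd p) \<omega>)) 1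
      = char (distr M borel (linear_form F w (fst p) (snd p))) (c (fst p))"
      unfolding char_def using linear_form_measurable[OF i] by (simp add: integral_distr)
    then show "char (distr M borel (\<lambda>\<omega>. c (fst p) * linear_form F w (fst p) (snd p) \<omega>)) 1 =
      char (distr M borel (linear_form F w (fst p) 0)) (c (fst p))"
      by (simp only: linear_form_distr[OF i, of "snd p"])
  qed
  also have "\<dots> = (\<Prod>i<k. \<Prod>j<ns m i. char (distr M borel (linear_form F w i 0)) (c i))"
    unfolding A_def by (subst prod.Sigma) (auto simp: case_prod_unfold)
  finally show ?thesis by (simp add: c_def)
qed

lemma char_scaled_sum_tendsto:
  "(\<lambda>m. char (distr M borel (scaled_sum F w m)) 1) \<longlonglongrightarrow> exp (- limit_variance F w / 2)"
proof -
  define V where "V i = (\<Sum>t\<in>F. \<Sum>s\<in>F. w i t * w i s * \<gamma> i t s)" for i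
  have "(\<lambda>m. char (distr M borel (linear_form F w i 0)) (sqrt (n m) / ns m i) ^ ns m i)
    \<longlonglongrightarrow> complex_of_real (exp (- (sqrt (1 / \<tau> i))\<^sup>2 * V i / 2))" if i: "i < k" for i
  proof -
    note lf = linear_form_moments[OF i, of 0] linear_form_measurable[OF i, of 0]
    interpret L: real_distribution "distr M borel (linear_form F w i 0)"
      using lf by (intro real_distribution_distr) simp
    \<comment> \<open>The scale sqrt n / n_i is written as sqrt (n / n_i) / sqrt n_i, whose
      numerator tends to sqrt (1 / \<tau>_i).\<close>
    have "(\<lambda>m. char (distr M borel (linear_form F w i 0)) (sqrt (real (n m) / real (ns m i)) / sqrt (ns m i))
      ^ ns m i)
      \<longlonglongrightarrow> exp (- (sqrt (1 / \<tau> i))\<^sup>2 * L.expectation (\<lambda>x. x\<^sup>2) / 2)"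
      using lf by (intro L.char_power_tendsto ns_infinity[OF i] tendsto_real_sqrt tau_lim_inverse[OF i])
        (simp_all add: integrable_distr_eq integral_distr)
    moreover have "L.expectation (\<lambda>x. x\<^sup>2) = V i"
      using lf by (simp add: integral_distr V_def)
    moreover have "sqrt (real (n m) / real (ns m i)) / sqrt (ns m i) = sqrt (n m) / ns m i" for m
      by (simp add: real_sqrt_divide)
    ultimately show ?thesis by simp
  qed
  then have "(\<lambda>m. char (distr M borel (scaled_sum F w m)) 1) \<longlonglongrightarrow>
      (\<Prod>i<k. complex_of_real (exp (- (sqrt (1 / \<tau> i))\<^sup>2 * V i / 2)))"
    unfolding char_scaled_sum by (intro tendsto_prod) auto
  also have "(\<Prod>i<k. complex_of_real (exp (- (sqrt (1 / \<tau> i))\<^sup>2 * V i / 2))) = exp (\<Sum>i<k. - (1 / \<tau> i) * V i / 2)"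
  proof -
    have "complex_of_real (exp (- (sqrt (1 / \<tau> i))\<^sup>2 * V i / 2)) = complex_of_real (exp (- (1 / \<tau> i) * V i /
      2))" if "i < k" for i
      using tau_pos[OF that] by simp
    then show ?thesis by (simp add: exp_sum)
  qed
  also have "(\<Sum>i<k. - (1 / \<tau> i) * V i / 2) = - limit_variance F w / 2"
    unfolding limit_variance_def V_def[symmetric] by (simp add: sum_negf sum_divide_distrib)
  finally show ?thesis .
qed

text \<open>Real parts suffice from here on: the bounded functionals below are built from cosines,
  and the product formula keeps them in that class.\<close>

lemma expectation_cos_scaled_sum_tendsto:
  "(\<lambda>m. expectation (\<lambda>\<omega>. cos (scaled_sum F w m \<omega>))) \<longlonglongrightarrow> exp (- limit_variance F w / 2)"
proof -
  have "Re (char (distr M borel (scaled_sum F w m)) 1) = expectation (\<lambda>\<omega>. cos (scaled_sum F w m \<omega>))" for m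
  proof -
    have "integrable M (\<lambda>\<omega>. iexp (scaled_sum F w m \<omega>))"
      using scaled_sum_measurable[of m] by (intro integrable_const_bound[where B = 1]) auto
    then have "Re (\<integral>\<omega>. iexp (scaled_sum F w m \<omega>) \<partial>M) = (\<integral>\<omega>. Re (iexp (scaled_sum F w m \<omega>)) \<partial>M)"
      by (rule integral_Re[symmetric])
    then show ?thesis
      unfolding char_def using scaled_sum_measurable[of m] by (simp add: integral_distr Re_exp)
  qed
  then show ?thesis using tendsto_Re[OF char_scaled_sum_tendsto] by simp
qed

end
end


section \<open>Moments of integrated cosines\<close>

text \<open>Random vectors are carried as sequences of reals; countability of the index set makes
  the product \<sigma>-algebra equal to the Borel sets of the product topology.\<close>

lemma measurable_fun_coordinatewise:
  fixes X :: "'w \<Rightarrow> nat \<Rightarrow> real"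
  assumes "\<And>l. (\<lambda>\<omega>. X \<omega> l) \<in> borel_measurable M"
  shows "X \<in> borel_measurable M"
proof -
  have "X \<in> measurable M (\<Pi>\<^sub>M l\<in>UNIV. borel)"
    using assms by (intro measurable_PiM_single') auto
  then show ?thesis by (simp add: sets_PiM_equal_borel cong: measurable_cong_sets)
qed

lemma abs_integral_le:
  fixes f g :: "'a \<Rightarrow> real"
  assumes "integrable M f" "integrable M g" "\<And>x. x \<in> space M \<Longrightarrow> \<bar>f x\<bar> \<le> g x"
  shows "\<bar>integral\<^sup>L M f\<bar> \<le> integral\<^sup>L M g"
  using assms by (intro order_trans[OF integral_abs_bound integral_mono]) auto

text \<open>A monomial is a coefficient with the list of its variables, repeated by multiplicity.
  The same lists index the mixed moments of a random sequence.\<close>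

definition poly_eval :: "(real \<times> nat list) list \<Rightarrow> (nat \<Rightarrow> real) \<Rightarrow> real" where
  "poly_eval cs f = (\<Sum>(c, ls)\<leftarrow>cs. c * (\<Prod>l\<leftarrow>ls. f l))"

lemma poly_eval_simps [simp]:
  "poly_eval [] f = 0"
  "poly_eval (c # cs) f = fst c * (\<Prod>l\<leftarrow>snd c. f l) + poly_eval cs f"
  "poly_eval (cs @ ds) f = poly_eval cs f + poly_eval ds f"
  by (auto simp: poly_eval_def case_prod_unfold)

definition poly_mult :: "(real \<times> nat list) list \<Rightarrow> (real \<times> nat list) list \<Rightarrow> (real \<times> nat list) list" where
  "poly_mult cs ds = concat (map (\<lambda>c. map (\<lambda>d. (fst c * fst d, snd c @ snd d)) ds) cs)"

lemma poly_eval_mult: "poly_eval (poly_mult cs ds) f = poly_eval cs f * poly_eval ds f"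
proof -
  have *: "poly_eval (map (\<lambda>d. (fst c * fst d, snd c @ snd d)) ds) f =
      fst c * (\<Prod>l\<leftarrow>snd c. f l) * poly_eval ds f" for c :: "real \<times> nat list"
    by (induction ds) (auto simp: algebra_simps)
  show ?thesis unfolding poly_mult_def
    by (induction cs) (auto simp: * algebra_simps)
qed

lemma continuous_on_poly_eval: "continuous_on S (poly_eval cs)"
proof -
  have prod: "continuous_on S (\<lambda>f. \<Prod>l\<leftarrow>ls. f l)" for ls :: "nat list"
    by (induction ls) (auto intro!: continuous_intros continuous_on_subset[OF continuous_on_product_coordinates])
  show ?thesis
    by (induction cs) (auto intro!: continuous_intros prod simp flip: poly_eval_def)
qed

text \<open>Tychonoff's theorem; boxes in infinitely many coordinates stay compact, so sequences can
  take the place of finite vectors.\<close>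

lemma compact_box: "compact {f :: nat \<Rightarrow> real. \<forall>l. \<bar>f l\<bar> \<le> D}"
proof -
  have "compactin (product_topology (\<lambda>_. euclideanreal) UNIV) (PiE UNIV (\<lambda>_ :: nat. {-D..D}))"
    by (subst compactin_PiE) auto
  then have "compact (PiE UNIV (\<lambda>_ :: nat. {-D..D}))"
    unfolding euclidean_product_topology by simp
  moreover have "PiE UNIV (\<lambda>_ :: nat. {-D..D}) = {f. \<forall>l. \<bar>f l\<bar> \<le> D}"
    by (auto simp: PiE_UNIV_domain Pi_iff abs_le_iff minus_le_iff)
  ultimately show ?thesis by simp
qed

text \<open>A bounded random vector is determined, also in the limit, by its mixed moments, because
  polynomials are uniformly dense on the box.\<close>

lemma expectation_tendsto_of_moments:
  fixes X :: "nat \<Rightarrow> 'w \<Rightarrow> nat \<Rightarrow> real" and Y :: "'z \<Rightarrow> nat \<Rightarrow> real" and \<Phi> :: "(nat \<Rightarrow> real) \<Rightarrow> real"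
  assumes M: "prob_space M" and N: "prob_space N"
    and Xm: "\<And>m l. (\<lambda>\<omega>. X m \<omega> l) \<in> borel_measurable M" and Ym: "\<And>l. (\<lambda>\<omega>. Y \<omega> l) \<in> borel_measurable N"
    and XD: "\<And>m \<omega> l. \<omega> \<in> space M \<Longrightarrow> \<bar>X m \<omega> l\<bar> \<le> D" and YD: "\<And>\<omega> l. \<omega> \<in> space N \<Longrightarrow> \<bar>Y \<omega> l\<bar> \<le> D"
    and moments: "\<And>ls. (\<lambda>m. \<integral>\<omega>. (\<Prod>l\<leftarrow>ls. X m \<omega> l) \<partial>M) \<longlonglongrightarrow> (\<integral>\<omega>. (\<Prod>l\<leftarrow>ls. Y \<omega> l) \<partial>N)"
    and \<Phi>: "continuous_on UNIV \<Phi>"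
  shows "(\<lambda>m. \<integral>\<omega>. \<Phi> (X m \<omega>) \<partial>M) \<longlonglongrightarrow> (\<integral>\<omega>. \<Phi> (Y \<omega>) \<partial>N)"
proof -
  interpret M: prob_space M by fact
  interpret N: prob_space N by fact
  define S where "S = {f :: nat \<Rightarrow> real. \<forall>l. \<bar>f l\<bar> \<le> D}"
  have XS: "X m \<omega> \<in> S" if "\<omega> \<in> space M" for m \<omega> using XD that by (auto simp: S_def)
  have YS: "Y \<omega> \<in> S" if "\<omega> \<in> space N" for \<omega> using YD that by (auto simp: S_def)
  have S: "compact S" unfolding S_def by (rule compact_box)
  interpret R: function_ring_on "range poly_eval" S
  proof
    show "compact S" by fact
    show "continuous_on S f" if "f \<in> range poly_eval" for f using that continuous_on_poly_eval by auto
    show "(\<lambda>x. f x + g x) \<in> range poly_eval" if "f \<in> range poly_eval" "g \<in> range poly_eval" for f g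
    proof -
      obtain cs ds where "f = poly_eval cs" "g = poly_eval ds" using \<open>f \<in> _\<close> \<open>g \<in> _\<close> by auto
      then show ?thesis by (intro image_eqI[of _ _ "cs @ ds"]) auto
    qed
    show "(\<lambda>x. f x * g x) \<in> range poly_eval" if "f \<in> range poly_eval" "g \<in> range poly_eval" for f g
    proof -
      obtain cs ds where "f = poly_eval cs" "g = poly_eval ds" using \<open>f \<in> _\<close> \<open>g \<in> _\<close> by auto
      then show ?thesis by (intro image_eqI[of _ _ "poly_mult cs ds"]) (auto simp: poly_eval_mult)
    qed
    show "(\<lambda>_. c) \<in> range poly_eval" for c
      by (rule image_eqI[of _ _ "[(c, [])]"]) auto
    show "\<exists>f\<in>range poly_eval. f x \<noteq> f y" if "x \<noteq> y" for x y :: "nat \<Rightarrow> real"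
    proof -
      obtain l where "x l \<noteq> y l" using \<open>x \<noteq> y\<close> by auto
      then show ?thesis by (intro bexI[of _ "poly_eval [(1, [l])]"]) auto
    qed
  qed
  have meas_comp: "(\<lambda>\<omega>. \<Psi> (X m \<omega>)) \<in> borel_measurable M" "(\<lambda>\<omega>. \<Psi> (Y \<omega>)) \<in> borel_measurable N"
    if "continuous_on UNIV \<Psi>" for \<Psi> :: "(nat \<Rightarrow> real) \<Rightarrow> real" and m
    using borel_measurable_continuous_onI[OF that]
    by (auto intro!: measurable_compose[of _ _ borel \<Psi>] measurable_fun_coordinatewise Xm Ym)
  have bdd: "\<exists>C. \<forall>f\<in>S. \<bar>\<Psi> f\<bar> \<le> C" if "continuous_on UNIV \<Psi>" for \<Psi> :: "(nat \<Rightarrow> real) \<Rightarrow> real"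
    using compact_imp_bounded[OF compact_continuous_image[OF continuous_on_subset[OF that subset_UNIV] S]]
    by (auto simp: bounded_iff)
  have int: "integrable M (\<lambda>\<omega>. \<Psi> (X m \<omega>))" "integrable N (\<lambda>\<omega>. \<Psi> (Y \<omega>))"
    if c: "continuous_on UNIV \<Psi>" for \<Psi> :: "(nat \<Rightarrow> real) \<Rightarrow> real" and m
  proof -
    obtain C where "\<forall>f\<in>S. \<bar>\<Psi> f\<bar> \<le> C" using bdd[OF c] by auto
    then show "integrable M (\<lambda>\<omega>. \<Psi> (X m \<omega>))" "integrable N (\<lambda>\<omega>. \<Psi> (Y \<omega>))"
      using XS YS meas_comp[OF c]
      by (auto intro!: M.integrable_const_bound[where B = C] N.integrable_const_bound[where B = C])
  qed
  have poly: "(\<lambda>m. \<integral>\<omega>. poly_eval cs (X m \<omega>) \<partial>M) \<longlonglongrightarrow> (\<integral>\<omega>. poly_eval cs (Y \<omega>) \<partial>N)" for cs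
  proof (induction cs)
    case (Cons c cs)
    have i1: "integrable M (\<lambda>\<omega>. fst c * (\<Prod>l\<leftarrow>snd c. X m \<omega> l))" "integrable N (\<lambda>\<omega>. fst c * (\<Prod>l\<leftarrow>snd c. Y \<omega> l))" for m
      using int[OF continuous_on_poly_eval[of UNIV "[c]"]] by auto
    note i2 = int[OF continuous_on_poly_eval[of UNIV cs]]
    have "(\<lambda>m. fst c * (\<integral>\<omega>. (\<Prod>l\<leftarrow>snd c. X m \<omega> l) \<partial>M) + (\<integral>\<omega>. poly_eval cs (X m \<omega>) \<partial>M)) \<longlonglongrightarrow>
       fst c * (\<integral>\<omega>. (\<Prod>l\<leftarrow>snd c. Y \<omega> l) \<partial>N) + (\<integral>\<omega>. poly_eval cs (Y \<omega>) \<partial>N)"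
      by (intro tendsto_intros moments Cons)
    then show ?case using i1 i2 by simp
  qed simp
  show ?thesis
  proof (rule LIMSEQ_I)
    fix e :: real assume "0 < e"
    then have e: "0 < e / 3" by simp
    obtain cs where cs: "\<And>f. f \<in> S \<Longrightarrow> \<bar>\<Phi> f - poly_eval cs f\<bar> < e / 3"
      using R.Stone_Weierstrass_basic[OF continuous_on_subset[OF \<Phi> subset_UNIV] e] by auto
    obtain m0 where m0: "\<And>m. m \<ge> m0 \<Longrightarrow> \<bar>(\<integral>\<omega>. poly_eval cs (X m \<omega>) \<partial>M) - (\<integral>\<omega>. poly_eval cs (Y \<omega>) \<partial>N)\<bar> < e / 3"
      using LIMSEQ_D[OF poly e, of cs] by auto
    note ip = int[OF continuous_on_poly_eval[of UNIV cs]] and i\<Phi> = int[OF \<Phi>]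
    have a: "\<bar>(\<integral>\<omega>. \<Phi> (X m \<omega>) \<partial>M) - (\<integral>\<omega>. poly_eval cs (X m \<omega>) \<partial>M)\<bar> \<le> e / 3" for m
    proof -
      have "\<bar>\<integral>\<omega>. \<Phi> (X m \<omega>) - poly_eval cs (X m \<omega>) \<partial>M\<bar> \<le> (\<integral>\<omega>. e / 3 \<partial>M)"
        using ip i\<Phi> cs[OF XS] by (intro abs_integral_le) (auto intro: less_imp_le)
      then show ?thesis using ip i\<Phi> by (simp add: M.prob_space)
    qed
    have b: "\<bar>(\<integral>\<omega>. \<Phi> (Y \<omega>) \<partial>N) - (\<integral>\<omega>. poly_eval cs (Y \<omega>) \<partial>N)\<bar> \<le> e / 3"
    proof -
      have "\<bar>\<integral>\<omega>. \<Phi> (Y \<omega>) - poly_eval cs (Y \<omega>) \<partial>N\<bar> \<le> (\<integral>\<omega>. e / 3 \<partial>N)"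
        using ip i\<Phi> cs[OF YS] by (intro abs_integral_le) (auto intro: less_imp_le)
      then show ?thesis using ip i\<Phi> by (simp add: N.prob_space)
    qed
    show "\<exists>no. \<forall>m\<ge>no. norm ((\<integral>\<omega>. \<Phi> (X m \<omega>) \<partial>M) - (\<integral>\<omega>. \<Phi> (Y \<omega>) \<partial>N)) < e"
    proof (intro exI allI impI)
      fix m assume "m \<ge> m0"
      then show "norm ((\<integral>\<omega>. \<Phi> (X m \<omega>) \<partial>M) - (\<integral>\<omega>. \<Phi> (Y \<omega>) \<partial>N)) < e"
        using m0[of m] a[of m] b unfolding real_norm_def by linarith
    qed
  qed
qed

text \<open>Abstracts from the origin of the process: it is used for the normalized sample means and
  for the Gaussian limit, on different probability spaces but with the same coefficients and
  frequencies. The bound \<open>B\<close>, uniform in \<open>l\<close> and time, makes all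
  functionals bounded, as the method of moments requires.\<close>

locale cosine_functionals = pr: prob_space P + mu: finite_measure \<mu>
  for P :: "'w measure" and \<mu> :: "'t measure" +
  fixes r :: nat and W :: "'w \<Rightarrow> 't \<Rightarrow> nat \<Rightarrow> real"
    and E :: "nat \<Rightarrow> 'e set" and \<alpha> :: "nat \<Rightarrow> 'e \<Rightarrow> 't \<Rightarrow> real" and \<kappa> :: "nat \<Rightarrow> 'e \<Rightarrow> nat \<Rightarrow> real"
    and B :: real
  assumes W [measurable]: "\<And>p. p < r \<Longrightarrow> (\<lambda>(\<omega>, t). W \<omega> t p) \<in> borel_measurable (P \<Otimes>\<^sub>M \<mu>)"
    and fin: "\<And>l. finite (E l)"
    and \<alpha> [measurable]: "\<And>l e. e \<in> E l \<Longrightarrow> \<alpha> l e \<in> borel_measurable \<mu>"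
    and \<alpha>B: "\<And>l t. t \<in> space \<mu> \<Longrightarrow> (\<Sum>e\<in>E l. \<bar>\<alpha> l e t\<bar>) \<le> B"
begin

sublocale pair_sigma_finite P \<mu> ..

definition phase :: "'t set \<Rightarrow> ('t \<Rightarrow> nat \<Rightarrow> real) \<Rightarrow> 'w \<Rightarrow> real" where
  "phase F u \<omega> = (\<Sum>t\<in>F. \<Sum>p<r. u t p * W \<omega> t p)"

definition G :: "nat \<Rightarrow> 'w \<Rightarrow> 't \<Rightarrow> real" where
  "G l \<omega> t = (\<Sum>e\<in>E l. \<alpha> l e t * cos (\<Sum>p<r. \<kappa> l e p * W \<omega> t p))"

definition I :: "nat \<Rightarrow> 'w \<Rightarrow> real" where
  "I l \<omega> = (\<integral>t. G l \<omega> t \<partial>\<mu>)"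

lemma G_measurable [measurable]: "(\<lambda>(\<omega>, t). G l \<omega> t) \<in> borel_measurable (P \<Otimes>\<^sub>M \<mu>)"
proof -
  have [measurable]: "(\<lambda>z. W (fst z) (snd z) p) \<in> borel_measurable (P \<Otimes>\<^sub>M \<mu>)" if "p < r" for p
    using W[OF that] by (simp add: case_prod_unfold)
  show ?thesis unfolding G_def case_prod_unfold
    by (intro borel_measurable_sum borel_measurable_times borel_measurable_cos) auto
qed

lemma I_measurable [measurable]: "I l \<in> borel_measurable P"
  unfolding I_def[abs_def] by (rule mu.borel_measurable_lebesgue_integral) measurable

lemma G_bound:
  assumes "t \<in> space \<mu>"
  shows "\<bar>G l \<omega> t\<bar> \<le> B"
proof -
  have "\<bar>G l \<omega> t\<bar> \<le> (\<Sum>e\<in>E l. \<bar>\<alpha> l e t * cos (\<Sum>p<r. \<kappa> l e p * W \<omega> t p)\<bar>)"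
    unfolding G_def by (rule sum_abs)
  also have "\<dots> \<le> (\<Sum>e\<in>E l. \<bar>\<alpha> l e t\<bar>)"
    by (intro sum_mono) (auto simp: abs_mult intro: mult_left_le)
  also have "\<dots> \<le> B" using \<alpha>B[OF assms] .
  finally show ?thesis .
qed

definition D :: real where "D = \<bar>B\<bar> * measure \<mu> (space \<mu>)"

lemma I_bound: "\<bar>I l \<omega>\<bar> \<le> D"
proof (cases "integrable \<mu> (G l \<omega>)")
  case True
  have "\<bar>I l \<omega>\<bar> \<le> (\<integral>t. \<bar>B\<bar> \<partial>\<mu>)"
    unfolding I_def using True G_bound[of _ l \<omega>] by (intro abs_integral_le) (auto intro: order_trans[OF _
      abs_ge_self])
  then show ?thesis by (simp add: D_def mult.commute)
next
  \<comment> \<open>A nonintegrable path has integral 0 by default, so the bound holds for every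
    \<omega>, with no exceptional null set.\<close>
  case False
  then show ?thesis by (simp add: I_def not_integrable_integral_eq D_def)
qed

lemma prod_I_bound: "\<bar>\<Prod>l\<leftarrow>ls. I l \<omega>\<bar> \<le> D ^ length ls"
proof (induction ls)
  case (Cons l ls)
  have "\<bar>I l \<omega>\<bar> * \<bar>\<Prod>l\<leftarrow>ls. I l \<omega>\<bar> \<le> D * D ^ length ls"
    using Cons I_bound[of l \<omega>] by (intro mult_mono) (auto simp: D_def)
  then show ?case by (simp add: abs_mult)
qed simp

lemma prod_I_measurable [measurable]: "(\<lambda>\<omega>. \<Prod>l\<leftarrow>ls. I l \<omega>) \<in> borel_measurable P"
  by (induction ls) auto

lemma W_section [measurable]: "p < r \<Longrightarrow> t \<in> space \<mu> \<Longrightarrow> (\<lambda>\<omega>. W \<omega> t p) \<in> borel_measurable P"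
  using measurable_compose[OF measurable_Pair2' W, of t p] by simp

lemma phase_measurable [measurable]: "F \<subseteq> space \<mu> \<Longrightarrow> phase F u \<in> borel_measurable P"
  unfolding phase_def[abs_def] by (intro borel_measurable_sum borel_measurable_times borel_measurable_const
    W_section) auto

text \<open>Adds the linear form \<open>w\<close> at time \<open>t\<close> to a phase. If
  \<open>t\<close> already lies in \<open>F\<close> the coefficients are added, so repeated times
  cause no case distinction.\<close>

definition shift :: "'t set \<Rightarrow> ('t \<Rightarrow> nat \<Rightarrow> real) \<Rightarrow> 't \<Rightarrow> (nat \<Rightarrow> real) \<Rightarrow> 't \<Rightarrow> nat \<Rightarrow> real" where
  "shift F u t w s p = (if s \<in> F then u s p else 0) + (if s = t then w p else 0)"

lemma phase_shift:
  assumes "finite F"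
  shows "phase (insert t F) (shift F u t w) \<omega> = phase F u \<omega> + (\<Sum>p<r. w p * W \<omega> t p)"
proof -
  have "phase (insert t F) (shift F u t w) \<omega> =
    (\<Sum>s\<in>insert t F. if s \<in> F then \<Sum>p<r. u s p * W \<omega> s p else 0) + (\<Sum>s\<in>insert t F. if s = t then \<Sum>p<r. w p * W
      \<omega> s p else 0)"
    unfolding phase_def shift_def distrib_right sum.distrib
    by (intro arg_cong2[where f = "(+)"] sum.cong) (auto simp: if_distrib[of "\<lambda>x. x * _"] intro!: sum.neutral)
  also have "(\<Sum>s\<in>insert t F. if s \<in> F then \<Sum>p<r. u s p * W \<omega> s p else 0) = phase F u \<omega>"
    unfolding phase_def using assms by (intro sum.mono_neutral_cong_right) auto
  also have "(\<Sum>s\<in>insert t F. if s = t then \<Sum>p<r. w p * W \<omega> s p else 0) = (\<Sum>p<r. w p * W \<omega> t p)"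
    using assms by (subst sum.delta) auto
  finally show ?thesis .
qed

text \<open>The cosine factor closes the induction over the list: taking one functional out of the
  product turns its cosine into a larger phase. The plain mixed moments are those with empty
  \<open>F\<close>.\<close>

definition moment :: "'t set \<Rightarrow> ('t \<Rightarrow> nat \<Rightarrow> real) \<Rightarrow> nat list \<Rightarrow> real" where
  "moment F u ls = pr.expectation (\<lambda>\<omega>. cos (phase F u \<omega>) * (\<Prod>l\<leftarrow>ls. I l \<omega>))"

text \<open>The two shifts are the sum and the difference in cos a cos b = (cos (a + b) + cos (a -
  b)) / 2.\<close>

definition integrand :: "'t set \<Rightarrow> ('t \<Rightarrow> nat \<Rightarrow> real) \<Rightarrow> nat \<Rightarrow> nat list \<Rightarrow> 't \<Rightarrow> real" where
  "integrand F u l ls t = (\<Sum>e\<in>E l. \<alpha> l e t / 2 *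
     (moment (insert t F) (shift F u t (\<kappa> l e)) ls + moment (insert t F) (shift F u t (\<lambda>p. - \<kappa> l e p)) ls))"

context
  fixes F :: "'t set" and u :: "'t \<Rightarrow> nat \<Rightarrow> real" and ls :: "nat list"
  assumes F: "finite F" "F \<subseteq> space \<mu>"
begin

lemma integrable_moment: "integrable P (\<lambda>\<omega>. cos (phase F u \<omega>) * (\<Prod>l\<leftarrow>ls. I l \<omega>))"
proof (rule pr.integrable_const_bound)
  show "AE \<omega> in P. norm (cos (phase F u \<omega>) * (\<Prod>l\<leftarrow>ls. I l \<omega>)) \<le> 1 * D ^ length ls"
    unfolding real_norm_def abs_mult by (intro AE_I2 mult_mono prod_I_bound) auto
qed (use F in measurable)

end

context
  fixes F :: "'t set" and u :: "'t \<Rightarrow> nat \<Rightarrow> real" and l :: nat and ls :: "nat list"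
  assumes F: "finite F" "F \<subseteq> space \<mu>"
begin

text \<open>The expectation under the time integral before the product formula is applied;
  measurability and bounds are proved for this form, convergence for
  \<open>integrand\<close>.\<close>

definition J :: "'t \<Rightarrow> real" where
  "J t = pr.expectation (\<lambda>\<omega>. cos (phase F u \<omega>) * G l \<omega> t * (\<Prod>l\<leftarrow>ls. I l \<omega>))"

lemma J_integrand_measurable [measurable]:
  "(\<lambda>(\<omega>, t). cos (phase F u \<omega>) * G l \<omega> t * (\<Prod>l\<leftarrow>ls. I l \<omega>)) \<in> borel_measurable (P \<Otimes>\<^sub>M \<mu>)"
proof -
  have "(\<lambda>z. phase F u (fst z)) \<in> borel_measurable (P \<Otimes>\<^sub>M \<mu>)" "(\<lambda>z. \<Prod>l\<leftarrow>ls. I l (fst z)) \<in> borel_measurable (P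
    \<Otimes>\<^sub>M \<mu>)"
    using phase_measurable[OF F(2), of u] prod_I_measurable[of ls]
      by (auto intro: measurable_compose[OF measurable_fst])
  then show ?thesis unfolding case_prod_unfold
    using G_measurable[of l] by (intro borel_measurable_times borel_measurable_cos) (auto simp: case_prod_unfold)
qed

lemma J_integrand_bound:
  "t \<in> space \<mu> \<Longrightarrow> \<bar>cos (phase F u \<omega>) * G l \<omega> t * (\<Prod>l\<leftarrow>ls. I l \<omega>)\<bar> \<le> \<bar>B\<bar> * D ^ length ls"
proof -
  assume t: "t \<in> space \<mu>"
  have "\<bar>cos (phase F u \<omega>)\<bar> * \<bar>G l \<omega> t\<bar> \<le> 1 * \<bar>B\<bar>"
    using order_trans[OF G_bound[OF t] abs_ge_self] by (intro mult_mono) auto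
  then show ?thesis unfolding abs_mult by (intro mult_mono prod_I_bound) auto
qed

lemma moment_Cons_J: "moment F u (l # ls) = (\<integral>t. J t \<partial>\<mu>)"
proof -
  let ?f = "\<lambda>\<omega> t. cos (phase F u \<omega>) * G l \<omega> t * (\<Prod>l\<leftarrow>ls. I l \<omega>)"
  interpret pm: finite_measure "P \<Otimes>\<^sub>M \<mu>"
    by (intro finite_measure_pair_measure) unfold_locales
  have "integrable (P \<Otimes>\<^sub>M \<mu>) (case_prod ?f)"
    using J_integrand_bound by (intro pm.integrable_const_bound[where B = "\<bar>B\<bar> * D ^ length ls"] AE_I2)
      (auto simp: space_pair_measure)
  from Fubini_integral[OF this] have "(\<integral>t. J t \<partial>\<mu>) = (\<integral>\<omega>. (\<integral>t. ?f \<omega> t \<partial>\<mu>) \<partial>P)"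
    unfolding J_def .
  also have "\<dots> = moment F u (l # ls)"
    unfolding moment_def I_def by (intro Bochner_Integration.integral_cong) (simp_all add: mult_ac)
  finally show ?thesis ..
qed

lemma J_measurable [measurable]: "J \<in> borel_measurable \<mu>"
proof -
  have "(\<lambda>(t, \<omega>). cos (phase F u \<omega>) * G l \<omega> t * (\<Prod>l\<leftarrow>ls. I l \<omega>)) \<in> borel_measurable (\<mu> \<Otimes>\<^sub>M P)"
    using J_integrand_measurable by (subst (asm) measurable_pair_swap_iff) (simp add: case_prod_unfold)
  then show ?thesis unfolding J_def[abs_def]
    by (rule pr.borel_measurable_lebesgue_integral[where f = "\<lambda>t \<omega>. cos (phase F u \<omega>) * G l \<omega> t * (\<Prod>l\<leftarrow>ls. I l \<omega>)"])
qed

lemma J_bound: "t \<in> space \<mu> \<Longrightarrow> \<bar>J t\<bar> \<le> \<bar>B\<bar> * D ^ length ls"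
proof -
  assume t: "t \<in> space \<mu>"
  let ?f = "\<lambda>\<omega>. cos (phase F u \<omega>) * G l \<omega> t * (\<Prod>l\<leftarrow>ls. I l \<omega>)"
  have "?f \<in> borel_measurable P"
    using measurable_compose[OF measurable_Pair2'[OF t] J_integrand_measurable] by simp
  then have "integrable P ?f"
    using J_integrand_bound[OF t] by (intro pr.integrable_const_bound[where B = "\<bar>B\<bar> * D ^ length ls"] AE_I2) auto
  then have "\<bar>J t\<bar> \<le> pr.expectation (\<lambda>_. \<bar>B\<bar> * D ^ length ls)"
    unfolding J_def using J_integrand_bound[OF t] by (intro abs_integral_le) auto
  then show ?thesis by (simp add: pr.prob_space)
qed

lemma J_eq_integrand: "t \<in> space \<mu> \<Longrightarrow> J t = integrand F u l ls t"
proof -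
  assume t: "t \<in> space \<mu>"
  let ?c = "\<lambda>w \<omega>. cos (phase (insert t F) (shift F u t w) \<omega>) * (\<Prod>l\<leftarrow>ls. I l \<omega>)"
  have int: "integrable P (?c w)" for w
    using F t by (intro integrable_moment) auto
  have "cos (phase F u \<omega>) * G l \<omega> t * (\<Prod>l\<leftarrow>ls. I l \<omega>)
    = (\<Sum>e\<in>E l. \<alpha> l e t / 2 * (?c (\<kappa> l e) \<omega> + ?c (\<lambda>p. - \<kappa> l e p) \<omega>))" for \<omega>
  proof -
    have "cos (phase F u \<omega>) * cos (\<Sum>p<r. w p * W \<omega> t p) =
        (cos (phase (insert t F) (shift F u t w) \<omega>) + cos (phase (insert t F) (shift F u t (\<lambda>p. - w p)) \<omega>)) /
          2" for w
      unfolding phase_shift[OF F(1)] by (simp add: cos_times_cos sum_negf)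
    note * = this
    have "cos (phase F u \<omega>) * G l \<omega> t * (\<Prod>l\<leftarrow>ls. I l \<omega>)
      = (\<Sum>e\<in>E l. \<alpha> l e t * (cos (phase F u \<omega>) * cos (\<Sum>p<r. \<kappa> l e p * W \<omega> t p)) * (\<Prod>l\<leftarrow>ls. I l \<omega>))"
      unfolding G_def sum_distrib_left sum_distrib_right by (simp only: mult_ac)
    from this[unfolded *] show ?thesis by (rule trans) (auto intro!: sum.cong simp: algebra_simps)
  qed
  then show ?thesis unfolding J_def integrand_def moment_def using int by simp
qed

end
end

text \<open>Induction over the list with \<open>F\<close> and \<open>u\<close> arbitrary. The empty
  list is the convergence of characteristic functions; each further functional costs one integration
  over time, where the constant \<open>\<bar>B\<bar> * D ^ length ls\<close> dominates.\<close>

lemma cosine_functionals_moment_tendsto: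
  assumes X: "\<And>m. cosine_functionals M \<mu> r (W m) E \<alpha> B" and Z: "cosine_functionals N \<mu> r Z E \<alpha> B"
    and fidi: "\<And>F u. finite F \<Longrightarrow> F \<subseteq> space \<mu> \<Longrightarrow>
      (\<lambda>m. \<integral>\<omega>. cos (cosine_functionals.phase r (W m) F u \<omega>) \<partial>M) \<longlonglongrightarrow> (\<integral>\<omega>. cos (cosine_functionals.phase r Z F u
        \<omega>) \<partial>N)"
    and F: "finite F" "F \<subseteq> space \<mu>"
  shows "(\<lambda>m. cosine_functionals.moment M \<mu> r (W m) E \<alpha> \<kappa> F u ls)
    \<longlonglongrightarrow> cosine_functionals.moment N \<mu> r Z E \<alpha> \<kappa> F u ls"
proof -
  interpret X: cosine_functionals M \<mu> r "W m" E \<alpha> \<kappa> B for m by (rule X)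
  interpret Z: cosine_functionals N \<mu> r Z E \<alpha> \<kappa> B by (rule Z)
  show ?thesis using F
  proof (induction ls arbitrary: F u)
    case Nil
    then show ?case using fidi[of F u] by (simp add: X.moment_def Z.moment_def)
  next
    case (Cons l ls)
    note F = Cons.prems
    have "(\<lambda>m. \<integral>t. X.J m F u l ls t \<partial>\<mu>) \<longlonglongrightarrow> (\<integral>t. Z.J F u l ls t \<partial>\<mu>)"
    proof (rule integral_dominated_convergence[where w = "\<lambda>_. \<bar>B\<bar> * X.D ^ length ls"])
      show "AE t in \<mu>. (\<lambda>m. X.J m F u l ls t) \<longlonglongrightarrow> Z.J F u l ls t"
      proof (rule AE_I2)
        fix t assume t: "t \<in> space \<mu>"
        have "(\<lambda>m. X.integrand m F u l ls t) \<longlonglongrightarrow> Z.integrand F u l ls t"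
          unfolding X.integrand_def Z.integrand_def X.shift_def Z.shift_def
          using F t by (intro tendsto_intros Cons.IH) auto
        then show "(\<lambda>m. X.J m F u l ls t) \<longlonglongrightarrow> Z.J F u l ls t"
          using X.J_eq_integrand[OF F t] Z.J_eq_integrand[OF F t] by simp
      qed
    qed (use X.J_measurable[OF F] Z.J_measurable[OF F] X.J_bound[OF F] X.mu.finite_measure_axioms in auto)
    then show ?case using X.moment_Cons_J[OF F] Z.moment_Cons_J[OF F] by simp
  qed
qed


section \<open>Outer expectations and measurable approximations\<close>

lemma ereal_expectation_mono:
  assumes "\<And>\<omega>. \<omega> \<in> space M \<Longrightarrow> X \<omega> \<le> Y \<omega>"
  shows "ereal_expectation M X \<le> ereal_expectation M Y"
  unfolding ereal_expectation_def
  using assms by (intro ereal_minus_mono) (auto simp: less_eq_ennreal.rep_eq[symmetric] intro!: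
    nn_integral_mono e2ennreal_mono)

lemma ereal_expectation_real:
  fixes U :: "'w \<Rightarrow> real"
  assumes U: "integrable M U"
  shows "ereal_expectation M (\<lambda>\<omega>. ereal (U \<omega>)) = ereal (\<integral>\<omega>. U \<omega> \<partial>M)"
    and "expectation_exists M (\<lambda>\<omega>. ereal (U \<omega>))"
proof -
  have e: "e2ennreal (ereal a) = ennreal a" for a by (simp add: ennreal.abs_eq)
  have fin: "(\<integral>\<^sup>+\<omega>. ennreal (U \<omega>) \<partial>M) < \<infinity>" "(\<integral>\<^sup>+\<omega>. ennreal (- U \<omega>) \<partial>M) < \<infinity>"
    using real_integrable_def[of M U] U by (auto simp: top.not_eq_extremum)
  have r: "enn2ereal a = ereal (enn2real a)" if "a < \<infinity>" for a
    using that by (cases a) (auto simp: enn2ereal_ennreal)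
  show "ereal_expectation M (\<lambda>\<omega>. ereal (U \<omega>)) = ereal (\<integral>\<omega>. U \<omega> \<partial>M)"
    unfolding ereal_expectation_def uminus_ereal.simps e r[OF fin(1)] r[OF fin(2)]
      real_lebesgue_integral_def[OF U] by simp
  show "expectation_exists M (\<lambda>\<omega>. ereal (U \<omega>))"
    unfolding expectation_exists_def e using fin by simp
qed

text \<open>Gives access to the outer expectations of the statistics: \<open>U\<close> is admissible
  in the infimum, and every majorant of \<open>X\<close> is one of \<open>L\<close>.\<close>

lemma outer_expectation_sandwich:
  fixes X L U :: "'w \<Rightarrow> real"
  assumes L: "integrable M L" and U: "integrable M U"
    and le: "\<And>\<omega>. \<omega> \<in> space M \<Longrightarrow> L \<omega> \<le> X \<omega>" "\<And>\<omega>. \<omega> \<in> space M \<Longrightarrow> X \<omega> \<le> U \<omega>"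
  shows "ereal (\<integral>\<omega>. L \<omega> \<partial>M) \<le> outer_expectation M (\<lambda>\<omega>. ereal (X \<omega>))"
    and "outer_expectation M (\<lambda>\<omega>. ereal (X \<omega>)) \<le> ereal (\<integral>\<omega>. U \<omega> \<partial>M)"
proof -
  show "outer_expectation M (\<lambda>\<omega>. ereal (X \<omega>)) \<le> ereal (\<integral>\<omega>. U \<omega> \<partial>M)"
    unfolding outer_expectation_def ereal_expectation_real(1)[OF U, symmetric]
  proof (rule Inf_lower, rule CollectI, intro exI conjI)
    show "(\<lambda>\<omega>. ereal (U \<omega>)) \<in> borel_measurable M" using U by measurable
  qed (use ereal_expectation_real(2)[OF U] le in auto)
  show "ereal (\<integral>\<omega>. L \<omega> \<partial>M) \<le> outer_expectation M (\<lambda>\<omega>. ereal (X \<omega>))"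
    unfolding outer_expectation_def
  proof (rule Inf_greatest)
    fix y assume "y \<in> {ereal_expectation M V | V. V \<in> borel_measurable M \<and> expectation_exists M V \<and>
            (\<forall>\<omega>\<in>space M. ereal (X \<omega>) \<le> V \<omega>)}"
    then obtain V where V: "y = ereal_expectation M V" "\<And>\<omega>. \<omega> \<in> space M \<Longrightarrow> ereal (X \<omega>) \<le> V \<omega>" by auto
    have "ereal_expectation M (\<lambda>\<omega>. ereal (L \<omega>)) \<le> ereal_expectation M V"
      using le(1) V(2) by (intro ereal_expectation_mono) (meson ereal_less_eq(3) order_trans)
    then show "ereal (\<integral>\<omega>. L \<omega> \<partial>M) \<le> y" using ereal_expectation_real(1)[OF L] V(1) by simp
  qed
qed

text \<open>The weights of the metric on sequences form a geometric series with sum 2.\<close>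

lemma dist_fun_le:
  fixes x y :: "nat \<Rightarrow> real"
  assumes "\<And>l. \<bar>x l - y l\<bar> \<le> \<delta>"
  shows "dist x y \<le> 2 * \<delta>"
proof -
  have s: "summable (\<lambda>n. (1/2::real) ^ n * \<delta>)" by (intro summable_mult2 summable_geometric) simp
  have le: "(1/2) ^ n * min (dist (x (from_nat n)) (y (from_nat n))) 1 \<le> (1/2) ^ n * \<delta>" for n
    using assms by (intro mult_left_mono) (auto simp: dist_real_def min.coboundedI1)
  have "dist x y \<le> (\<Sum>n. (1/2) ^ n * \<delta>)"
    unfolding dist_fun_def
  proof (rule suminf_le[OF le _ s])
    show "summable (\<lambda>n. (1/2) ^ n * min (dist (x (from_nat n)) (y (from_nat n))) 1)"
      by (rule summable_comparison_test'[OF s]) (use le in auto)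
  qed
  also have "\<dots> = 2 * \<delta>" by (subst suminf_mult2[symmetric]) (auto simp: suminf_geometric)
  finally show ?thesis .
qed

text \<open>Tightness of a single random vector. It is applied to the limit only; the approximating
  sequence inherits it by weak convergence.\<close>

lemma exists_box_probability:
  fixes Z :: "'z \<Rightarrow> nat \<Rightarrow> real"
  assumes N: "prob_space N" and Z [measurable]: "\<And>l. (\<lambda>\<omega>. Z \<omega> l) \<in> borel_measurable N" and \<eta>: "0 < \<eta>"
  shows "\<exists>C>0. measure N {\<omega> \<in> space N. \<forall>l<R. \<bar>Z \<omega> l\<bar> \<le> C} \<ge> 1 - \<eta>"
proof -
  interpret prob_space N by fact
  define A where "A c = {\<omega> \<in> space N. \<forall>l<R. \<bar>Z \<omega> l\<bar> \<le> real c}" for c :: nat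
  have [measurable]: "A c \<in> sets N" for c unfolding A_def by measurable
  have "(\<Union>c. A c) = space N"
  proof (intro equalityI subsetI)
    fix \<omega> assume \<omega>: "\<omega> \<in> space N"
    obtain c :: nat where "(\<Sum>l<R. \<bar>Z \<omega> l\<bar>) \<le> real c" using real_arch_simple by blast
    moreover have "\<bar>Z \<omega> l\<bar> \<le> (\<Sum>l<R. \<bar>Z \<omega> l\<bar>)" if "l < R" for l
      using that by (intro member_le_sum) auto
    ultimately show "\<omega> \<in> (\<Union>c. A c)" using \<omega> by (auto simp: A_def intro: order_trans)
  qed (auto simp: A_def)
  moreover have "incseq A" by (auto simp: incseq_def A_def intro: order_trans)
  ultimately have "(\<lambda>c. measure N (A c)) \<longlonglongrightarrow> 1"
    using finite_Lim_measure_incseq[of A] by (auto simp: prob_space image_subset_iff)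
  then have "\<forall>\<^sub>F c in sequentially. 1 - \<eta> < measure N (A c)"
    using \<eta> by (intro order_tendstoD) auto
  then have "\<forall>\<^sub>F c in sequentially. 1 - \<eta> < measure N (A c) \<and> 0 < c"
    using eventually_gt_at_top[of 0] by eventually_elim auto
  then obtain c where "1 - \<eta> < measure N (A c)" "0 < c" by (auto simp: eventually_sequentially)
  then show ?thesis by (intro exI[of _ "real c"]) (auto simp: A_def)
qed

text \<open>Convergence in distribution of a possibly nonmeasurable sequence, from convergent measurable
  approximations: \<open>\<chi>\<close> below cuts off the part of the approximations outside a box, where the
  uniform continuity of \<open>F\<close> is not available.\<close>

lemma outer_expectation_tendsto_of_approximation:
  fixes X :: "nat \<Rightarrow> 'w \<Rightarrow> nat \<Rightarrow> real" and Z :: "'z \<Rightarrow> nat \<Rightarrow> real" and F :: "(nat \<Rightarrow> real) \<Rightarrow> real"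
  assumes M: "prob_space M" and N: "prob_space N"
    and Zm [measurable]: "\<And>l. (\<lambda>\<omega>. Z \<omega> l) \<in> borel_measurable N"
    and X0: "\<And>m \<omega> l. l \<ge> R \<Longrightarrow> X m \<omega> l = 0" and Z0: "\<And>\<omega> l. l \<ge> R \<Longrightarrow> Z \<omega> l = 0"
    and F: "continuous_on UNIV F" and FB: "\<And>f. \<bar>F f\<bar> \<le> B"
    and approx: "\<And>\<eta>. 0 < \<eta> \<Longrightarrow> \<exists>A A'.
        (\<forall>m l. (\<lambda>\<omega>. A m \<omega> l) \<in> borel_measurable M) \<and> (\<forall>l. (\<lambda>\<omega>. A' \<omega> l) \<in> borel_measurable N) \<and>
        (\<forall>\<Phi> :: (nat \<Rightarrow> real) \<Rightarrow> real. continuous_on UNIV \<Phi> \<longrightarrow> (\<lambda>m. \<integral>\<omega>. \<Phi> (A m \<omega>) \<partial>M) \<longlonglongrightarrow> (\<integral>\<omega>. \<Phi> (A' \<omega>) \<partial>N)) \<and>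
        (\<forall>\<^sub>F m in sequentially. \<exists>G\<in>sets M. measure M G \<ge> 1 - \<eta> \<and> (\<forall>\<omega>\<in>G. \<forall>l. \<bar>X m \<omega> l - A m \<omega> l\<bar> \<le> \<eta>)) \<and>
        (\<exists>G\<in>sets N. measure N G \<ge> 1 - \<eta> \<and> (\<forall>\<omega>\<in>G. \<forall>l. \<bar>Z \<omega> l - A' \<omega> l\<bar> \<le> \<eta>))"
  shows "(\<lambda>m. outer_expectation M (\<lambda>\<omega>. ereal (F (X m \<omega>)))) \<longlonglongrightarrow> ereal (\<integral>\<omega>. F (Z \<omega>) \<partial>N)"
proof -
  interpret M: prob_space M by fact
  interpret N: prob_space N by fact
  have B: "0 \<le> B" using FB[of undefined] by linarith
  have main: "\<forall>\<^sub>F m in sequentially. \<exists>a. outer_expectation M (\<lambda>\<omega>. ereal (F (X m \<omega>))) = ereal a \<and>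
      \<bar>a - (\<integral>\<omega>. F (Z \<omega>) \<partial>N)\<bar> < e" if e: "0 < e" for e
  proof -
    \<comment> \<open>Total error in units of \<eta>0: 1 + 8 B from the sandwich, 1 from the
      convergence of the \<Phi>-expectations, 1 + 6 B on the side of the limit.\<close>
    define S where "S = 3 + 14 * B"
    have S: "0 < S" using B by (simp add: S_def)
    define \<eta>0 where "\<eta>0 = e / (2 * S)"
    have \<eta>0': "S * \<eta>0 = e / 2" using S by (simp add: \<eta>0_def)
    have \<eta>0: "0 < \<eta>0" using e S by (simp add: \<eta>0_def)
    have \<eta>0e: "(3 + 14 * B) * \<eta>0 < e" using \<eta>0' e by (simp add: S_def)
    obtain C where C: "0 < C" "measure N {\<omega> \<in> space N. \<forall>l<R. \<bar>Z \<omega> l\<bar> \<le> C} \<ge> 1 - \<eta>0"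
      using exists_box_probability[where Z = Z and R = R, OF N Zm \<eta>0] by (elim exE conjE) (rule that)
    \<comment> \<open>Where \<open>\<chi> g\<close> is nonzero, the first \<open>R\<close>
      coordinates of \<open>g\<close> are below C + 2 in modulus, and those of a point within \<eta>
      \<le> 1 of it below C + 3.\<close>
    define K where "K = {f :: nat \<Rightarrow> real. \<forall>l. \<bar>f l\<bar> \<le> C + 3}"
    have "uniformly_continuous_on K F"
      unfolding K_def by (intro compact_uniformly_continuous compact_box continuous_on_subset[OF F]) auto
    then have "\<exists>d>0. \<forall>g\<in>K. \<forall>f\<in>K. dist f g < d \<longrightarrow> dist (F f) (F g) < \<eta>0"
      unfolding uniformly_continuous_on_def using \<eta>0 by (elim allE impE)
    then obtain d where d: "0 < d" "\<And>f g. f \<in> K \<Longrightarrow> g \<in> K \<Longrightarrow> dist f g < d \<Longrightarrow> dist (F f) (F g) < \<eta>0"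
      by blast
    \<comment> \<open>The third bound makes 2 \<eta> < d, the distance at which uniform continuity
      of \<open>F\<close> on \<open>K\<close> applies.\<close>
    define \<eta> where "\<eta> = min (min \<eta>0 1) (d / 3)"
    have \<eta>: "0 < \<eta>" "\<eta> \<le> \<eta>0" "\<eta> \<le> 1" "2 * \<eta> < d" using \<eta>0 d by (auto simp: \<eta>_def min_def)
    obtain A A' where Am1: "\<forall>m l. (\<lambda>\<omega>. A m \<omega> l) \<in> borel_measurable M" and Am2: "\<forall>l. (\<lambda>\<omega>. A' \<omega> l) \<in>
      borel_measurable N"
      and lim1: "\<forall>\<Phi> :: (nat \<Rightarrow> real) \<Rightarrow> real. continuous_on UNIV \<Phi> \<longrightarrow> (\<lambda>m. \<integral>\<omega>. \<Phi> (A m \<omega>) \<partial>M) \<longlonglongrightarrow> (\<integral>\<omega>. \<Phi> (A' \<omega>) \<partial>N)"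
      and evG: "\<forall>\<^sub>F m in sequentially. \<exists>G\<in>sets M. measure M G \<ge> 1 - \<eta> \<and> (\<forall>\<omega>\<in>G. \<forall>l. \<bar>X m \<omega> l - A m \<omega> l\<bar> \<le> \<eta>)"
      and exG: "\<exists>G\<in>sets N. measure N G \<ge> 1 - \<eta> \<and> (\<forall>\<omega>\<in>G. \<forall>l. \<bar>Z \<omega> l - A' \<omega> l\<bar> \<le> \<eta>)"
      using approx[OF \<eta>(1)] by (elim exE conjE) (rule that)
    note Am = Am1[rule_format] Am2[rule_format] and lim = lim1[rule_format]
    obtain G' where G': "G' \<in> sets N" "measure N G' \<ge> 1 - \<eta>" "\<And>\<omega> l. \<omega> \<in> G' \<Longrightarrow> \<bar>Z \<omega> l - A' \<omega> l\<bar> \<le> \<eta>"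
      using exG by blast
    \<comment> \<open>Clamping forces every sequence into \<open>K\<close> and is the identity
      there, so \<Phi> is continuous everywhere, agrees with \<open>F\<close> on \<open>K\<close>
      and profits from the uniform continuity on \<open>K\<close>.\<close>
    define clamp where "clamp f l = max (- (C + 3)) (min (C + 3) (f l))" for f :: "nat \<Rightarrow> real" and l
    define \<Phi> where "\<Phi> f = F (clamp f)" for f
    define \<chi> where "\<chi> f = max 0 (1 - (\<Sum>l<R. max 0 (\<bar>f l\<bar> - (C + 1))))" for f :: "nat \<Rightarrow> real"
    have coord: "continuous_on UNIV (\<lambda>f :: nat \<Rightarrow> real. f l)" for l by (rule continuous_on_product_coordinates)
    have "continuous_on UNIV clamp" unfolding clamp_def[abs_def]
      by (intro continuous_on_coordinatewise_then_product continuous_intros coord)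
    then have \<Phi>c: "continuous_on UNIV \<Phi>" unfolding \<Phi>_def[abs_def]
      by (rule continuous_on_compose2[OF F]) auto
    have \<chi>c: "continuous_on UNIV \<chi>" unfolding \<chi>_def[abs_def] by (intro continuous_intros coord)
    have \<chi>01: "0 \<le> \<chi> f" "\<chi> f \<le> 1" for f by (auto simp: \<chi>_def intro!: sum_nonneg)
    have \<Phi>B: "\<bar>\<Phi> f\<bar> \<le> B" for f unfolding \<Phi>_def by (rule FB)
    have near: "\<bar>F f - \<Phi> g\<bar> \<le> \<eta>0 + 2 * B * (1 - \<chi> g)" if f0: "\<And>l. l \<ge> R \<Longrightarrow> f l = 0" and fg: "\<And>l. \<bar>f l - g l\<bar> \<le>
      \<eta>" for f g
    proof (cases "\<chi> g = 0")
      case True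
      then show ?thesis using FB[of f] \<Phi>B[of g] \<eta>0 by simp
    next
      case False
      then have s: "(\<Sum>l<R. max 0 (\<bar>g l\<bar> - (C + 1))) < 1" by (auto simp: \<chi>_def max_def split: if_splits)
      have fb: "\<bar>f l\<bar> \<le> C + 3" for l
      proof (cases "l < R")
        case True
        have "max 0 (\<bar>g l\<bar> - (C + 1)) \<le> (\<Sum>l<R. max 0 (\<bar>g l\<bar> - (C + 1)))"
          using True by (intro member_le_sum) auto
        then show ?thesis using s fg[of l] \<eta>(3) by linarith
      next
        case False
        then show ?thesis using f0[of l] C(1) by simp
      qed
      have f: "clamp f = f" "f \<in> K"
      proof -
        have "clamp f l = f l" for l using fb[of l] unfolding clamp_def by linarith
        then show "clamp f = f" by blast
      qed (use fb in \<open>simp add: K_def\<close>)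
      have "clamp g \<in> K" using C(1) by (auto simp: clamp_def K_def)
      moreover have "\<bar>clamp f l - clamp g l\<bar> \<le> \<eta>" for l
        using fg[of l] unfolding clamp_def by linarith
      then have "dist f (clamp g) \<le> 2 * \<eta>" using f(1) by (intro dist_fun_le) metis
      ultimately have "dist (F f) (F (clamp g)) < \<eta>0" using d(2)[OF f(2)] \<eta>(4) by auto
      moreover have "0 \<le> 2 * B * (1 - \<chi> g)" using B \<chi>01 by simp
      ultimately show ?thesis by (simp add: \<Phi>_def dist_real_def)
    qed
    \<comment> \<open>\<open>q\<close> will be the indicator of the event on which the approximation
      is close; off this event the trivial bound 2 B is charged.\<close>
    have bound: "\<bar>F f - \<Phi> g\<bar> \<le> \<eta>0 + 2 * B * (1 - \<chi> g) + 2 * B * (1 - q)"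
      if "\<And>l. l \<ge> R \<Longrightarrow> f l = 0" and "\<And>l. q = 1 \<Longrightarrow> \<bar>f l - g l\<bar> \<le> \<eta>" and q: "q = 0 \<or> q = 1" for f g and q :: real
    proof (cases "q = 1")
      case True
      then show ?thesis using near[of f g] that by simp
    next
      case False
      have "\<bar>F f - \<Phi> g\<bar> \<le> 2 * B" using FB[of f] \<Phi>B[of g] by simp
      moreover have "0 \<le> 2 * B * (1 - \<chi> g)" using B \<chi>01[of g] by simp
      ultimately show ?thesis using False q \<eta>0 by simp
    qed
    have meas: "(\<lambda>\<omega>. \<Psi> (A m \<omega>)) \<in> borel_measurable M" "(\<lambda>\<omega>. \<Psi> (A' \<omega>)) \<in> borel_measurable N" "(\<lambda>\<omega>. \<Psi> (Z \<omega>)) \<in>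
      borel_measurable N"
      if "continuous_on UNIV \<Psi>" for \<Psi> :: "(nat \<Rightarrow> real) \<Rightarrow> real" and m
      using borel_measurable_continuous_onI[OF that]
      by (auto intro!: measurable_compose[of _ _ borel \<Psi>] measurable_fun_coordinatewise Am Zm)
    have intM: "integrable M (\<lambda>\<omega>. \<Phi> (A m \<omega>))" "integrable M (\<lambda>\<omega>. \<chi> (A m \<omega>))" for m
      using \<Phi>B \<chi>01 by (intro M.integrable_const_bound[where B = B, OF _ meas(1)[OF \<Phi>c]]
        M.integrable_const_bound[where B = 1, OF _ meas(1)[OF \<chi>c]]; simp)+
    have intN: "integrable N (\<lambda>\<omega>. \<Phi> (A' \<omega>))" "integrable N (\<lambda>\<omega>. \<chi> (A' \<omega>))" "integrable N (\<lambda>\<omega>. F (Z \<omega>))"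
      using \<Phi>B \<chi>01 FB by (intro N.integrable_const_bound[where B = B, OF _ meas(2)[OF \<Phi>c]]
        N.integrable_const_bound[where B = 1, OF _ meas(2)[OF \<chi>c]]
          N.integrable_const_bound[where B = B, OF _ meas(3)[OF F]]; simp)+
    define p where "p = (\<integral>\<omega>. \<Phi> (A' \<omega>) \<partial>N)"
    define c where "c = (\<integral>\<omega>. \<chi> (A' \<omega>) \<partial>N)"
    \<comment> \<open>On the event where the limit lies in the box and is well approximated, the
      approximation stays within C + 1, where the cutoff is 1.\<close>
    have c: "1 - 2 * \<eta>0 \<le> c"
    proof -
      let ?Q = "{\<omega> \<in> space N. \<forall>l<R. \<bar>Z \<omega> l\<bar> \<le> C}"
      have Q: "?Q \<in> sets N" by measurable
      have "measure N (G' \<inter> ?Q) \<ge> 1 - 2 * \<eta>0"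
      proof -
        have "1 - measure N (G' \<inter> ?Q) = measure N (space N - G' \<inter> ?Q)"
          using N.prob_compl[of "G' \<inter> ?Q"] G'(1) Q by auto
        also have "space N - G' \<inter> ?Q = (space N - G') \<union> (space N - ?Q)" by auto
        also have "measure N \<dots> \<le> measure N (space N - G') + measure N (space N - ?Q)"
          using G'(1) Q by (intro measure_Un_le) auto
        also have "\<dots> = (1 - measure N G') + (1 - measure N ?Q)"
          using N.prob_compl G'(1) Q by auto
        finally show ?thesis using G'(2) C(2) \<eta>(2) by linarith
      qed
      also have "measure N (G' \<inter> ?Q) = (\<integral>\<omega>. indicator (G' \<inter> ?Q) \<omega> \<partial>N)"
        using sets.sets_into_space[OF G'(1)] by (simp add: Int_absorb1 Int_absorb2 inf.absorb1 Int_assoc)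
      also have "\<dots> \<le> c" unfolding c_def
      proof (rule integral_mono)
        fix \<omega> assume "\<omega> \<in> space N"
        show "indicator (G' \<inter> ?Q) \<omega> \<le> \<chi> (A' \<omega>)"
        proof (cases "\<omega> \<in> G' \<inter> ?Q")
          case True
          have "\<bar>A' \<omega> l\<bar> \<le> C + 1" if "l < R" for l
          proof -
            have "\<bar>Z \<omega> l\<bar> \<le> C" "\<bar>Z \<omega> l - A' \<omega> l\<bar> \<le> \<eta>" using True that G'(3) by auto
            then show ?thesis using \<eta>(3) by linarith
          qed
          then have "\<chi> (A' \<omega>) = 1" by (simp add: \<chi>_def)
          then show ?thesis by (simp add: indicator_def)
        qed (use \<chi>01 in auto)
      qed (use intN G'(1) Q in \<open>auto intro!: integrable_real_indicator simp: N.emeasure_eq_measure\<close>)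
      finally show ?thesis .
    qed
    have Zp: "\<bar>(\<integral>\<omega>. F (Z \<omega>) \<partial>N) - p\<bar> \<le> \<eta>0 + 2 * B * (1 - c) + 2 * B * \<eta>0"
    proof -
      have iG: "integrable N (indicator G' :: 'z \<Rightarrow> real)" using G'(1) by (simp add: N.emeasure_eq_measure)
      have eG: "(\<integral>\<omega>. indicator G' \<omega> \<partial>N) = measure N G'"
        using sets.sets_into_space[OF G'(1)] by (simp add: inf.absorb1)
      have "\<bar>\<integral>\<omega>. F (Z \<omega>) - \<Phi> (A' \<omega>) \<partial>N\<bar> \<le> (\<integral>\<omega>. \<eta>0 + 2 * B * (1 - \<chi> (A' \<omega>)) + 2 * B * (1 - indicator G' \<omega>) \<partial>N)"
      proof (rule abs_integral_le)
        fix \<omega>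
        show "\<bar>F (Z \<omega>) - \<Phi> (A' \<omega>)\<bar> \<le> \<eta>0 + 2 * B * (1 - \<chi> (A' \<omega>)) + 2 * B * (1 - indicator G' \<omega>)"
          using G'(3) by (intro bound Z0) (auto simp: indicator_def split: if_splits)
      qed (use intN iG in simp_all)
      also have "\<dots> = \<eta>0 + 2 * B * (1 - c) + 2 * B * (1 - measure N G')"
        using intN iG by (simp add: c_def N.prob_space eG del: Bochner_Integration.integral_indicator)
      also have "\<dots> \<le> \<eta>0 + 2 * B * (1 - c) + 2 * B * \<eta>0"
        using B G'(2) \<eta>(2) by (intro add_left_mono mult_left_mono) auto
      finally show ?thesis using intN by (simp add: p_def)
    qed
    have ev1: "\<forall>\<^sub>F m in sequentially. \<bar>(\<integral>\<omega>. \<Phi> (A m \<omega>) \<partial>M) - p\<bar> < \<eta>0"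
      using tendstoD[OF lim[OF \<Phi>c] \<eta>0] by (simp add: p_def dist_real_def)
    have ev2: "\<forall>\<^sub>F m in sequentially. \<bar>(\<integral>\<omega>. \<chi> (A m \<omega>) \<partial>M) - c\<bar> < \<eta>0"
      using tendstoD[OF lim[OF \<chi>c] \<eta>0] by (simp add: c_def dist_real_def)
    show ?thesis using evG ev1 ev2
    proof eventually_elim
      case (elim m)
      then obtain G where G: "G \<in> sets M" "measure M G \<ge> 1 - \<eta>" "\<And>\<omega> l. \<omega> \<in> G \<Longrightarrow> \<bar>X m \<omega> l - A m \<omega> l\<bar> \<le> \<eta>" by auto
      define h where "h \<omega> = \<eta>0 + 2 * B * (1 - \<chi> (A m \<omega>)) + 2 * B * (1 - indicator G \<omega>)" for \<omega>
      have iG: "integrable M (indicator G :: 'w \<Rightarrow> real)" using G(1) by (simp add: M.emeasure_eq_measure)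
      have ih: "integrable M h" unfolding h_def using intM iG by auto
      have Eh: "(\<integral>\<omega>. h \<omega> \<partial>M) \<le> \<eta>0 + 2 * B * (3 * \<eta>0) + 2 * B * \<eta>0"
      proof -
        have "(\<integral>\<omega>. h \<omega> \<partial>M) = \<eta>0 + 2 * B * (1 - (\<integral>\<omega>. \<chi> (A m \<omega>) \<partial>M)) + 2 * B * (1 - measure M G)"
          unfolding h_def using intM iG sets.sets_into_space[OF G(1)]
          by (simp add: M.prob_space M.emeasure_eq_measure inf.absorb1 inf.absorb2)
        \<comment> \<open>Tightness passes from the limit to the approximations through convergence
          of the expectations of the continuous cutoff.\<close>
        moreover have "1 - (\<integral>\<omega>. \<chi> (A m \<omega>) \<partial>M) \<le> 3 * \<eta>0" using elim c by linarith
        moreover have "2 * B * (1 - (\<integral>\<omega>. \<chi> (A m \<omega>) \<partial>M)) \<le> 2 * B * (3 * \<eta>0)"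
          using B \<open>1 - (\<integral>\<omega>. \<chi> (A m \<omega>) \<partial>M) \<le> 3 * \<eta>0\<close> by (intro mult_left_mono) auto
        moreover have "2 * B * (1 - measure M G) \<le> 2 * B * \<eta>0"
          using B G(2) \<eta>(2) by (intro mult_left_mono) auto
        ultimately show ?thesis by linarith
      qed
      have hb: "\<bar>F (X m \<omega>) - \<Phi> (A m \<omega>)\<bar> \<le> h \<omega>" for \<omega>
        using G(3) unfolding h_def by (intro bound X0) (auto simp: indicator_def split: if_splits)
      have le: "\<Phi> (A m \<omega>) - h \<omega> \<le> F (X m \<omega>)" "F (X m \<omega>) \<le> \<Phi> (A m \<omega>) + h \<omega>" for \<omega>
        using hb[of \<omega>] by linarith+
      note s = outer_expectation_sandwich[OF Bochner_Integration.integrable_diff[OF intM(1) ih]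
        Bochner_Integration.integrable_add[OF intM(1) ih] le]
      have 1: "ereal ((\<integral>\<omega>. \<Phi> (A m \<omega>) \<partial>M) - (\<integral>\<omega>. h \<omega> \<partial>M)) \<le> outer_expectation M (\<lambda>\<omega>. ereal (F (X m \<omega>)))"
        using s(1) unfolding Bochner_Integration.integral_diff[OF intM(1) ih] .
      have 2: "outer_expectation M (\<lambda>\<omega>. ereal (F (X m \<omega>))) \<le> ereal ((\<integral>\<omega>. \<Phi> (A m \<omega>) \<partial>M) + (\<integral>\<omega>. h \<omega> \<partial>M))"
        using s(2) unfolding Bochner_Integration.integral_add[OF intM(1) ih] .
      obtain a where a: "outer_expectation M (\<lambda>\<omega>. ereal (F (X m \<omega>))) = ereal a"
        using 1 2 by (cases "outer_expectation M (\<lambda>\<omega>. ereal (F (X m \<omega>)))") auto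
      have aa: "\<bar>a - (\<integral>\<omega>. \<Phi> (A m \<omega>) \<partial>M)\<bar> \<le> (\<integral>\<omega>. h \<omega> \<partial>M)" using 1 2 unfolding a by (auto simp: abs_le_iff)
      have "2 * B * (1 - c) \<le> 2 * B * (2 * \<eta>0)" using B c by (intro mult_left_mono) auto
      then have "\<bar>a - (\<integral>\<omega>. F (Z \<omega>) \<partial>N)\<bar> \<le> (3 + 14 * B) * \<eta>0"
        using aa Eh Zp elim(2) by (simp add: algebra_simps)
      then show ?case using a \<eta>0e by auto
    qed
  qed
  let ?o = "\<lambda>m. outer_expectation M (\<lambda>\<omega>. ereal (F (X m \<omega>)))"
  \<comment> \<open>\<open>main\<close> gives finiteness of the outer expectations eventually, hence
    the detour through reals.\<close>
  have "(\<lambda>m. real_of_ereal (?o m)) \<longlonglongrightarrow> (\<integral>\<omega>. F (Z \<omega>) \<partial>N)"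
  proof (rule tendstoI)
    fix e :: real assume "0 < e"
    from main[OF this] show "\<forall>\<^sub>F m in sequentially. dist (real_of_ereal (?o m)) (\<integral>\<omega>. F (Z \<omega>) \<partial>N) < e"
      by eventually_elim (auto simp: dist_real_def)
  qed
  then have "(\<lambda>m. ereal (real_of_ereal (?o m))) \<longlonglongrightarrow> ereal (\<integral>\<omega>. F (Z \<omega>) \<partial>N)"
    by simp
  moreover have "\<forall>\<^sub>F m in sequentially. ereal (real_of_ereal (?o m)) = ?o m"
    proof -
    have "(0::real) < 1" by simp
    from main[OF this] show ?thesis by eventually_elim auto
  qed
  ultimately show ?thesis by (rule Lim_transform_eventually)
qed


section \<open>Uniform consistency of the variance estimators\<close>

lemma (in prob_space) second_moment_sum_of_orthogonal:
  fixes X :: "'i \<Rightarrow> 'a \<Rightarrow> real"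
  assumes A: "finite A"
    and int: "\<And>j j'. j \<in> A \<Longrightarrow> j' \<in> A \<Longrightarrow> integrable M (\<lambda>\<omega>. X j \<omega> * X j' \<omega>)"
    and orth: "\<And>j j'. j \<in> A \<Longrightarrow> j' \<in> A \<Longrightarrow> j \<noteq> j' \<Longrightarrow> expectation (\<lambda>\<omega>. X j \<omega> * X j' \<omega>) = 0"
  shows "integrable M (\<lambda>\<omega>. (\<Sum>j\<in>A. X j \<omega>)\<^sup>2)"
    and "expectation (\<lambda>\<omega>. (\<Sum>j\<in>A. X j \<omega>)\<^sup>2) = (\<Sum>j\<in>A. expectation (\<lambda>\<omega>. (X j \<omega>)\<^sup>2))"
proof -
  have eq: "(\<Sum>j\<in>A. X j \<omega>)\<^sup>2 = (\<Sum>j\<in>A. \<Sum>j'\<in>A. X j \<omega> * X j' \<omega>)" for \<omega>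
    by (simp add: power2_eq_square sum_product)
  show "integrable M (\<lambda>\<omega>. (\<Sum>j\<in>A. X j \<omega>)\<^sup>2)" unfolding eq
    by (intro Bochner_Integration.integrable_sum int)
  have "expectation (\<lambda>\<omega>. (\<Sum>j\<in>A. X j \<omega>)\<^sup>2) = (\<Sum>j\<in>A. \<Sum>j'\<in>A. expectation (\<lambda>\<omega>. X j \<omega> * X j' \<omega>))"
    unfolding eq using int by (simp add: Bochner_Integration.integral_sum Bochner_Integration.integrable_sum)
  also have "\<dots> = (\<Sum>j\<in>A. \<Sum>j'\<in>A. if j' = j then expectation (\<lambda>\<omega>. (X j \<omega>)\<^sup>2) else 0)"
    by (intro sum.cong refl) (auto simp: orth power2_eq_square)
  also have "\<dots> = (\<Sum>j\<in>A. expectation (\<lambda>\<omega>. (X j \<omega>)\<^sup>2))" using A by simp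
  finally show "expectation (\<lambda>\<omega>. (\<Sum>j\<in>A. X j \<omega>)\<^sup>2) = (\<Sum>j\<in>A. expectation (\<lambda>\<omega>. (X j \<omega>)\<^sup>2))" .
qed

lemma (in prob_space) indep_vars_expectation_mult:
  fixes X :: "'i \<Rightarrow> 'a \<Rightarrow> real"
  assumes ind: "indep_vars (\<lambda>_. borel) X I" and ij: "i \<in> I" "j \<in> I" "i \<noteq> j"
    and int: "integrable M (X i)" "integrable M (X j)"
  shows "integrable M (\<lambda>\<omega>. X i \<omega> * X j \<omega>)"
    and "expectation (\<lambda>\<omega>. X i \<omega> * X j \<omega>) = expectation (X i) * expectation (X j)"
proof -
  have ind2: "indep_vars (\<lambda>_. borel) X {i, j}" using ij by (intro indep_vars_subset[OF ind]) auto
  have int2: "\<And>l. l \<in> {i, j} \<Longrightarrow> integrable M (X l)" using int by blast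
  show "integrable M (\<lambda>\<omega>. X i \<omega> * X j \<omega>)"
    using indep_vars_integrable[OF _ ind2 int2] ij(3) by simp
  show "expectation (\<lambda>\<omega>. X i \<omega> * X j \<omega>) = expectation (X i) * expectation (X j)"
    using indep_vars_lebesgue_integral[OF _ ind2 int2] ij(3) by simp
qed

text \<open>Convergence in mean is proved because it is later added to oscillation bounds in mean
  under one Markov inequality. Truncation at \<open>C\<close> leaves an error \<rho> C that is small
  in mean and a bounded part whose sums have variance of order \<open>N\<close>.\<close>

theorem (in prob_space) weak_law_of_large_numbers_L1:
  fixes X :: "nat \<Rightarrow> 'a \<Rightarrow> real"
  assumes ind: "indep_vars (\<lambda>_. borel) X UNIV"
    and ident: "\<And>j. distr M borel (X j) = distr M borel (X 0)"
    and int0: "integrable M (X 0)"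
  shows "(\<lambda>N. expectation (\<lambda>\<omega>. \<bar>(\<Sum>j<N. X j \<omega>) / N - expectation (X 0)\<bar>)) \<longlonglongrightarrow> 0"
proof (rule LIMSEQ_I)
  fix \<epsilon> :: real assume \<epsilon>: "0 < \<epsilon>"
  have Xm [measurable]: "X j \<in> borel_measurable M" for j using ind unfolding indep_vars_def2 by auto
  have tr: "integrable M (\<lambda>\<omega>. f (X j \<omega>)) \<longleftrightarrow> integrable M (\<lambda>\<omega>. f (X 0 \<omega>))"
    "expectation (\<lambda>\<omega>. f (X j \<omega>)) = expectation (\<lambda>\<omega>. f (X 0 \<omega>))"
    if [measurable]: "f \<in> borel_measurable borel" for f :: "real \<Rightarrow> real" and j
    using integrable_distr_eq[of "X j" M borel f] integrable_distr_eq[of "X 0" M borel f]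
      integral_distr[of "X j" M borel f] integral_distr[of "X 0" M borel f] ident[of j] by simp_all
  define \<mu> where "\<mu> = expectation (X 0)"
  define h where "h C y = (if \<bar>y\<bar> \<le> C then y else 0)" for C y :: real
  have hm [measurable]: "h C \<in> borel_measurable borel" for C unfolding h_def[abs_def] by measurable
  have hb: "\<bar>h C y\<bar> \<le> \<bar>C\<bar>" "\<bar>h C y\<bar> \<le> \<bar>y\<bar>" for C y by (auto simp: h_def)
  have inth: "integrable M (\<lambda>\<omega>. h C (X j \<omega>))" for C j
    by (rule integrable_const_bound[where B = "\<bar>C\<bar>"]) (use hb in auto)
  have intX: "integrable M (X j)" for j using tr(1)[of "\<lambda>x. x" j] int0 by simp
  define \<rho> where "\<rho> C = expectation (\<lambda>\<omega>. \<bar>X 0 \<omega> - h C (X 0 \<omega>)\<bar>)" for C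
  have "(\<lambda>c. \<rho> (real c)) \<longlonglongrightarrow> expectation (\<lambda>_. 0)"
    unfolding \<rho>_def
  proof (rule integral_dominated_convergence[where w = "\<lambda>\<omega>. \<bar>X 0 \<omega>\<bar>"])
    show "AE \<omega> in M. (\<lambda>c. \<bar>X 0 \<omega> - h (real c) (X 0 \<omega>)\<bar>) \<longlonglongrightarrow> 0"
    proof (rule AE_I2)
      fix \<omega>
      have "\<forall>\<^sub>F c in sequentially. \<bar>X 0 \<omega>\<bar> \<le> real c"
        using eventually_ge_at_top[of "nat \<lceil>\<bar>X 0 \<omega>\<bar>\<rceil>"] by eventually_elim linarith
      then have "\<forall>\<^sub>F c in sequentially. \<bar>X 0 \<omega> - h (real c) (X 0 \<omega>)\<bar> = 0"
        by eventually_elim (simp add: h_def)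
      then show "(\<lambda>c. \<bar>X 0 \<omega> - h (real c) (X 0 \<omega>)\<bar>) \<longlonglongrightarrow> 0" by (rule tendsto_eventually)
    qed
    show "AE \<omega> in M. norm \<bar>X 0 \<omega> - h (real c) (X 0 \<omega>)\<bar> \<le> \<bar>X 0 \<omega>\<bar>" for c
      by (rule AE_I2) (auto simp: h_def)
  qed (use intX in auto)
  then have "(\<lambda>c. \<rho> (real c)) \<longlonglongrightarrow> 0" by simp
  then have "\<forall>\<^sub>F c in sequentially. \<rho> (real c) < \<epsilon> / 8" using \<epsilon> by (intro order_tendstoD) auto
  then obtain C where C: "\<rho> C < \<epsilon> / 8" by (auto simp: eventually_sequentially)
  define Y where "Y j \<omega> = h C (X j \<omega>) - expectation (\<lambda>\<omega>. h C (X 0 \<omega>))" for j \<omega>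
  have Yb: "\<bar>Y j \<omega>\<bar> \<le> 2 * \<bar>C\<bar>" for j \<omega>
  proof -
    have "\<bar>expectation (\<lambda>\<omega>. h C (X 0 \<omega>))\<bar> \<le> expectation (\<lambda>_. \<bar>C\<bar>)"
      using inth hb by (intro abs_integral_le) auto
    then show ?thesis unfolding Y_def using hb(1)[of C "X j \<omega>"] by (simp add: prob_space)
  qed
  have Ym [measurable]: "Y j \<in> borel_measurable M" for j unfolding Y_def[abs_def] by measurable
  have Yint: "integrable M (Y j)" for j by (rule integrable_const_bound[where B = "2 * \<bar>C\<bar>"]) (use Yb in auto)
  have YYint: "integrable M (\<lambda>\<omega>. Y j \<omega> * Y j' \<omega>)" for j j'
  proof (rule integrable_const_bound[where B = "(2 * \<bar>C\<bar>) * (2 * \<bar>C\<bar>)"], rule AE_I2)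
    show "norm (Y j \<omega> * Y j' \<omega>) \<le> (2 * \<bar>C\<bar>) * (2 * \<bar>C\<bar>)" for \<omega>
      unfolding real_norm_def abs_mult[of "Y j \<omega>"] by (intro mult_mono Yb) auto
  qed measurable
  have Y0: "expectation (Y j) = 0" for j
    unfolding Y_def using inth tr(2)[OF hm, of C j] by (simp add: prob_space)
  have Yind: "indep_vars (\<lambda>_. borel) Y UNIV"
    unfolding Y_def[abs_def]
    by (rule indep_vars_compose2[OF ind, where Y = "\<lambda>_ y. h C y - expectation (\<lambda>\<omega>. h C (X 0 \<omega>))"]) measurable
  have orth: "expectation (\<lambda>\<omega>. Y j \<omega> * Y j' \<omega>) = 0" if "j \<noteq> j'" for j j'
    using indep_vars_expectation_mult(2)[OF Yind UNIV_I UNIV_I that Yint Yint] Y0 by simp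
  have YS: "integrable M (\<lambda>\<omega>. (\<Sum>j<N. Y j \<omega>)\<^sup>2)"
    "expectation (\<lambda>\<omega>. (\<Sum>j<N. Y j \<omega>)\<^sup>2) = (\<Sum>j<N. expectation (\<lambda>\<omega>. (Y j \<omega>)\<^sup>2))" for N
    by (rule second_moment_sum_of_orthogonal[OF finite_lessThan YYint orth]; assumption)+
  have ES: "expectation (\<lambda>\<omega>. (\<Sum>j<N. Y j \<omega>)\<^sup>2) \<le> N * (4 * C\<^sup>2)" for N
  proof -
    have "expectation (\<lambda>\<omega>. (Y j \<omega>)\<^sup>2) \<le> expectation (\<lambda>_. 4 * C\<^sup>2)" for j
    proof (rule integral_mono)
      show "(Y j \<omega>)\<^sup>2 \<le> 4 * C\<^sup>2" for \<omega>
        using power_mono[OF Yb[of j \<omega>], of 2] by (simp add: power_mult_distrib)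
    qed (use YYint[of j j] in \<open>auto simp: power2_eq_square\<close>)
    then have "(\<Sum>j<N. expectation (\<lambda>\<omega>. (Y j \<omega>)\<^sup>2)) \<le> (\<Sum>j<N. 4 * C\<^sup>2)"
      by (intro sum_mono) (simp add: prob_space)
    then show ?thesis unfolding YS(2) by simp
  qed
  have hl: "\<bar>expectation (\<lambda>\<omega>. h C (X 0 \<omega>)) - \<mu>\<bar> \<le> \<rho> C"
  proof -
    have "\<bar>expectation (\<lambda>\<omega>. h C (X 0 \<omega>) - X 0 \<omega>)\<bar> \<le> \<rho> C"
      unfolding \<rho>_def using inth intX by (intro abs_integral_le) auto
    then show ?thesis using inth intX by (simp add: \<mu>_def)
  qed
  define e where "e = \<epsilon> / 4"
  have e: "0 < e" using \<epsilon> by (simp add: e_def)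
  have main: "expectation (\<lambda>\<omega>. \<bar>(\<Sum>j<N. X j \<omega>) / N - \<mu>\<bar>) \<le> 2 * \<rho> C + e + 4 * C\<^sup>2 / (N * e)" if N: "0 < N" for N
  proof -
    let ?b = "\<lambda>\<omega>. (\<Sum>j<N. \<bar>X j \<omega> - h C (X j \<omega>)\<bar>) / N + (e + (\<Sum>j<N. Y j \<omega>)\<^sup>2 / (N\<^sup>2 * e)) + \<rho> C"
    have pt: "\<bar>(\<Sum>j<N. X j \<omega>) / N - \<mu>\<bar> \<le> ?b \<omega>" for \<omega>
    proof -
      define S where "S = (\<Sum>j<N. Y j \<omega>) / N"
      have "(\<Sum>j<N. X j \<omega>) / N - \<mu> = (\<Sum>j<N. X j \<omega> - h C (X j \<omega>)) / N + S + (expectation (\<lambda>\<omega>. h C (X 0 \<omega>)) - \<mu>)"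
        using N unfolding S_def Y_def by (simp add: sum_subtractf diff_divide_distrib)
      moreover have "\<bar>(\<Sum>j<N. X j \<omega> - h C (X j \<omega>)) / N\<bar> \<le> (\<Sum>j<N. \<bar>X j \<omega> - h C (X j \<omega>)\<bar>) / N"
        by (simp add: divide_right_mono)
      \<comment> \<open>Elementary substitute for the Cauchy-Schwarz bound of the mean of |S| by its
        second moment.\<close>
      moreover have "\<bar>S\<bar> \<le> e + S\<^sup>2 / e"
      proof (cases "\<bar>S\<bar> \<le> e")
        case False
        then have "\<bar>S\<bar> * e \<le> \<bar>S\<bar> * \<bar>S\<bar>" by (intro mult_left_mono) auto
        then have "\<bar>S\<bar> \<le> S\<^sup>2 / e" using e by (simp add: le_divide_eq power2_eq_square)
        then show ?thesis using e by simp
      qed (use e in \<open>auto intro: add_increasing2\<close>)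
      moreover have "S\<^sup>2 / e = (\<Sum>j<N. Y j \<omega>)\<^sup>2 / (N\<^sup>2 * e)" by (simp add: S_def power_divide)
      ultimately show ?thesis using hl by linarith
    qed
    have i1: "integrable M (\<lambda>\<omega>. (\<Sum>j<N. \<bar>X j \<omega> - h C (X j \<omega>)\<bar>) / N)"
      using intX inth by auto
    have i2: "integrable M (\<lambda>\<omega>. (\<Sum>j<N. Y j \<omega>)\<^sup>2 / (N\<^sup>2 * e))"
      using YS(1)[of N] by auto
    have "expectation (\<lambda>\<omega>. \<bar>(\<Sum>j<N. X j \<omega>) / N - \<mu>\<bar>) \<le> expectation ?b"
      using i1 i2 intX pt by (intro integral_mono) auto
    also have "\<dots> = (\<Sum>j<N. expectation (\<lambda>\<omega>. \<bar>X j \<omega> - h C (X j \<omega>)\<bar>)) / N + (e + expectation (\<lambda>\<omega>. (\<Sum>j<N. Y j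
      \<omega>)\<^sup>2) / (N\<^sup>2 * e)) + \<rho> C"
      using i1 i2 intX inth by (simp add: prob_space)
    also have "(\<Sum>j<N. expectation (\<lambda>\<omega>. \<bar>X j \<omega> - h C (X j \<omega>)\<bar>)) / N = \<rho> C"
    proof -
      have "expectation (\<lambda>\<omega>. \<bar>X j \<omega> - h C (X j \<omega>)\<bar>) = \<rho> C" for j
        unfolding \<rho>_def using tr(2)[of "\<lambda>y. \<bar>y - h C y\<bar>" j] by simp
      then show ?thesis using N by simp
    qed
    also have "expectation (\<lambda>\<omega>. (\<Sum>j<N. Y j \<omega>)\<^sup>2) / (N\<^sup>2 * e) \<le> (N * (4 * C\<^sup>2)) / (N\<^sup>2 * e)"
      using e N by (intro divide_right_mono ES) auto
    also have "(N * (4 * C\<^sup>2)) / (N\<^sup>2 * e) = 4 * C\<^sup>2 / (N * e)"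
      using N by (simp add: power2_eq_square)
    finally show ?thesis by simp
  qed
  have "(\<lambda>N. 4 * C\<^sup>2 / (real N * e)) \<longlonglongrightarrow> 0"
    using e by (intro tendsto_divide_0[OF tendsto_const] filterlim_at_top_imp_at_infinity
        filterlim_at_top_mult_tendsto_pos[OF tendsto_const _ filterlim_real_sequentially]) auto
  then have "\<forall>\<^sub>F N in sequentially. 4 * C\<^sup>2 / (real N * e) < \<epsilon> / 4" using \<epsilon> by (intro order_tendstoD) auto
  then have "\<forall>\<^sub>F N in sequentially. 4 * C\<^sup>2 / (real N * e) < \<epsilon> / 4 \<and> 0 < N"
    using eventually_gt_at_top[of 0] by eventually_elim auto
  then obtain N0 where N0: "\<And>N. N \<ge> N0 \<Longrightarrow> 4 * C\<^sup>2 / (real N * e) < \<epsilon> / 4 \<and> 0 < N"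
    unfolding eventually_sequentially by blast
  show "\<exists>no. \<forall>N\<ge>no. norm (expectation (\<lambda>\<omega>. \<bar>(\<Sum>j<N. X j \<omega>) / N - expectation (X 0)\<bar>) - 0) < \<epsilon>"
  proof (intro exI allI impI)
    fix N assume "N0 \<le> N"
    from N0[OF this] have N: "4 * C\<^sup>2 / (real N * e) < \<epsilon> / 4" "0 < N" by auto
    have "expectation (\<lambda>\<omega>. \<bar>(\<Sum>j<N. X j \<omega>) / N - expectation (X 0)\<bar>) \<le> 2 * \<rho> C + e + 4 * C\<^sup>2 / (real N * e)"
      using main[OF N(2)] by (simp only: \<mu>_def)
    also have "\<dots> < 2 * (\<epsilon> / 8) + \<epsilon> / 4 + \<epsilon> / 4"
      using N(1) C by (intro add_le_less_mono) (simp_all add: e_def)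
    also have "\<dots> \<le> \<epsilon>" using \<epsilon> by simp
    finally have "expectation (\<lambda>\<omega>. \<bar>(\<Sum>j<N. X j \<omega>) / N - expectation (X 0)\<bar>) < \<epsilon>" .
    then show "norm (expectation (\<lambda>\<omega>. \<bar>(\<Sum>j<N. X j \<omega>) / N - expectation (X 0)\<bar>) - 0) < \<epsilon>"
      by simp
  qed
qed

text \<open>A null set of times that is hit with small probability by every finite sample is hit with
  small probability altogether: \<open>g \<omega>\<close>, the measure of the good times, satisfies
  \<open>E (g ^ n) \<ge> c ^ n (1 - p)\<close> by Fubini, and \<open>(g / c) ^ n\<close> tends to the indicator of \<open>g = c\<close>.\<close>

lemma (in prob_space) prob_AE_ge_of_finite_samples:
  fixes good :: "'a \<Rightarrow> 't \<Rightarrow> bool" and p :: real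
  assumes \<mu>: "finite_measure \<mu>"
    and good [measurable]: "Measurable.pred (M \<Otimes>\<^sub>M \<mu>) (\<lambda>(\<omega>, t). good \<omega> t)"
    and fin: "\<And>F. finite F \<Longrightarrow> F \<subseteq> space \<mu> \<Longrightarrow> prob {\<omega> \<in> space M. \<forall>t\<in>F. good \<omega> t} \<ge> 1 - p"
  shows "\<exists>G\<in>events. prob G \<ge> 1 - p \<and> (\<forall>\<omega>\<in>G. AE t in \<mu>. good \<omega> t)"
proof (cases "measure \<mu> (space \<mu>) = 0")
  \<comment> \<open>On a null set of times, as for a degenerate interval, everything holds almost
    everywhere; in the other case the total mass can be divided by.\<close>
  case True
  interpret mu: finite_measure \<mu> by fact
  have "emeasure \<mu> (space \<mu>) = 0" using True by (simp add: mu.emeasure_eq_measure)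
  then have "AE t in \<mu>. good \<omega> t" for \<omega> by (intro AE_I[of _ _ "space \<mu>"]) auto
  moreover have "prob (space M) \<ge> 1 - p" using fin[of "{}"] by simp
  ultimately show ?thesis by (intro bexI[of _ "space M"]) auto
next
  case False
  interpret mu: finite_measure \<mu> by fact
  interpret pair_sigma_finite M \<mu> ..
  interpret pm: finite_measure "M \<Otimes>\<^sub>M \<mu>" by (intro finite_measure_pair_measure) unfold_locales
  define c where "c = measure \<mu> (space \<mu>)"
  have c: "0 < c" using False by (simp add: c_def zero_less_measure_iff)
  define i where "i \<omega> t = (if good \<omega> t then 1 else 0 :: real)" for \<omega> t
  have im [measurable]: "(\<lambda>(\<omega>, t). i \<omega> t) \<in> borel_measurable (M \<Otimes>\<^sub>M \<mu>)"
    unfolding i_def by (rule measurable_cong[THEN iffD1, where f1 = "\<lambda>z. if (case z of (\<omega>, t) \<Rightarrow> good \<omega> t) then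
      1 else 0"]) auto
  have i01: "0 \<le> i \<omega> t" "i \<omega> t \<le> 1" for \<omega> t by (auto simp: i_def)
  have isec [measurable]: "t \<in> space \<mu> \<Longrightarrow> (\<lambda>\<omega>. i \<omega> t) \<in> borel_measurable M" for t
    using measurable_compose[OF measurable_Pair2' im, of t] by simp
  have isec2 [measurable]: "\<omega> \<in> space M \<Longrightarrow> i \<omega> \<in> borel_measurable \<mu>" for \<omega>
    using measurable_compose[OF measurable_Pair1' im, of \<omega>] by simp
  define g where "g \<omega> = (\<integral>t. i \<omega> t \<partial>\<mu>)" for \<omega>
  have gm [measurable]: "g \<in> borel_measurable M"
    unfolding g_def[abs_def] by (rule mu.borel_measurable_lebesgue_integral) measurable
  have iint: "\<omega> \<in> space M \<Longrightarrow> integrable \<mu> (i \<omega>)" for \<omega>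
    by (rule mu.integrable_const_bound[where B = 1]) (use i01 in auto)
  have g0: "0 \<le> g \<omega>" for \<omega> unfolding g_def using i01 by simp
  have gc: "g \<omega> \<le> c" if "\<omega> \<in> space M" for \<omega>
  proof -
    have "g \<omega> \<le> (\<integral>t. 1 \<partial>\<mu>)" unfolding g_def using iint[OF that] i01 by (intro integral_mono) auto
    then show ?thesis by (simp add: c_def)
  qed
  define J where "J F \<omega> = (if \<forall>t\<in>F. good \<omega> t then 1 else 0 :: real)" for F \<omega>
  have Jprod: "J F \<omega> = (\<Prod>t\<in>F. i \<omega> t)" if "finite F" for F \<omega>
    using that unfolding J_def i_def by induction auto
  have Jm: "J F \<in> borel_measurable M" if "finite F" "F \<subseteq> space \<mu>" for F
    using that isec by (subst measurable_cong[OF Jprod]) (auto intro!: borel_measurable_prod)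
  have J01: "0 \<le> J F \<omega>" "J F \<omega> \<le> 1" for F \<omega> by (auto simp: J_def)
  \<comment> \<open>The finite set \<open>F\<close> is generalized so that the induction closes:
    each factor \<open>g \<omega>\<close> is one integration over time, and fixing its variable
    enlarges \<open>F\<close> by that point.\<close>
  have bound: "c ^ n * (1 - p) \<le> expectation (\<lambda>\<omega>. J F \<omega> * g \<omega> ^ n)" if "finite F" "F \<subseteq> space \<mu>" for F n
    using that
  proof (induction n arbitrary: F)
    case 0
    note [measurable] = Jm[OF 0]
    have "expectation (J F) = prob {\<omega> \<in> space M. \<forall>t\<in>F. good \<omega> t}"
    proof -
      have "{\<omega> \<in> space M. \<forall>t\<in>F. good \<omega> t} = J F -` {1} \<inter> space M" by (auto simp: J_def split: if_splits)
      then have "{\<omega> \<in> space M. \<forall>t\<in>F. good \<omega> t} \<in> events" by simp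
      moreover have "expectation (J F) = expectation (indicator {\<omega> \<in> space M. \<forall>t\<in>F. good \<omega> t})"
        by (intro Bochner_Integration.integral_cong) (auto simp: J_def indicator_def)
      ultimately show ?thesis by simp
    qed
    then show ?case using fin[OF 0] by simp
  next
    case (Suc n)
    let ?f = "\<lambda>\<omega> t. J F \<omega> * g \<omega> ^ n * i \<omega> t"
    note [measurable] = Jm[OF Suc.prems]
    have fb: "\<bar>?f \<omega> t\<bar> \<le> c ^ n" if "\<omega> \<in> space M" for \<omega> t
    proof -
      have "\<bar>?f \<omega> t\<bar> \<le> 1 * c ^ n * 1"
        unfolding abs_mult power_abs using J01[of F \<omega>] i01[of \<omega> t] g0[of \<omega>] gc[OF that]
        by (intro mult_mono power_mono) auto
      then show ?thesis by simp
    qed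
    have fm [measurable]: "case_prod ?f \<in> borel_measurable (M \<Otimes>\<^sub>M \<mu>)"
      using im unfolding case_prod_unfold by measurable
    have fint: "integrable (M \<Otimes>\<^sub>M \<mu>) (case_prod ?f)"
      by (rule pm.integrable_const_bound[where B = "c ^ n"]) (use fb in \<open>auto simp: space_pair_measure\<close>)
    have "c ^ Suc n * (1 - p) = (\<integral>t. c ^ n * (1 - p) \<partial>\<mu>)" by (simp add: c_def)
    also have "\<dots> \<le> (\<integral>t. (\<integral>\<omega>. ?f \<omega> t \<partial>M) \<partial>\<mu>)"
    proof (rule integral_mono)
      show "integrable \<mu> (\<lambda>t. \<integral>\<omega>. ?f \<omega> t \<partial>M)" using integrable_snd[OF fint] by simp
      fix t assume t: "t \<in> space \<mu>"
      have "J (insert t F) \<omega> = J F \<omega> * i \<omega> t" for \<omega> by (auto simp: J_def i_def)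
      then have "expectation (\<lambda>\<omega>. J (insert t F) \<omega> * g \<omega> ^ n) = (\<integral>\<omega>. ?f \<omega> t \<partial>M)"
        by (simp add: mult_ac)
      then show "c ^ n * (1 - p) \<le> (\<integral>\<omega>. ?f \<omega> t \<partial>M)" using Suc.IH[of "insert t F"] Suc.prems t by simp
    qed simp
    also have "\<dots> = (\<integral>\<omega>. (\<integral>t. ?f \<omega> t \<partial>\<mu>) \<partial>M)" by (rule Fubini_integral[OF fint])
    also have "\<dots> = expectation (\<lambda>\<omega>. J F \<omega> * g \<omega> ^ Suc n)"
      by (intro Bochner_Integration.integral_cong refl) (simp add: g_def mult_ac)
    finally show ?case .
  qed
  have le: "1 - p \<le> expectation (\<lambda>\<omega>. (g \<omega> / c) ^ n)" for n
  proof -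
    have "c ^ n * (1 - p) \<le> expectation (\<lambda>\<omega>. g \<omega> ^ n)" using bound[of "{}" n] by (simp add: J_def)
    then show ?thesis using c by (simp add: power_divide le_divide_eq mult.commute)
  qed
  define G where "G = {\<omega> \<in> space M. g \<omega> = c}"
  have Gm: "G \<in> events" unfolding G_def by measurable
  have "(\<lambda>n. expectation (\<lambda>\<omega>. (g \<omega> / c) ^ n)) \<longlonglongrightarrow> expectation (indicator G)"
  proof (rule integral_dominated_convergence[where w = "\<lambda>_. 1"])
    show "AE \<omega> in M. (\<lambda>n. (g \<omega> / c) ^ n) \<longlonglongrightarrow> indicator G \<omega>"
    proof (rule AE_I2)
      fix \<omega> assume \<omega>: "\<omega> \<in> space M"
      show "(\<lambda>n. (g \<omega> / c) ^ n) \<longlonglongrightarrow> indicator G \<omega>"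
      proof (cases "g \<omega> = c")
        case False
        then have "0 \<le> g \<omega> / c" "g \<omega> / c < 1" using g0[of \<omega>] gc[OF \<omega>] c by auto
        then show ?thesis using False by (simp add: G_def LIMSEQ_realpow_zero)
      qed (use \<omega> c in \<open>simp add: G_def\<close>)
    qed
    show "AE \<omega> in M. norm ((g \<omega> / c) ^ n) \<le> 1" for n
      using g0 gc c by (intro AE_I2) (auto simp: power_le_one)
  qed (use Gm in auto)
  then have "1 - p \<le> prob G" using le Gm by (intro LIMSEQ_le_const[of _ "prob G"]) (auto simp: )
  moreover have "AE t in \<mu>. good \<omega> t" if "\<omega> \<in> G" for \<omega>
  proof -
    have \<omega>: "\<omega> \<in> space M" "g \<omega> = c" using that by (auto simp: G_def)
    have "(\<integral>t. 1 - i \<omega> t \<partial>\<mu>) = 0" using iint[OF \<omega>(1)] \<omega>(2) by (simp add: g_def c_def)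
    then have "AE t in \<mu>. 1 - i \<omega> t = 0"
      using iint[OF \<omega>(1)] i01 by (subst (asm) integral_nonneg_eq_0_iff_AE) auto
    then show ?thesis by eventually_elim (simp add: i_def split: if_splits)
  qed
  ultimately show ?thesis using Gm by blast
qed

text \<open>Extracts a single sample, or a pair of observations, from the array indexed by (i,
  j).\<close>

lemma (in prob_space) indep_vars_reindexed:
  assumes ind: "indep_vars M' X I" and f: "inj_on f J" "f ` J \<subseteq> I"
  shows "indep_vars (\<lambda>j. M' (f j)) (\<lambda>j. X (f j)) J"
  unfolding indep_vars_def2
proof (intro conjI ballI)
  have rv: "\<And>i. i \<in> I \<Longrightarrow> X i \<in> measurable M (M' i)"
    and sets: "indep_sets (\<lambda>i. {X i -` A \<inter> space M |A. A \<in> sets (M' i)}) I"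
    using ind unfolding indep_vars_def2 by auto
  show "X (f j) \<in> measurable M (M' (f j))" if "j \<in> J" for j using rv f that by auto
  show "indep_sets (\<lambda>j. {X (f j) -` A \<inter> space M |A. A \<in> sets (M' (f j))}) J"
  proof (rule indep_setsI)
    show "{X (f j) -` A \<inter> space M |A. A \<in> sets (M' (f j))} \<subseteq> events" if "j \<in> J" for j
      using rv[of "f j"] f that by (auto intro: measurable_sets)
    fix A K assume K: "K \<noteq> {}" "K \<subseteq> J" "finite K"
      and A: "\<forall>j\<in>K. A j \<in> {X (f j) -` A \<inter> space M |A. A \<in> sets (M' (f j))}"
    have inj: "inj_on f K" using f(1) K(2) by (rule inj_on_subset)
    define A' where "A' i = A (the_inv_into K f i)" for i
    have A': "A' (f j) = A j" if "j \<in> K" for j unfolding A'_def using the_inv_into_f_f[OF inj that] by simp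
    have "prob (\<Inter>i\<in>f ` K. A' i) = (\<Prod>i\<in>f ` K. prob (A' i))"
    proof (rule indep_setsD[OF sets])
      show "\<forall>i\<in>f ` K. A' i \<in> {X i -` A \<inter> space M |A. A \<in> sets (M' i)}"
        using A by (simp add: A')
    qed (use K f in auto)
    moreover have "(\<Inter>i\<in>f ` K. A' i) = (\<Inter>j\<in>K. A j)" by (simp add: A')
    moreover have "(\<Prod>i\<in>f ` K. prob (A' i)) = (\<Prod>j\<in>K. prob (A j))"
      by (simp add: prod.reindex[OF inj] A')
    ultimately show "prob (\<Inter> (A ` K)) = (\<Prod>j\<in>K. prob (A j))" by simp
  qed
qed

context k_sample
begin

lemma indep_paths:
  "indep_vars (\<lambda>_. path_space T) (\<lambda>p \<omega>. restrict (x (fst p) (snd p) \<omega>) T) ({..<k} \<times> UNIV)"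
  using indep unfolding independent_processes_def by (simp add: case_prod_unfold)

lemma indep_v:
  assumes i: "i < k" and t: "t \<in> T"
  shows "indep_vars (\<lambda>_. borel) (\<lambda>j \<omega>. v i j \<omega> t) UNIV"
proof -
  have "indep_vars (\<lambda>_. path_space T) (\<lambda>j \<omega>. restrict (x i j \<omega>) T) UNIV"
    using indep_vars_reindexed[OF indep_paths, of "Pair i" UNIV] i by (auto simp: inj_on_def)
  then have "indep_vars (\<lambda>_. borel) (\<lambda>j \<omega>. restrict (x i j \<omega>) T t - \<eta> i t) UNIV"
    by (rule indep_vars_compose2[where Y = "\<lambda>_ f. f t - \<eta> i t"])
      (use t in \<open>auto intro!: borel_measurable_diff measurable_component_singleton\<close>)
  then show ?thesis using t by (simp add: v_def[abs_def])
qed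

lemma distr_v:
  assumes i: "i < k" and t: "t \<in> T"
  shows "distr M borel (\<lambda>\<omega>. v i j \<omega> t) = distr M borel (\<lambda>\<omega>. v i 0 \<omega> t)"
  using distr_path_functional[OF i, of "\<lambda>f. f t - \<eta> i t" j] t
  by (simp add: v_def[abs_def] borel_measurable_diff measurable_component_singleton)

definition ghat :: "nat \<Rightarrow> nat \<Rightarrow> 'w \<Rightarrow> real \<Rightarrow> real" where
  "ghat m i \<omega> t = gamma_hat (ns m) (\<lambda>i j t. x i j \<omega> t) i t t"

text \<open>Shift invariance of the empirical variance replaces observations by deviations from the
  true mean; two observations keep the denominator away from 0.\<close>

lemma ghat_eq:
  assumes N: "2 \<le> ns m i"
  shows "ghat m i \<omega> t = ns m i / (real (ns m i) - 1) *
    ((\<Sum>j<ns m i. (v i j \<omega> t)\<^sup>2) / ns m i - ((\<Sum>j<ns m i. v i j \<omega> t) / ns m i)\<^sup>2)"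
proof -
  define N where "N = ns m i"
  define S where "S = (\<Sum>j<N. v i j \<omega> t)"
  have N0: "real N \<noteq> 0" using N by (simp add: N_def)
  have dev: "x i j \<omega> t - eta_hat (ns m) (\<lambda>i j t. x i j \<omega> t) i t = v i j \<omega> t - S / N" for j
    unfolding eta_hat_def S_def v_def N_def[symmetric] using N0 by (simp add: sum_subtractf diff_divide_distrib)
  have "(\<Sum>j<N. (v i j \<omega> t - S / N) * (v i j \<omega> t - S / N)) = (\<Sum>j<N. (v i j \<omega> t)\<^sup>2 - 2 * (S / N) * v i j \<omega> t +
    (S / N)\<^sup>2)"
    by (intro sum.cong refl) (simp add: power2_eq_square algebra_simps)
  also have "\<dots> = (\<Sum>j<N. (v i j \<omega> t)\<^sup>2) - (\<Sum>j<N. 2 * (S / N) * v i j \<omega> t) + N * (S / N)\<^sup>2"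
    by (simp add: sum.distrib sum_subtractf)
  also have "(\<Sum>j<N. 2 * (S / N) * v i j \<omega> t) = 2 * (S / N) * S"
    by (simp only: sum_distrib_left[symmetric] S_def[symmetric])
  also have "(\<Sum>j<N. (v i j \<omega> t)\<^sup>2) - 2 * (S / N) * S + N * (S / N)\<^sup>2 = N * ((\<Sum>j<N. (v i j \<omega> t)\<^sup>2) / N - (S / N)\<^sup>2)"
    using N0 by (simp add: power2_eq_square right_diff_distrib)
  finally show ?thesis
    unfolding ghat_def gamma_hat_def dev N_def[symmetric] S_def[symmetric] by simp
qed

lemma factor_bounds:
  assumes "2 \<le> (N :: nat)"
  shows "0 \<le> N / (real N - 1)" "N / (real N - 1) \<le> 2" "\<bar>N / (real N - 1) - 1\<bar> \<le> 2 / N"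
proof -
  have N: "2 \<le> real N" using assms by simp
  show "0 \<le> N / (real N - 1)" "N / (real N - 1) \<le> 2" using N by (auto simp: divide_le_eq)
  have "N / (real N - 1) - 1 = 1 / (real N - 1)" using N by (simp add: field_simps)
  also have "\<dots> \<le> 2 / N" using N by (simp add: field_simps)
  finally have "N / (real N - 1) - 1 \<le> 2 / N" .
  moreover have "0 \<le> N / (real N - 1) - 1" using N by (simp add: le_divide_eq)
  ultimately show "\<bar>N / (real N - 1) - 1\<bar> \<le> 2 / N" by simp
qed

lemma ghat_section_measurable:
  assumes i: "i < k" and t: "t \<in> T"
  shows "(\<lambda>\<omega>. ghat m i \<omega> t) \<in> borel_measurable M"
proof -
  have "(\<lambda>\<omega>. x i j \<omega> t) \<in> borel_measurable M" for j
    using mean[OF i, of j] t unfolding has_mean_function_def by auto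
  then show ?thesis unfolding ghat_def gamma_hat_def eta_hat_def by measurable
qed

text \<open>Law of large numbers for the squares; the squared sample mean has expectation
  \<open>\<gamma> i t t\<close> divided by the sample size.\<close>

lemma ghat_tendsto:
  assumes i: "i < k" and t: "t \<in> T"
  shows "(\<lambda>m. expectation (\<lambda>\<omega>. \<bar>ghat m i \<omega> t - \<gamma> i t t\<bar>)) \<longlonglongrightarrow> 0"
    and "2 \<le> ns m i \<Longrightarrow> integrable M (\<lambda>\<omega>. \<bar>ghat m i \<omega> t - \<gamma> i t t\<bar>)"
proof -
  let ?g = "\<gamma> i t t"
  define A where "A N \<omega> = (\<Sum>j<N. (v i j \<omega> t)\<^sup>2) / N" for N \<omega>
  define B where "B N \<omega> = ((\<Sum>j<N. v i j \<omega> t) / N)\<^sup>2" for N \<omega>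
  have vm [measurable]: "(\<lambda>\<omega>. v i j \<omega> t) \<in> borel_measurable M" for j using integrable_v[OF i t] by auto
  have intA: "integrable M (A N)" for N unfolding A_def[abs_def] using integrable_v_sq[OF i t] by auto
  have orth: "expectation (\<lambda>\<omega>. v i j \<omega> t * v i j' \<omega> t) = 0" if "j \<noteq> j'" for j j'
    using indep_vars_expectation_mult(2)[OF indep_v[OF i t] UNIV_I UNIV_I that integrable_v[OF i t]
      integrable_v[OF i t]]
      expectation_v[OF i t] by simp
  have vv: "integrable M (\<lambda>\<omega>. v i j \<omega> t * v i j' \<omega> t)" for j j'
  proof (cases "j = j'")
    case True
    then show ?thesis using integrable_v_sq[OF i t, of j] by (simp add: power2_eq_square)
  next
    case False
    then show ?thesis
      using indep_vars_expectation_mult(1)[OF indep_v[OF i t] UNIV_I UNIV_I False integrable_v[OF i t]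
        integrable_v[OF i t]] by simp
  qed
  have S: "integrable M (\<lambda>\<omega>. (\<Sum>j<N. v i j \<omega> t)\<^sup>2)"
    "expectation (\<lambda>\<omega>. (\<Sum>j<N. v i j \<omega> t)\<^sup>2) = (\<Sum>j<N. expectation (\<lambda>\<omega>. (v i j \<omega> t)\<^sup>2))" for N
    by (rule second_moment_sum_of_orthogonal[OF finite_lessThan vv orth]; assumption)+
  have g: "expectation (\<lambda>\<omega>. (v i j \<omega> t)\<^sup>2) = ?g" for j
    using expectation_v_mult[OF i t t, of j] by (simp add: power2_eq_square)
  have intB: "integrable M (B N)" for N unfolding B_def[abs_def] power_divide using S(1)[of N] by auto
  have EB: "expectation (B N) = ?g / N" for N
  proof -
    have "expectation (B N) = (real N * ?g) / (real N)\<^sup>2" unfolding B_def power_divide by (simp add: S(2) g)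
    then show ?thesis by (simp add: power2_eq_square)
  qed
  have LLN: "(\<lambda>N. expectation (\<lambda>\<omega>. \<bar>A N \<omega> - ?g\<bar>)) \<longlonglongrightarrow> 0"
  proof -
    have "(\<lambda>N. expectation (\<lambda>\<omega>. \<bar>(\<Sum>j<N. (v i j \<omega> t)\<^sup>2) / N - expectation (\<lambda>\<omega>. (v i 0 \<omega> t)\<^sup>2)\<bar>)) \<longlonglongrightarrow> 0"
    proof (rule weak_law_of_large_numbers_L1[where X = "\<lambda>j \<omega>. (v i j \<omega> t)\<^sup>2"])
      show "indep_vars (\<lambda>_. borel) (\<lambda>j \<omega>. (v i j \<omega> t)\<^sup>2) UNIV"
        by (rule indep_vars_compose2[OF indep_v[OF i t], where Y = "\<lambda>_ y. y\<^sup>2"]) measurable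
      fix j
      have "distr (distr M borel (\<lambda>\<omega>. v i j \<omega> t)) borel (\<lambda>y. y\<^sup>2) = distr (distr M borel (\<lambda>\<omega>. v i 0 \<omega> t))
        borel (\<lambda>y. y\<^sup>2)"
        by (simp only: distr_v[OF i t, of j])
      then show "distr M borel (\<lambda>\<omega>. (v i j \<omega> t)\<^sup>2) = distr M borel (\<lambda>\<omega>. (v i 0 \<omega> t)\<^sup>2)"
        by (simp add: distr_distr comp_def)
    qed (rule integrable_v_sq[OF i t])
    then show ?thesis by (simp add: A_def g)
  qed
  show int: "integrable M (\<lambda>\<omega>. \<bar>ghat m i \<omega> t - ?g\<bar>)" if N: "2 \<le> ns m i" for m
    unfolding ghat_eq[OF N] using intA[of "ns m i"] intB[of "ns m i"] unfolding A_def B_def by auto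
  \<comment> \<open>Bessel's factor is at most 2 and within 2 / N of 1. Of the 4 |\<gamma>| / N,
    half comes from the squared mean and half from that factor.\<close>
  have bound: "expectation (\<lambda>\<omega>. \<bar>ghat m i \<omega> t - ?g\<bar>) \<le> 2 * expectation (\<lambda>\<omega>. \<bar>A (ns m i) \<omega> - ?g\<bar>) + 4 * \<bar>?g\<bar> /
    ns m i"
    if N: "2 \<le> ns m i" for m
  proof -
    define N' where "N' = ns m i"
    define c where "c = N' / (real N' - 1)"
    note c = factor_bounds[OF N[folded N'_def], folded c_def]
    have "\<bar>ghat m i \<omega> t - ?g\<bar> \<le> 2 * \<bar>A N' \<omega> - ?g\<bar> + 2 * B N' \<omega> + 2 / N' * \<bar>?g\<bar>" for \<omega>
    proof -
      have "ghat m i \<omega> t - ?g = c * (A N' \<omega> - ?g) - c * B N' \<omega> + (c - 1) * ?g"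
        unfolding ghat_eq[OF N] by (simp add: A_def B_def c_def N'_def algebra_simps)
      then have "\<bar>ghat m i \<omega> t - ?g\<bar> \<le> \<bar>c * (A N' \<omega> - ?g)\<bar> + \<bar>c * B N' \<omega>\<bar> + \<bar>(c - 1) * ?g\<bar>" by linarith
      also have "\<bar>c * (A N' \<omega> - ?g)\<bar> \<le> 2 * \<bar>A N' \<omega> - ?g\<bar>" unfolding abs_mult
        using c by (intro mult_right_mono) auto
      also have "\<bar>c * B N' \<omega>\<bar> \<le> 2 * B N' \<omega>" unfolding abs_mult
        using c by (auto simp: B_def intro!: mult_right_mono)
      also have "\<bar>(c - 1) * ?g\<bar> \<le> 2 / N' * \<bar>?g\<bar>" unfolding abs_mult using c by (intro mult_right_mono) auto
      finally show ?thesis by simp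
    qed
    then have "expectation (\<lambda>\<omega>. \<bar>ghat m i \<omega> t - ?g\<bar>) \<le> expectation (\<lambda>\<omega>. 2 * \<bar>A N' \<omega> - ?g\<bar> + 2 * B N' \<omega> + 2 /
      N' * \<bar>?g\<bar>)"
      using int[OF N] intA[of N'] intB[of N'] by (intro integral_mono) auto
    also have "\<dots> = 2 * expectation (\<lambda>\<omega>. \<bar>A N' \<omega> - ?g\<bar>) + 2 * (?g / N') + 2 / N' * \<bar>?g\<bar>"
      using intA[of N'] intB[of N'] by (simp add: EB prob_space)
    also have "\<dots> \<le> 2 * expectation (\<lambda>\<omega>. \<bar>A N' \<omega> - ?g\<bar>) + 4 * \<bar>?g\<bar> / N'"
    proof -
      have "?g / N' \<le> \<bar>?g\<bar> / N'" by (intro divide_right_mono) auto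
      moreover have "4 * \<bar>?g\<bar> / N' = 2 * (\<bar>?g\<bar> / N') + 2 / N' * \<bar>?g\<bar>" by simp
      ultimately show ?thesis by linarith
    qed
    finally show ?thesis by (simp add: N'_def)
  qed
  show "(\<lambda>m. expectation (\<lambda>\<omega>. \<bar>ghat m i \<omega> t - ?g\<bar>)) \<longlonglongrightarrow> 0"
  proof (rule tendsto_sandwich)
    show "\<forall>\<^sub>F m in sequentially. 0 \<le> expectation (\<lambda>\<omega>. \<bar>ghat m i \<omega> t - ?g\<bar>)" by simp
    show "\<forall>\<^sub>F m in sequentially. expectation (\<lambda>\<omega>. \<bar>ghat m i \<omega> t - ?g\<bar>) \<le> 2 * expectation (\<lambda>\<omega>. \<bar>A (ns m i) \<omega> -
      ?g\<bar>) + 4 * \<bar>?g\<bar> / ns m i"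
      using ns_ge[OF i, of 2] by eventually_elim (rule bound)
    have "(\<lambda>m. 2 * expectation (\<lambda>\<omega>. \<bar>A (ns m i) \<omega> - ?g\<bar>) + 4 * \<bar>?g\<bar> / ns m i) \<longlonglongrightarrow> 2 * 0 + 0"
      by (intro tendsto_intros filterlim_compose[OF LLN ns_infinity[OF i]] tendsto_divide_0[OF tendsto_const]
          filterlim_at_top_imp_at_infinity filterlim_compose[OF filterlim_real_sequentially ns_infinity[OF i]])
    then show "(\<lambda>m. 2 * expectation (\<lambda>\<omega>. \<bar>A (ns m i) \<omega> - ?g\<bar>) + 4 * \<bar>?g\<bar> / ns m i) \<longlonglongrightarrow> 0" by simp
  qed simp
qed

text \<open>The finite counterpart of the supremum in the oscillation hypothesis: measurable, and
  determined in law by finitely many times.\<close>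

definition max_osc :: "(real \<times> real) set \<Rightarrow> (real \<Rightarrow> real) \<Rightarrow> real" where
  "max_osc P h = Max ((\<lambda>p. \<bar>h (fst p) - h (snd p)\<bar>) ` P)"

text \<open>A function of two abstract paths, so that expectations of its oscillation are integrals
  against the joint law on the path space.\<close>

definition product_path :: "nat \<Rightarrow> (real \<Rightarrow> real) \<Rightarrow> (real \<Rightarrow> real) \<Rightarrow> real \<Rightarrow> real" where
  "product_path i f f' t = (f t - \<eta> i t) * (f' t - \<eta> i t)"

context
  fixes P :: "(real \<times> real) set"
  assumes P: "finite P" "P \<noteq> {}" "P \<subseteq> T \<times> T"
begin

lemma max_osc_ge: "p \<in> P \<Longrightarrow> \<bar>h (fst p) - h (snd p)\<bar> \<le> max_osc P h"
  unfolding max_osc_def using P by (intro Max_ge) auto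

lemma max_osc_le: "(\<And>p. p \<in> P \<Longrightarrow> \<bar>h (fst p) - h (snd p)\<bar> \<le> C) \<Longrightarrow> max_osc P h \<le> C"
  unfolding max_osc_def using P by (intro Max.boundedI) auto

lemma max_osc_nonneg: "0 \<le> max_osc P h"
  using P(2) max_osc_ge[of _ h] by (metis abs_ge_zero all_not_in_conv order_trans)

lemma max_osc_product_path_measurable:
  "(\<lambda>z. max_osc P (product_path i (fst z) (snd z))) \<in> borel_measurable (path_space T \<Otimes>\<^sub>M path_space T)"
proof -
  have c: "(\<lambda>z. fst z t) \<in> borel_measurable (path_space T \<Otimes>\<^sub>M path_space T)"
    "(\<lambda>z. snd z t) \<in> borel_measurable (path_space T \<Otimes>\<^sub>M path_space T)" if "t \<in> T" for t
    using that by (auto intro: measurable_compose[OF measurable_fst] measurable_compose[OF measurable_snd]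
      measurable_component_singleton)
  show ?thesis unfolding max_osc_def product_path_def
    using P by (intro borel_measurable_Max borel_measurable_abs borel_measurable_diff borel_measurable_times
      borel_measurable_const c) auto
qed

lemma max_osc_product_path_eq:
  "max_osc P (product_path i (restrict (x i j \<omega>) T) (restrict (x i j' \<omega>) T)) = max_osc P (\<lambda>t. v i j \<omega> t * v i
    j' \<omega> t)"
  unfolding max_osc_def product_path_def v_def using P(3) by (intro arg_cong[where f = Max] image_cong) auto

lemma max_osc_measurable:
  assumes h: "\<And>t. t \<in> T \<Longrightarrow> (\<lambda>\<omega>. h \<omega> t) \<in> borel_measurable M"
  shows "(\<lambda>\<omega>. max_osc P (h \<omega>)) \<in> borel_measurable M"
  unfolding max_osc_def using P by (intro borel_measurable_Max borel_measurable_abs borel_measurable_diff h) auto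

lemma integrable_max_osc:
  assumes h: "\<And>t. t \<in> T \<Longrightarrow> integrable M (\<lambda>\<omega>. h \<omega> t)"
  shows "integrable M (\<lambda>\<omega>. max_osc P (h \<omega>))"
proof (rule Bochner_Integration.integrable_bound)
  show "integrable M (\<lambda>\<omega>. \<Sum>p\<in>P. \<bar>h \<omega> (fst p) - h \<omega> (snd p)\<bar>)"
    using P(3) by (intro Bochner_Integration.integrable_sum integrable_abs Bochner_Integration.integrable_diff
      h) auto
  show "(\<lambda>\<omega>. max_osc P (h \<omega>)) \<in> borel_measurable M" using h by (intro max_osc_measurable) auto
  show "AE \<omega> in M. norm (max_osc P (h \<omega>)) \<le> norm (\<Sum>p\<in>P. \<bar>h \<omega> (fst p) - h \<omega> (snd p)\<bar>)"
  proof (rule AE_I2)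
    fix \<omega>
    have "max_osc P (h \<omega>) \<le> (\<Sum>p\<in>P. \<bar>h \<omega> (fst p) - h \<omega> (snd p)\<bar>)"
      using P(1) by (intro max_osc_le member_le_sum) auto
    then show "norm (max_osc P (h \<omega>)) \<le> norm (\<Sum>p\<in>P. \<bar>h \<omega> (fst p) - h \<omega> (snd p)\<bar>)"
      using max_osc_nonneg[of "h \<omega>"] by simp
  qed
qed

end

lemma integrable_vv:
  assumes i: "i < k" and t: "t \<in> T"
  shows "integrable M (\<lambda>\<omega>. v i j \<omega> t * v i j' \<omega> t)"
proof (cases "j = j'")
  case True
  then show ?thesis using integrable_v_sq[OF i t, of j] by (simp add: power2_eq_square)
next
  case False
  then show ?thesis
    using indep_vars_expectation_mult(1)[OF indep_v[OF i t] UNIV_I UNIV_I False integrable_v[OF i t]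
      integrable_v[OF i t]] by simp
qed

text \<open>Only finitely many times enter here, so equality of the finite-dimensional distributions
  transfers the oscillation bound from the pairs \<open>(0, 0)\<close> and \<open>(0, 1)\<close> to all pairs.\<close>

lemma expectation_max_osc_eq:
  assumes i: "i < k" and P: "finite P" "P \<noteq> {}" "P \<subseteq> T \<times> T"
  shows "expectation (\<lambda>\<omega>. max_osc P (\<lambda>t. v i j \<omega> t * v i j' \<omega> t)) =
    expectation (\<lambda>\<omega>. max_osc P (\<lambda>t. v i 0 \<omega> t * v i (if j = j' then 0 else 1) \<omega> t))"
proof -
  let ?g = "\<lambda>z. max_osc P (product_path i (fst z) (snd z))"
  note gm = max_osc_product_path_measurable[OF P, of i]
  note rm = restrict_x_measurable[OF i]
  show ?thesis
  proof (cases "j = j'")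
    case True
    have dm: "(\<lambda>f. ?g (f, f)) \<in> borel_measurable (path_space T)"
      by (rule measurable_compose[OF _ gm]) measurable
    have "integral\<^sup>L (distr M borel (\<lambda>\<omega>. ?g (restrict (x i j \<omega>) T, restrict (x i j \<omega>) T))) (\<lambda>y. y)
      = integral\<^sup>L (distr M borel (\<lambda>\<omega>. ?g (restrict (x i 0 \<omega>) T, restrict (x i 0 \<omega>) T))) (\<lambda>y. y)"
      using distr_path_functional[OF i dm, of j] by simp
    then show ?thesis
      using True measurable_compose[OF rm dm]
      by (simp add: integral_distr max_osc_product_path_eq[OF P])
  next
    case False
    let ?X = "\<lambda>j \<omega>. restrict (x i j \<omega>) T"
    have joint: "distr M (path_space T \<Otimes>\<^sub>M path_space T) (\<lambda>\<omega>. (?X j \<omega>, ?X j' \<omega>)) =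
      distr M (path_space T) (?X j) \<Otimes>\<^sub>M distr M (path_space T) (?X j')" if "j \<noteq> j'" for j j'
    proof -
      have "indep_vars (\<lambda>_. path_space T) (\<lambda>b. ?X (if b then j else j')) UNIV"
      proof -
        have "inj_on (\<lambda>b. (i, if b then j else j')) UNIV" using that by (auto simp: inj_on_def split: if_splits)
        from indep_vars_reindexed[OF indep_paths this] show ?thesis using i by auto
      qed
      moreover have "(\<lambda>b. ?X (if b then j else j')) = case_bool (?X j) (?X j')"
        by (auto simp: fun_eq_iff split: bool.split)
      moreover have "(\<lambda>_. path_space T) = case_bool (path_space T) (path_space T)"
        by (auto simp: fun_eq_iff split: bool.split)
      ultimately have "indep_var (path_space T) (?X j) (path_space T) (?X j')"
        unfolding indep_var_def by simp
      then show ?thesis unfolding indep_var_distribution_eq by simp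
    qed
    \<comment> \<open>Joint laws of two distinct observations are products, so equal marginals make
      them equal.\<close>
    have "distr M (path_space T \<Otimes>\<^sub>M path_space T) (\<lambda>\<omega>. (?X j \<omega>, ?X j' \<omega>)) =
      distr M (path_space T \<Otimes>\<^sub>M path_space T) (\<lambda>\<omega>. (?X 0 \<omega>, ?X 1 \<omega>))"
      unfolding joint[OF False] joint[OF zero_neq_one]
      using ident[OF i, of j] ident[OF i, of j'] ident[OF i, of 1] unfolding identically_distributed_def by simp
    then have "integral\<^sup>L (distr M (path_space T \<Otimes>\<^sub>M path_space T) (\<lambda>\<omega>. (?X j \<omega>, ?X j' \<omega>))) ?g =
      integral\<^sup>L (distr M (path_space T \<Otimes>\<^sub>M path_space T) (\<lambda>\<omega>. (?X 0 \<omega>, ?X 1 \<omega>))) ?g" by simp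
    moreover have "integral\<^sup>L (distr M (path_space T \<Otimes>\<^sub>M path_space T) (\<lambda>\<omega>. (?X j \<omega>, ?X j' \<omega>))) ?g =
      expectation (\<lambda>\<omega>. max_osc P (\<lambda>t. v i j \<omega> t * v i j' \<omega> t))" for j j'
      using rm gm by (subst integral_distr) (auto simp: max_osc_product_path_eq[OF P])
    ultimately show ?thesis using False by simp
  qed
qed

text \<open>The oscillation hypothesis in its usable form: \<delta> works for all pairs of
  observations and all finite sets of nearby pairs of times, regardless of their number.\<close>

lemma expectation_max_osc_small:
  assumes i: "i < k" and \<epsilon>: "0 < \<epsilon>"
  shows "\<exists>\<delta>>0. \<forall>P j j'. finite P \<longrightarrow> P \<noteq> {} \<longrightarrow> P \<subseteq> {(t, s). t \<in> T \<and> s \<in> T \<and> \<bar>t - s\<bar> < \<delta>} \<longrightarrow>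
    expectation (\<lambda>\<omega>. max_osc P (\<lambda>t. v i j \<omega> t * v i j' \<omega> t)) \<le> \<epsilon>"
proof -
  let ?sup = "\<lambda>\<delta> j \<omega>. SUP (t, s) \<in> {(t, s). t \<in> T \<and> s \<in> T \<and> \<bar>t - s\<bar> < \<delta>}.
    ereal \<bar>v i 0 \<omega> t * v i j \<omega> t - v i 0 \<omega> s * v i j \<omega> s\<bar>"
  have "\<forall>\<^sub>F \<delta> in at_right 0. outer_expectation M (?sup \<delta> j) < ereal \<epsilon>" if "j \<in> {0, 1}" for j
    using osc[OF i that] \<epsilon> unfolding v_def by (intro order_tendstoD(2)) auto
  then have "\<forall>\<^sub>F \<delta> in at_right 0. outer_expectation M (?sup \<delta> 0) < ereal \<epsilon> \<and> outer_expectation M (?sup \<delta> 1) <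
    ereal \<epsilon>"
    by (intro eventually_conj) auto
  then obtain b :: real where b: "b > 0" "\<And>\<delta>. 0 < \<delta> \<Longrightarrow> \<delta> < b \<Longrightarrow>
      outer_expectation M (?sup \<delta> 0) < ereal \<epsilon> \<and> outer_expectation M (?sup \<delta> 1) < ereal \<epsilon>"
    unfolding eventually_at_right_field by auto
  define \<delta> where "\<delta> = b / 2"
  have \<delta>: "0 < \<delta>" and small: "outer_expectation M (?sup \<delta> j) < ereal \<epsilon>" if "j \<in> {0, 1}" for j
    using b(1) b(2)[of \<delta>] that by (auto simp: \<delta>_def)
  show ?thesis
  proof (intro exI[of _ \<delta>] conjI allI impI)
    show "0 < \<delta>" using \<delta>[of 0] by simp
    fix P :: "(real \<times> real) set" and j j' :: nat
    assume P: "finite P" "P \<noteq> {}" and sub: "P \<subseteq> {(t, s). t \<in> T \<and> s \<in> T \<and> \<bar>t - s\<bar> < \<delta>}"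
    have PT: "P \<subseteq> T \<times> T" using sub by auto
    define j1 :: nat where "j1 = (if j = j' then 0 else 1)"
    let ?h = "\<lambda>\<omega>. max_osc P (\<lambda>t. v i 0 \<omega> t * v i j1 \<omega> t)"
    have "j1 \<in> {0, 1}" by (simp add: j1_def)
    \<comment> \<open>The infimum in the outer expectation supplies a majorant of the supremum over
      all nearby pairs; it dominates every finite maximum.\<close>
    from small[OF this] obtain U where U: "ereal_expectation M U < ereal \<epsilon>" "\<forall>\<omega>\<in>space M. ?sup \<delta> j1 \<omega> \<le> U \<omega>"
      unfolding outer_expectation_def Inf_less_iff by auto
    have "ereal (?h \<omega>) \<le> ?sup \<delta> j1 \<omega>" for \<omega>
    proof -
      have "?h \<omega> \<in> (\<lambda>p. \<bar>v i 0 \<omega> (fst p) * v i j1 \<omega> (fst p) - v i 0 \<omega> (snd p) * v i j1 \<omega> (snd p)\<bar>) ` P"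
        unfolding max_osc_def using P by (intro Max_in) auto
      then obtain p where p: "p \<in> P" "?h \<omega> = \<bar>v i 0 \<omega> (fst p) * v i j1 \<omega> (fst p) - v i 0 \<omega> (snd p) * v i j1 \<omega>
        (snd p)\<bar>"
        by auto
      have "ereal (?h \<omega>) = (case p of (t, s) \<Rightarrow> ereal \<bar>v i 0 \<omega> t * v i j1 \<omega> t - v i 0 \<omega> s * v i j1 \<omega> s\<bar>)"
        unfolding p(2) by (simp add: case_prod_unfold)
      also have "\<dots> \<le> ?sup \<delta> j1 \<omega>" by (rule SUP_upper) (use p sub in auto)
      finally show ?thesis .
    qed
    then have "ereal_expectation M (\<lambda>\<omega>. ereal (?h \<omega>)) \<le> ereal_expectation M U"
      using U(2) by (intro ereal_expectation_mono) (blast intro: order_trans)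
    moreover have "integrable M ?h" by (intro integrable_max_osc[OF P PT] integrable_vv i)
    ultimately have "ereal (expectation ?h) \<le> ereal_expectation M U"
      using ereal_expectation_real(1)[of M ?h] by simp
    then have "ereal (expectation ?h) < ereal \<epsilon>" using U(1) by (rule le_less_trans)
    then show "expectation (\<lambda>\<omega>. max_osc P (\<lambda>t. v i j \<omega> t * v i j' \<omega> t)) \<le> \<epsilon>"
      unfolding expectation_max_osc_eq[OF i P PT, of j j'] by (simp add: j1_def)
  qed
qed


text \<open>The estimator is Bessel's factor, at most 2, times the difference of a mean of diagonal
  products and a double mean of products over all pairs. This is where products of two distinct
  observations enter.\<close>

lemma max_osc_ghat_le:
  assumes P: "finite P" "P \<noteq> {}" "P \<subseteq> T \<times> T" and N: "2 \<le> ns m i"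
  shows "max_osc P (ghat m i \<omega>) \<le> 2 * ((\<Sum>j<ns m i. max_osc P (\<lambda>t. v i j \<omega> t * v i j \<omega> t)) / ns m i +
    (\<Sum>j<ns m i. \<Sum>j'<ns m i. max_osc P (\<lambda>t. v i j \<omega> t * v i j' \<omega> t)) / (real (ns m i))\<^sup>2)"
proof (rule max_osc_le[OF P])
  fix p assume p: "p \<in> P"
  define N' where "N' = ns m i"
  define c where "c = N' / (real N' - 1)"
  note c = factor_bounds[OF N[folded N'_def], folded c_def]
  define A where "A t = (\<Sum>j<N'. v i j \<omega> t * v i j \<omega> t) / N'" for t
  define B where "B t = (\<Sum>j<N'. \<Sum>j'<N'. v i j \<omega> t * v i j' \<omega> t) / (real N')\<^sup>2" for t
  have g: "ghat m i \<omega> t = c * (A t - B t)" for t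
    unfolding ghat_eq[OF N] c_def A_def B_def N'_def by (simp add: power2_eq_square sum_product)
  have dA: "\<bar>A (fst p) - A (snd p)\<bar> \<le> (\<Sum>j<N'. max_osc P (\<lambda>t. v i j \<omega> t * v i j \<omega> t)) / N'"
  proof -
    have eq: "A (fst p) - A (snd p) = (\<Sum>j<N'. v i j \<omega> (fst p) * v i j \<omega> (fst p) - v i j \<omega> (snd p) * v i j \<omega>
      (snd p)) / N'"
      unfolding A_def by (simp add: sum_subtractf diff_divide_distrib)
    have "\<bar>A (fst p) - A (snd p)\<bar> \<le> (\<Sum>j<N'. \<bar>v i j \<omega> (fst p) * v i j \<omega> (fst p) - v i j \<omega> (snd p) * v i j \<omega>
      (snd p)\<bar>) / N'"
      unfolding eq by (simp add: divide_right_mono)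
    also have "\<dots> \<le> (\<Sum>j<N'. max_osc P (\<lambda>t. v i j \<omega> t * v i j \<omega> t)) / N'"
      by (intro divide_right_mono sum_mono max_osc_ge[OF P p]) simp
    finally show ?thesis .
  qed
  have dB: "\<bar>B (fst p) - B (snd p)\<bar> \<le> (\<Sum>j<N'. \<Sum>j'<N'. max_osc P (\<lambda>t. v i j \<omega> t * v i j' \<omega> t)) / (real N')\<^sup>2"
  proof -
    have eq: "B (fst p) - B (snd p) = (\<Sum>j<N'. \<Sum>j'<N'. v i j \<omega> (fst p) * v i j' \<omega> (fst p) - v i j \<omega> (snd p) * v
      i j' \<omega> (snd p)) / (real N')\<^sup>2"
      unfolding B_def by (simp add: sum_subtractf diff_divide_distrib)
    have "\<bar>B (fst p) - B (snd p)\<bar> \<le> (\<Sum>j<N'. \<Sum>j'<N'. \<bar>v i j \<omega> (fst p) * v i j' \<omega> (fst p) - v i j \<omega> (snd p) * v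
      i j' \<omega> (snd p)\<bar>) / (real N')\<^sup>2"
      unfolding eq by (simp add: divide_right_mono order_trans[OF sum_abs sum_mono[OF sum_abs]])
    also have "\<dots> \<le> (\<Sum>j<N'. \<Sum>j'<N'. max_osc P (\<lambda>t. v i j \<omega> t * v i j' \<omega> t)) / (real N')\<^sup>2"
      by (intro divide_right_mono sum_mono max_osc_ge[OF P p]) simp
    finally show ?thesis .
  qed
  have eq: "ghat m i \<omega> (fst p) - ghat m i \<omega> (snd p) = c * ((A (fst p) - A (snd p)) - (B (fst p) - B (snd p)))"
    unfolding g by (simp add: algebra_simps)
  have "\<bar>ghat m i \<omega> (fst p) - ghat m i \<omega> (snd p)\<bar> \<le> 2 * (\<bar>A (fst p) - A (snd p)\<bar> + \<bar>B (fst p) - B (snd p)\<bar>)"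
    unfolding eq abs_mult using c by (intro mult_mono) auto
  also have "\<dots> \<le> 2 * ((\<Sum>j<N'. max_osc P (\<lambda>t. v i j \<omega> t * v i j \<omega> t)) / N' + (\<Sum>j<N'. \<Sum>j'<N'. max_osc P (\<lambda>t. v i
    j \<omega> t * v i j' \<omega> t)) / (real N')\<^sup>2)"
    by (intro mult_left_mono add_mono dA dB) simp
  finally show "\<bar>ghat m i \<omega> (fst p) - ghat m i \<omega> (snd p)\<bar> \<le> 2 * ((\<Sum>j<ns m i. max_osc P (\<lambda>t. v i j \<omega> t * v i j
    \<omega> t)) / ns m i +
    (\<Sum>j<ns m i. \<Sum>j'<ns m i. max_osc P (\<lambda>t. v i j \<omega> t * v i j' \<omega> t)) / (real (ns m i))\<^sup>2)"
    unfolding N'_def .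
qed

text \<open>The threshold for \<open>m\<close> must not depend on \<open>F\<close>. A fixed finite
  net takes care of pointwise convergence, and each time in \<open>F\<close> is compared with a net
  point through the oscillation bound, whose expectation ignores the size of
  \<open>F\<close>.\<close>

lemma ghat_finite_sets:
  assumes i: "i < k" and \<rho>: "0 < \<rho>" and p: "0 < p"
  shows "\<forall>\<^sub>F m in sequentially. \<forall>F. finite F \<longrightarrow> F \<subseteq> T \<longrightarrow>
    prob {\<omega> \<in> space M. \<forall>t\<in>F. \<bar>ghat m i \<omega> t - \<gamma> i t t\<bar> \<le> \<rho>} \<ge> 1 - p"
proof -
  define r where "r = \<rho> / 3"
  have r: "0 < r" using \<rho> by (simp add: r_def)
  \<comment> \<open>The two averages of oscillations contribute 2 (\<epsilon> + \<epsilon>) = p r /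
    2 to the mean of \<open>Y\<close> below and the net another p r / 2, so Markov's inequality at
    level \<open>r\<close> gives probability \<open>p\<close>.\<close>
  define \<epsilon> where "\<epsilon> = p * r / 8"
  have \<epsilon>: "0 < \<epsilon>" using p r by (simp add: \<epsilon>_def)
  obtain \<delta>1 where \<delta>1: "0 < \<delta>1" "\<And>P j j'. finite P \<Longrightarrow> P \<noteq> {} \<Longrightarrow> P \<subseteq> {(t, s). t \<in> T \<and> s \<in> T \<and> \<bar>t - s\<bar> < \<delta>1} \<Longrightarrow>
    expectation (\<lambda>\<omega>. max_osc P (\<lambda>t. v i j \<omega> t * v i j' \<omega> t)) \<le> \<epsilon>"
    using expectation_max_osc_small[OF i \<epsilon>] by blast
  have cT: "compact T" unfolding T by simp
  have "uniformly_continuous_on T (\<lambda>t. \<gamma> i t t)"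
    using gamma_cont[OF i] cT by (rule compact_uniformly_continuous)
  then obtain \<delta>2 where \<delta>2: "0 < \<delta>2" "\<And>t s. t \<in> T \<Longrightarrow> s \<in> T \<Longrightarrow> \<bar>t - s\<bar> < \<delta>2 \<Longrightarrow> \<bar>\<gamma> i t t - \<gamma> i s s\<bar> < r"
    unfolding uniformly_continuous_on_def using r by (auto simp: dist_real_def)
  define \<delta> where "\<delta> = min \<delta>1 \<delta>2"
  have \<delta>: "0 < \<delta>" using \<delta>1(1) \<delta>2(1) by (simp add: \<delta>_def)
  obtain D where D: "D \<subseteq> T" "finite D" "T \<subseteq> (\<Union>d\<in>D. ball d \<delta>)"
  proof (rule compactE_image[OF cT, of T "\<lambda>d. ball d \<delta>"])
    show "T \<subseteq> (\<Union>d\<in>T. ball d \<delta>)" using \<delta> by auto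
  qed auto
  have "(\<lambda>m. \<Sum>d\<in>D. expectation (\<lambda>\<omega>. \<bar>ghat m i \<omega> d - \<gamma> i d d\<bar>)) \<longlonglongrightarrow> (\<Sum>d\<in>D. 0)"
    using D(1) by (intro tendsto_sum ghat_tendsto(1)[OF i]) auto
  then have "\<forall>\<^sub>F m in sequentially. (\<Sum>d\<in>D. expectation (\<lambda>\<omega>. \<bar>ghat m i \<omega> d - \<gamma> i d d\<bar>)) < p * r / 2"
    using p r by (intro order_tendstoD(2)) auto
  then show ?thesis using ns_ge[OF i, of 2]
  proof eventually_elim
    case (elim m)
    define N where "N = ns m i"
    have N: "2 \<le> N" using elim(2) by (simp add: N_def)
    show ?case
    proof (intro allI impI)
      fix F assume F: "finite F" "F \<subseteq> T"
      show "prob {\<omega> \<in> space M. \<forall>t\<in>F. \<bar>ghat m i \<omega> t - \<gamma> i t t\<bar> \<le> \<rho>} \<ge> 1 - p"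
      proof (cases "F = {}")
        case True
        then show ?thesis using p by (simp add: prob_space)
      next
        case False
        define P where "P = {(t, d). t \<in> F \<and> d \<in> D \<and> \<bar>t - d\<bar> < \<delta>}"
        have Psub: "P \<subseteq> F \<times> D" by (auto simp: P_def)
        have near: "\<exists>d. (t, d) \<in> P" if "t \<in> F" for t
        proof -
          have "t \<in> T" using F that by auto
          then obtain d where "d \<in> D" "t \<in> ball d \<delta>" using D(3) by blast
          then show ?thesis using that by (auto simp: P_def dist_real_def abs_minus_commute)
        qed
        have P: "finite P" "P \<noteq> {}" "P \<subseteq> T \<times> T"
        proof -
          show "finite P" using finite_subset[OF Psub] F(1) D(2) by simp
          obtain t where "t \<in> F" using False by blast
          then show "P \<noteq> {}" using near[of t] by blast
          show "P \<subseteq> T \<times> T" using Psub F(2) D(1) by blast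
        qed
        have Posc: "P \<subseteq> {(t, s). t \<in> T \<and> s \<in> T \<and> \<bar>t - s\<bar> < \<delta>1}" using F D by (auto simp: P_def \<delta>_def)
        \<comment> \<open>Dominates the oscillation of the estimator between \<open>F\<close> and
          the net plus all its errors on the net, and has a mean that can be bounded term by
          term.\<close>
        define Y where "Y \<omega> = 2 * ((\<Sum>j<N. max_osc P (\<lambda>t. v i j \<omega> t * v i j \<omega> t)) / N +
          (\<Sum>j<N. \<Sum>j'<N. max_osc P (\<lambda>t. v i j \<omega> t * v i j' \<omega> t)) / (real N)\<^sup>2) + (\<Sum>d\<in>D. \<bar>ghat m i \<omega> d - \<gamma> i d
            d\<bar>)" for \<omega>
        have imo: "integrable M (\<lambda>\<omega>. max_osc P (\<lambda>t. v i j \<omega> t * v i j' \<omega> t))" for j j'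
          by (intro integrable_max_osc[OF P] integrable_vv i)
        have ig: "integrable M (\<lambda>\<omega>. \<bar>ghat m i \<omega> d - \<gamma> i d d\<bar>)" if "d \<in> D" for d
          using ghat_tendsto(2)[OF i _ elim(2)] D(1) that by auto
        have iY: "integrable M Y" unfolding Y_def using imo ig by auto
        have "expectation Y = 2 * ((\<Sum>j<N. expectation (\<lambda>\<omega>. max_osc P (\<lambda>t. v i j \<omega> t * v i j \<omega> t))) / N +
          (\<Sum>j<N. \<Sum>j'<N. expectation (\<lambda>\<omega>. max_osc P (\<lambda>t. v i j \<omega> t * v i j' \<omega> t))) / (real N)\<^sup>2) + (\<Sum>d\<in>D.
            expectation (\<lambda>\<omega>. \<bar>ghat m i \<omega> d - \<gamma> i d d\<bar>))"
          unfolding Y_def using imo ig by simp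
        also have "\<dots> \<le> 2 * ((\<Sum>j<N. \<epsilon>) / N + (\<Sum>j<N. \<Sum>j'<N. \<epsilon>) / (real N)\<^sup>2) + p * r / 2"
          using elim(1) by (intro add_mono mult_left_mono divide_right_mono sum_mono \<delta>1(2) P Posc) auto
        also have "\<dots> = p * r" using N by (simp add: \<epsilon>_def power2_eq_square)
        finally have EY: "expectation Y \<le> p * r" .
        have Y0: "0 \<le> Y \<omega>" for \<omega> unfolding Y_def
          by (intro add_nonneg_nonneg mult_nonneg_nonneg divide_nonneg_nonneg sum_nonneg max_osc_nonneg[OF P]) auto
        have good: "\<bar>ghat m i \<omega> t - \<gamma> i t t\<bar> \<le> \<rho>" if t: "t \<in> F" and Y: "Y \<omega> < r" for \<omega> t
        proof -
          obtain d where d: "(t, d) \<in> P" using near[OF t] by blast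
          then have dD: "d \<in> D" "\<bar>t - d\<bar> < \<delta>" by (auto simp: P_def)
          let ?m = "max_osc P (ghat m i \<omega>)" and ?s = "\<Sum>d\<in>D. \<bar>ghat m i \<omega> d - \<gamma> i d d\<bar>"
          have "?m + ?s \<le> Y \<omega>" unfolding Y_def N_def using max_osc_ghat_le[OF P elim(2)] by (intro add_right_mono)
          moreover have "0 \<le> ?m" by (rule max_osc_nonneg[OF P])
          moreover have "0 \<le> ?s" by (intro sum_nonneg) auto
          moreover have "\<bar>ghat m i \<omega> t - ghat m i \<omega> d\<bar> \<le> ?m" using max_osc_ge[OF P d, of "ghat m i \<omega>"] by simp
          moreover have "\<bar>ghat m i \<omega> d - \<gamma> i d d\<bar> \<le> ?s" using D(2) dD by (intro member_le_sum) auto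
          moreover have "\<bar>\<gamma> i t t - \<gamma> i d d\<bar> < r" using \<delta>2(2)[of t d] dD D(1) F t by (auto simp: \<delta>_def)
          ultimately have "\<bar>ghat m i \<omega> t - \<gamma> i t t\<bar> \<le> 3 * r" using Y by linarith
          then show ?thesis by (simp add: r_def)
        qed
        have gm: "{\<omega> \<in> space M. \<forall>t\<in>F. \<bar>ghat m i \<omega> t - \<gamma> i t t\<bar> \<le> \<rho>} \<in> events"
        proof -
          have "Measurable.pred M (\<lambda>\<omega>. \<bar>ghat m i \<omega> t - \<gamma> i t t\<bar> \<le> \<rho>)" if "t \<in> F" for t
          proof -
            have [measurable]: "(\<lambda>\<omega>. ghat m i \<omega> t) \<in> borel_measurable M"
              using F that by (intro ghat_section_measurable i) auto
            show ?thesis by measurable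
          qed
          then have "Measurable.pred M (\<lambda>\<omega>. \<forall>t\<in>F. \<bar>ghat m i \<omega> t - \<gamma> i t t\<bar> \<le> \<rho>)"
            using F(1) by (intro pred_intros_finite) auto
          then show ?thesis by (simp add: pred_def)
        qed
        have Ym: "{\<omega> \<in> space M. r \<le> Y \<omega>} \<in> events" using iY by measurable
        have "prob {\<omega> \<in> space M. r \<le> Y \<omega>} \<le> expectation Y / r"
          using iY Y0 r by (intro integral_Markov_inequality_measure[where A = "{}"]) auto
        also have "\<dots> \<le> p" using EY r by (simp add: divide_le_eq)
        finally have "1 - p \<le> 1 - prob {\<omega> \<in> space M. r \<le> Y \<omega>}" by simp
        also have "\<dots> = prob (space M - {\<omega> \<in> space M. r \<le> Y \<omega>})" using prob_compl[OF Ym] by simp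
        also have "\<dots> \<le> prob {\<omega> \<in> space M. \<forall>t\<in>F. \<bar>ghat m i \<omega> t - \<gamma> i t t\<bar> \<le> \<rho>}"
          using good by (intro finite_measure_mono gm) (auto simp: not_le)
        finally show ?thesis .
      qed
    qed
  qed
qed

section \<open>Joint measurability and consistency at almost every time\<close>

abbreviation \<mu> :: "real measure" where "\<mu> \<equiv> lebesgue_on T"

lemma space_\<mu> [simp]: "space \<mu> = T"
  by (simp add: space_restrict_space)

lemma finite_measure_\<mu>: "finite_measure \<mu>"
  unfolding T by (rule finite_measure_lebesgue_on) simp

lemma x_pair_measurable:
  "i < k \<Longrightarrow> (\<lambda>z. x i j (fst z) (snd z)) \<in> borel_measurable (M \<Otimes>\<^sub>M \<mu>)"
  using L2[of i j] unfolding L2_process_def by (simp add: case_prod_unfold)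

lemma ghat_pair_measurable:
  assumes "i < k"
  shows "(\<lambda>z. ghat m i (fst z) (snd z)) \<in> borel_measurable (M \<Otimes>\<^sub>M \<mu>)"
proof -
  note [measurable] = x_pair_measurable[OF assms]
  show ?thesis unfolding ghat_def gamma_hat_def eta_hat_def by measurable
qed

lemma gamma_diag_measurable:
  assumes "i < k"
  shows "(\<lambda>t. \<gamma> i t t) \<in> borel_measurable \<mu>"
  by (rule continuous_imp_measurable_on_sets_lebesgue[OF gamma_cont[OF assms]]) (simp add: T)

lemma ghat_uniform:
  assumes \<rho>: "0 < \<rho>" and p: "0 < p"
  shows "\<forall>\<^sub>F m in sequentially. \<exists>G\<in>events. prob G \<ge> 1 - p \<and>
    (\<forall>\<omega>\<in>G. AE t in \<mu>. \<forall>i<k. \<bar>ghat m i \<omega> t - \<gamma> i t t\<bar> \<le> \<rho>)"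
proof -
  \<comment> \<open>Prepares a union bound over the \<open>k\<close> samples; the summand 1 avoids
    division by zero.\<close>
  define q where "q = p / (k + 1)"
  have q: "0 < q" using p by (simp add: q_def)
  have "\<forall>\<^sub>F m in sequentially. \<forall>i\<in>{..<k}. \<forall>F. finite F \<longrightarrow> F \<subseteq> T \<longrightarrow>
    prob {\<omega> \<in> space M. \<forall>t\<in>F. \<bar>ghat m i \<omega> t - \<gamma> i t t\<bar> \<le> \<rho>} \<ge> 1 - q"
    using ghat_finite_sets[OF _ \<rho> q] by (intro eventually_ball_finite) auto
  then show ?thesis
  proof eventually_elim
    case (elim m)
    have "\<exists>G\<in>events. prob G \<ge> 1 - q \<and> (\<forall>\<omega>\<in>G. AE t in \<mu>. \<bar>ghat m i \<omega> t - \<gamma> i t t\<bar> \<le> \<rho>)" if i: "i < k" for i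
    proof (rule prob_AE_ge_of_finite_samples[OF finite_measure_\<mu>])
      have "(\<lambda>z. \<gamma> i (snd z) (snd z)) \<in> borel_measurable (M \<Otimes>\<^sub>M \<mu>)"
        by (rule measurable_compose[OF measurable_snd gamma_diag_measurable[OF i]])
      then show "Measurable.pred (M \<Otimes>\<^sub>M \<mu>) (\<lambda>(\<omega>, t). \<bar>ghat m i \<omega> t - \<gamma> i t t\<bar> \<le> \<rho>)"
        using ghat_pair_measurable[OF i, of m] unfolding case_prod_unfold by measurable
      show "prob {\<omega> \<in> space M. \<forall>t\<in>F. \<bar>ghat m i \<omega> t - \<gamma> i t t\<bar> \<le> \<rho>} \<ge> 1 - q" if "finite F" "F \<subseteq> space \<mu>" for F
        using elim i that by auto
    qed
    then have "\<forall>i\<in>{..<k}. \<exists>G. G \<in> events \<and> prob G \<ge> 1 - q \<and> (\<forall>\<omega>\<in>G. AE t in \<mu>. \<bar>ghat m i \<omega> t - \<gamma> i t t\<bar> \<le> \<rho>)"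
      by blast
    from bchoice[OF this] obtain G where G0: "\<forall>i\<in>{..<k}. G i \<in> events \<and> prob (G i) \<ge> 1 - q \<and>
      (\<forall>\<omega>\<in>G i. AE t in \<mu>. \<bar>ghat m i \<omega> t - \<gamma> i t t\<bar> \<le> \<rho>)" ..
    have G: "\<And>i. i < k \<Longrightarrow> G i \<in> events" "\<And>i. i < k \<Longrightarrow> prob (G i) \<ge> 1 - q"
      "\<And>i \<omega>. i < k \<Longrightarrow> \<omega> \<in> G i \<Longrightarrow> AE t in \<mu>. \<bar>ghat m i \<omega> t - \<gamma> i t t\<bar> \<le> \<rho>"
      using G0 by simp_all
    define G' where "G' = space M - (\<Union>i\<in>{..<k}. space M - G i)"
    have Gm: "(\<Union>i\<in>{..<k}. space M - G i) \<in> events" using G(1) by (intro sets.finite_UN) auto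
    have "prob (\<Union>i\<in>{..<k}. space M - G i) \<le> (\<Sum>i<k. prob (space M - G i))"
      using G(1) by (intro finite_measure_subadditive_finite) auto
    also have "\<dots> \<le> (\<Sum>i<k. q)"
    proof (rule sum_mono)
      fix i assume "i \<in> {..<k}"
      then show "prob (space M - G i) \<le> q" using G(2)[of i] prob_compl[OF G(1)[of i]] by simp
    qed
    also have "\<dots> \<le> p" using p by (simp add: q_def divide_le_eq)
    finally have "prob G' \<ge> 1 - p" unfolding G'_def using Gm by (simp add: prob_compl)
    moreover have "AE t in \<mu>. \<forall>i<k. \<bar>ghat m i \<omega> t - \<gamma> i t t\<bar> \<le> \<rho>" if "\<omega> \<in> G'" for \<omega>
    proof -
      have "AE t in \<mu>. \<forall>i\<in>{..<k}. \<bar>ghat m i \<omega> t - \<gamma> i t t\<bar> \<le> \<rho>"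
        using that G(3) unfolding G'_def by (intro AE_finite_allI) auto
      then show ?thesis by eventually_elim auto
    qed
    ultimately show ?case using Gm by (auto simp: G'_def intro!: bexI[of _ G'])
  qed
qed

end


section \<open>Integrated quadratic forms\<close>

definition sq_defect :: "real \<Rightarrow> real \<Rightarrow> real" where
  "sq_defect \<epsilon> u = u\<^sup>2 - 2 / \<epsilon>\<^sup>2 * (1 - cos (\<epsilon> * u))"

text \<open>1 - cos x = 2 sin^2 (x / 2) \<le> x^2 / 2. Nonnegativity allows Markov's inequality, and
  the bound by u^2 gives dominated convergence for small \<epsilon>.\<close>

lemma sq_defect_bounds:
  assumes "\<epsilon> \<noteq> 0"
  shows "0 \<le> sq_defect \<epsilon> u" "sq_defect \<epsilon> u \<le> u\<^sup>2"
proof -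
  have "1 - cos (\<epsilon> * u) = 2 * (sin (\<epsilon> * u / 2))\<^sup>2"
    using cos_double_sin[of "\<epsilon> * u / 2"] by simp
  also have "\<dots> \<le> 2 * (\<epsilon> * u / 2)\<^sup>2"
    using abs_le_square_iff[THEN iffD1, OF abs_sin_x_le_abs_x[of "\<epsilon> * u / 2"]] by simp
  finally have le: "1 - cos (\<epsilon> * u) \<le> \<epsilon>\<^sup>2 * u\<^sup>2 / 2" by (simp add: power_mult_distrib power_divide)
  have "2 / \<epsilon>\<^sup>2 * (1 - cos (\<epsilon> * u)) \<le> 2 / \<epsilon>\<^sup>2 * (\<epsilon>\<^sup>2 * u\<^sup>2 / 2)" by (intro mult_left_mono le) simp
  also have "\<dots> = u\<^sup>2" using assms by simp
  finally show "0 \<le> sq_defect \<epsilon> u" by (simp add: sq_defect_def)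
  have "0 \<le> 2 / \<epsilon>\<^sup>2 * (1 - cos (\<epsilon> * u))" by (intro mult_nonneg_nonneg) auto
  then show "sq_defect \<epsilon> u \<le> u\<^sup>2" unfolding sq_defect_def by linarith
qed

lemma sq_defect_measurable [measurable]: "sq_defect \<epsilon> \<in> borel_measurable borel"
  unfolding sq_defect_def[abs_def] by measurable

text \<open>Third-order Taylor remainder of the exponential. It serves for pointwise convergence as
  \<epsilon> tends to 0; means are handled by domination, since third moments may be
  infinite.\<close>

lemma sq_defect_le_cube:
  assumes "\<epsilon> \<noteq> 0"
  shows "sq_defect \<epsilon> u \<le> \<bar>\<epsilon>\<bar> * \<bar>u\<bar> ^ 3 / 3"
proof -
  define y where "y = \<epsilon> * u"
  have "(\<Sum>k\<le>2. (\<i> * complex_of_real y) ^ k / fact k) = 1 + \<i> * y - complex_of_real (y\<^sup>2 / 2)"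
    by (simp add: numeral_2_eq_2 power2_eq_square algebra_simps)
  then have "cmod (iexp y - (1 + \<i> * y - complex_of_real (y\<^sup>2 / 2))) \<le> \<bar>y\<bar> ^ 3 / 6"
    using iexp_approx1[of y 2] by (simp add: numeral_3_eq_3 fact_numeral)
  then have "\<bar>Re (iexp y - (1 + \<i> * y - complex_of_real (y\<^sup>2 / 2)))\<bar> \<le> \<bar>y\<bar> ^ 3 / 6"
    by (rule order_trans[OF abs_Re_le_cmod])
  then have "\<bar>cos y - (1 - y\<^sup>2 / 2)\<bar> \<le> \<bar>y\<bar> ^ 3 / 6" by (simp add: Re_exp)
  then have le: "cos y - 1 + y\<^sup>2 / 2 \<le> \<bar>y\<bar> ^ 3 / 6" by linarith
  have "sq_defect \<epsilon> u = 2 / \<epsilon>\<^sup>2 * (cos y - 1 + y\<^sup>2 / 2)"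
    using assms by (simp add: sq_defect_def y_def power_mult_distrib right_diff_distrib distrib_left
      diff_divide_distrib)
  also have "\<dots> \<le> 2 / \<epsilon>\<^sup>2 * (\<bar>y\<bar> ^ 3 / 6)" by (intro mult_left_mono le) simp
  also have "\<dots> = \<bar>\<epsilon>\<bar> * \<bar>u\<bar> ^ 3 / 3"
  proof -
    have "\<bar>\<epsilon>\<bar> ^ 3 = \<bar>\<epsilon>\<bar> * \<epsilon>\<^sup>2" by (simp add: power3_eq_cube power2_eq_square)
    then show ?thesis using assms by (simp add: y_def abs_mult power_mult_distrib)
  qed
  finally show ?thesis .
qed

lemma sq_defect_tendsto_0: "(\<lambda>c. sq_defect (1 / real (Suc c)) u) \<longlonglongrightarrow> 0"
proof (rule tendsto_sandwich[where f = "\<lambda>_. 0" and h = "\<lambda>c. 1 / real (Suc c) * (\<bar>u\<bar> ^ 3 / 3)"])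
  have nz: "1 / real (Suc c) \<noteq> 0" for c by simp
  have "0 \<le> sq_defect (1 / real (Suc c)) u" for c by (rule sq_defect_bounds(1)[OF nz])
  then show "\<forall>\<^sub>F c in sequentially. 0 \<le> sq_defect (1 / real (Suc c)) u" by (rule always_eventually[OF allI])
  have "sq_defect (1 / real (Suc c)) u \<le> 1 / real (Suc c) * (\<bar>u\<bar> ^ 3 / 3)" for c
    using sq_defect_le_cube[OF nz, of c u] by (simp only: abs_of_nonneg times_divide_eq_right
      zero_le_divide_1_iff of_nat_0_le_iff)
  then show "\<forall>\<^sub>F c in sequentially. sq_defect (1 / real (Suc c)) u \<le> 1 / real (Suc c) * (\<bar>u\<bar> ^ 3 / 3)"
    by (rule always_eventually[OF allI])
  show "(\<lambda>c. 1 / real (Suc c) * (\<bar>u\<bar> ^ 3 / 3)) \<longlonglongrightarrow> 0"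
    by (rule tendsto_mult_left_zero[OF LIMSEQ_Suc[OF lim_1_over_n]])
qed (rule tendsto_const)

text \<open>x y = ((x + y)^2 - (x - y)^2) / 4, with each square replaced by its cosine
  approximation. The constant terms of the two approximations cancel, so pure cosines with
  coefficients of modulus |c| / (2 \<epsilon>^2) remain. The factors 1 and -1 are left in place to
  match the signs in \<open>terms\<close>.\<close>

lemma polarization_defect:
  "c * (x * y) - (- 1 * c / (2 * \<epsilon>\<^sup>2) * cos (\<epsilon> * (x + 1 * y)) + - (-1) * c / (2 * \<epsilon>\<^sup>2) * cos (\<epsilon> * (x + -1 * y)))
    = 1 * c / 4 * sq_defect \<epsilon> (x + 1 * y) + -1 * c / 4 * sq_defect \<epsilon> (x + -1 * y)"
proof -
  define i where "i = 1 / \<epsilon>\<^sup>2"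
  have d: "sq_defect \<epsilon> w = w * w - 2 * i * (1 - cos (\<epsilon> * w))" for w
    by (simp add: sq_defect_def i_def power2_eq_square)
  have e: "- 1 * c / (2 * \<epsilon>\<^sup>2) = - (c * i / 2)" "- (-1) * c / (2 * \<epsilon>\<^sup>2) = c * i / 2"
    by (simp_all add: i_def)
  define c1 c2 where "c1 = cos (\<epsilon> * (x + 1 * y))" and "c2 = cos (\<epsilon> * (x + -1 * y))"
  show ?thesis unfolding d e c1_def[symmetric] c2_def[symmetric] by (simp add: field_simps)
qed

lemma integral_double_sum:
  fixes f :: "'i \<Rightarrow> 'j \<Rightarrow> 'a \<Rightarrow> real"
  assumes "\<And>p q. p \<in> A \<Longrightarrow> q \<in> B \<Longrightarrow> integrable M (f p q)"
  shows "(\<integral>t. (\<Sum>p\<in>A. \<Sum>q\<in>B. f p q t) \<partial>M) = (\<Sum>p\<in>A. \<Sum>q\<in>B. \<integral>t. f p q t \<partial>M)"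
proof -
  have "(\<integral>t. (\<Sum>p\<in>A. \<Sum>q\<in>B. f p q t) \<partial>M) = (\<Sum>p\<in>A. \<integral>t. (\<Sum>q\<in>B. f p q t) \<partial>M)"
    using assms by (intro Bochner_Integration.integral_sum Bochner_Integration.integrable_sum)
  also have "\<dots> = (\<Sum>p\<in>A. \<Sum>q\<in>B. \<integral>t. f p q t \<partial>M)"
    using assms by (intro sum.cong refl Bochner_Integration.integral_sum)
  finally show ?thesis .
qed

text \<open>Common frame for the sample side and the limit: block \<open>l\<close> of the
  \<open>r\<close> components starts at \<open>off l\<close>, and \<open>a l p q\<close> stands for
  the entries of the pseudoinverse. The bound \<open>K\<close> is uniform in time, and the instances
  for all \<open>m\<close> share it, which provides the domination in both variables.\<close>

locale quadratic_functionals = pr: prob_space P + mu: finite_measure \<mu>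
  for P :: "'w measure" and \<mu> :: "'t measure" +
  fixes r R :: nat and X :: "'w \<Rightarrow> 't \<Rightarrow> nat \<Rightarrow> real"
    and rs off :: "nat \<Rightarrow> nat" and a :: "nat \<Rightarrow> nat \<Rightarrow> nat \<Rightarrow> 't \<Rightarrow> real" and Ca K :: real
  assumes X: "\<And>p. p < r \<Longrightarrow> (\<lambda>(\<omega>, t). X \<omega> t p) \<in> borel_measurable (P \<Otimes>\<^sub>M \<mu>)"
    and off: "\<And>l p. l < R \<Longrightarrow> p < rs l \<Longrightarrow> off l + p < r"
    and a_measurable: "\<And>l p q. l < R \<Longrightarrow> p < rs l \<Longrightarrow> q < rs l \<Longrightarrow> a l p q \<in> borel_measurable \<mu>"
    and a_bound: "\<And>l p q t. l < R \<Longrightarrow> p < rs l \<Longrightarrow> q < rs l \<Longrightarrow> t \<in> space \<mu> \<Longrightarrow> \<bar>a l p q t\<bar> \<le> Ca"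
    and Ca: "0 \<le> Ca"
    and X_path: "\<And>\<omega> p. \<omega> \<in> space P \<Longrightarrow> p < r \<Longrightarrow> integrable \<mu> (\<lambda>t. (X \<omega> t p)\<^sup>2)"
    and X_sq: "\<And>t p. t \<in> space \<mu> \<Longrightarrow> p < r \<Longrightarrow> integrable P (\<lambda>\<omega>. (X \<omega> t p)\<^sup>2)"
    and X_sq_bound: "\<And>t p. t \<in> space \<mu> \<Longrightarrow> p < r \<Longrightarrow> pr.expectation (\<lambda>\<omega>. (X \<omega> t p)\<^sup>2) \<le> K"
begin

sublocale pair_sigma_finite P \<mu> ..

definition Q :: "nat \<Rightarrow> 'w \<Rightarrow> 't \<Rightarrow> real" where
  "Q l \<omega> t = (\<Sum>p<rs l. \<Sum>q<rs l. a l p q t * (X \<omega> t (off l + p) * X \<omega> t (off l + q)))"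

text \<open>Extended by 0 beyond \<open>R\<close>, so that the \<open>R\<close> statistics form a
  sequence as in the method of moments.\<close>

definition S :: "nat \<Rightarrow> 'w \<Rightarrow> real" where
  "S l \<omega> = (if l < R then \<integral>t. Q l \<omega> t \<partial>\<mu> else 0)"

text \<open>Two positions in a block and the sign inside the square that they contribute to the
  polarization of their product.\<close>

definition terms :: "nat \<Rightarrow> (nat \<times> nat \<times> real) set" where
  "terms l = (if l < R then {..<rs l} \<times> {..<rs l} \<times> {1, -1} else {})"

definition u :: "nat \<Rightarrow> nat \<times> nat \<times> real \<Rightarrow> 'w \<Rightarrow> 't \<Rightarrow> real" where
  "u l e \<omega> t = X \<omega> t (off l + fst e) + snd (snd e) * X \<omega> t (off l + fst (snd e))"

definition coef :: "real \<Rightarrow> nat \<Rightarrow> nat \<times> nat \<times> real \<Rightarrow> 't \<Rightarrow> real" where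
  "coef \<epsilon> l e t = - snd (snd e) * a l (fst e) (fst (snd e)) t / (2 * \<epsilon>\<^sup>2)"

text \<open>The two conditionals are added because both positions may coincide; then the frequency
  is 2 \<epsilon> or 0.\<close>

definition freq :: "real \<Rightarrow> nat \<Rightarrow> nat \<times> nat \<times> real \<Rightarrow> nat \<Rightarrow> real" where
  "freq \<epsilon> l e p = \<epsilon> * ((if p = off l + fst e then 1 else 0) + (if p = off l + fst (snd e) then snd (snd e)
    else 0))"

text \<open>A single random variable that bounds the error for all \<open>l\<close> at once, so one
  application of Markov's inequality suffices.\<close>

definition defect :: "real \<Rightarrow> 'w \<Rightarrow> real" where
  "defect \<epsilon> \<omega> = Ca / 4 * (\<Sum>l<R. \<Sum>e\<in>terms l. \<integral>t. sq_defect \<epsilon> (u l e \<omega> t) \<partial>\<mu>)"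

definition coef_bound :: "real \<Rightarrow> real" where
  "coef_bound \<epsilon> = (\<Sum>l<R. \<Sum>e\<in>terms l. Ca / (2 * \<epsilon>\<^sup>2))"

lemma finite_terms [simp]: "finite (terms l)" by (simp add: terms_def)

lemma termsD:
  assumes "e \<in> terms l"
  shows "l < R" "fst e < rs l" "fst (snd e) < rs l" "snd (snd e) = 1 \<or> snd (snd e) = -1"
    "off l + fst e < r" "off l + fst (snd e) < r"
  using assms off by (auto simp: terms_def split: if_splits)

lemma X_pair [measurable]: "p < r \<Longrightarrow> (\<lambda>z. X (fst z) (snd z) p) \<in> borel_measurable (P \<Otimes>\<^sub>M \<mu>)"
  using X[of p] by (simp add: case_prod_unfold)

lemma X_section: "p < r \<Longrightarrow> t \<in> space \<mu> \<Longrightarrow> (\<lambda>\<omega>. X \<omega> t p) \<in> borel_measurable P"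
  using measurable_compose[OF measurable_Pair2' X, of t p] by simp

lemma X_path_measurable: "p < r \<Longrightarrow> \<omega> \<in> space P \<Longrightarrow> (\<lambda>t. X \<omega> t p) \<in> borel_measurable \<mu>"
  using measurable_compose[OF measurable_Pair1' X, of \<omega> p] by simp

lemma cosine_functionals: "cosine_functionals P \<mu> r X terms (coef \<epsilon>) (coef_bound \<epsilon>)"
proof
  show "(\<lambda>(\<omega>, t). X \<omega> t p) \<in> borel_measurable (P \<Otimes>\<^sub>M \<mu>)" if "p < r" for p using X that .
  show "finite (terms l)" for l by simp
  show "coef \<epsilon> l e \<in> borel_measurable \<mu>" if "e \<in> terms l" for l e
    unfolding coef_def using termsD[OF that] a_measurable[of l "fst e" "fst (snd e)"] by measurable
  fix l t assume t: "t \<in> space \<mu>"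
  have "(\<Sum>e\<in>terms l. \<bar>coef \<epsilon> l e t\<bar>) \<le> (\<Sum>e\<in>terms l. Ca / (2 * \<epsilon>\<^sup>2))"
  proof (rule sum_mono)
    fix e assume e: "e \<in> terms l"
    have "\<bar>coef \<epsilon> l e t\<bar> = \<bar>a l (fst e) (fst (snd e)) t\<bar> / (2 * \<epsilon>\<^sup>2)"
      using termsD(4)[OF e] by (auto simp: coef_def abs_divide abs_mult)
    also have "\<dots> \<le> Ca / (2 * \<epsilon>\<^sup>2)" using termsD[OF e] t by (intro divide_right_mono a_bound) auto
    finally show "\<bar>coef \<epsilon> l e t\<bar> \<le> Ca / (2 * \<epsilon>\<^sup>2)" .
  qed
  also have "\<dots> \<le> coef_bound \<epsilon>"
  proof (cases "l < R")
    case True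
    then show ?thesis unfolding coef_bound_def using Ca
      by (intro member_le_sum[where f = "\<lambda>l. \<Sum>e\<in>terms l. Ca / (2 * \<epsilon>\<^sup>2)"]) (auto intro!: sum_nonneg)
  next
    case False
    then show ?thesis unfolding coef_bound_def using Ca by (auto simp: terms_def intro!: sum_nonneg)
  qed
  finally show "(\<Sum>e\<in>terms l. \<bar>coef \<epsilon> l e t\<bar>) \<le> coef_bound \<epsilon>" .
qed

abbreviation G where "G \<epsilon> \<equiv> cosine_functionals.G r X terms (coef \<epsilon>) (freq \<epsilon>)"
abbreviation I where "I \<epsilon> \<equiv> cosine_functionals.I \<mu> r X terms (coef \<epsilon>) (freq \<epsilon>)"

lemma freq_sum:
  assumes "e \<in> terms l"
  shows "(\<Sum>p<r. freq \<epsilon> l e p * X \<omega> t p) = \<epsilon> * u l e \<omega> t"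
proof -
  have "(\<Sum>p<r. freq \<epsilon> l e p * X \<omega> t p) = \<epsilon> * ((\<Sum>p<r. if p = off l + fst e then X \<omega> t p else 0) +
      (\<Sum>p<r. if p = off l + fst (snd e) then snd (snd e) * X \<omega> t p else 0))"
    unfolding sum.distrib[symmetric] sum_distrib_left freq_def by (intro sum.cong refl) (auto simp: algebra_simps)
  then show ?thesis using termsD(5,6)[OF assms] by (simp add: u_def)
qed

lemma sum_terms:
  fixes f :: "nat \<Rightarrow> nat \<Rightarrow> real \<Rightarrow> real"
  assumes "l < R"
  shows "(\<Sum>e\<in>terms l. f (fst e) (fst (snd e)) (snd (snd e))) = (\<Sum>p<rs l. \<Sum>q<rs l. f p q 1 + f p q (-1))"
proof -
  have "(\<Sum>e\<in>terms l. f (fst e) (fst (snd e)) (snd (snd e))) = (\<Sum>p<rs l. \<Sum>q<rs l. \<Sum>s\<in>{1, -1}. f p q s)"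
    using assms unfolding terms_def by (simp only: if_True sum.cartesian_product) (simp add: case_prod_unfold)
  then show ?thesis by simp
qed

lemma Q_minus_G:
  assumes l: "l < R" and t: "t \<in> space \<mu>" and \<epsilon>: "\<epsilon> \<noteq> 0"
  shows "\<bar>Q l \<omega> t - G \<epsilon> l \<omega> t\<bar> \<le> Ca / 4 * (\<Sum>e\<in>terms l. sq_defect \<epsilon> (u l e \<omega> t))"
proof -
  interpret c: cosine_functionals P \<mu> r X terms "coef \<epsilon>" "freq \<epsilon>" "coef_bound \<epsilon>" by (rule cosine_functionals)
  have G: "G \<epsilon> l \<omega> t = (\<Sum>e\<in>terms l. coef \<epsilon> l e t * cos (\<epsilon> * u l e \<omega> t))"
    unfolding c.G_def using freq_sum by (intro sum.cong refl) simp
  have "Q l \<omega> t - (\<Sum>e\<in>terms l. coef \<epsilon> l e t * cos (\<epsilon> * u l e \<omega> t)) =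
    (\<Sum>e\<in>terms l. snd (snd e) * a l (fst e) (fst (snd e)) t / 4 * sq_defect \<epsilon> (u l e \<omega> t))"
    unfolding coef_def u_def Q_def sum_terms[OF l, where f = "\<lambda>p q s. - s * a l p q t / (2 * \<epsilon>\<^sup>2) * cos (\<epsilon> *
      (X \<omega> t (off l + p) + s * X \<omega> t (off l + q)))"]
      sum_terms[OF l, where f = "\<lambda>p q s. s * a l p q t / 4 * sq_defect \<epsilon> (X \<omega> t (off l + p) + s * X \<omega> t (off l
        + q))"]
      sum_subtractf[symmetric]
    by (intro sum.cong refl polarization_defect)
  then have "\<bar>Q l \<omega> t - G \<epsilon> l \<omega> t\<bar> \<le> (\<Sum>e\<in>terms l. \<bar>snd (snd e) * a l (fst e) (fst (snd e)) t / 4 * sq_defect \<epsilon>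
    (u l e \<omega> t)\<bar>)"
    unfolding G by (simp only: sum_abs)
  also have "\<dots> \<le> (\<Sum>e\<in>terms l. Ca / 4 * sq_defect \<epsilon> (u l e \<omega> t))"
  proof (rule sum_mono)
    fix e assume e: "e \<in> terms l"
    have "\<bar>snd (snd e) * a l (fst e) (fst (snd e)) t / 4\<bar> \<le> Ca / 4"
      using termsD(4)[OF e] a_bound[OF termsD(1-3)[OF e] t] by (auto simp: abs_mult)
    then show "\<bar>snd (snd e) * a l (fst e) (fst (snd e)) t / 4 * sq_defect \<epsilon> (u l e \<omega> t)\<bar> \<le> Ca / 4 * sq_defect
      \<epsilon> (u l e \<omega> t)"
      unfolding abs_mult[of _ "sq_defect \<epsilon> _"] abs_of_nonneg[OF sq_defect_bounds(1)[OF \<epsilon>]]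
      by (intro mult_right_mono sq_defect_bounds(1) \<epsilon>)
  qed
  finally show ?thesis by (simp only: sum_distrib_left)
qed

lemma mult_bound: "\<bar>y * z\<bar> \<le> y\<^sup>2 + (z :: real)\<^sup>2"
proof -
  have "2 * \<bar>y\<bar> * \<bar>z\<bar> \<le> y\<^sup>2 + z\<^sup>2" using sum_squares_bound[of "\<bar>y\<bar>" "\<bar>z\<bar>"] by simp
  moreover have "0 \<le> \<bar>y\<bar> * \<bar>z\<bar>" by simp
  ultimately show ?thesis unfolding abs_mult by linarith
qed

lemma u_sq_bound:
  assumes "e \<in> terms l"
  shows "(u l e \<omega> t)\<^sup>2 \<le> 2 * ((X \<omega> t (off l + fst e))\<^sup>2 + (X \<omega> t (off l + fst (snd e)))\<^sup>2)"
proof -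
  have *: "(y + z)\<^sup>2 \<le> 2 * (y\<^sup>2 + z\<^sup>2)" "(y - z)\<^sup>2 \<le> 2 * (y\<^sup>2 + z\<^sup>2)" for y z :: real
    using zero_le_power2[of "y - z"] zero_le_power2[of "y + z"] by (simp_all add: power2_sum power2_diff)
  show ?thesis using termsD(4)[OF assms] *[of "X \<omega> t (off l + fst e)" "X \<omega> t (off l + fst (snd e))"]
    unfolding u_def by auto
qed

lemma X_sq_pair_integrable: "p < r \<Longrightarrow> integrable (P \<Otimes>\<^sub>M \<mu>) (\<lambda>z. (X (fst z) (snd z) p)\<^sup>2)"
proof (rule integrableI_bounded)
  assume p: "p < r"
  show "(\<lambda>z. (X (fst z) (snd z) p)\<^sup>2) \<in> borel_measurable (P \<Otimes>\<^sub>M \<mu>)" using p by measurable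
  have "(\<integral>\<^sup>+z. ennreal (norm ((X (fst z) (snd z) p)\<^sup>2)) \<partial>(P \<Otimes>\<^sub>M \<mu>)) =
      (\<integral>\<^sup>+t. \<integral>\<^sup>+\<omega>. ennreal ((X \<omega> t p)\<^sup>2) \<partial>P \<partial>\<mu>)"
    using p by (subst nn_integral_snd[symmetric]) (auto simp: case_prod_unfold)
  also have "\<dots> \<le> (\<integral>\<^sup>+t. ennreal K \<partial>\<mu>)"
  proof (rule nn_integral_mono)
    fix t assume t: "t \<in> space \<mu>"
    have "(\<integral>\<^sup>+\<omega>. ennreal ((X \<omega> t p)\<^sup>2) \<partial>P) = ennreal (pr.expectation (\<lambda>\<omega>. (X \<omega> t p)\<^sup>2))"
      by (intro nn_integral_eq_integral X_sq t p) auto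
    also have "\<dots> \<le> ennreal K" by (intro ennreal_leI X_sq_bound t p)
    finally show "(\<integral>\<^sup>+\<omega>. ennreal ((X \<omega> t p)\<^sup>2) \<partial>P) \<le> ennreal K" .
  qed
  also have "\<dots> < \<infinity>" by (simp add: mu.emeasure_eq_measure ennreal_mult_less_top)
  finally show "(\<integral>\<^sup>+z. ennreal (norm ((X (fst z) (snd z) p)\<^sup>2)) \<partial>(P \<Otimes>\<^sub>M \<mu>)) < \<infinity>" .
qed

lemma defect_pair_integrable:
  assumes e: "e \<in> terms l" and \<epsilon>: "\<epsilon> \<noteq> 0"
  shows "integrable (P \<Otimes>\<^sub>M \<mu>) (\<lambda>(\<omega>, t). sq_defect \<epsilon> (u l e \<omega> t))"
proof (rule Bochner_Integration.integrable_bound)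
  note [measurable] = X_pair[OF termsD(5)[OF e]] X_pair[OF termsD(6)[OF e]]
  show "integrable (P \<Otimes>\<^sub>M \<mu>) (\<lambda>z. 2 * ((X (fst z) (snd z) (off l + fst e))\<^sup>2 + (X (fst z) (snd z) (off l + fst
    (snd e)))\<^sup>2))"
    using X_sq_pair_integrable termsD[OF e] by auto
  show "(\<lambda>(\<omega>, t). sq_defect \<epsilon> (u l e \<omega> t)) \<in> borel_measurable (P \<Otimes>\<^sub>M \<mu>)"
    unfolding u_def case_prod_unfold by measurable
  show "AE z in P \<Otimes>\<^sub>M \<mu>. norm (case z of (\<omega>, t) \<Rightarrow> sq_defect \<epsilon> (u l e \<omega> t)) \<le>
      norm (2 * ((X (fst z) (snd z) (off l + fst e))\<^sup>2 + (X (fst z) (snd z) (off l + fst (snd e)))\<^sup>2))"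
    using order_trans[OF sq_defect_bounds(2)[OF \<epsilon>] u_sq_bound[OF e]] sq_defect_bounds(1)[OF \<epsilon>]
    by (intro AE_I2) (auto simp: case_prod_unfold)
qed

lemma u_path_integrable:
  assumes e: "e \<in> terms l" and \<epsilon>: "\<epsilon> \<noteq> 0" and \<omega>: "\<omega> \<in> space P"
  shows "integrable \<mu> (\<lambda>t. sq_defect \<epsilon> (u l e \<omega> t))"
proof (rule Bochner_Integration.integrable_bound)
  note [measurable] = X_path_measurable[OF termsD(5)[OF e] \<omega>] X_path_measurable[OF termsD(6)[OF e] \<omega>]
  show "integrable \<mu> (\<lambda>t. 2 * ((X \<omega> t (off l + fst e))\<^sup>2 + (X \<omega> t (off l + fst (snd e)))\<^sup>2))"
    using X_path[OF \<omega>] termsD[OF e] by auto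
  show "(\<lambda>t. sq_defect \<epsilon> (u l e \<omega> t)) \<in> borel_measurable \<mu>" unfolding u_def by measurable
  show "AE t in \<mu>. norm (sq_defect \<epsilon> (u l e \<omega> t)) \<le> norm (2 * ((X \<omega> t (off l + fst e))\<^sup>2 + (X \<omega> t (off l + fst
    (snd e)))\<^sup>2))"
    using order_trans[OF sq_defect_bounds(2)[OF \<epsilon>] u_sq_bound[OF e]] sq_defect_bounds(1)[OF \<epsilon>]
    by (intro AE_I2) auto
qed

lemma Q_path_integrable:
  assumes l: "l < R" and \<omega>: "\<omega> \<in> space P"
  shows "integrable \<mu> (Q l \<omega>)"
  unfolding Q_def
proof (intro Bochner_Integration.integrable_sum)
  fix p q assume "p \<in> {..<rs l}" "q \<in> {..<rs l}"
  then have pq: "p < rs l" "q < rs l" "off l + p < r" "off l + q < r" using off[OF l] by auto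
  note [measurable] = X_path_measurable[OF pq(3) \<omega>] X_path_measurable[OF pq(4) \<omega>] a_measurable[OF l pq(1,2)]
  show "integrable \<mu> (\<lambda>t. a l p q t * (X \<omega> t (off l + p) * X \<omega> t (off l + q)))"
  proof (rule Bochner_Integration.integrable_bound)
    show "integrable \<mu> (\<lambda>t. Ca * ((X \<omega> t (off l + p))\<^sup>2 + (X \<omega> t (off l + q))\<^sup>2))" using X_path[OF \<omega>] pq by auto
    show "AE t in \<mu>. norm (a l p q t * (X \<omega> t (off l + p) * X \<omega> t (off l + q))) \<le> norm (Ca * ((X \<omega> t (off l +
      p))\<^sup>2 + (X \<omega> t (off l + q))\<^sup>2))"
    proof (rule AE_I2)
      fix t assume t: "t \<in> space \<mu>"
      have "\<bar>a l p q t * (X \<omega> t (off l + p) * X \<omega> t (off l + q))\<bar> \<le> Ca * ((X \<omega> t (off l + p))\<^sup>2 + (X \<omega> t (off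
        l + q))\<^sup>2)"
        unfolding abs_mult[of "a l p q t"] by (intro mult_mono a_bound[OF l pq(1,2) t] mult_bound Ca) auto
      then show "norm (a l p q t * (X \<omega> t (off l + p) * X \<omega> t (off l + q))) \<le> norm (Ca * ((X \<omega> t (off l +
        p))\<^sup>2 + (X \<omega> t (off l + q))\<^sup>2))"
        by simp
    qed
  qed measurable
qed

lemma S_measurable: "S l \<in> borel_measurable P"
proof (cases "l < R")
  case True
  have "(\<lambda>(\<omega>, t). Q l \<omega> t) \<in> borel_measurable (P \<Otimes>\<^sub>M \<mu>)"
    unfolding Q_def case_prod_unfold
  proof (intro borel_measurable_sum borel_measurable_times)
    fix p q assume pq: "p \<in> {..<rs l}" "q \<in> {..<rs l}"
    show "(\<lambda>z. a l p q (snd z)) \<in> borel_measurable (P \<Otimes>\<^sub>M \<mu>)"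
      using a_measurable[OF True, of p q] pq by (intro measurable_compose[OF measurable_snd]) auto
    show "(\<lambda>z. X (fst z) (snd z) (off l + p)) \<in> borel_measurable (P \<Otimes>\<^sub>M \<mu>)"
      "(\<lambda>z. X (fst z) (snd z) (off l + q)) \<in> borel_measurable (P \<Otimes>\<^sub>M \<mu>)"
      using X_pair off[OF True] pq by auto
  qed
  then show ?thesis using True unfolding S_def[abs_def] by (simp add: mu.borel_measurable_lebesgue_integral)
next
  case False
  then show ?thesis by (simp add: S_def[abs_def])
qed

lemma defect_nonneg: "\<epsilon> \<noteq> 0 \<Longrightarrow> 0 \<le> defect \<epsilon> \<omega>"
  unfolding defect_def using Ca sq_defect_bounds(1)[of \<epsilon>] by (intro mult_nonneg_nonneg sum_nonneg) auto

lemma S_minus_I: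
  assumes \<omega>: "\<omega> \<in> space P" and \<epsilon>: "\<epsilon> \<noteq> 0"
  shows "\<bar>S l \<omega> - I \<epsilon> l \<omega>\<bar> \<le> defect \<epsilon> \<omega>"
proof -
  interpret c: cosine_functionals P \<mu> r X terms "coef \<epsilon>" "freq \<epsilon>" "coef_bound \<epsilon>" by (rule cosine_functionals)
  have nonneg: "0 \<le> (\<Sum>e\<in>terms l. \<integral>t. sq_defect \<epsilon> (u l e \<omega> t) \<partial>\<mu>)" for l
    using sq_defect_bounds(1)[OF \<epsilon>] by (intro sum_nonneg) simp
  show ?thesis
  proof (cases "l < R")
    case True
    have Gint: "integrable \<mu> (G \<epsilon> l \<omega>)"
    proof (rule mu.integrable_const_bound[where B = "coef_bound \<epsilon>"])
      show "AE t in \<mu>. norm (G \<epsilon> l \<omega> t) \<le> coef_bound \<epsilon>" using c.G_bound by (intro AE_I2) simp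
      show "G \<epsilon> l \<omega> \<in> borel_measurable \<mu>"
        using measurable_compose[OF measurable_Pair1'[OF \<omega>] c.G_measurable[of l]] by simp
    qed
    have eq: "S l \<omega> - I \<epsilon> l \<omega> = (\<integral>t. Q l \<omega> t - G \<epsilon> l \<omega> t \<partial>\<mu>)"
      unfolding S_def c.I_def using True Q_path_integrable[OF True \<omega>] Gint by simp
    have "\<bar>S l \<omega> - I \<epsilon> l \<omega>\<bar> \<le> (\<integral>t. Ca / 4 * (\<Sum>e\<in>terms l. sq_defect \<epsilon> (u l e \<omega> t)) \<partial>\<mu>)"
      unfolding eq
    proof (rule abs_integral_le)
      show "integrable \<mu> (\<lambda>t. Q l \<omega> t - G \<epsilon> l \<omega> t)"
        by (intro Bochner_Integration.integrable_diff Q_path_integrable[OF True \<omega>] Gint)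
      show "integrable \<mu> (\<lambda>t. Ca / 4 * (\<Sum>e\<in>terms l. sq_defect \<epsilon> (u l e \<omega> t)))"
        by (intro Bochner_Integration.integrable_mult_right Bochner_Integration.integrable_sum
          u_path_integrable[OF _ \<epsilon> \<omega>])
      show "\<bar>Q l \<omega> t - G \<epsilon> l \<omega> t\<bar> \<le> Ca / 4 * (\<Sum>e\<in>terms l. sq_defect \<epsilon> (u l e \<omega> t))" if "t \<in> space \<mu>" for t
        by (rule Q_minus_G[OF True that \<epsilon>])
    qed
    also have "\<dots> = Ca / 4 * (\<Sum>e\<in>terms l. \<integral>t. sq_defect \<epsilon> (u l e \<omega> t) \<partial>\<mu>)"
      using u_path_integrable[OF _ \<epsilon> \<omega>] by simp
    also have "\<dots> \<le> defect \<epsilon> \<omega>"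
      unfolding defect_def using True Ca nonneg by (intro mult_left_mono member_le_sum) auto
    finally show ?thesis .
  next
    case False
    then have "S l \<omega> = 0" "I \<epsilon> l \<omega> = 0" by (simp_all add: S_def c.I_def c.G_def terms_def)
    then show ?thesis using defect_nonneg[OF \<epsilon>, of \<omega>] by simp
  qed
qed

text \<open>Fubini's theorem reduces the mean error to second moments and characteristic functions
  at a single time, and these are what converges.\<close>

lemma
  assumes \<epsilon>: "\<epsilon> \<noteq> 0"
  shows integrable_defect: "integrable P (defect \<epsilon>)"
    and expectation_defect: "pr.expectation (defect \<epsilon>) =
      Ca / 4 * (\<Sum>l<R. \<Sum>e\<in>terms l. \<integral>t. pr.expectation (\<lambda>\<omega>. sq_defect \<epsilon> (u l e \<omega> t)) \<partial>\<mu>)"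
proof -
  have i: "integrable P (\<lambda>\<omega>. \<integral>t. sq_defect \<epsilon> (u l e \<omega> t) \<partial>\<mu>)" if "e \<in> terms l" for l e
    using integrable_fst[OF defect_pair_integrable[OF that \<epsilon>]] by simp
  show "integrable P (defect \<epsilon>)" unfolding defect_def[abs_def]
    by (intro Bochner_Integration.integrable_mult_right Bochner_Integration.integrable_sum i)
  have "pr.expectation (defect \<epsilon>) = Ca / 4 * (\<Sum>l<R. \<Sum>e\<in>terms l. pr.expectation (\<lambda>\<omega>. \<integral>t. sq_defect \<epsilon> (u l e \<omega>
    t) \<partial>\<mu>))"
    unfolding defect_def[abs_def] using i by simp
  also have "\<dots> = Ca / 4 * (\<Sum>l<R. \<Sum>e\<in>terms l. \<integral>t. pr.expectation (\<lambda>\<omega>. sq_defect \<epsilon> (u l e \<omega> t)) \<partial>\<mu>)"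
    using Fubini_integral[OF defect_pair_integrable[OF _ \<epsilon>]] by simp
  finally show "pr.expectation (defect \<epsilon>) =
      Ca / 4 * (\<Sum>l<R. \<Sum>e\<in>terms l. \<integral>t. pr.expectation (\<lambda>\<omega>. sq_defect \<epsilon> (u l e \<omega> t)) \<partial>\<mu>)" .
qed

lemma u_sq_integrable:
  assumes e: "e \<in> terms l" and t: "t \<in> space \<mu>"
  shows "integrable P (\<lambda>\<omega>. (u l e \<omega> t)\<^sup>2)" "pr.expectation (\<lambda>\<omega>. (u l e \<omega> t)\<^sup>2) \<le> 4 * K"
    "(\<lambda>\<omega>. u l e \<omega> t) \<in> borel_measurable P"
proof -
  note [measurable] = X_section[OF termsD(5)[OF e] t] X_section[OF termsD(6)[OF e] t]
  show m: "(\<lambda>\<omega>. u l e \<omega> t) \<in> borel_measurable P" unfolding u_def by measurable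
  have b: "integrable P (\<lambda>\<omega>. 2 * ((X \<omega> t (off l + fst e))\<^sup>2 + (X \<omega> t (off l + fst (snd e)))\<^sup>2))"
    using X_sq[OF t] termsD[OF e] by auto
  show i: "integrable P (\<lambda>\<omega>. (u l e \<omega> t)\<^sup>2)"
    by (rule Bochner_Integration.integrable_bound[OF b]) (use m u_sq_bound[OF e] in auto)
  have "pr.expectation (\<lambda>\<omega>. (u l e \<omega> t)\<^sup>2) \<le> pr.expectation (\<lambda>\<omega>. 2 * ((X \<omega> t (off l + fst e))\<^sup>2 + (X \<omega> t (off
    l + fst (snd e)))\<^sup>2))"
    by (rule integral_mono[OF i b u_sq_bound[OF e]])
  also have "\<dots> \<le> 2 * (K + K)"
    using X_sq[OF t termsD(5)[OF e]] X_sq[OF t termsD(6)[OF e]] X_sq_bound[OF t termsD(5)[OF e]] X_sq_bound[OF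
      t termsD(6)[OF e]] by simp
  finally show "pr.expectation (\<lambda>\<omega>. (u l e \<omega> t)\<^sup>2) \<le> 4 * K" by simp
qed

text \<open>Bounds every \<open>S l\<close> at once, with an expectation controlled by the constants
  of the locale. It will absorb the relative error made by replacing the estimated
  variances.\<close>

definition S_bound :: "'w \<Rightarrow> real" where
  "S_bound \<omega> = Ca * (\<Sum>l<R. \<Sum>p<rs l. \<Sum>q<rs l. \<integral>t. (X \<omega> t (off l + p))\<^sup>2 + (X \<omega> t (off l + q))\<^sup>2 \<partial>\<mu>)"

lemma S_le_S_bound:
  assumes \<omega>: "\<omega> \<in> space P"
  shows "\<bar>S l \<omega>\<bar> \<le> S_bound \<omega>" "0 \<le> S_bound \<omega>"
proof -
  have nonneg: "0 \<le> (\<Sum>p<rs l. \<Sum>q<rs l. \<integral>t. (X \<omega> t (off l + p))\<^sup>2 + (X \<omega> t (off l + q))\<^sup>2 \<partial>\<mu>)" for l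
    by (intro sum_nonneg) simp
  show 0: "0 \<le> S_bound \<omega>" unfolding S_bound_def by (intro mult_nonneg_nonneg Ca sum_nonneg[OF nonneg])
  show "\<bar>S l \<omega>\<bar> \<le> S_bound \<omega>"
  proof (cases "l < R")
    case True
    have i: "integrable \<mu> (\<lambda>t. (X \<omega> t (off l + p))\<^sup>2 + (X \<omega> t (off l + q))\<^sup>2)" if "p < rs l" "q < rs l" for p q
      using X_path[OF \<omega>] off[OF True] that by auto
    have "\<bar>S l \<omega>\<bar> \<le> (\<integral>t. (\<Sum>p<rs l. \<Sum>q<rs l. Ca * ((X \<omega> t (off l + p))\<^sup>2 + (X \<omega> t (off l + q))\<^sup>2)) \<partial>\<mu>)"
      unfolding S_def if_P[OF True]
    proof (rule abs_integral_le[OF Q_path_integrable[OF True \<omega>]])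
      show "integrable \<mu> (\<lambda>t. \<Sum>p<rs l. \<Sum>q<rs l. Ca * ((X \<omega> t (off l + p))\<^sup>2 + (X \<omega> t (off l + q))\<^sup>2))"
        using i by (intro Bochner_Integration.integrable_sum Bochner_Integration.integrable_mult_right) auto
      fix t assume t: "t \<in> space \<mu>"
      have "\<bar>Q l \<omega> t\<bar> \<le> (\<Sum>p<rs l. \<Sum>q<rs l. \<bar>a l p q t * (X \<omega> t (off l + p) * X \<omega> t (off l + q))\<bar>)"
        unfolding Q_def by (rule order_trans[OF sum_abs sum_mono[OF sum_abs]])
      also have "\<dots> \<le> (\<Sum>p<rs l. \<Sum>q<rs l. Ca * ((X \<omega> t (off l + p))\<^sup>2 + (X \<omega> t (off l + q))\<^sup>2))"
        unfolding abs_mult[of "a l _ _ t"] by (intro sum_mono mult_mono mult_bound a_bound[OF True _ _ t] Ca) auto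
      finally show "\<bar>Q l \<omega> t\<bar> \<le> (\<Sum>p<rs l. \<Sum>q<rs l. Ca * ((X \<omega> t (off l + p))\<^sup>2 + (X \<omega> t (off l + q))\<^sup>2))" .
    qed
    also have "\<dots> = (\<Sum>p<rs l. \<Sum>q<rs l. \<integral>t. Ca * ((X \<omega> t (off l + p))\<^sup>2 + (X \<omega> t (off l + q))\<^sup>2) \<partial>\<mu>)"
      using i by (intro integral_double_sum Bochner_Integration.integrable_mult_right) auto
    also have "\<dots> = Ca * (\<Sum>p<rs l. \<Sum>q<rs l. \<integral>t. (X \<omega> t (off l + p))\<^sup>2 + (X \<omega> t (off l + q))\<^sup>2 \<partial>\<mu>)"
      by (simp only: sum_distrib_left integral_mult_right_zero)
    also have "\<dots> \<le> S_bound \<omega>"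
      unfolding S_bound_def using True Ca nonneg by (intro mult_left_mono member_le_sum) auto
    finally show ?thesis .
  next
    case False
    then show ?thesis using 0 by (simp add: S_def)
  qed
qed

lemma
  shows integrable_S_bound: "integrable P S_bound"
    and expectation_S_bound: "pr.expectation S_bound \<le> Ca * (\<Sum>l<R. \<Sum>p<rs l. \<Sum>q<rs l. 2 * K * measure \<mu> (space \<mu>))"
proof -
  let ?f = "\<lambda>l p q \<omega> t. (X \<omega> t (off l + p))\<^sup>2 + (X \<omega> t (off l + q))\<^sup>2"
  have pint: "integrable (P \<Otimes>\<^sub>M \<mu>) (\<lambda>(\<omega>, t). ?f l p q \<omega> t)" if "l < R" "p < rs l" "q < rs l" for l p q
    using X_sq_pair_integrable off that by (auto simp: case_prod_unfold)
  have i: "integrable P (\<lambda>\<omega>. \<integral>t. ?f l p q \<omega> t \<partial>\<mu>)" if "l < R" "p < rs l" "q < rs l" for l p q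
    using integrable_fst[OF pint[OF that]] by simp
  have E: "pr.expectation (\<lambda>\<omega>. \<integral>t. ?f l p q \<omega> t \<partial>\<mu>) \<le> 2 * K * measure \<mu> (space \<mu>)" if "l < R" "p < rs l" "q <
    rs l" for l p q
  proof -
    have "pr.expectation (\<lambda>\<omega>. \<integral>t. ?f l p q \<omega> t \<partial>\<mu>) = (\<integral>t. pr.expectation (\<lambda>\<omega>. ?f l p q \<omega> t) \<partial>\<mu>)"
      by (rule Fubini_integral[OF pint[OF that], symmetric])
    also have "\<dots> \<le> (\<integral>t. 2 * K \<partial>\<mu>)"
    proof (rule integral_mono)
      show "integrable \<mu> (\<lambda>t. pr.expectation (\<lambda>\<omega>. ?f l p q \<omega> t))" using integrable_snd[OF pint[OF that]] by simp
      show "pr.expectation (\<lambda>\<omega>. ?f l p q \<omega> t) \<le> 2 * K" if t: "t \<in> space \<mu>" for t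
      proof -
        have pq: "off l + p < r" "off l + q < r" using off \<open>l < R\<close> \<open>p < rs l\<close> \<open>q < rs l\<close> by auto
        have "pr.expectation (\<lambda>\<omega>. ?f l p q \<omega> t) = pr.expectation (\<lambda>\<omega>. (X \<omega> t (off l + p))\<^sup>2) + pr.expectation
          (\<lambda>\<omega>. (X \<omega> t (off l + q))\<^sup>2)"
          by (rule Bochner_Integration.integral_add[OF X_sq[OF t pq(1)] X_sq[OF t pq(2)]])
        then show ?thesis using X_sq_bound[OF t pq(1)] X_sq_bound[OF t pq(2)] by linarith
      qed
    qed simp
    finally show ?thesis by (simp add: mult_ac)
  qed
  show "integrable P S_bound" unfolding S_bound_def[abs_def]
    using i by (intro Bochner_Integration.integrable_mult_right Bochner_Integration.integrable_sum) auto
  have "pr.expectation S_bound = Ca * (\<Sum>l<R. \<Sum>p<rs l. \<Sum>q<rs l. pr.expectation (\<lambda>\<omega>. \<integral>t. ?f l p q \<omega> t \<partial>\<mu>))"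
  proof -
    have "pr.expectation (\<lambda>\<omega>. \<Sum>l<R. \<Sum>p<rs l. \<Sum>q<rs l. \<integral>t. ?f l p q \<omega> t \<partial>\<mu>) =
        (\<Sum>l<R. pr.expectation (\<lambda>\<omega>. \<Sum>p<rs l. \<Sum>q<rs l. \<integral>t. ?f l p q \<omega> t \<partial>\<mu>))"
      using i by (intro Bochner_Integration.integral_sum Bochner_Integration.integrable_sum) auto
    also have "\<dots> = (\<Sum>l<R. \<Sum>p<rs l. \<Sum>q<rs l. pr.expectation (\<lambda>\<omega>. \<integral>t. ?f l p q \<omega> t \<partial>\<mu>))"
      using i by (intro sum.cong refl integral_double_sum) auto
    finally show ?thesis unfolding S_bound_def[abs_def] integral_mult_right_zero by (rule arg_cong)
  qed
  also have "\<dots> \<le> Ca * (\<Sum>l<R. \<Sum>p<rs l. \<Sum>q<rs l. 2 * K * measure \<mu> (space \<mu>))"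
    using E Ca by (intro mult_left_mono sum_mono) auto
  finally show "pr.expectation S_bound \<le> Ca * (\<Sum>l<R. \<Sum>p<rs l. \<Sum>q<rs l. 2 * K * measure \<mu> (space \<mu>))" .
qed

end

text \<open>The mean of \<open>sq_defect\<close> is a second moment minus a multiple of 1 - E cos,
  and both converge. Hence an \<epsilon> that makes the mean error small for the limit makes it
  small for all large \<open>m\<close>. The conclusion has the shape required by
  \<open>outer_expectation_tendsto_of_approximation\<close>.\<close>

theorem quadratic_functionals_approximation:
  fixes X :: "nat \<Rightarrow> 'w \<Rightarrow> 't \<Rightarrow> nat \<Rightarrow> real" and Z :: "'z \<Rightarrow> 't \<Rightarrow> nat \<Rightarrow> real"
  assumes X: "\<And>m. quadratic_functionals M \<mu> r R (X m) rs off a Ca K"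
    and Z: "quadratic_functionals N \<mu> r R Z rs off a Ca K"
    and fidi: "\<And>F u. finite F \<Longrightarrow> F \<subseteq> space \<mu> \<Longrightarrow>
      (\<lambda>m. \<integral>\<omega>. cos (\<Sum>t\<in>F. \<Sum>p<r. u t p * X m \<omega> t p) \<partial>M) \<longlonglongrightarrow> (\<integral>\<omega>. cos (\<Sum>t\<in>F. \<Sum>p<r. u t p * Z \<omega> t p) \<partial>N)"
    and second: "\<And>t p q s. t \<in> space \<mu> \<Longrightarrow> p < r \<Longrightarrow> q < r \<Longrightarrow> s = 1 \<or> s = -1 \<Longrightarrow>
      (\<lambda>m. \<integral>\<omega>. (X m \<omega> t p + s * X m \<omega> t q)\<^sup>2 \<partial>M) \<longlonglongrightarrow> (\<integral>\<omega>. (Z \<omega> t p + s * Z \<omega> t q)\<^sup>2 \<partial>N)"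
    and \<eta>: "0 < \<eta>"
  shows "\<exists>A A'.
    (\<forall>m l. (\<lambda>\<omega>. A m \<omega> l) \<in> borel_measurable M) \<and> (\<forall>l. (\<lambda>\<omega>. A' \<omega> l) \<in> borel_measurable N) \<and>
    (\<forall>\<Phi> :: (nat \<Rightarrow> real) \<Rightarrow> real. continuous_on UNIV \<Phi> \<longrightarrow> (\<lambda>m. \<integral>\<omega>. \<Phi> (A m \<omega>) \<partial>M) \<longlonglongrightarrow> (\<integral>\<omega>. \<Phi> (A' \<omega>) \<partial>N)) \<and>
    (\<forall>\<^sub>F m in sequentially. \<exists>G\<in>sets M. measure M G \<ge> 1 - \<eta> \<and>
      (\<forall>\<omega>\<in>G. \<forall>l. \<bar>quadratic_functionals.S \<mu> R (X m) rs off a l \<omega> - A m \<omega> l\<bar> \<le> \<eta>)) \<and>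
    (\<exists>G\<in>sets N. measure N G \<ge> 1 - \<eta> \<and>
      (\<forall>\<omega>\<in>G. \<forall>l. \<bar>quadratic_functionals.S \<mu> R Z rs off a l \<omega> - A' \<omega> l\<bar> \<le> \<eta>))"
proof -
  interpret X: quadratic_functionals M \<mu> r R "X m" rs off a Ca K for m by (rule X)
  interpret Z: quadratic_functionals N \<mu> r R Z rs off a Ca K by (rule Z)
  let ?terms = "Z.terms"
  have eN: "(\<integral>\<omega>. sq_defect \<epsilon> (Z.u l e \<omega> t) \<partial>N) = (\<integral>\<omega>. (Z.u l e \<omega> t)\<^sup>2 \<partial>N) - 2 / \<epsilon>\<^sup>2 * (1 - (\<integral>\<omega>. cos (\<epsilon> * Z.u l
    e \<omega> t) \<partial>N))"
    if e: "e \<in> ?terms l" and t: "t \<in> space \<mu>" for \<epsilon> l e t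
  proof -
    note u = Z.u_sq_integrable[OF e t]
    have "integrable N (\<lambda>\<omega>. cos (\<epsilon> * Z.u l e \<omega> t))"
      by (rule Z.pr.integrable_const_bound[where B = 1]) (use u(3) in auto)
    then show ?thesis unfolding sq_defect_def using u(1) by (simp add: Z.pr.prob_space)
  qed
  have eM: "(\<integral>\<omega>. sq_defect \<epsilon> (X.u m l e \<omega> t) \<partial>M) = (\<integral>\<omega>. (X.u m l e \<omega> t)\<^sup>2 \<partial>M) - 2 / \<epsilon>\<^sup>2 * (1 - (\<integral>\<omega>. cos (\<epsilon> *
    X.u m l e \<omega> t) \<partial>M))"
    if e: "e \<in> X.terms l" and t: "t \<in> space \<mu>" for \<epsilon> l e t m
  proof -
    note u = X.u_sq_integrable[OF e t, of m]
    have "integrable M (\<lambda>\<omega>. cos (\<epsilon> * X.u m l e \<omega> t))"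
      by (rule X.pr.integrable_const_bound[where B = 1]) (use u(3) in auto)
    then show ?thesis unfolding sq_defect_def using u(1) by (simp add: X.pr.prob_space)
  qed
  have bM: "\<bar>\<integral>\<omega>. sq_defect \<epsilon> (X.u m l e \<omega> t) \<partial>M\<bar> \<le> 4 * K" if \<epsilon>: "\<epsilon> \<noteq> 0" and e: "e \<in> X.terms l" and t: "t \<in>
    space \<mu>" for \<epsilon> l e t m
  proof -
    note u = X.u_sq_integrable[OF e t, of m]
    have "(\<integral>\<omega>. sq_defect \<epsilon> (X.u m l e \<omega> t) \<partial>M) \<le> (\<integral>\<omega>. (X.u m l e \<omega> t)\<^sup>2 \<partial>M)"
      using sq_defect_bounds[OF \<epsilon>] u by (intro integral_mono Bochner_Integration.integrable_bound[OF u(1)])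
        (auto simp: measurable_compose[OF _ sq_defect_measurable])
    moreover have "0 \<le> (\<integral>\<omega>. sq_defect \<epsilon> (X.u m l e \<omega> t) \<partial>M)" using sq_defect_bounds(1)[OF \<epsilon>] by simp
    ultimately show ?thesis using u(2) by simp
  qed
  have bN: "\<bar>\<integral>\<omega>. sq_defect \<epsilon> (Z.u l e \<omega> t) \<partial>N\<bar> \<le> 4 * K" if \<epsilon>: "\<epsilon> \<noteq> 0" and e: "e \<in> ?terms l" and t: "t \<in> space
    \<mu>" for \<epsilon> l e t
  proof -
    note u = Z.u_sq_integrable[OF e t]
    have "(\<integral>\<omega>. sq_defect \<epsilon> (Z.u l e \<omega> t) \<partial>N) \<le> (\<integral>\<omega>. (Z.u l e \<omega> t)\<^sup>2 \<partial>N)"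
      using sq_defect_bounds[OF \<epsilon>] u by (intro integral_mono Bochner_Integration.integrable_bound[OF u(1)])
        (auto simp: measurable_compose[OF _ sq_defect_measurable])
    moreover have "0 \<le> (\<integral>\<omega>. sq_defect \<epsilon> (Z.u l e \<omega> t) \<partial>N)" using sq_defect_bounds(1)[OF \<epsilon>] by simp
    ultimately show ?thesis using u(2) by simp
  qed
  have mM: "(\<lambda>t. \<integral>\<omega>. sq_defect \<epsilon> (X.u m l e \<omega> t) \<partial>M) \<in> borel_measurable \<mu>" if "\<epsilon> \<noteq> 0" "e \<in> X.terms l" for \<epsilon> l e m
    using X.integrable_snd[OF X.defect_pair_integrable[OF that(2,1)]] by auto
  have mN: "(\<lambda>t. \<integral>\<omega>. sq_defect \<epsilon> (Z.u l e \<omega> t) \<partial>N) \<in> borel_measurable \<mu>" if "\<epsilon> \<noteq> 0" "e \<in> ?terms l" for \<epsilon> l e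
    using Z.integrable_snd[OF Z.defect_pair_integrable[OF that(2,1)]] by auto
  \<comment> \<open>\<epsilon> is fixed by the limit process alone, through dominated convergence
    twice: u^2 dominates over \<omega> and 4 K over time.\<close>
  have "(\<lambda>c. Z.pr.expectation (Z.defect (1 / real (Suc c)))) \<longlonglongrightarrow> Ca / 4 * (\<Sum>l<R. \<Sum>e\<in>?terms l. \<integral>t. 0 \<partial>\<mu>)"
  proof -
    have nz: "1 / real (Suc c) \<noteq> 0" for c by simp
    have "(\<lambda>c. \<integral>t. (\<integral>\<omega>. sq_defect (1 / real (Suc c)) (Z.u l e \<omega> t) \<partial>N) \<partial>\<mu>) \<longlonglongrightarrow> (\<integral>t. 0 \<partial>\<mu>)" if e: "e \<in> ?terms l"
      for l e
    proof (rule integral_dominated_convergence[where w = "\<lambda>_. 4 * K"])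
      show "AE t in \<mu>. (\<lambda>c. \<integral>\<omega>. sq_defect (1 / real (Suc c)) (Z.u l e \<omega> t) \<partial>N) \<longlonglongrightarrow> 0"
      proof (rule AE_I2)
        fix t assume t: "t \<in> space \<mu>"
        note u = Z.u_sq_integrable[OF e t]
        have "(\<lambda>c. \<integral>\<omega>. sq_defect (1 / real (Suc c)) (Z.u l e \<omega> t) \<partial>N) \<longlonglongrightarrow> (\<integral>\<omega>. 0 \<partial>N)"
        proof (rule integral_dominated_convergence[where w = "\<lambda>\<omega>. (Z.u l e \<omega> t)\<^sup>2"])
          show "AE \<omega> in N. norm (sq_defect (1 / real (Suc c)) (Z.u l e \<omega> t)) \<le> (Z.u l e \<omega> t)\<^sup>2" for c
            using sq_defect_bounds[OF nz[of c]] by (intro AE_I2) (simp only: real_norm_def abs_of_nonneg)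
          show "AE \<omega> in N. (\<lambda>c. sq_defect (1 / real (Suc c)) (Z.u l e \<omega> t)) \<longlonglongrightarrow> 0"
            by (intro AE_I2 sq_defect_tendsto_0)
        qed (use u in \<open>auto intro: measurable_compose[OF _ sq_defect_measurable]\<close>)
        then show "(\<lambda>c. \<integral>\<omega>. sq_defect (1 / real (Suc c)) (Z.u l e \<omega> t) \<partial>N) \<longlonglongrightarrow> 0" by simp
      qed
      show "AE t in \<mu>. norm (\<integral>\<omega>. sq_defect (1 / real (Suc c)) (Z.u l e \<omega> t) \<partial>N) \<le> 4 * K" for c
        using bN[OF nz e] by (intro AE_I2) (simp only: real_norm_def)
    qed (use mN[OF nz e] in auto)
    then show ?thesis unfolding Z.expectation_defect[OF nz] by (intro tendsto_mult tendsto_const tendsto_sum)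
  qed
  then have "(\<lambda>c. Z.pr.expectation (Z.defect (1 / real (Suc c)))) \<longlonglongrightarrow> 0" by simp
  \<comment> \<open>The bound \<eta>^2 for the mean makes Markov's inequality at level \<eta> give
    probability \<eta>.\<close>
  then have "\<forall>\<^sub>F c in sequentially. Z.pr.expectation (Z.defect (1 / real (Suc c))) < \<eta>\<^sup>2"
    using \<eta> by (intro order_tendstoD) auto
  then obtain c where c: "Z.pr.expectation (Z.defect (1 / real (Suc c))) < \<eta>\<^sup>2"
    by (auto simp: eventually_sequentially)
  define \<epsilon> where "\<epsilon> = 1 / real (Suc c)"
  have \<epsilon>: "\<epsilon> \<noteq> 0" by (simp add: \<epsilon>_def)
  have small: "Z.pr.expectation (Z.defect \<epsilon>) < \<eta>\<^sup>2" using c by (simp only: \<epsilon>_def)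
  have cosX: "(\<lambda>m. \<integral>\<omega>. cos (\<epsilon> * X.u m l e \<omega> t) \<partial>M) \<longlonglongrightarrow> (\<integral>\<omega>. cos (\<epsilon> * Z.u l e \<omega> t) \<partial>N)"
    if e: "e \<in> ?terms l" and t: "t \<in> space \<mu>" for l e t
  proof -
    have "(\<Sum>s\<in>{t}. \<Sum>p<r. Z.freq \<epsilon> l e p * Z \<omega> s p) = \<epsilon> * Z.u l e \<omega> t" for \<omega>
      using Z.freq_sum[OF e, of \<epsilon> \<omega> t] by simp
    moreover have "(\<Sum>s\<in>{t}. \<Sum>p<r. Z.freq \<epsilon> l e p * X m \<omega> s p) = \<epsilon> * X.u m l e \<omega> t" for \<omega> m
      using X.freq_sum[OF e, of \<epsilon> m \<omega> t] by simp
    ultimately show ?thesis using fidi[of "{t}" "\<lambda>_. Z.freq \<epsilon> l e"] t by simp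
  qed
  have secX: "(\<lambda>m. \<integral>\<omega>. (X.u m l e \<omega> t)\<^sup>2 \<partial>M) \<longlonglongrightarrow> (\<integral>\<omega>. (Z.u l e \<omega> t)\<^sup>2 \<partial>N)"
    if e: "e \<in> ?terms l" and t: "t \<in> space \<mu>" for l e t
    unfolding X.u_def Z.u_def using Z.termsD[OF e] by (intro second t) auto
  have "(\<lambda>m. X.pr.expectation (X.defect m \<epsilon>)) \<longlonglongrightarrow> Z.pr.expectation (Z.defect \<epsilon>)"
    unfolding X.expectation_defect[OF \<epsilon>] Z.expectation_defect[OF \<epsilon>]
  proof (intro tendsto_mult tendsto_const tendsto_sum)
    fix l e assume e: "e \<in> ?terms l"
    note e' = e
    show "(\<lambda>m. \<integral>t. (\<integral>\<omega>. sq_defect \<epsilon> (X.u m l e \<omega> t) \<partial>M) \<partial>\<mu>) \<longlonglongrightarrow> (\<integral>t. (\<integral>\<omega>. sq_defect \<epsilon> (Z.u l e \<omega> t) \<partial>N) \<partial>\<mu>)"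
    proof (rule integral_dominated_convergence[where w = "\<lambda>_. 4 * K"])
      show "AE t in \<mu>. (\<lambda>m. \<integral>\<omega>. sq_defect \<epsilon> (X.u m l e \<omega> t) \<partial>M) \<longlonglongrightarrow> (\<integral>\<omega>. sq_defect \<epsilon> (Z.u l e \<omega> t) \<partial>N)"
      proof (rule AE_I2)
        fix t assume t: "t \<in> space \<mu>"
        show "(\<lambda>m. \<integral>\<omega>. sq_defect \<epsilon> (X.u m l e \<omega> t) \<partial>M) \<longlonglongrightarrow> (\<integral>\<omega>. sq_defect \<epsilon> (Z.u l e \<omega> t) \<partial>N)"
          unfolding eM[OF e' t] eN[OF e t] by (intro tendsto_intros cosX[OF e t] secX[OF e t])
      qed
      show "AE t in \<mu>. norm (\<integral>\<omega>. sq_defect \<epsilon> (X.u m l e \<omega> t) \<partial>M) \<le> 4 * K" for m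
        using bM[OF \<epsilon> e'] by (intro AE_I2) simp
    qed (use mM[OF \<epsilon> e'] mN[OF \<epsilon> e] in auto)
  qed
  then have ev: "\<forall>\<^sub>F m in sequentially. X.pr.expectation (X.defect m \<epsilon>) < \<eta>\<^sup>2"
    using small by (rule order_tendstoD(2))
  interpret cX: cosine_functionals M \<mu> r "X m" ?terms "Z.coef \<epsilon>" "Z.freq \<epsilon>" "Z.coef_bound \<epsilon>" for m
    by (rule X.cosine_functionals)
  interpret cZ: cosine_functionals N \<mu> r Z ?terms "Z.coef \<epsilon>" "Z.freq \<epsilon>" "Z.coef_bound \<epsilon>"
    by (rule Z.cosine_functionals)
  have mom: "(\<lambda>m. \<integral>\<omega>. (\<Prod>l\<leftarrow>ls. cX.I m l \<omega>) \<partial>M) \<longlonglongrightarrow> (\<integral>\<omega>. (\<Prod>l\<leftarrow>ls. cZ.I l \<omega>) \<partial>N)" for ls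
  proof -
    \<comment> \<open>Over the empty set of times the phase is 0 and its cosine 1, which leaves the
      plain mixed moments.\<close>
    have "(\<lambda>m. cX.moment m {} (\<lambda>_ _. 0) ls) \<longlonglongrightarrow> cZ.moment {} (\<lambda>_ _. 0) ls"
    proof (rule cosine_functionals_moment_tendsto)
      show "cosine_functionals M \<mu> r (X m) ?terms (Z.coef \<epsilon>) (Z.coef_bound \<epsilon>)" for m
        by (rule cX.cosine_functionals_axioms)
      show "cosine_functionals N \<mu> r Z ?terms (Z.coef \<epsilon>) (Z.coef_bound \<epsilon>)" by (rule cZ.cosine_functionals_axioms)
      show "(\<lambda>m. \<integral>\<omega>. cos (cX.phase m F u \<omega>) \<partial>M) \<longlonglongrightarrow> (\<integral>\<omega>. cos (cZ.phase F u \<omega>) \<partial>N)"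
        if "finite F" "F \<subseteq> space \<mu>" for F u
        unfolding cX.phase_def cZ.phase_def by (rule fidi[OF that])
    qed auto
    then show ?thesis by (simp add: cX.moment_def cZ.moment_def cX.phase_def cZ.phase_def)
  qed
  have lim: "(\<lambda>m. \<integral>\<omega>. \<Phi> (\<lambda>l. cX.I m l \<omega>) \<partial>M) \<longlonglongrightarrow> (\<integral>\<omega>. \<Phi> (\<lambda>l. cZ.I l \<omega>) \<partial>N)"
    if "continuous_on UNIV \<Phi>" for \<Phi> :: "(nat \<Rightarrow> real) \<Rightarrow> real"
  proof (rule expectation_tendsto_of_moments[where D = "cZ.D" and X = "\<lambda>m \<omega> l. cX.I m l \<omega>" and Y = "\<lambda>\<omega> l. cZ.I
    l \<omega>"])
    show "prob_space M" "prob_space N" by (rule X.pr.prob_space_axioms Z.pr.prob_space_axioms)+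
    show "\<bar>cX.I m l \<omega>\<bar> \<le> cZ.D" for m l \<omega> using cX.I_bound[of m l \<omega>] by (simp add: cX.D_def cZ.D_def)
  qed (use that mom cX.I_measurable cZ.I_measurable cZ.I_bound in auto)
  show ?thesis
  proof (rule exI[of _ "\<lambda>m \<omega> l. cX.I m l \<omega>"], rule exI[of _ "\<lambda>\<omega> l. cZ.I l \<omega>"], intro conjI)
    show "\<forall>\<^sub>F m in sequentially. \<exists>G\<in>sets M. measure M G \<ge> 1 - \<eta> \<and> (\<forall>\<omega>\<in>G. \<forall>l. \<bar>X.S m l \<omega> - cX.I m l \<omega>\<bar> \<le> \<eta>)"
      using ev
    proof eventually_elim
      case (elim m)
      let ?B = "{\<omega> \<in> space M. \<eta> \<le> X.defect m \<epsilon> \<omega>}"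
      have Bm: "?B \<in> sets M" using X.integrable_defect[OF \<epsilon>, of m] by measurable
      have "measure M ?B \<le> X.pr.expectation (X.defect m \<epsilon>) / \<eta>"
        using X.integrable_defect[OF \<epsilon>, of m] X.defect_nonneg[OF \<epsilon>] \<eta>
          by (intro integral_Markov_inequality_measure[where A = "{}"]) auto
      also have "\<dots> \<le> \<eta>" using elim \<eta> by (simp add: divide_le_eq power2_eq_square)
      finally have "measure M (space M - ?B) \<ge> 1 - \<eta>" using X.pr.prob_compl[OF Bm] by simp
      moreover have "\<bar>X.S m l \<omega> - cX.I m l \<omega>\<bar> \<le> \<eta>" if "\<omega> \<in> space M - ?B" for \<omega> l
        using X.S_minus_I[of \<omega> \<epsilon> m l] \<epsilon> that by auto
      ultimately show ?case using Bm by (intro bexI[of _ "space M - ?B"]) auto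
    qed
    show "\<exists>G\<in>sets N. measure N G \<ge> 1 - \<eta> \<and> (\<forall>\<omega>\<in>G. \<forall>l. \<bar>Z.S l \<omega> - cZ.I l \<omega>\<bar> \<le> \<eta>)"
    proof -
      let ?B = "{\<omega> \<in> space N. \<eta> \<le> Z.defect \<epsilon> \<omega>}"
      have Bm: "?B \<in> sets N" using Z.integrable_defect[OF \<epsilon>] by measurable
      have "measure N ?B \<le> Z.pr.expectation (Z.defect \<epsilon>) / \<eta>"
        using Z.integrable_defect[OF \<epsilon>] Z.defect_nonneg[OF \<epsilon>] \<eta>
          by (intro integral_Markov_inequality_measure[where A = "{}"]) auto
      also have "\<dots> \<le> \<eta>" using small \<eta> by (simp add: divide_le_eq power2_eq_square)
      finally have "measure N (space N - ?B) \<ge> 1 - \<eta>" using Z.pr.prob_compl[OF Bm] by simp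
      moreover have "\<bar>Z.S l \<omega> - cZ.I l \<omega>\<bar> \<le> \<eta>" if "\<omega> \<in> space N - ?B" for \<omega> l
        using Z.S_minus_I[of \<omega> \<epsilon> l] \<epsilon> that by auto
      ultimately show ?thesis using Bm by (intro bexI[of _ "space N - ?B"]) auto
    qed
  qed (use lim cX.I_measurable cZ.I_measurable in auto)
qed


section \<open>The test statistics\<close>

text \<open>Treats point masses and densities alike as affine images of the standard normal
  law.\<close>

lemma normal_law_eq_distr:
  assumes "0 \<le> \<sigma>"
  shows "normal_law \<mu> \<sigma> = distr std_normal_distribution borel (\<lambda>x. \<mu> + \<sigma> * x)"
proof (cases "\<sigma> = 0")
  case True
  interpret real_distribution std_normal_distribution by (rule real_dist_normal_dist)
  show ?thesis using True by (simp add: normal_law_def distr_const)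
next
  case False
  interpret real_distribution std_normal_distribution by (rule real_dist_normal_dist)
  have "distributed std_normal_distribution lborel (\<lambda>x. x) (\<lambda>x. ennreal (normal_density 0 1 x))"
  proof -
    have "distr std_normal_distribution lborel (\<lambda>x. x) = std_normal_distribution" by (rule distr_id2) simp
    then show ?thesis unfolding distributed_def by simp
  qed
  from normal_density_affine[OF this, of \<sigma> \<mu>] False assms
  have "distr std_normal_distribution lborel (\<lambda>x. \<mu> + \<sigma> * x) = density lborel (\<lambda>x. ennreal (normal_density \<mu> \<sigma> x))"
    by (simp add: distributed_def)
  moreover have "distr std_normal_distribution lborel (\<lambda>x. \<mu> + \<sigma> * x) = distr std_normal_distribution borel
    (\<lambda>x. \<mu> + \<sigma> * x)"
    by (rule distr_cong) auto
  ultimately show ?thesis using False by (simp add: normal_law_def)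
qed

lemma (in prob_space) affine_moments:
  fixes X :: "'a \<Rightarrow> real"
  assumes i1: "integrable M X" and i2: "integrable M (\<lambda>\<omega>. (X \<omega>)\<^sup>2)"
    and e1: "expectation X = 0" and e2: "expectation (\<lambda>\<omega>. (X \<omega>)\<^sup>2) = 1"
  shows "integrable M (\<lambda>\<omega>. \<mu> + \<sigma> * X \<omega>)" "expectation (\<lambda>\<omega>. \<mu> + \<sigma> * X \<omega>) = \<mu>"
    "integrable M (\<lambda>\<omega>. (\<mu> + \<sigma> * X \<omega>)\<^sup>2)" "expectation (\<lambda>\<omega>. (\<mu> + \<sigma> * X \<omega>)\<^sup>2) = \<mu>\<^sup>2 + \<sigma>\<^sup>2"
proof -
  have eq: "(\<mu> + \<sigma> * X \<omega>)\<^sup>2 = \<mu>\<^sup>2 + (2 * \<mu> * \<sigma>) * X \<omega> + \<sigma>\<^sup>2 * (X \<omega>)\<^sup>2" for \<omega>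
    by (simp add: power2_eq_square algebra_simps)
  show "integrable M (\<lambda>\<omega>. \<mu> + \<sigma> * X \<omega>)" "expectation (\<lambda>\<omega>. \<mu> + \<sigma> * X \<omega>) = \<mu>"
    using i1 by (auto simp: e1 prob_space)
  show "integrable M (\<lambda>\<omega>. (\<mu> + \<sigma> * X \<omega>)\<^sup>2)" "expectation (\<lambda>\<omega>. (\<mu> + \<sigma> * X \<omega>)\<^sup>2) = \<mu>\<^sup>2 + \<sigma>\<^sup>2"
    unfolding eq using i1 i2 by (auto simp: e1 e2 prob_space)
qed

lemma normal_law_moments:
  assumes \<sigma>: "0 \<le> \<sigma>" and Y: "Y \<in> borel_measurable N" and law: "distr N borel Y = normal_law \<mu> \<sigma>"
  shows "integrable N Y" "(\<integral>\<omega>. Y \<omega> \<partial>N) = \<mu>"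
    and "integrable N (\<lambda>\<omega>. (Y \<omega>)\<^sup>2)" "(\<integral>\<omega>. (Y \<omega>)\<^sup>2 \<partial>N) = \<mu>\<^sup>2 + \<sigma>\<^sup>2"
    and "\<mu> = 0 \<Longrightarrow> (\<integral>\<omega>. cos (Y \<omega>) \<partial>N) = exp (- \<sigma>\<^sup>2 / 2)"
proof -
  interpret real_distribution std_normal_distribution by (rule real_dist_normal_dist)
  have i1: "integrable std_normal_distribution (\<lambda>x. x)"
    using integrable_std_normal_distribution_moment[of 1] by simp
  have i2: "integrable std_normal_distribution (\<lambda>x. x\<^sup>2)"
    using integrable_std_normal_distribution_moment[of 2] by simp
  have e1: "expectation (\<lambda>x. x) = 0"
    using integral_std_normal_distribution_moment_odd[of 1] by simp
  have e2: "expectation (\<lambda>x. x\<^sup>2) = 1"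
    using std_normal_distribution_even_moments(1)[of 1] by (simp add: fact_numeral)
  have law': "distr N borel Y = distr std_normal_distribution borel (\<lambda>x. \<mu> + \<sigma> * x)"
    using law normal_law_eq_distr[OF \<sigma>] by simp
  have tr: "integrable N (\<lambda>\<omega>. f (Y \<omega>)) \<longleftrightarrow> integrable std_normal_distribution (\<lambda>x. f (\<mu> + \<sigma> * x))"
    "(\<integral>\<omega>. f (Y \<omega>) \<partial>N) = expectation (\<lambda>x. f (\<mu> + \<sigma> * x))"
    if [measurable]: "f \<in> borel_measurable borel" for f :: "real \<Rightarrow> real"
  proof -
    show "integrable N (\<lambda>\<omega>. f (Y \<omega>)) \<longleftrightarrow> integrable std_normal_distribution (\<lambda>x. f (\<mu> + \<sigma> * x))"
      using integrable_distr_eq[OF Y that] integrable_distr_eq[of "\<lambda>x. \<mu> + \<sigma> * x" std_normal_distribution borel f]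
      by (simp add: law')
    show "(\<integral>\<omega>. f (Y \<omega>) \<partial>N) = expectation (\<lambda>x. f (\<mu> + \<sigma> * x))"
      using integral_distr[OF Y that] integral_distr[of "\<lambda>x. \<mu> + \<sigma> * x" std_normal_distribution borel f]
      by (simp add: law')
  qed
  note aff = affine_moments[OF i1 i2 e1 e2, of \<mu> \<sigma>]
  have m1: "(\<lambda>x :: real. x) \<in> borel_measurable borel" and m2: "(\<lambda>x :: real. x\<^sup>2) \<in> borel_measurable borel"
    by measurable
  show "integrable N Y" "integrable N (\<lambda>\<omega>. (Y \<omega>)\<^sup>2)" by (rule iffD2[OF tr(1)[OF m1] aff(1)] iffD2[OF tr(1)[OF
    m2] aff(3)])+
  show "(\<integral>\<omega>. Y \<omega> \<partial>N) = \<mu>" "(\<integral>\<omega>. (Y \<omega>)\<^sup>2 \<partial>N) = \<mu>\<^sup>2 + \<sigma>\<^sup>2"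
    by (rule trans[OF tr(2)[OF m1] aff(2)] trans[OF tr(2)[OF m2] aff(4)])+
  show "(\<integral>\<omega>. cos (Y \<omega>) \<partial>N) = exp (- \<sigma>\<^sup>2 / 2)" if "\<mu> = 0"
  proof -
    have "complex_integrable std_normal_distribution (\<lambda>x. iexp (\<sigma> * x))"
      by (intro integrable_const_bound[where B = 1]) auto
    then have "Re (char std_normal_distribution \<sigma>) = expectation (\<lambda>x. Re (iexp (\<sigma> * x)))"
      unfolding char_def by (rule integral_Re[symmetric])
    then have "exp (- \<sigma>\<^sup>2 / 2) = expectation (\<lambda>x. cos (\<sigma> * x))"
      by (simp add: char_std_normal_distribution Re_exp)
    moreover have "(\<integral>\<omega>. cos (Y \<omega>) \<partial>N) = expectation (\<lambda>x. cos (\<mu> + \<sigma> * x))"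
      by (rule tr(2)) measurable
    ultimately show ?thesis unfolding that add_0 by (rule trans[OF _ sym, rotated])
  qed
qed

lemma L2_on_add:
  assumes "f \<in> L2_on T" "g \<in> L2_on T"
  shows "(\<lambda>t. f t + g t) \<in> L2_on T"
proof -
  have fg: "f \<in> borel_measurable (lebesgue_on T)" "g \<in> borel_measurable (lebesgue_on T)"
    "integrable (lebesgue_on T) (\<lambda>t. (f t)\<^sup>2)" "integrable (lebesgue_on T) (\<lambda>t. (g t)\<^sup>2)"
    using assms by (auto simp: L2_on_def)
  have "integrable (lebesgue_on T) (\<lambda>t. (f t + g t)\<^sup>2)"
  proof (rule Bochner_Integration.integrable_bound)
    show "integrable (lebesgue_on T) (\<lambda>t. 2 * ((f t)\<^sup>2 + (g t)\<^sup>2))" using fg by auto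
    have "(y + z)\<^sup>2 \<le> 2 * (y\<^sup>2 + z\<^sup>2)" for y z :: real
      using zero_le_power2[of "y - z"] by (simp add: power2_sum power2_diff)
    then show "AE t in lebesgue_on T. norm ((f t + g t)\<^sup>2) \<le> norm (2 * ((f t)\<^sup>2 + (g t)\<^sup>2))" by (intro AE_I2) simp
  qed (use fg in auto)
  then show ?thesis using fg by (auto simp: L2_on_def)
qed

lemma L2_on_cmult: "f \<in> L2_on T \<Longrightarrow> (\<lambda>t. c * f t) \<in> L2_on T"
  by (auto simp: L2_on_def power_mult_distrib)

lemma L2_on_zero: "(\<lambda>_. 0) \<in> L2_on T"
  by (auto simp: L2_on_def)

lemma L2_on_sum: "(\<And>i. i \<in> A \<Longrightarrow> f i \<in> L2_on T) \<Longrightarrow> (\<lambda>t. \<Sum>i\<in>A. f i t) \<in> L2_on T"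
proof (induction A rule: infinite_finite_induct)
  case (insert i A)
  then show ?case using L2_on_add[of "f i" T "\<lambda>t. \<Sum>i\<in>A. f i t"] by simp
qed (simp_all add: L2_on_zero)

lemma gram_entry:
  assumes A: "A \<in> carrier_mat r k" and "p < r" "q < r"
  shows "(A * mat_diag k d * A\<^sup>T) $$ (p, q) = (\<Sum>i<k. A $$ (p, i) * d i * A $$ (q, i))"
  using A assms(2,3) unfolding mat_diag_mult_right[OF A]
  by (simp add: scalar_prod_def lessThan_atLeast0)

context k_sample
begin

lemma scaled_sum_second_moment:
  assumes F: "finite F" "F \<subseteq> T" and pos: "\<And>i. i < k \<Longrightarrow> 0 < ns m i"
  shows "integrable M (\<lambda>\<omega>. (scaled_sum F w m \<omega>)\<^sup>2)"
    and "expectation (\<lambda>\<omega>. (scaled_sum F w m \<omega>)\<^sup>2) =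
      (\<Sum>i<k. real (n m) / real (ns m i) * (\<Sum>t\<in>F. \<Sum>s\<in>F. w i t * w i s * \<gamma> i t s))"
proof -
  define c where "c i = sqrt (n m) / ns m i" for i
  define A where "A = (SIGMA i:{..<k}. {..<ns m i})"
  define V where "V i = (\<Sum>t\<in>F. \<Sum>s\<in>F. w i t * w i s * \<gamma> i t s)" for i
  let ?X = "\<lambda>p \<omega>. c (fst p) * linear_form F w (fst p) (snd p) \<omega>"
  have eq: "scaled_sum F w m \<omega> = (\<Sum>p\<in>A. ?X p \<omega>)" for \<omega>
    unfolding A_def scaled_sum_def c_def sum_distrib_left by (subst sum.Sigma) (auto simp: case_prod_unfold)
  have A: "finite A" "A \<subseteq> {..<k} \<times> UNIV" by (auto simp: A_def)
  have i: "fst p < k" if "p \<in> A" for p using that by (auto simp: A_def)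
  have X1: "integrable M (?X p)" "expectation (?X p) = 0" if "p \<in> A" for p
    using linear_form_moments(1,2)[OF F i[OF that]] by auto
  have X2: "integrable M (\<lambda>\<omega>. (?X p \<omega>)\<^sup>2)" "expectation (\<lambda>\<omega>. (?X p \<omega>)\<^sup>2) = (c (fst p))\<^sup>2 * V (fst p)" if "p \<in>
    A" for p
    using linear_form_moments(3,4)[OF F i[OF that]] by (auto simp: power_mult_distrib V_def)
  have ind: "indep_vars (\<lambda>_. borel) ?X A" by (rule indep_linear_form[OF F A(2)])
  have int: "integrable M (\<lambda>\<omega>. ?X p \<omega> * ?X p' \<omega>)" if "p \<in> A" "p' \<in> A" for p p'
  proof (cases "p = p'")
    case True
    then show ?thesis using X2(1)[OF that(1)] by (simp only: power2_eq_square)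
  next
    case False
    show ?thesis by (rule indep_vars_expectation_mult(1)[OF ind that False X1(1)[OF that(1)] X1(1)[OF that(2)]])
  qed
  have orth: "expectation (\<lambda>\<omega>. ?X p \<omega> * ?X p' \<omega>) = 0" if "p \<in> A" "p' \<in> A" "p \<noteq> p'" for p p'
    using indep_vars_expectation_mult(2)[OF ind that X1(1)[OF that(1)] X1(1)[OF that(2)]] X1(2)[OF that(1)] by simp
  show "integrable M (\<lambda>\<omega>. (scaled_sum F w m \<omega>)\<^sup>2)"
    unfolding eq by (rule second_moment_sum_of_orthogonal(1)[OF A(1) int orth])
  have "expectation (\<lambda>\<omega>. (scaled_sum F w m \<omega>)\<^sup>2) = (\<Sum>p\<in>A. expectation (\<lambda>\<omega>. (?X p \<omega>)\<^sup>2))"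
    unfolding eq by (rule second_moment_sum_of_orthogonal(2)[OF A(1) int orth])
  also have "\<dots> = (\<Sum>p\<in>A. (c (fst p))\<^sup>2 * V (fst p))" by (intro sum.cong refl X2(2))
  also have "\<dots> = (\<Sum>i<k. \<Sum>j<ns m i. (c i)\<^sup>2 * V i)"
    unfolding A_def by (subst sum.Sigma) (auto simp: case_prod_unfold)
  also have "\<dots> = (\<Sum>i<k. real (n m) / real (ns m i) * V i)"
  proof (intro sum.cong refl)
    fix i assume "i \<in> {..<k}"
    then have "0 < ns m i" using pos by simp
    then show "(\<Sum>j<ns m i. (c i)\<^sup>2 * V i) = real (n m) / real (ns m i) * V i"
      by (simp add: c_def power_divide power2_eq_square)
  qed
  finally show "expectation (\<lambda>\<omega>. (scaled_sum F w m \<omega>)\<^sup>2) =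
      (\<Sum>i<k. real (n m) / real (ns m i) * (\<Sum>t\<in>F. \<Sum>s\<in>F. w i t * w i s * \<gamma> i t s))"
    unfolding V_def .
qed

lemma gamma_bounded: "\<exists>g\<ge>0. \<forall>i<k. \<forall>t\<in>T. \<gamma> i t t \<le> g"
proof -
  have "\<exists>B. \<forall>t\<in>T. \<bar>\<gamma> i t t\<bar> \<le> B" if "i < k" for i
    using compact_imp_bounded[OF compact_continuous_image[OF gamma_cont[OF that]]] by (auto simp: bounded_iff T)
  then have "\<forall>i\<in>{..<k}. \<exists>B. \<forall>t\<in>T. \<bar>\<gamma> i t t\<bar> \<le> B" by blast
  from bchoice[OF this] obtain B where B: "\<forall>i\<in>{..<k}. \<forall>t\<in>T. \<bar>\<gamma> i t t\<bar> \<le> B i" ..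
  have "\<gamma> i t t \<le> (\<Sum>i<k. \<bar>B i\<bar>)" if "i < k" "t \<in> T" for i t
  proof -
    have "\<gamma> i t t \<le> \<bar>B i\<bar>" using B that by force
    also have "\<dots> \<le> (\<Sum>i<k. \<bar>B i\<bar>)" using that by (intro member_le_sum) auto
    finally show ?thesis .
  qed
  then show ?thesis by (intro exI[of _ "\<Sum>i<k. \<bar>B i\<bar>"]) (auto intro: sum_nonneg)
qed

lemma v_L2_on:
  assumes "i < k" "\<omega> \<in> space M"
  shows "v i j \<omega> \<in> L2_on T"
proof -
  have "x i j \<omega> \<in> L2_on T" using L2[OF assms(1), of j] assms(2) by (auto simp: L2_process_def)
  from L2_on_add[OF this L2_on_cmult[OF eta[OF assms(1)], of "-1"]] show ?thesis
    by (simp add: v_def[abs_def])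
qed

lemma v_pair_measurable:
  assumes i: "i < k"
  shows "(\<lambda>z. v i j (fst z) (snd z)) \<in> borel_measurable (M \<Otimes>\<^sub>M \<mu>)"
proof -
  have "\<eta> i \<in> borel_measurable \<mu>" using eta[OF i] by (simp add: L2_on_def)
  then have "(\<lambda>z :: 'w \<times> real. \<eta> i (snd z)) \<in> borel_measurable (M \<Otimes>\<^sub>M \<mu>)"
    by (rule measurable_compose[OF measurable_snd])
  then show ?thesis unfolding v_def by (intro borel_measurable_diff x_pair_measurable[OF i])
qed

end

section \<open>The Gaussian limit and the normalized sample means\<close>

locale k_sample_test = k_sample M a b T k x \<eta> \<gamma> \<tau> ns n + N: prob_space N
  for M :: "'w measure" and a b T k x \<eta> \<gamma> \<tau> ns n and N :: "'z measure" +
  fixes r R :: nat and rs :: "nat \<Rightarrow> nat" and H :: "real mat" and z :: "'z \<Rightarrow> real \<Rightarrow> real Matrix.vec"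
  assumes r: "r = (\<Sum>l<R. rs l)" and H: "H \<in> carrier_mat r k"
    and z: "gaussian_process N T r (\<lambda>t s. H * Sigma_mat k \<tau> \<gamma> t s * H\<^sup>T) z"
begin

text \<open>The functional \<open>u\<close> of \<open>r\<close>-dimensional vectors, pulled back
  along \<open>H\<close> to the \<open>k\<close> samples.\<close>

definition weight :: "(real \<Rightarrow> nat \<Rightarrow> real) \<Rightarrow> nat \<Rightarrow> real \<Rightarrow> real" where
  "weight u i t = (\<Sum>p<r. u t p * H $$ (p, i))"

lemma z_measurable: "t \<in> T \<Longrightarrow> p < r \<Longrightarrow> (\<lambda>\<omega>. z \<omega> t $ p) \<in> borel_measurable N"
proof -
  assume t: "t \<in> T" and p: "p < r"
  have "(\<lambda>(\<omega>, t). z \<omega> t $ p) \<in> borel_measurable (N \<Otimes>\<^sub>M \<mu>)"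
    using z p unfolding gaussian_process_def L2_process_def by blast
  from measurable_compose[OF measurable_Pair2' this, of t] show ?thesis using t by simp
qed

lemma z_linear:
  fixes u :: "real \<Rightarrow> nat \<Rightarrow> real"
  assumes F: "finite F" "F \<subseteq> T"
  shows "\<exists>\<nu> \<sigma>. 0 \<le> \<sigma> \<and> distr N borel (\<lambda>\<omega>. \<Sum>t\<in>F. \<Sum>p<r. u t p * z \<omega> t $ p) = normal_law \<nu> \<sigma>"
    and "(\<lambda>\<omega>. \<Sum>t\<in>F. \<Sum>p<r. u t p * z \<omega> t $ p) \<in> borel_measurable N"
proof -
  have "\<forall>F u. finite F \<and> F \<subseteq> T \<longrightarrow>
      (\<exists>\<nu> \<sigma>. 0 \<le> \<sigma> \<and> distr N borel (\<lambda>\<omega>. \<Sum>t\<in>F. \<Sum>p<r. u t p * z \<omega> t $ p) = normal_law \<nu> \<sigma>)"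
    using z unfolding gaussian_process_def by (elim conjE) assumption
  then show "\<exists>\<nu> \<sigma>. 0 \<le> \<sigma> \<and> distr N borel (\<lambda>\<omega>. \<Sum>t\<in>F. \<Sum>p<r. u t p * z \<omega> t $ p) = normal_law \<nu> \<sigma>"
    using F by (elim allE[of _ F] allE[of _ u]) simp
  have m: "(\<lambda>\<omega>. z \<omega> t $ p) \<in> borel_measurable N" if "t \<in> F" "p < r" for t p
    using z_measurable F(2) that by auto
  show "(\<lambda>\<omega>. \<Sum>t\<in>F. \<Sum>p<r. u t p * z \<omega> t $ p) \<in> borel_measurable N"
    by (intro borel_measurable_sum borel_measurable_times borel_measurable_const m) auto
qed

text \<open>Prescribed mean and covariance do not imply integrability, because nonintegrable
  functions have integral 0 by default. It comes from normality of a single coordinate, selected by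
  the weights \<open>?u\<close>.\<close>

lemma z_moments:
  assumes t: "t \<in> T" and p: "p < r"
  shows "integrable N (\<lambda>\<omega>. z \<omega> t $ p)" "N.expectation (\<lambda>\<omega>. z \<omega> t $ p) = 0" "integrable N (\<lambda>\<omega>. (z \<omega> t $ p)\<^sup>2)"
proof -
  let ?u = "\<lambda>(_ :: real) q. if q = p then 1 else 0 :: real"
  have F: "finite {t}" "{t} \<subseteq> T" using t by auto
  obtain \<nu> \<sigma> where l: "0 \<le> \<sigma>" "distr N borel (\<lambda>\<omega>. \<Sum>t\<in>{t}. \<Sum>q<r. ?u t q * z \<omega> t $ q) = normal_law \<nu> \<sigma>"
    using z_linear(1)[OF F, of ?u] by (elim exE conjE) (rule that)
  note l = l z_linear(2)[OF F, of ?u]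
  have eq: "(\<Sum>t\<in>{t}. \<Sum>q<r. ?u t q * z \<omega> t $ q) = z \<omega> t $ p" for \<omega>
  proof -
    have "(\<Sum>q<r. ?u t q * z \<omega> t $ q) = (\<Sum>q<r. if q = p then z \<omega> t $ q else 0)" by (intro sum.cong) auto
    then show ?thesis using p by simp
  qed
  show "integrable N (\<lambda>\<omega>. z \<omega> t $ p)" "integrable N (\<lambda>\<omega>. (z \<omega> t $ p)\<^sup>2)"
    using normal_law_moments(1,3)[OF l(1,3,2)] unfolding eq by auto
  show "N.expectation (\<lambda>\<omega>. z \<omega> t $ p) = 0" using z t p unfolding gaussian_process_def by blast
qed

lemma z_mult:
  assumes "t \<in> T" "p < r" "s \<in> T" "q < r"
  shows "integrable N (\<lambda>\<omega>. z \<omega> t $ p * z \<omega> s $ q)"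
    and "N.expectation (\<lambda>\<omega>. z \<omega> t $ p * z \<omega> s $ q) = (\<Sum>i<k. H $$ (p, i) * (1 / \<tau> i * \<gamma> i t s) * H $$ (q, i))"
proof -
  show "integrable N (\<lambda>\<omega>. z \<omega> t $ p * z \<omega> s $ q)"
  proof (rule Bochner_Integration.integrable_bound)
    show "integrable N (\<lambda>\<omega>. (z \<omega> t $ p)\<^sup>2 + (z \<omega> s $ q)\<^sup>2)" using z_moments(3) assms by auto
    have "\<bar>y * w\<bar> \<le> y\<^sup>2 + w\<^sup>2" for y w :: real
    proof -
      have "2 * \<bar>y\<bar> * \<bar>w\<bar> \<le> y\<^sup>2 + w\<^sup>2" using sum_squares_bound[of "\<bar>y\<bar>" "\<bar>w\<bar>"] by simp
      moreover have "0 \<le> \<bar>y\<bar> * \<bar>w\<bar>" by simp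
      ultimately show ?thesis unfolding abs_mult by linarith
    qed
    then show "AE \<omega> in N. norm (z \<omega> t $ p * z \<omega> s $ q) \<le> norm ((z \<omega> t $ p)\<^sup>2 + (z \<omega> s $ q)\<^sup>2)"
      by (intro AE_I2) simp
  qed (use z_measurable assms in auto)
  have "N.expectation (\<lambda>\<omega>. z \<omega> t $ p * z \<omega> s $ q) = (H * Sigma_mat k \<tau> \<gamma> t s * H\<^sup>T) $$ (p, q)"
    using z assms unfolding gaussian_process_def by blast
  then show "N.expectation (\<lambda>\<omega>. z \<omega> t $ p * z \<omega> s $ q) = (\<Sum>i<k. H $$ (p, i) * (1 / \<tau> i * \<gamma> i t s) * H $$ (q, i))"
    unfolding Sigma_mat_def gram_entry[OF H assms(2,4)] .
qed

lemma limit_variance_expand: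
  "limit_variance F (weight u) = (\<Sum>t\<in>F. \<Sum>p<r. \<Sum>s\<in>F. \<Sum>q<r. u t p * u s q * (\<Sum>i<k. H $$ (p, i) * (1 / \<tau> i * \<gamma> i
    t s) * H $$ (q, i)))"
proof -
  let ?g = "\<lambda>i t p s q. u t p * u s q * (H $$ (p, i) * (1 / \<tau> i * \<gamma> i t s) * H $$ (q, i))"
  have w: "1 / \<tau> i * (weight u i t * weight u i s * \<gamma> i t s) = (\<Sum>p<r. \<Sum>q<r. ?g i t p s q)" for i t s
    unfolding weight_def sum_product unfolding sum_distrib_right unfolding sum_distrib_left
    by (rule sum.cong[OF refl], rule sum.cong[OF refl], simp)
  have "limit_variance F (weight u) = (\<Sum>i<k. \<Sum>t\<in>F. \<Sum>s\<in>F. \<Sum>p<r. \<Sum>q<r. ?g i t p s q)"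
    unfolding limit_variance_def w[symmetric] sum_distrib_left ..
  also have "\<dots> = (\<Sum>i<k. \<Sum>t\<in>F. \<Sum>p<r. \<Sum>s\<in>F. \<Sum>q<r. ?g i t p s q)"
    by (rule sum.cong[OF refl], rule sum.cong[OF refl], rule sum.swap)
  also have "\<dots> = (\<Sum>t\<in>F. \<Sum>i<k. \<Sum>p<r. \<Sum>s\<in>F. \<Sum>q<r. ?g i t p s q)"
    by (rule sum.swap)
  also have "\<dots> = (\<Sum>t\<in>F. \<Sum>p<r. \<Sum>i<k. \<Sum>s\<in>F. \<Sum>q<r. ?g i t p s q)"
    by (rule sum.cong[OF refl], rule sum.swap)
  also have "\<dots> = (\<Sum>t\<in>F. \<Sum>p<r. \<Sum>s\<in>F. \<Sum>i<k. \<Sum>q<r. ?g i t p s q)"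
    by (rule sum.cong[OF refl], rule sum.cong[OF refl], rule sum.swap)
  also have "\<dots> = (\<Sum>t\<in>F. \<Sum>p<r. \<Sum>s\<in>F. \<Sum>q<r. \<Sum>i<k. ?g i t p s q)"
    by (rule sum.cong[OF refl], rule sum.cong[OF refl], rule sum.cong[OF refl], rule sum.swap)
  finally show ?thesis by (simp only: sum_distrib_left)
qed

text \<open>The definition of a Gaussian process only says that linear forms are normal with some
  parameters; the prescribed means and covariances identify them.\<close>

lemma z_form:
  fixes u :: "real \<Rightarrow> nat \<Rightarrow> real"
  assumes F: "finite F" "F \<subseteq> T"
  defines "Y \<equiv> \<lambda>\<omega>. \<Sum>t\<in>F. \<Sum>p<r. u t p * z \<omega> t $ p"
  shows "N.expectation (\<lambda>\<omega>. (Y \<omega>)\<^sup>2) = limit_variance F (weight u)"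
    and "N.expectation (\<lambda>\<omega>. cos (Y \<omega>)) = exp (- limit_variance F (weight u) / 2)"
proof -
  obtain \<nu> \<sigma> where l: "0 \<le> \<sigma>" "distr N borel Y = normal_law \<nu> \<sigma>"
    using z_linear(1)[OF F, of u] unfolding Y_def[symmetric] by (elim exE conjE) (rule that)
  note l = l z_linear(2)[OF F, of u, folded Y_def]
  note m = normal_law_moments[OF l(1,3,2)]
  have FT: "t \<in> T" if "t \<in> F" for t using that F by auto
  have "N.expectation Y = (\<Sum>t\<in>F. \<Sum>p<r. N.expectation (\<lambda>\<omega>. u t p * z \<omega> t $ p))"
    unfolding Y_def using z_moments(1) FT by (intro integral_double_sum
      Bochner_Integration.integrable_mult_right) auto
  also have "\<dots> = 0" using z_moments(2) FT by simp
  finally have \<nu>: "\<nu> = 0" using m(2) by simp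
  have Ysq: "(Y \<omega>)\<^sup>2 = (\<Sum>t\<in>F. \<Sum>p<r. \<Sum>s\<in>F. \<Sum>q<r. u t p * u s q * (z \<omega> t $ p * z \<omega> s $ q))" for \<omega>
  proof -
    have "(Y \<omega>)\<^sup>2 = (\<Sum>t\<in>F. \<Sum>p<r. u t p * z \<omega> t $ p * Y \<omega>)"
      unfolding power2_eq_square by (subst (1) Y_def) (simp only: sum_distrib_right)
    also have "\<dots> = (\<Sum>t\<in>F. \<Sum>p<r. \<Sum>s\<in>F. \<Sum>q<r. u t p * u s q * (z \<omega> t $ p * z \<omega> s $ q))"
      unfolding Y_def sum_distrib_left
      by (rule sum.cong[OF refl], rule sum.cong[OF refl], rule sum.cong[OF refl], rule sum.cong[OF refl], simp)
    finally show ?thesis .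
  qed
  have ii: "integrable N (\<lambda>\<omega>. u t p * u s q * (z \<omega> t $ p * z \<omega> s $ q))" if "t \<in> F" "p < r" "s \<in> F" "q < r" for
    t p s q
    using z_mult(1)[of t p s q] FT that by simp
  have "N.expectation (\<lambda>\<omega>. (Y \<omega>)\<^sup>2) = (\<Sum>t\<in>F. \<Sum>p<r. N.expectation (\<lambda>\<omega>. \<Sum>s\<in>F. \<Sum>q<r. u t p * u s q * (z \<omega> t $ p *
    z \<omega> s $ q)))"
    unfolding Ysq using ii by (intro integral_double_sum Bochner_Integration.integrable_sum) auto
  also have "\<dots> = (\<Sum>t\<in>F. \<Sum>p<r. \<Sum>s\<in>F. \<Sum>q<r. N.expectation (\<lambda>\<omega>. u t p * u s q * (z \<omega> t $ p * z \<omega> s $ q)))"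
    using ii by (intro sum.cong refl integral_double_sum) auto
  also have "\<dots> = limit_variance F (weight u)"
    unfolding limit_variance_expand using z_mult(2) FT by (intro sum.cong refl) simp
  finally show 2: "N.expectation (\<lambda>\<omega>. (Y \<omega>)\<^sup>2) = limit_variance F (weight u)" .
  have "\<sigma>\<^sup>2 = limit_variance F (weight u)" using m(4) 2 \<nu> by simp
  then show "N.expectation (\<lambda>\<omega>. cos (Y \<omega>)) = exp (- limit_variance F (weight u) / 2)" using m(5)[OF \<nu>] by simp
qed

text \<open>For the finitely many \<open>m\<close> with too small samples, \<open>W m\<close> below is set to 0; then the moment
  bounds hold for all \<open>m\<close>.\<close>

definition ok :: "nat \<Rightarrow> bool" where
  "ok m \<longleftrightarrow> (\<forall>i<k. 2 \<le> ns m i \<and> real (n m) / real (ns m i) \<le> 2 / \<tau> i)"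

lemma eventually_ok: "\<forall>\<^sub>F m in sequentially. ok m"
proof -
  have "\<forall>\<^sub>F m in sequentially. 2 \<le> ns m i \<and> real (n m) / real (ns m i) \<le> 2 / \<tau> i" if "i < k" for i
  proof -
    have "1 / \<tau> i < 2 / \<tau> i" using tau_pos[OF that] by (simp add: divide_strict_right_mono)
    then have "\<forall>\<^sub>F m in sequentially. real (n m) / real (ns m i) < 2 / \<tau> i"
      using order_tendstoD(2)[OF tau_lim_inverse[OF that]] by blast
    then show ?thesis using ns_ge[OF that, of 2] by eventually_elim auto
  qed
  then have "\<forall>\<^sub>F m in sequentially. \<forall>i\<in>{..<k}. 2 \<le> ns m i \<and> real (n m) / real (ns m i) \<le> 2 / \<tau> i"
    by (intro eventually_ball_finite) auto
  then show ?thesis by eventually_elim (auto simp: ok_def)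
qed

definition W :: "nat \<Rightarrow> 'w \<Rightarrow> real \<Rightarrow> nat \<Rightarrow> real" where
  "W m \<omega> t p = (if ok m then \<Sum>i<k. sqrt (n m) / ns m i * (H $$ (p, i) * (\<Sum>j<ns m i. v i j \<omega> t)) else 0)"

lemma W_form:
  assumes "ok m"
  shows "(\<Sum>t\<in>F. \<Sum>p<r. u t p * W m \<omega> t p) = scaled_sum F (weight u) m \<omega>"
proof -
  define c where "c i = sqrt (n m) / ns m i" for i
  define s where "s i t = (\<Sum>j<ns m i. v i j \<omega> t)" for i t
  have "(\<Sum>t\<in>F. \<Sum>p<r. u t p * W m \<omega> t p) = (\<Sum>t\<in>F. \<Sum>p<r. \<Sum>i<k. c i * (u t p * H $$ (p, i) * s i t))"
    unfolding W_def if_P[OF assms] c_def[symmetric] s_def[symmetric] sum_distrib_left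
    by (rule sum.cong[OF refl], rule sum.cong[OF refl], rule sum.cong[OF refl], simp)
  also have "\<dots> = (\<Sum>t\<in>F. \<Sum>i<k. \<Sum>p<r. c i * (u t p * H $$ (p, i) * s i t))"
    by (rule sum.cong[OF refl], rule sum.swap)
  also have "\<dots> = (\<Sum>i<k. \<Sum>t\<in>F. \<Sum>p<r. c i * (u t p * H $$ (p, i) * s i t))"
    by (rule sum.swap)
  also have "\<dots> = (\<Sum>i<k. c i * (\<Sum>t\<in>F. weight u i t * s i t))"
    unfolding weight_def by (simp only: sum_distrib_left sum_distrib_right)
  also have "\<dots> = scaled_sum F (weight u) m \<omega>"
    unfolding scaled_sum_def c_def linear_form_def
    unfolding s_def by (rule sum.cong[OF refl]) (subst sum.swap, simp only: sum_distrib_left)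
  finally show ?thesis .
qed

lemma W_cos_tendsto:
  assumes F: "finite F" "F \<subseteq> T"
  shows "(\<lambda>m. expectation (\<lambda>\<omega>. cos (\<Sum>t\<in>F. \<Sum>p<r. u t p * W m \<omega> t p))) \<longlonglongrightarrow>
    N.expectation (\<lambda>\<omega>. cos (\<Sum>t\<in>F. \<Sum>p<r. u t p * z \<omega> t $ p))"
proof -
  have "\<forall>\<^sub>F m in sequentially. expectation (\<lambda>\<omega>. cos (scaled_sum F (weight u) m \<omega>)) =
      expectation (\<lambda>\<omega>. cos (\<Sum>t\<in>F. \<Sum>p<r. u t p * W m \<omega> t p))"
    using eventually_ok by (rule eventually_mono) (simp only: W_form)
  then show ?thesis
    unfolding z_form(2)[OF F] by (rule Lim_transform_eventually[OF expectation_cos_scaled_sum_tendsto[OF F]])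
qed

lemma W_second_moment:
  assumes "ok m" and t: "t \<in> T"
  shows "integrable M (\<lambda>\<omega>. (\<Sum>p<r. u p * W m \<omega> t p)\<^sup>2)"
    and "expectation (\<lambda>\<omega>. (\<Sum>p<r. u p * W m \<omega> t p)\<^sup>2) =
      (\<Sum>i<k. real (n m) / real (ns m i) * ((\<Sum>p<r. u p * H $$ (p, i))\<^sup>2 * \<gamma> i t t))"
proof -
  have eq: "(\<Sum>p<r. u p * W m \<omega> t p) = scaled_sum {t} (weight (\<lambda>_. u)) m \<omega>" for \<omega>
    using W_form[OF assms(1), of "\<lambda>_. u" \<omega> "{t}"] by simp
  have pos: "0 < ns m i" if "i < k" for i using assms(1) that by (auto simp: ok_def)
  have F: "finite {t}" "{t} \<subseteq> T" using t by auto
  show "integrable M (\<lambda>\<omega>. (\<Sum>p<r. u p * W m \<omega> t p)\<^sup>2)"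
    unfolding eq by (rule scaled_sum_second_moment(1)[OF F pos])
  have "expectation (\<lambda>\<omega>. (\<Sum>p<r. u p * W m \<omega> t p)\<^sup>2) = (\<Sum>i<k. real (n m) / real (ns m i) *
      (\<Sum>t'\<in>{t}. \<Sum>s\<in>{t}. weight (\<lambda>_. u) i t' * weight (\<lambda>_. u) i s * \<gamma> i t' s))"
    unfolding eq by (rule scaled_sum_second_moment(2)[OF F pos])
  then show "expectation (\<lambda>\<omega>. (\<Sum>p<r. u p * W m \<omega> t p)\<^sup>2) =
      (\<Sum>i<k. real (n m) / real (ns m i) * ((\<Sum>p<r. u p * H $$ (p, i))\<^sup>2 * \<gamma> i t t))"
    by (simp add: weight_def[abs_def] power2_eq_square[of "sum _ _"])
qed

text \<open>Convergence in law would not give this. For large \<open>m\<close> the second moment is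
  an explicit combination of the ratios n / n_i, and only these vary.\<close>

lemma W_second_moment_tendsto:
  assumes t: "t \<in> T"
  shows "(\<lambda>m. expectation (\<lambda>\<omega>. (\<Sum>p<r. u p * W m \<omega> t p)\<^sup>2)) \<longlonglongrightarrow> N.expectation (\<lambda>\<omega>. (\<Sum>p<r. u p * z \<omega> t $ p)\<^sup>2)"
proof -
  have e: "N.expectation (\<lambda>\<omega>. (\<Sum>p<r. u p * z \<omega> t $ p)\<^sup>2) = (\<Sum>i<k. 1 / \<tau> i * ((\<Sum>p<r. u p * H $$ (p, i))\<^sup>2 * \<gamma> i
    t t))"
  proof -
    have "N.expectation (\<lambda>\<omega>. (\<Sum>p<r. u p * z \<omega> t $ p)\<^sup>2) = limit_variance {t} (weight (\<lambda>_. u))"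
      using z_form(1)[of "{t}" "\<lambda>_. u"] t by simp
    also have "\<dots> = (\<Sum>i<k. 1 / \<tau> i * ((\<Sum>p<r. u p * H $$ (p, i))\<^sup>2 * \<gamma> i t t))"
      unfolding limit_variance_def unfolding weight_def power2_eq_square by simp
    finally show ?thesis .
  qed
  have l: "(\<lambda>m. \<Sum>i<k. real (n m) / real (ns m i) * ((\<Sum>p<r. u p * H $$ (p, i))\<^sup>2 * \<gamma> i t t)) \<longlonglongrightarrow>
      (\<Sum>i<k. 1 / \<tau> i * ((\<Sum>p<r. u p * H $$ (p, i))\<^sup>2 * \<gamma> i t t))"
    by (intro tendsto_sum tendsto_mult tendsto_const tau_lim_inverse) auto
  have ev: "\<forall>\<^sub>F m in sequentially. (\<Sum>i<k. real (n m) / real (ns m i) * ((\<Sum>p<r. u p * H $$ (p, i))\<^sup>2 * \<gamma> i t t)) =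
      expectation (\<lambda>\<omega>. (\<Sum>p<r. u p * W m \<omega> t p)\<^sup>2)"
    using eventually_ok by (rule eventually_mono) (rule W_second_moment(2)[OF _ t, symmetric])
  show ?thesis unfolding e by (rule Lim_transform_eventually[OF l ev])
qed

end

lemma sum_if_mult:
  "p < (r :: nat) \<Longrightarrow> (\<Sum>p'<r. (if p' = p then c else 0) * f p') = (c * f p :: real)"
proof -
  assume p: "p < r"
  have "(\<Sum>p'<r. (if p' = p then c else 0) * f p') = (\<Sum>p'<r. if p' = p then c * f p' else 0)"
    by (intro sum.cong) auto
  then show ?thesis using p by simp
qed

context k_sample_test
begin

definition off :: "nat \<Rightarrow> nat" where
  "off l = (\<Sum>m<l. rs m)"

lemma off_less:
  assumes "l < R" "p < rs l"
  shows "off l + p < r"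
proof -
  have "off l + p < (\<Sum>m<Suc l. rs m)" using assms by (simp add: off_def)
  also have "\<dots> \<le> r" unfolding r using assms by (intro sum_mono2) auto
  finally show ?thesis .
qed

lemma row_block_H:
  "row_block rs l H \<in> carrier_mat (rs l) k"
  "p < rs l \<Longrightarrow> i < k \<Longrightarrow> row_block rs l H $$ (p, i) = H $$ (off l + p, i)"
  using H by (auto simp: row_block_def off_def)

text \<open>The diagonal of \<Sigma> as a sequence; the value 1 from \<open>k\<close> on keeps all
  coordinates positive.\<close>

definition D :: "real \<Rightarrow> nat \<Rightarrow> real" where
  "D t i = (if i < k then 1 / \<tau> i * \<gamma> i t t else 1)"

definition ent :: "nat \<Rightarrow> nat \<Rightarrow> nat \<Rightarrow> real \<Rightarrow> real" where
  "ent l p q t = pinv_entry k (row_block rs l H) (D t) p q"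

lemma D_pos: "t \<in> T \<Longrightarrow> 0 < D t i"
  using gamma_pos tau_pos by (simp add: D_def)

lemma mat_diag_D: "mat_diag k (D t) = Sigma_mat k \<tau> \<gamma> t t"
  unfolding Sigma_mat_def mat_diag_def by (rule eq_matI) (auto simp: D_def)

lemma continuous_on_D: "continuous_on T D"
proof (rule continuous_on_coordinatewise_then_product)
  fix i show "continuous_on T (\<lambda>t. D t i)"
    using tau_pos[of i] by (cases "i < k") (auto simp: D_def intro!: continuous_intros gamma_cont)
qed

lemma continuous_on_ent:
  assumes "p < rs l" "q < rs l"
  shows "continuous_on T (ent l p q)"
  unfolding ent_def
  by (rule continuous_on_compose2[OF continuous_on_pinv_entry[OF row_block_H(1) assms] continuous_on_D])
    (use D_pos in auto)

lemma ent_measurable: "p < rs l \<Longrightarrow> q < rs l \<Longrightarrow> ent l p q \<in> borel_measurable \<mu>"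
  by (rule continuous_imp_measurable_on_sets_lebesgue[OF continuous_on_ent]) (simp_all add: T)

lemma ent_bounded:
  "\<exists>Ca\<ge>0. \<forall>l<R. \<forall>p<rs l. \<forall>q<rs l. \<forall>t\<in>T. \<bar>ent l p q t\<bar> \<le> Ca"
proof -
  define I where "I = (SIGMA l:{..<R}. {..<rs l} \<times> {..<rs l})"
  let ?e = "\<lambda>i. ent (fst i) (fst (snd i)) (snd (snd i))"
  have "\<exists>B. \<forall>t\<in>T. \<bar>?e i t\<bar> \<le> B" if "i \<in> I" for i
  proof -
    have "continuous_on T (?e i)" using that by (intro continuous_on_ent) (auto simp: I_def)
    from compact_imp_bounded[OF compact_continuous_image[OF this]] show ?thesis by (auto simp: bounded_iff T)
  qed
  then have "\<forall>i\<in>I. \<exists>B. \<forall>t\<in>T. \<bar>?e i t\<bar> \<le> B" by blast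
  from bchoice[OF this] obtain B where B: "\<forall>i\<in>I. \<forall>t\<in>T. \<bar>?e i t\<bar> \<le> B i" ..
  have fin: "finite I" by (auto simp: I_def)
  have "\<bar>?e i t\<bar> \<le> (\<Sum>i\<in>I. \<bar>B i\<bar>)" if "i \<in> I" "t \<in> T" for i t
  proof -
    have "\<bar>?e i t\<bar> \<le> \<bar>B i\<bar>" using B that by force
    also have "\<dots> \<le> (\<Sum>i\<in>I. \<bar>B i\<bar>)" using that fin by (intro member_le_sum) auto
    finally show ?thesis .
  qed
  from this[of "(l, p, q)" for l p q] show ?thesis
    by (intro exI[of _ "\<Sum>i\<in>I. \<bar>B i\<bar>"]) (auto simp: I_def intro: sum_nonneg)
qed

text \<open>The cap 2 / \<tau>_i in \<open>ok\<close> and the vanishing of \<open>W\<close>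
  otherwise make one constant work for all \<open>m\<close>.\<close>

lemma second_moment_bound:
  "\<exists>K\<ge>0. \<forall>t\<in>T. \<forall>p<r. (\<forall>m. expectation (\<lambda>\<omega>. (W m \<omega> t p)\<^sup>2) \<le> K) \<and> N.expectation (\<lambda>\<omega>. (z \<omega> t $ p)\<^sup>2) \<le> K"
proof -
  obtain g where g: "0 \<le> g" "\<And>i t. i < k \<Longrightarrow> t \<in> T \<Longrightarrow> \<gamma> i t t \<le> g" using gamma_bounded by blast
  define e where "e p = (\<Sum>i<k. 2 / \<tau> i * ((H $$ (p, i))\<^sup>2 * g))" for p
  have e0: "0 \<le> e p" for p unfolding e_def using g(1) tau_pos by (intro sum_nonneg) (simp add: less_imp_le)
  have le: "e p \<le> (\<Sum>p<r. e p)" if "p < r" for p using that e0 by (intro member_le_sum) auto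
  have weaken: "c * ((H $$ (p, i))\<^sup>2 * \<gamma> i t t) \<le> 2 / \<tau> i * ((H $$ (p, i))\<^sup>2 * g)"
    if "i < k" "t \<in> T" "c \<le> 2 / \<tau> i" for c p i t
    using that g tau_pos[OF that(1)] gamma_pos[OF that(1,2)] by (intro mult_mono) (auto simp: less_imp_le)
  have 1: "expectation (\<lambda>\<omega>. (W m \<omega> t p)\<^sup>2) \<le> (\<Sum>p<r. e p)" if t: "t \<in> T" and p: "p < r" for m t p
  proof (cases "ok m")
    case True
    have "expectation (\<lambda>\<omega>. (W m \<omega> t p)\<^sup>2) = (\<Sum>i<k. real (n m) / real (ns m i) * ((H $$ (p, i))\<^sup>2 * \<gamma> i t t))"
      using W_second_moment(2)[OF True t, of "\<lambda>p'. if p' = p then 1 else 0"] unfolding sum_if_mult[OF p] by simp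
    also have "\<dots> \<le> e p" unfolding e_def using True t by (intro sum_mono weaken) (auto simp: ok_def)
    finally show ?thesis using le[OF p] by simp
  next
    case False
    have "0 \<le> (\<Sum>p<r. e p)" using e0 by (intro sum_nonneg)
    then show ?thesis using False by (simp add: W_def)
  qed
  have 2: "N.expectation (\<lambda>\<omega>. (z \<omega> t $ p)\<^sup>2) \<le> (\<Sum>p<r. e p)" if t: "t \<in> T" and p: "p < r" for t p
  proof -
    have "N.expectation (\<lambda>\<omega>. (z \<omega> t $ p)\<^sup>2) = (\<Sum>i<k. 1 / \<tau> i * ((H $$ (p, i))\<^sup>2 * \<gamma> i t t))"
      using z_mult(2)[OF t p t p] by (simp add: power2_eq_square mult_ac)
    also have "\<dots> \<le> e p" unfolding e_def
    proof (intro sum_mono weaken)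
      fix i assume "i \<in> {..<k}"
      then show "1 / \<tau> i \<le> 2 / \<tau> i" using tau_pos[of i] by (intro divide_right_mono) auto
    qed (use t in auto)
    finally show ?thesis using le[OF p] by simp
  qed
  have "0 \<le> (\<Sum>p<r. e p)" using e0 by (intro sum_nonneg)
  with 1 2 show ?thesis by blast
qed

lemma W_pair_measurable: "(\<lambda>(\<omega>, t). W m \<omega> t p) \<in> borel_measurable (M \<Otimes>\<^sub>M \<mu>)"
  unfolding W_def case_prod_unfold
  by (cases "ok m")
    (simp_all only: if_True if_False, intro borel_measurable_sum borel_measurable_times borel_measurable_const
      v_pair_measurable, simp_all)

lemma W_L2_on: "\<omega> \<in> space M \<Longrightarrow> (\<lambda>t. W m \<omega> t p) \<in> L2_on T"
  unfolding W_def
  by (cases "ok m") (simp_all only: if_True if_False L2_on_zero, intro L2_on_sum L2_on_cmult v_L2_on, simp_all)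

lemma z_pair: "p < r \<Longrightarrow> L2_process N T (\<lambda>\<omega> t. z \<omega> t $ p)"
  using z unfolding gaussian_process_def by (elim conjE) simp

lemma W_sq_integrable:
  assumes "t \<in> T" "p < r"
  shows "integrable M (\<lambda>\<omega>. (W m \<omega> t p)\<^sup>2)"
proof (cases "ok m")
  case True
  show ?thesis using W_second_moment(1)[OF True assms(1), of "\<lambda>p'. if p' = p then 1 else 0"]
    unfolding sum_if_mult[OF assms(2)] by simp
qed (simp add: W_def)

lemma quadratic_functionals_instances:
  "\<exists>Ca K. 0 \<le> Ca \<and> 0 \<le> K \<and> (\<forall>m. quadratic_functionals M \<mu> r R (W m) rs off ent Ca K) \<and>
    quadratic_functionals N \<mu> r R (\<lambda>\<omega> t p. z \<omega> t $ p) rs off ent Ca K"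
proof -
  obtain Ca where Ca: "0 \<le> Ca" "\<forall>l<R. \<forall>p<rs l. \<forall>q<rs l. \<forall>t\<in>T. \<bar>ent l p q t\<bar> \<le> Ca"
    using ent_bounded by blast
  obtain K where K: "0 \<le> K" "\<forall>t\<in>T. \<forall>p<r. (\<forall>m. expectation (\<lambda>\<omega>. (W m \<omega> t p)\<^sup>2) \<le> K) \<and> N.expectation (\<lambda>\<omega>. (z \<omega> t
    $ p)\<^sup>2) \<le> K"
    using second_moment_bound by blast
  interpret mu: finite_measure \<mu> by (rule finite_measure_\<mu>)
  have "quadratic_functionals M \<mu> r R (W m) rs off ent Ca K" for m
  proof (unfold_locales)
    show "integrable \<mu> (\<lambda>t. (W m \<omega> t p)\<^sup>2)" if "\<omega> \<in> space M" for \<omega> p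
      using W_L2_on[OF that, of m p] by (simp add: L2_on_def)
  qed (use Ca K in \<open>simp_all add: W_pair_measurable off_less ent_measurable W_sq_integrable\<close>)
  moreover have "quadratic_functionals N \<mu> r R (\<lambda>\<omega> t p. z \<omega> t $ p) rs off ent Ca K"
  proof (unfold_locales)
    show "integrable \<mu> (\<lambda>t. (z \<omega> t $ p)\<^sup>2)" if "\<omega> \<in> space N" "p < r" for \<omega> p
      using z_pair[OF that(2)] that(1) by (auto simp: L2_on_def L2_process_def)
    show "(\<lambda>(\<omega>, t). z \<omega> t $ p) \<in> borel_measurable (N \<Otimes>\<^sub>M \<mu>)" if "p < r" for p
      using z_pair[OF that] by (auto simp: L2_process_def)
  qed (use Ca K z_moments(3) in \<open>simp_all add: off_less ent_measurable\<close>)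
  ultimately show ?thesis using Ca(1) K(1) by blast
qed

lemma second_moment_pair_tendsto:
  assumes t: "t \<in> T" and p: "p < r" and q: "q < r"
  shows "(\<lambda>m. expectation (\<lambda>\<omega>. (W m \<omega> t p + s * W m \<omega> t q)\<^sup>2)) \<longlonglongrightarrow> N.expectation (\<lambda>\<omega>. (z \<omega> t $ p + s * z \<omega> t $ q)\<^sup>2)"
proof -
  let ?u = "\<lambda>p'. (if p' = p then 1 else 0) + (if p' = q then s else 0)"
  have e: "(\<Sum>p'<r. ?u p' * f p') = f p + s * f q" for f :: "nat \<Rightarrow> real"
    unfolding distrib_right sum.distrib sum_if_mult[OF p] sum_if_mult[OF q] by simp
  from W_second_moment_tendsto[OF t, of ?u] show ?thesis unfolding e .
qed

end

lemma complete_measure_lebesgue_on: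
  assumes T: "T \<in> sets lebesgue"
  shows "complete_measure (lebesgue_on T)"
proof
  fix A B :: "'a set" assume BA: "B \<subseteq> A" and A: "A \<in> null_sets (lebesgue_on T)"
  have "A \<subseteq> T" "A \<in> null_sets lebesgue"
    using A null_sets_restrict_space[of T lebesgue A] T by auto
  then have "B \<subseteq> T" "B \<in> sets lebesgue"
    using BA completion.complete[of B A lborel] by auto
  then show "B \<in> sets (lebesgue_on T)" using T by (simp add: sets_restrict_space_iff)
qed

lemma (in complete_measure) borel_measurable_AE_eq:
  fixes f g :: "'a \<Rightarrow> real"
  assumes g: "g \<in> borel_measurable M" and eq: "AE x in M. f x = g x"
  shows "f \<in> borel_measurable M"
proof (rule borel_measurableI)
  fix S :: "real set" assume "open S"
  then have A: "g -` S \<inter> space M \<in> sets M" using g by (auto intro: measurable_sets)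
  have ae: "AE x in M. x \<in> g -` S \<inter> space M \<longleftrightarrow> x \<in> f -` S \<inter> space M"
    using eq by eventually_elim simp
  show "f -` S \<inter> space M \<in> sets M" by (rule in_sets_AE[OF ae A]) simp
qed

lemma mat_diag_cong: "(\<And>i. i < k \<Longrightarrow> d i = d' i) \<Longrightarrow> mat_diag k d = mat_diag k d'"
  unfolding mat_diag_def by (rule eq_matI) auto

section \<open>The null hypothesis and the estimated variances\<close>

locale k_sample_null = k_sample_test M a b T k x \<eta> \<gamma> \<tau> ns n N r R rs H z
  for M :: "'w measure" and a b T k x \<eta> \<gamma> \<tau> ns n and N :: "'z measure" and r R rs H z +
  fixes c :: "real \<Rightarrow> real Matrix.vec"
  assumes null: "\<And>t. t \<in> T \<Longrightarrow> H *\<^sub>v Matrix.vec k (\<lambda>i. \<eta> i t) = c t"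
begin

definition stat :: "nat \<Rightarrow> 'w \<Rightarrow> nat \<Rightarrow> real" where
  "stat m \<omega> l = (if l < R then T_stat T k (ns m) (\<lambda>i j t. x i j \<omega> t) (row_block rs l H) (\<lambda>t. vec_block rs l (c
    t)) else 0)"

definition Dhat :: "nat \<Rightarrow> 'w \<Rightarrow> real \<Rightarrow> nat \<Rightarrow> real" where
  "Dhat m \<omega> t i = real (n m) / real (ns m i) * ghat m i \<omega> t"

definition Wvec :: "nat \<Rightarrow> 'w \<Rightarrow> nat \<Rightarrow> real \<Rightarrow> real Matrix.vec" where
  "Wvec m \<omega> l t = Matrix.vec (rs l) (\<lambda>p. W m \<omega> t (off l + p))"

definition Qhat :: "nat \<Rightarrow> 'w \<Rightarrow> nat \<Rightarrow> real \<Rightarrow> real" where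
  "Qhat m \<omega> l t = pinv_form k (row_block rs l H) (Dhat m \<omega> t) (Wvec m \<omega> l t)"

lemma Wvec_carrier: "Wvec m \<omega> l t \<in> carrier_vec (rs l)"
  by (simp add: Wvec_def)

text \<open>The null hypothesis turns \<open>c\<close> into the image of the true means, so
  centering by \<open>c\<close> is centering by \<eta>.\<close>

lemma residual_entry:
  fixes \<omega> :: 'w
  assumes ok: "ok m" and t: "t \<in> T" and l: "l < R" and p: "p < rs l"
  defines "y \<equiv> row_block rs l H *\<^sub>v Matrix.vec k (\<lambda>i. eta_hat (ns m) (\<lambda>i j t. x i j \<omega> t) i t) - vec_block rs l
    (c t)"
  shows "sqrt (n m) * y $ p = W m \<omega> t (off l + p)"
proof -
  let ?e = "\<lambda>i. eta_hat (ns m) (\<lambda>i j t. x i j \<omega> t) i t"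
  have op: "off l + p < r" by (rule off_less[OF l p])
  have "y $ p = (\<Sum>i<k. H $$ (off l + p, i) * ?e i) - c t $ (off l + p)"
    using row_block_H(1)[of l] p unfolding y_def vec_block_def off_def[symmetric]
    by (simp add: scalar_prod_def lessThan_atLeast0 row_block_H(2))
  also have "c t $ (off l + p) = (\<Sum>i<k. H $$ (off l + p, i) * \<eta> i t)"
    unfolding null[OF t, symmetric] using H op by (simp add: scalar_prod_def lessThan_atLeast0)
  finally have y: "y $ p = (\<Sum>i<k. H $$ (off l + p, i) * (?e i - \<eta> i t))"
    by (simp add: sum_subtractf right_diff_distrib)
  have e: "?e i - \<eta> i t = (\<Sum>j<ns m i. v i j \<omega> t) / ns m i" if "i < k" for i
  proof -
    have "0 < ns m i" using ok that by (auto simp: ok_def)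
    then show ?thesis by (simp add: eta_hat_def v_def sum_subtractf diff_divide_distrib)
  qed
  have "sqrt (n m) * y $ p = (\<Sum>i<k. sqrt (n m) / ns m i * (H $$ (off l + p, i) * (\<Sum>j<ns m i. v i j \<omega> t)))"
    unfolding y by (subst sum_distrib_left, rule sum.cong[OF refl]) (simp add: e)
  then show ?thesis using ok by (simp add: W_def)
qed

text \<open>The factor \<open>n\<close> is split into two roots, one for each argument of the
  quadratic form. The integrands agree at every time, so the identity holds for every \<omega>,
  integrable or not.\<close>

lemma stat_eq:
  assumes ok: "ok m" and l: "l < R"
  shows "stat m \<omega> l = (\<integral>t. Qhat m \<omega> l t \<partial>\<mu>)"
proof -
  let ?A = "row_block rs l H"
  let ?y = "\<lambda>t. ?A *\<^sub>v Matrix.vec k (\<lambda>i. eta_hat (ns m) (\<lambda>i j t. x i j \<omega> t) i t) - vec_block rs l (c t)"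
  have y: "?y t \<in> carrier_vec (rs l)" for t
    unfolding vec_block_def by (intro minus_carrier_vec mult_mat_vec_carrier[OF row_block_H(1)] vec_carrier)
  have Sig: "Sigma_hat k (ns m) (\<lambda>i j t. x i j \<omega> t) t t = mat_diag k (Dhat m \<omega> t)" for t
    unfolding Sigma_hat_def by (rule mat_diag_cong) (simp only: n[of m, symmetric] Dhat_def ghat_def)
  have "real (\<Sum>i<k. ns m i) * (?y t \<bullet> (moore_penrose_inverse (?A * Sigma_hat k (ns m) (\<lambda>i j t. x i j \<omega> t) t t
    * ?A\<^sup>T) *\<^sub>v ?y t))
      = Qhat m \<omega> l t" if t: "t \<in> T" for t
  proof -
    let ?P = "pinv_entry k ?A (Dhat m \<omega> t)"
    have "real (n m) * pinv_form k ?A (Dhat m \<omega> t) (?y t) = (\<Sum>p<rs l. \<Sum>q<rs l. ?P p q * ((sqrt (n m) * ?y t $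
      p) * (sqrt (n m) * ?y t $ q)))"
    proof -
      have sq: "sqrt (n m) * a * (sqrt (n m) * b) = n m * (a * b)" for a b :: real
      proof -
        have "sqrt (n m) * a * (sqrt (n m) * b) = (sqrt (n m) * sqrt (n m)) * (a * b)" by (simp only: mult_ac)
        then show ?thesis by simp
      qed
      show ?thesis
        unfolding pinv_form_eq_sum[OF row_block_H(1) y] sq sum_distrib_left
        by (rule sum.cong[OF refl], rule sum.cong[OF refl]) simp
    qed
    also have "\<dots> = (\<Sum>p<rs l. \<Sum>q<rs l. ?P p q * (Wvec m \<omega> l t $ p * Wvec m \<omega> l t $ q))"
      using residual_entry[OF ok t l] by (intro sum.cong refl) (simp add: Wvec_def)
    also have "\<dots> = Qhat m \<omega> l t"
      unfolding Qhat_def pinv_form_eq_sum[OF row_block_H(1) Wvec_carrier] ..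
    finally show ?thesis unfolding Sig n[of m, symmetric] pinv_form_def .
  qed
  then show ?thesis using l unfolding stat_def T_stat_def
    by (simp only: if_True) (rule Bochner_Integration.integral_cong[OF refl], simp)
qed

lemma gamma_lower_bound: "\<exists>g>0. \<forall>i<k. \<forall>t\<in>T. g \<le> \<gamma> i t t"
proof -
  have "\<exists>g>0. \<forall>t\<in>T. g \<le> \<gamma> i t t" if i: "i < k" for i
  proof -
    have "compact T" "T \<noteq> {}" using ab by (auto simp: T)
    then obtain t0 where "t0 \<in> T" "\<forall>t\<in>T. \<gamma> i t0 t0 \<le> \<gamma> i t t"
      using continuous_attains_inf[OF _ _ gamma_cont[OF i]] by auto
    then show ?thesis using gamma_pos[OF i] by (intro exI[of _ "\<gamma> i t0 t0"]) auto
  qed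
  then have "\<forall>i\<in>{..<k}. \<exists>g>0. \<forall>t\<in>T. g \<le> \<gamma> i t t" by blast
  from bchoice[OF this] obtain g where g: "\<forall>i\<in>{..<k}. 0 < g i \<and> (\<forall>t\<in>T. g i \<le> \<gamma> i t t)" ..
  let ?m = "Min (insert 1 (g ` {..<k}))"
  have "0 < ?m" using g by (subst Min_gr_iff) auto
  moreover have "?m \<le> \<gamma> i t t" if "i < k" "t \<in> T" for i t
  proof -
    have "?m \<le> g i" using that by (intro Min_le) auto
    also have "\<dots> \<le> \<gamma> i t t" using g that by auto
    finally show ?thesis .
  qed
  ultimately show ?thesis by blast
qed

text \<open>The true variances are bounded below on the compact interval, so a uniform additive
  error is a uniform relative one, as the comparison of quadratic forms requires.\<close>

lemma Dhat_uniform: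
  assumes \<kappa>: "1 < \<kappa>" and p: "0 < p"
  shows "\<forall>\<^sub>F m in sequentially. \<exists>G\<in>events. prob G \<ge> 1 - p \<and> (\<forall>\<omega>\<in>G. AE t in \<mu>. \<forall>i<k.
    0 < Dhat m \<omega> t i \<and> Dhat m \<omega> t i \<le> \<kappa> * D t i \<and> D t i \<le> \<kappa> * Dhat m \<omega> t i)"
proof -
  obtain g where g: "0 < g" "\<And>i t. i < k \<Longrightarrow> t \<in> T \<Longrightarrow> g \<le> \<gamma> i t t" using gamma_lower_bound by blast
  \<comment> \<open>The factor \<kappa> is shared equally between the ratio n / n_i and the
    estimator of \<gamma>_i.\<close>
  define s where "s = sqrt \<kappa>"
  have s: "1 < s" and ss: "s * s = \<kappa>" using \<kappa> by (auto simp: s_def)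
  define q where "q = 1 / s"
  have q: "0 < q" "q < 1" and sq: "s * q = 1" using s by (auto simp: q_def)
  \<comment> \<open>Lets the one tolerance g (1 - q) ensure both the upper factor \<open>s\<close>
    and the lower factor \<open>q\<close>.\<close>
  have qq: "1 - q \<le> s - 1"
  proof -
    have "0 \<le> (s - 1) * (1 - q)" using s q by simp
    then have "0 \<le> s - s * q - 1 + q" by (simp add: algebra_simps)
    then show ?thesis using sq by linarith
  qed
  define \<rho> where "\<rho> = g * (1 - q)"
  have \<rho>: "0 < \<rho>" using g q by (simp add: \<rho>_def)
  have "\<forall>\<^sub>F m in sequentially. q * (1 / \<tau> i) \<le> n m / ns m i \<and> n m / ns m i \<le> s * (1 / \<tau> i)" if i: "i < k" for i
  proof -
    have t: "0 < 1 / \<tau> i" using tau_pos[OF i] by simp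
    have "q * (1 / \<tau> i) < 1 / \<tau> i" "1 / \<tau> i < s * (1 / \<tau> i)"
      using mult_strict_right_mono[OF q(2) t] mult_strict_right_mono[OF s t] by simp_all
    then have "\<forall>\<^sub>F m in sequentially. q * (1 / \<tau> i) < real (n m) / real (ns m i)"
        "\<forall>\<^sub>F m in sequentially. real (n m) / real (ns m i) < s * (1 / \<tau> i)"
      using order_tendstoD[OF tau_lim_inverse[OF i]] by blast+
    then show ?thesis by eventually_elim auto
  qed
  then have "\<forall>\<^sub>F m in sequentially. \<forall>i\<in>{..<k}. q * (1 / \<tau> i) \<le> n m / ns m i \<and> n m / ns m i \<le> s * (1 / \<tau> i)"
    by (intro eventually_ball_finite) auto
  with ghat_uniform[OF \<rho> p] show ?thesis
  proof eventually_elim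
    case (elim m)
    from elim(1) obtain G where G: "G \<in> events" "prob G \<ge> 1 - p"
      "\<forall>\<omega>\<in>G. AE t in \<mu>. \<forall>i<k. \<bar>ghat m i \<omega> t - \<gamma> i t t\<bar> \<le> \<rho>" by blast
    have "AE t in \<mu>. \<forall>i<k. 0 < Dhat m \<omega> t i \<and> Dhat m \<omega> t i \<le> \<kappa> * D t i \<and> D t i \<le> \<kappa> * Dhat m \<omega> t i" if "\<omega> \<in> G" for \<omega>
    proof -
      have "AE t in \<mu>. \<forall>i<k. \<bar>ghat m i \<omega> t - \<gamma> i t t\<bar> \<le> \<rho>" using G(3) that by blast
      then show ?thesis
      proof (rule AE_mp, intro AE_I2 impI allI)
        fix t i assume t: "t \<in> space \<mu>" and le: "\<forall>i<k. \<bar>ghat m i \<omega> t - \<gamma> i t t\<bar> \<le> \<rho>" and i: "i < k"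
        define f h e u where "f = real (n m) / real (ns m i)" and "h = ghat m i \<omega> t" and "e = \<gamma> i t t" and "u
          = 1 / \<tau> i"
        have u: "0 < u" using tau_pos[OF i] by (simp add: u_def)
        have e: "g \<le> e" "0 < e" using g(2)[OF i] gamma_pos[OF i] t by (auto simp: e_def)
        have "\<bar>h - e\<bar> \<le> \<rho>" using le i by (simp add: h_def e_def)
        moreover have "\<rho> \<le> e * (1 - q)" using e q unfolding \<rho>_def by (intro mult_right_mono) auto
        moreover have "e * (1 - q) \<le> e * (s - 1)" using e qq by (intro mult_left_mono) auto
        ultimately have "h - e \<le> e * (s - 1)" "e - h \<le> e * (1 - q)" by linarith+
        then have h: "h \<le> s * e" "q * e \<le> h" by (simp_all add: algebra_simps)
        have f: "q * u \<le> f" "f \<le> s * u" using elim(2) i by (auto simp: f_def u_def)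
        have qe: "0 < q * e" "0 < q * u" using q e u by auto
        have hp: "0 < h" "0 < f" using qe h f by linarith+
        have D: "Dhat m \<omega> t i = f * h" "D t i = u * e" using i
          by (auto simp: Dhat_def D_def f_def h_def u_def e_def)
        have "f * h \<le> (s * u) * (s * e)" using f h hp u s by (intro mult_mono) auto
        then have 1: "f * h \<le> \<kappa> * (u * e)" unfolding ss[symmetric] by (simp only: mult_ac)
        have "(q * u) * (q * e) \<le> f * h" using f h hp qe by (intro mult_mono) auto
        then have "\<kappa> * ((q * u) * (q * e)) \<le> \<kappa> * (f * h)" using \<kappa> by (intro mult_left_mono) auto
        moreover have "\<kappa> * ((q * u) * (q * e)) = (s * q) * (s * q) * (u * e)"
          unfolding ss[symmetric] by (simp only: mult_ac)
        ultimately have 2: "u * e \<le> \<kappa> * (f * h)" by (simp add: sq)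
        show "0 < Dhat m \<omega> t i \<and> Dhat m \<omega> t i \<le> \<kappa> * D t i \<and> D t i \<le> \<kappa> * Dhat m \<omega> t i"
          unfolding D using hp 1 2 by simp
      qed
    qed
    then show ?case using G(1,2) by blast
  qed
qed

text \<open>Measurability matters because the integral of a nonmeasurable function is 0. Off a null set of
  times the integrand is a continuous function of the estimated variances; completeness of the
  Lebesgue measure takes care of the null set.\<close>

lemma Qhat_measurable:
  assumes \<omega>: "\<omega> \<in> space M" and l: "l < R"
    and pos: "AE t in \<mu>. \<forall>i<k. 0 < Dhat m \<omega> t i"
  shows "Qhat m \<omega> l \<in> borel_measurable \<mu>"
proof -
  \<comment> \<open>Replacing nonpositive values by 1 keeps \<open>D'\<close> in the set where the
    entries of the pseudoinverse are continuous; the first \<open>k\<close> coordinates are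
    unchanged at almost every time.\<close>
  define D' where "D' t i = (if i < k \<and> 0 < Dhat m \<omega> t i then Dhat m \<omega> t i else 1)" for t i
  have ghat: "(\<lambda>t. ghat m i \<omega> t) \<in> borel_measurable \<mu>" if "i < k" for i
    using measurable_compose[OF measurable_Pair1'[OF \<omega>] ghat_pair_measurable[OF that]] by simp
  have "(\<lambda>t. D' t i) \<in> borel_measurable \<mu>" for i
  proof (cases "i < k")
    case True
    note [measurable] = ghat[OF True]
    show ?thesis unfolding D'_def Dhat_def using True by simp
  qed (simp add: D'_def)
  then have D': "D' \<in> borel_measurable \<mu>" by (rule measurable_fun_coordinatewise)
  have "D' \<in> measurable \<mu> (restrict_space borel {d. \<forall>i<k. 0 < d i})"
    by (rule measurable_restrict_space2[OF _ D']) (auto simp: D'_def)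
  from measurable_compose[OF this borel_measurable_continuous_on_restrict[OF continuous_on_pinv_entry[OF
    row_block_H(1)]]]
  have ent': "(\<lambda>t. pinv_entry k (row_block rs l H) (D' t) p q) \<in> borel_measurable \<mu>" if "p < rs l" "q < rs l"
    for p q
    using that by blast
  have Wm: "(\<lambda>t. W m \<omega> t p) \<in> borel_measurable \<mu>" for p using W_L2_on[OF \<omega>, of m p] by (simp add: L2_on_def)
  let ?g = "\<lambda>t. \<Sum>p<rs l. \<Sum>q<rs l. pinv_entry k (row_block rs l H) (D' t) p q * (W m \<omega> t (off l + p) * W m \<omega> t
    (off l + q))"
  have g: "?g \<in> borel_measurable \<mu>"
    by (intro borel_measurable_sum borel_measurable_times ent' Wm) auto
  have "AE t in \<mu>. Qhat m \<omega> l t = ?g t"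
    using pos
  proof eventually_elim
    case (elim t)
    then have "mat_diag k (Dhat m \<omega> t) = mat_diag k (D' t)" by (intro mat_diag_cong) (simp add: D'_def)
    then have "Qhat m \<omega> l t = pinv_form k (row_block rs l H) (D' t) (Wvec m \<omega> l t)"
      unfolding Qhat_def pinv_form_def by simp
    also have "\<dots> = ?g t"
      unfolding pinv_form_eq_sum[OF row_block_H(1) Wvec_carrier] by (intro sum.cong refl) (simp add: Wvec_def)
    finally show ?case .
  qed
  moreover have "complete_measure \<mu>" by (rule complete_measure_lebesgue_on) (simp add: T)
  ultimately show ?thesis using complete_measure.borel_measurable_AE_eq g by blast
qed

text \<open>The relative error of the quadratic forms holds at almost every time and integrates to a
  relative error of the statistic, which \<open>S_bound\<close> turns into a bound common to all
  \<open>l\<close>.\<close>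

lemma stat_close:
  assumes W: "quadratic_functionals M \<mu> r R (W m) rs off ent Ca K"
    and ok: "ok m" and \<omega>: "\<omega> \<in> space M" and \<kappa>: "1 < \<kappa>"
    and D: "AE t in \<mu>. \<forall>i<k. 0 < Dhat m \<omega> t i \<and> Dhat m \<omega> t i \<le> \<kappa> * D t i \<and> D t i \<le> \<kappa> * Dhat m \<omega> t i"
  shows "\<bar>stat m \<omega> l - quadratic_functionals.S \<mu> R (W m) rs off ent l \<omega>\<bar>
    \<le> (\<kappa> - 1) * quadratic_functionals.S_bound \<mu> R (W m) rs off Ca \<omega>"
proof -
  interpret q: quadratic_functionals M \<mu> r R "W m" rs off ent Ca K by (rule W)
  show ?thesis
  proof (cases "l < R")
    case True
    have Q: "q.Q l \<omega> t = pinv_form k (row_block rs l H) (D t) (Wvec m \<omega> l t)" for t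
      unfolding q.Q_def pinv_form_eq_sum[OF row_block_H(1) Wvec_carrier] ent_def
      by (intro sum.cong refl) (simp add: Wvec_def)
    have Qi: "integrable \<mu> (q.Q l \<omega>)" by (rule q.Q_path_integrable[OF True \<omega>])
    have close: "AE t in \<mu>. \<bar>Qhat m \<omega> l t - q.Q l \<omega> t\<bar> \<le> (\<kappa> - 1) * q.Q l \<omega> t"
      using D AE_space
    proof eventually_elim
      case (elim t)
      then have "t \<in> T" by simp
      then show ?case unfolding Qhat_def Q using elim \<kappa> D_pos
        by (intro pinv_form_close[OF row_block_H(1) Wvec_carrier]) auto
    qed
    have pos: "AE t in \<mu>. \<forall>i<k. 0 < Dhat m \<omega> t i" using D by eventually_elim auto
    note Qm = Qhat_measurable[OF \<omega> True pos]
    \<comment> \<open>Integrability of the difference, and with it of \<open>Qhat\<close>, must be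
      known before the integral of the difference may be split.\<close>
    have di: "integrable \<mu> (\<lambda>t. Qhat m \<omega> l t - q.Q l \<omega> t)"
    proof (rule Bochner_Integration.integrable_bound)
      show "integrable \<mu> (\<lambda>t. (\<kappa> - 1) * q.Q l \<omega> t)" using Qi by simp
      show "AE t in \<mu>. norm (Qhat m \<omega> l t - q.Q l \<omega> t) \<le> norm ((\<kappa> - 1) * q.Q l \<omega> t)"
        using close by eventually_elim simp
    qed (use Qm Qi in auto)
    have Qhi: "integrable \<mu> (Qhat m \<omega> l)" using Bochner_Integration.integrable_add[OF di Qi] by simp
    have "stat m \<omega> l - q.S l \<omega> = (\<integral>t. Qhat m \<omega> l t - q.Q l \<omega> t \<partial>\<mu>)"
      unfolding stat_eq[OF ok True] q.S_def using True Qhi Qi by simp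
    then have "\<bar>stat m \<omega> l - q.S l \<omega>\<bar> \<le> (\<integral>t. \<bar>Qhat m \<omega> l t - q.Q l \<omega> t\<bar> \<partial>\<mu>)"
      using integral_abs_bound[of \<mu> "\<lambda>t. Qhat m \<omega> l t - q.Q l \<omega> t"] by simp
    also have "\<dots> \<le> (\<integral>t. (\<kappa> - 1) * q.Q l \<omega> t \<partial>\<mu>)"
      using di Qi close by (intro integral_mono_AE) auto
    also have "\<dots> = (\<kappa> - 1) * q.S l \<omega>" using True by (simp add: q.S_def)
    also have "\<dots> \<le> (\<kappa> - 1) * q.S_bound \<omega>" using q.S_le_S_bound(1)[OF \<omega>, of l] \<kappa> by (intro mult_left_mono) auto
    finally show ?thesis .
  next
    case False
    then show ?thesis using q.S_le_S_bound(2)[OF \<omega>] \<kappa> by (simp add: stat_def q.S_def)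
  qed
qed

end

lemma (in prob_space) prob_Int_ge:
  assumes A: "A \<in> events" "prob A \<ge> 1 - a" and B: "B \<in> events" "prob B \<ge> 1 - b"
  shows "prob (A \<inter> B) \<ge> 1 - (a + b)"
proof -
  have "prob (A - B) = prob A - prob (A \<inter> B)" by (rule finite_measure_Diff'[OF A(1) B(1)])
  moreover have "prob (A - B) \<le> prob (space M - B)"
    using A(1) B(1) sets.sets_into_space[OF A(1)] by (intro finite_measure_mono) auto
  moreover have "prob (space M - B) = 1 - prob B" by (rule prob_compl[OF B(1)])
  ultimately show ?thesis using A(2) B(2) by linarith
qed

context k_sample_null
begin

definition limit_stat :: "'z \<Rightarrow> nat \<Rightarrow> real" where
  "limit_stat \<omega> l = quadratic_functionals.S \<mu> R (\<lambda>\<omega> t p. z \<omega> t $ p) rs off ent l \<omega>"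

lemma limit_stat_measurable: "(\<lambda>\<omega>. limit_stat \<omega> l) \<in> borel_measurable N"
  and limit_stat_0: "l \<ge> R \<Longrightarrow> limit_stat \<omega> l = 0"
proof -
  obtain Ca K where "quadratic_functionals N \<mu> r R (\<lambda>\<omega> t p. z \<omega> t $ p) rs off ent Ca K"
    using quadratic_functionals_instances by blast
  then interpret q: quadratic_functionals N \<mu> r R "\<lambda>\<omega> t p. z \<omega> t $ p" rs off ent Ca K .
  show "(\<lambda>\<omega>. limit_stat \<omega> l) \<in> borel_measurable N"
    unfolding limit_stat_def by (rule q.S_measurable)
  show "l \<ge> R \<Longrightarrow> limit_stat \<omega> l = 0" unfolding limit_stat_def q.S_def by simp
qed

lemma limit_stat_eq:
  assumes \<omega>: "\<omega> \<in> space N" and l: "l < R"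
  shows "(\<integral>t. vec_block rs l (z \<omega> t) \<bullet>
      (moore_penrose_inverse (row_block rs l H * Sigma_mat k \<tau> \<gamma> t t * (row_block rs l H)\<^sup>T) *\<^sub>v
        vec_block rs l (z \<omega> t)) \<partial>\<mu>) = limit_stat \<omega> l"
proof -
  obtain Ca K where "quadratic_functionals N \<mu> r R (\<lambda>\<omega> t p. z \<omega> t $ p) rs off ent Ca K"
    using quadratic_functionals_instances by blast
  then interpret q: quadratic_functionals N \<mu> r R "\<lambda>\<omega> t p. z \<omega> t $ p" rs off ent Ca K .
  have c: "vec_block rs l (z \<omega> t) \<in> carrier_vec (rs l)" for t unfolding vec_block_def by (rule vec_carrier)
  have "pinv_form k (row_block rs l H) (D t) (vec_block rs l (z \<omega> t)) = q.Q l \<omega> t" for t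
    unfolding pinv_form_eq_sum[OF row_block_H(1) c] q.Q_def ent_def
    by (rule sum.cong[OF refl], rule sum.cong[OF refl]) (simp add: vec_block_def off_def)
  then show ?thesis
    unfolding limit_stat_def q.S_def mat_diag_D[symmetric] pinv_form_def[symmetric] using l by simp
qed

text \<open>Half of \<epsilon> goes to the cosine approximation of the forms with the true
  variances, the other half to the replacement of the estimated variances, which is paid with
  \<open>S_bound\<close>.\<close>

lemma stat_approximation:
  assumes \<epsilon>: "0 < \<epsilon>"
  shows "\<exists>A A'.
    (\<forall>m l. (\<lambda>\<omega>. A m \<omega> l) \<in> borel_measurable M) \<and> (\<forall>l. (\<lambda>\<omega>. A' \<omega> l) \<in> borel_measurable N) \<and>
    (\<forall>\<Phi> :: (nat \<Rightarrow> real) \<Rightarrow> real. continuous_on UNIV \<Phi> \<longrightarrow> (\<lambda>m. \<integral>\<omega>. \<Phi> (A m \<omega>) \<partial>M) \<longlonglongrightarrow> (\<integral>\<omega>. \<Phi> (A' \<omega>) \<partial>N)) \<and>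
    (\<forall>\<^sub>F m in sequentially. \<exists>G\<in>sets M. measure M G \<ge> 1 - \<epsilon> \<and> (\<forall>\<omega>\<in>G. \<forall>l. \<bar>stat m \<omega> l - A m \<omega> l\<bar> \<le> \<epsilon>)) \<and>
    (\<exists>G\<in>sets N. measure N G \<ge> 1 - \<epsilon> \<and> (\<forall>\<omega>\<in>G. \<forall>l. \<bar>limit_stat \<omega> l - A' \<omega> l\<bar> \<le> \<epsilon>))"
proof -
  obtain Ca K where W: "\<And>m. quadratic_functionals M \<mu> r R (W m) rs off ent Ca K"
    and Z: "quadratic_functionals N \<mu> r R (\<lambda>\<omega> t p. z \<omega> t $ p) rs off ent Ca K"
    using quadratic_functionals_instances by (elim exE conjE) (rule that, blast+)
  interpret q: quadratic_functionals M \<mu> r R "W m" rs off ent Ca K for m by (rule W)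
  have h: "0 < \<epsilon> / 2" using \<epsilon> by simp
  have "\<exists>A A'.
    (\<forall>m l. (\<lambda>\<omega>. A m \<omega> l) \<in> borel_measurable M) \<and> (\<forall>l. (\<lambda>\<omega>. A' \<omega> l) \<in> borel_measurable N) \<and>
    (\<forall>\<Phi> :: (nat \<Rightarrow> real) \<Rightarrow> real. continuous_on UNIV \<Phi> \<longrightarrow> (\<lambda>m. \<integral>\<omega>. \<Phi> (A m \<omega>) \<partial>M) \<longlonglongrightarrow> (\<integral>\<omega>. \<Phi> (A' \<omega>) \<partial>N)) \<and>
    (\<forall>\<^sub>F m in sequentially. \<exists>G\<in>sets M. measure M G \<ge> 1 - \<epsilon> / 2 \<and> (\<forall>\<omega>\<in>G. \<forall>l. \<bar>q.S m l \<omega> - A m \<omega> l\<bar> \<le> \<epsilon> / 2)) \<and>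
    (\<exists>G\<in>sets N. measure N G \<ge> 1 - \<epsilon> / 2 \<and> (\<forall>\<omega>\<in>G. \<forall>l. \<bar>limit_stat \<omega> l - A' \<omega> l\<bar> \<le> \<epsilon> / 2))"
    unfolding limit_stat_def
  proof (rule quadratic_functionals_approximation[OF W Z])
    fix F :: "real set" and u :: "real \<Rightarrow> nat \<Rightarrow> real" assume "finite F" "F \<subseteq> space \<mu>"
    then show "(\<lambda>m. expectation (\<lambda>\<omega>. cos (\<Sum>t\<in>F. \<Sum>p<r. u t p * W m \<omega> t p))) \<longlonglongrightarrow>
        N.expectation (\<lambda>\<omega>. cos (\<Sum>t\<in>F. \<Sum>p<r. u t p * z \<omega> t $ p))"
      by (intro W_cos_tendsto) simp_all
  next
    fix t p q and s :: real assume "t \<in> space \<mu>" "p < r" "q < r"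
    then show "(\<lambda>m. expectation (\<lambda>\<omega>. (W m \<omega> t p + s * W m \<omega> t q)\<^sup>2)) \<longlonglongrightarrow> N.expectation (\<lambda>\<omega>. (z \<omega> t $ p + s * z \<omega>
      t $ q)\<^sup>2)"
      by (intro second_moment_pair_tendsto) simp_all
  qed (rule h)
  then obtain A A' where A: "\<forall>m l. (\<lambda>\<omega>. A m \<omega> l) \<in> borel_measurable M" "\<forall>l. (\<lambda>\<omega>. A' \<omega> l) \<in> borel_measurable N"
    "\<forall>\<Phi> :: (nat \<Rightarrow> real) \<Rightarrow> real. continuous_on UNIV \<Phi> \<longrightarrow> (\<lambda>m. \<integral>\<omega>. \<Phi> (A m \<omega>) \<partial>M) \<longlonglongrightarrow> (\<integral>\<omega>. \<Phi> (A' \<omega>) \<partial>N)"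
    and AM: "\<forall>\<^sub>F m in sequentially. \<exists>G\<in>sets M. measure M G \<ge> 1 - \<epsilon> / 2 \<and> (\<forall>\<omega>\<in>G. \<forall>l. \<bar>q.S m l \<omega> - A m \<omega> l\<bar> \<le> \<epsilon> / 2)"
    and AN: "\<exists>G\<in>sets N. measure N G \<ge> 1 - \<epsilon> / 2 \<and> (\<forall>\<omega>\<in>G. \<forall>l. \<bar>limit_stat \<omega> l - A' \<omega> l\<bar> \<le> \<epsilon> / 2)"
    by (elim exE conjE) (rule that)
  define C where "C = Ca * (\<Sum>l<R. \<Sum>p<rs l. \<Sum>q<rs l. 2 * K * measure \<mu> (space \<mu>))"
  have EC: "expectation (q.S_bound m) \<le> C" for m unfolding C_def by (rule q.expectation_S_bound)
  have "0 \<le> expectation (q.S_bound 0)" using q.S_le_S_bound(2) by (intro integral_nonneg_AE AE_I2)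
  then have C: "0 \<le> C" using EC[of 0] by linarith
  \<comment> \<open>Chosen together with \<open>b\<close> such that the error \<delta> b of the
    replacement is \<epsilon> / 2, while the bound \<open>C\<close> on the mean gives C / b \<le>
    \<epsilon> / 4 in Markov's inequality. The summand 1 covers C = 0.\<close>
  define \<delta> where "\<delta> = \<epsilon> * \<epsilon> / (8 * (C + 1))"
  have \<delta>: "0 < \<delta>" using \<epsilon> C by (simp add: \<delta>_def)
  define b where "b = \<epsilon> / (2 * \<delta>)"
  have b: "0 < b" "\<delta> * b = \<epsilon> / 2" using \<delta> \<epsilon> by (auto simp: b_def)
  have Cb: "C / b \<le> \<epsilon> / 4"
  proof -
    have "\<delta> * (8 * (C + 1)) = \<epsilon> * \<epsilon>" using C by (simp add: \<delta>_def)
    moreover have "\<epsilon> * \<epsilon> = 2 * (\<delta> * b) * \<epsilon>" unfolding b(2) by simp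
    ultimately have "\<delta> * (8 * (C + 1)) = 2 * (\<delta> * b) * \<epsilon>" by simp
    then have "\<delta> * (2 * (C + 1)) = \<delta> * (b * (\<epsilon> / 2))" by (simp add: algebra_simps)
    then have "2 * (C + 1) = b * (\<epsilon> / 2)" using \<delta> by simp
    then have "C \<le> \<epsilon> / 4 * b" by (simp add: algebra_simps)
    then show ?thesis using b(1) by (simp add: pos_divide_le_eq)
  qed
  have S_small: "prob {\<omega> \<in> space M. q.S_bound m \<omega> < b} \<ge> 1 - \<epsilon> / 4"
    "{\<omega> \<in> space M. q.S_bound m \<omega> < b} \<in> events" for m
  proof -
    note i = q.integrable_S_bound[of m]
    have [measurable]: "q.S_bound m \<in> borel_measurable M" using i by simp
    have "prob {\<omega> \<in> space M. b \<le> q.S_bound m \<omega>} \<le> expectation (q.S_bound m) / b"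
      using i b(1) q.S_le_S_bound(2) by (intro integral_Markov_inequality_measure[where A = "{}"]) auto
    also have "\<dots> \<le> C / b" using EC b(1) by (intro divide_right_mono) auto
    also note Cb
    finally have le: "prob {\<omega> \<in> space M. b \<le> q.S_bound m \<omega>} \<le> \<epsilon> / 4" .
    show "{\<omega> \<in> space M. q.S_bound m \<omega> < b} \<in> events" by measurable
    have e: "{\<omega> \<in> space M. q.S_bound m \<omega> < b} = space M - {\<omega> \<in> space M. b \<le> q.S_bound m \<omega>}" by auto
    have "{\<omega> \<in> space M. b \<le> q.S_bound m \<omega>} \<in> events" by measurable
    from prob_compl[OF this] le show "prob {\<omega> \<in> space M. q.S_bound m \<omega> < b} \<ge> 1 - \<epsilon> / 4" unfolding e by linarith
  qed
  have k1: "1 < 1 + \<delta>" and e4: "0 < \<epsilon> / 4" using \<delta> \<epsilon> by auto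
  have "\<forall>\<^sub>F m in sequentially. \<exists>G\<in>sets M. measure M G \<ge> 1 - \<epsilon> \<and> (\<forall>\<omega>\<in>G. \<forall>l. \<bar>stat m \<omega> l - A m \<omega> l\<bar> \<le> \<epsilon>)"
    using AM Dhat_uniform[OF k1 e4] eventually_ok
  proof eventually_elim
    case (elim m)
    obtain G1 where G1: "G1 \<in> events" "prob G1 \<ge> 1 - \<epsilon> / 2" "\<forall>\<omega>\<in>G1. \<forall>l. \<bar>q.S m l \<omega> - A m \<omega> l\<bar> \<le> \<epsilon> / 2"
      using elim(1) by (elim bexE conjE) (rule that)
    obtain G2 where G2: "G2 \<in> events" "prob G2 \<ge> 1 - \<epsilon> / 4" "\<forall>\<omega>\<in>G2. AE t in \<mu>. \<forall>i<k.
        0 < Dhat m \<omega> t i \<and> Dhat m \<omega> t i \<le> (1 + \<delta>) * D t i \<and> D t i \<le> (1 + \<delta>) * Dhat m \<omega> t i"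
      using elim(2) by (elim bexE conjE) (rule that)
    let ?G3 = "{\<omega> \<in> space M. q.S_bound m \<omega> < b}"
    \<comment> \<open>The three exceptional events belong to the cosine approximation, the estimated
      variances and large values of \<open>S_bound\<close>.\<close>
    have "prob (G1 \<inter> (G2 \<inter> ?G3)) \<ge> 1 - (\<epsilon> / 2 + (\<epsilon> / 4 + \<epsilon> / 4))"
      using G1 G2 S_small by (intro prob_Int_ge) auto
    then have "prob (G1 \<inter> (G2 \<inter> ?G3)) \<ge> 1 - \<epsilon>" by simp
    moreover have "\<bar>stat m \<omega> l - A m \<omega> l\<bar> \<le> \<epsilon>" if \<omega>: "\<omega> \<in> G1 \<inter> (G2 \<inter> ?G3)" for \<omega> l
    proof -
      have sp: "\<omega> \<in> space M" and sb: "q.S_bound m \<omega> \<le> b" using \<omega> by auto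
      have "\<bar>stat m \<omega> l - q.S m l \<omega>\<bar> \<le> (1 + \<delta> - 1) * q.S_bound m \<omega>"
        using G2(3) \<omega> by (intro stat_close[OF W elim(3) sp k1]) blast
      also have "\<dots> \<le> \<delta> * b" using sb \<delta> by (simp add: mult_left_mono)
      finally have "\<bar>stat m \<omega> l - q.S m l \<omega>\<bar> \<le> \<epsilon> / 2" unfolding b(2) .
      moreover have "\<bar>q.S m l \<omega> - A m \<omega> l\<bar> \<le> \<epsilon> / 2" using G1(3) \<omega> by blast
      ultimately show ?thesis by linarith
    qed
    moreover have "G1 \<inter> (G2 \<inter> ?G3) \<in> events" using G1(1) G2(1) S_small(2) by blast
    ultimately show ?case by blast
  qed
  moreover have "\<exists>G\<in>sets N. measure N G \<ge> 1 - \<epsilon> \<and> (\<forall>\<omega>\<in>G. \<forall>l. \<bar>limit_stat \<omega> l - A' \<omega> l\<bar> \<le> \<epsilon>)"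
  proof -
    obtain G where G: "G \<in> sets N" "measure N G \<ge> 1 - \<epsilon> / 2" "\<forall>\<omega>\<in>G. \<forall>l. \<bar>limit_stat \<omega> l - A' \<omega> l\<bar> \<le> \<epsilon> / 2"
      using AN by (elim bexE conjE) (rule that)
    have "\<bar>limit_stat \<omega> l - A' \<omega> l\<bar> \<le> \<epsilon>" if "\<omega> \<in> G" for \<omega> l
    proof -
      have "\<bar>limit_stat \<omega> l - A' \<omega> l\<bar> \<le> \<epsilon> / 2" using G(3) that by blast
      then show ?thesis using \<epsilon> by linarith
    qed
    moreover have "measure N G \<ge> 1 - \<epsilon>" using G(2) \<epsilon> by linarith
    ultimately show ?thesis using G(1) by blast
  qed
  ultimately show ?thesis using A by (intro exI[of _ A] exI[of _ A'] conjI)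
qed

text \<open>The statistics take values in functions restricted to the first \<open>R\<close>
  indices. Restriction is a continuous map from sequences, so test functions and open sets are
  pulled back along it and the result for sequences applies.\<close>

theorem statistics_converge:
  "converges_in_distribution (powertop_real {..<R})
      M (\<lambda>m \<omega>. \<lambda>l\<in>{..<R}.
           T_stat T k (ns m) (\<lambda>i j t. x i j \<omega> t) (row_block rs l H) (\<lambda>t. vec_block rs l (c t)))
      N (\<lambda>\<omega>. \<lambda>l\<in>{..<R}.
           \<integral>t. vec_block rs l (z \<omega> t) \<bullet>
               (moore_penrose_inverse
                  (row_block rs l H * Sigma_mat k \<tau> \<gamma> t t * (row_block rs l H)\<^sup>T) *\<^sub>v
                vec_block rs l (z \<omega> t)) \<partial>lebesgue_on T)"
    (is "converges_in_distribution ?X M ?Y N ?Z")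
proof -
  have Y: "?Y m \<omega> = restrict (stat m \<omega>) {..<R}" for m \<omega>
    by (rule restrict_ext) (simp add: stat_def)
  have Z: "?Z \<omega> = restrict (limit_stat \<omega>) {..<R}" if "\<omega> \<in> space N" for \<omega>
    by (rule restrict_ext) (simp add: limit_stat_eq[OF that])
  have cont: "continuous_map euclidean ?X (\<lambda>x :: nat \<Rightarrow> real. restrict x {..<R})"
  proof -
    have "continuous_map euclidean euclideanreal (\<lambda>x :: nat \<Rightarrow> real. restrict x {..<R} l)" if "l \<in> {..<R}" for l
      using that by (simp add: continuous_on_product_coordinates)
    then show ?thesis unfolding continuous_map_componentwise by auto
  qed
  have meas: "limit_stat \<in> borel_measurable N" by (rule measurable_fun_coordinatewise[OF limit_stat_measurable])
  show ?thesis
    unfolding converges_in_distribution_def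
  proof (intro conjI allI ballI impI)
    show "?Y m \<omega> \<in> topspace ?X" for m \<omega> by (simp add: PiE_iff)
    show "?Z \<omega> \<in> topspace ?X" for \<omega> by (simp add: PiE_iff)
    show "{\<omega> \<in> space N. ?Z \<omega> \<in> U} \<in> sets N" if U: "openin ?X U" for U
    proof -
      have "open {x :: nat \<Rightarrow> real. restrict x {..<R} \<in> U}"
        using openin_continuous_map_preimage[OF cont U] by simp
      then have "limit_stat -` {x. restrict x {..<R} \<in> U} \<inter> space N \<in> sets N"
        by (intro measurable_sets[OF meas] borel_open)
      moreover have "limit_stat -` {x. restrict x {..<R} \<in> U} \<inter> space N = {\<omega> \<in> space N. ?Z \<omega> \<in> U}"
        using Z by auto
      ultimately show ?thesis by simp
    qed
  next
    fix f assume f: "continuous_map ?X euclideanreal f \<and> bounded (f ` topspace ?X)"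
    define F where "F x = f (restrict x {..<R})" for x :: "nat \<Rightarrow> real"
    obtain B where B: "\<And>x. x \<in> topspace ?X \<Longrightarrow> \<bar>f x\<bar> \<le> B" using f by (auto simp: bounded_iff)
    have FB: "\<bar>F x\<bar> \<le> B" for x unfolding F_def by (rule B) (simp add: PiE_iff)
    have F: "continuous_on UNIV F"
      using continuous_map_compose[OF cont conjunct1[OF f]] by (simp add: F_def[abs_def] comp_def)
    have X0: "stat m \<omega> l = 0" if "R \<le> l" for m \<omega> l using that by (simp add: stat_def)
    have lim: "(\<lambda>m. outer_expectation M (\<lambda>\<omega>. ereal (F (stat m \<omega>)))) \<longlonglongrightarrow> ereal (\<integral>\<omega>. F (limit_stat \<omega>) \<partial>N)"
      by (rule outer_expectation_tendsto_of_approximation[OF prob_space_axioms N.prob_space_axioms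
          limit_stat_measurable X0 limit_stat_0 F FB stat_approximation])
    have "(\<integral>\<omega>. f (?Z \<omega>) \<partial>N) = (\<integral>\<omega>. F (limit_stat \<omega>) \<partial>N)"
      by (rule Bochner_Integration.integral_cong[OF refl]) (simp only: Z F_def)
    then show "(\<lambda>m. outer_expectation M (\<lambda>\<omega>. ereal (f (?Y m \<omega>)))) \<longlonglongrightarrow> ereal (\<integral>\<omega>. f (?Z \<omega>) \<partial>N)"
      using lim unfolding Y F_def by (simp only:)
  qed
qed

end

theorem theorem3:
  fixes a b :: real and T :: "real set"
    and k R :: nat and r :: nat and rs :: "nat \<Rightarrow> nat"
    and H :: "real mat" and c :: "real \<Rightarrow> real Matrix.vec"
    and M :: "'w measure" and N :: "'z measure"
    and x v :: "nat \<Rightarrow> nat \<Rightarrow> 'w \<Rightarrow> real \<Rightarrow> real"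
    and \<eta> :: "nat \<Rightarrow> real \<Rightarrow> real" and \<gamma> :: "nat \<Rightarrow> real \<Rightarrow> real \<Rightarrow> real"
    and \<tau> :: "nat \<Rightarrow> real"
    and ns :: "nat \<Rightarrow> nat \<Rightarrow> nat" and n :: "nat \<Rightarrow> nat"
    and z :: "'z \<Rightarrow> real \<Rightarrow> real Matrix.vec"
  assumes "a \<le> b" and T: "T = {a..b}"
    and "k \<ge> 1" and "R \<ge> 1" and "\<And>l. l < R \<Longrightarrow> rs l \<ge> 1" and r: "r = (\<Sum>l<R. rs l)"
    and H: "H \<in> carrier_mat r k"
    and c: "\<And>t. t \<in> T \<Longrightarrow> c t \<in> carrier_vec r"
      "\<And>p. p < r \<Longrightarrow> (\<lambda>t. c t $ p) \<in> borel_measurable (lebesgue_on T)"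
    and M: "prob_space M" and N: "prob_space N"
    and n: "\<And>m. n m = (\<Sum>i<k. ns m i)" and n_infinity: "filterlim n at_top sequentially"
    and v: "\<And>i j \<omega> t. v i j \<omega> t = x i j \<omega> t - \<eta> i t"
    and indep: "independent_processes M T ({..<k} \<times> UNIV) (\<lambda>(i, j). x i j)"
    and ident: "\<And>i j. i < k \<Longrightarrow> identically_distributed M T (x i j) (x i 0)"
    and mean: "\<And>i j. i < k \<Longrightarrow> has_mean_function M T (x i j) (\<eta> i)"
    and cov: "\<And>i j. i < k \<Longrightarrow> has_covariance_function M T (x i j) (\<gamma> i)"
    and L2: "\<And>i j. i < k \<Longrightarrow> L2_process M T (x i j)"
    and eta: "\<And>i. i < k \<Longrightarrow> \<eta> i \<in> L2_on T"
    and gamma: "\<And>i. i < k \<Longrightarrow> continuous_on T (\<lambda>t. \<gamma> i t t)"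
      "\<And>i t. i < k \<Longrightarrow> t \<in> T \<Longrightarrow> \<gamma> i t t > 0"
    and tau: "\<And>i. i < k \<Longrightarrow> \<tau> i > 0"
      "\<And>i. i < k \<Longrightarrow> (\<lambda>m. real (ns m i) / real (n m)) \<longlonglongrightarrow> \<tau> i"
    and osc: "\<And>i j. i < k \<Longrightarrow> j \<in> {0, 1} \<Longrightarrow>
      ((\<lambda>\<delta>. outer_expectation M
          (\<lambda>\<omega>. SUP (t, s) \<in> {(t, s). t \<in> T \<and> s \<in> T \<and> \<bar>t - s\<bar> < \<delta>}.
                 ereal \<bar>v i 0 \<omega> t * v i j \<omega> t - v i 0 \<omega> s * v i j \<omega> s\<bar>))
        \<longlongrightarrow> 0) (at_right 0)"
    and null: "\<And>t. t \<in> T \<Longrightarrow> H *\<^sub>v Matrix.vec k (\<lambda>i. \<eta> i t) = c t"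
    and z: "gaussian_process N T r (\<lambda>t s. H * Sigma_mat k \<tau> \<gamma> t s * H\<^sup>T) z"
  shows "converges_in_distribution (powertop_real {..<R})
      M (\<lambda>m \<omega>. \<lambda>l\<in>{..<R}.
           T_stat T k (ns m) (\<lambda>i j t. x i j \<omega> t) (row_block rs l H) (\<lambda>t. vec_block rs l (c t)))
      N (\<lambda>\<omega>. \<lambda>l\<in>{..<R}.
           \<integral>t. vec_block rs l (z \<omega> t) \<bullet>
               (moore_penrose_inverse
                  (row_block rs l H * Sigma_mat k \<tau> \<gamma> t t * (row_block rs l H)\<^sup>T) *\<^sub>v
                vec_block rs l (z \<omega> t)) \<partial>lebesgue_on T)"
proof -
  interpret k_sample_null M a b T k x \<eta> \<gamma> \<tau> ns n N r R rs H z c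
  proof (intro k_sample_null.intro k_sample_test.intro k_sample.intro k_sample_axioms.intro k_sample_test_axioms.intro k_sample_null_axioms.intro)
    show "((\<lambda>\<delta>. outer_expectation M
          (\<lambda>\<omega>. SUP (t, s) \<in> {(t, s). t \<in> T \<and> s \<in> T \<and> \<bar>t - s\<bar> < \<delta>}.
                 ereal \<bar>(x i 0 \<omega> t - \<eta> i t) * (x i j \<omega> t - \<eta> i t) -
                   (x i 0 \<omega> s - \<eta> i s) * (x i j \<omega> s - \<eta> i s)\<bar>))
        \<longlongrightarrow> 0) (at_right 0)" if "i < k" "j \<in> {0, 1}" for i j
      using osc[OF that] unfolding v .
  qed (fact assms)+
  show ?thesis by (rule statistics_converge)
qed

end
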